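(* Let $s,t>0$ satisfy $s+t>1$ and let $a\in\Gamma_{t,s}^{s,t;0}(\mathbf R^{2d})$. Then $$\mathrm{WF}^{t,s}(a^w(x,D)u)\subseteq \mathrm{WF}^{t,s}(u)\qquad\text{for all } u\in(\Sigma_t^s)'(\mathbf R^d).$$
   Context: Notation: $\mathbf N=\{0,1,2,\dots\}$, $D^\beta=(-i)^{|\beta|}\partial^\beta$. For $s,t>0$ with $s+t>1$, the (Beurling type) Gelfand--Shilov space $\Sigma_t^s(\mathbf R^d)$ consists of all $f\in C^\infty(\mathbf R^d)$ such that for every $h>0$ $$\|f\|_{\mathcal S_{t,h}^s}=\sup_{\alpha,\beta\in\mathbf N^d,\,x\in\mathbf R^d}\frac{|x^\alpha D^\beta f(x)|}{h^{|\alpha+\beta|}\alpha!^t\beta!^s}<\infty,$$ with the Fréchet topology given by these seminorms (it is nonzero since $s+t>1$). $(\Sigma_t^s)'(\mathbf R^d)$ is its topological dual; the action $(u,\varphi)$ of $u$ on a test function $\varphi$ is conjugate linear in $\varphi$ and consistent with the $L^2$ inner product (linear in the first argument). Short-time Fourier transform: with $T_xf(y)=f(y-x)$, $M_\xi f(y)=e^{i\langle y,\xi\rangle}f(y)$, set $V_\psi u(x,\xi)=(2\pi)^{-d/2}(u,M_\xi T_x\psi)$, $x,\xi\in\mathbf R^d$. Wave front set: write $T^*\mathbf R^d\simeq\mathbf R^{2d}$. For $u\in(\Sigma_t^s)'(\mathbf R^d)$ and a fixed $\psi\in\Sigma_t^s(\mathbf R^d)\setminus\{0\}$, $\mathrm{WF}^{t,s}(u)\subseteq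 T^*\mathbf R^d\setminus 0$ is defined by: $(x_0,\xi_0)\in T^*\mathbf R^d\setminus0$ satisfies $(x_0,\xi_0)\notin\mathrm{WF}^{t,s}(u)$ if there is an open set $U\subseteq T^*\mathbf R^d\setminus0$ containing $(x_0,\xi_0)$ such that $$\sup_{\lambda>0,\,(x,\xi)\in U}e^{r\lambda}|V_\psi u(\lambda^tx,\lambda^s\xi)|<\infty\quad\forall r>0.$$ The definition does not depend on the choice of $\psi$. Symbols: $a\in\Gamma_{t,s}^{s,t;0}(\mathbf R^{2d})$ means $a\in C^\infty(\mathbf R^{2d})$ and there is $\mu>0$ such that for every $h>0$ there is $C>0$ with $$|\partial_x^\alpha\partial_\xi^\beta a(x,\xi)|\leq C h^{|\alpha+\beta|}\alpha!^s\beta!^te^{\mu(|x|^{1/t}+|\xi|^{1/s})},\quad \alpha,\beta\in\mathbf N^d,\ x,\xi\in\mathbf R^d.$$ Weyl quantization: formally $a^w(x,D)f(x)=(2\pi)^{-d}\int_{\mathbf R^{2d}}e^{i\langle x-y,\xi\rangle}a(\frac{x+y}2,\xi)f(y)\,dy\,d\xi$; precisely $(a^w(x,D)f,g)=(2\pi)^{-d}(a,W(g,f))$ for $f,g\in\Sigma_t^s(\mathbf R^d)$, where $W(g,f)(x,\xi)=\int_{\mathbf R^d}g(x+y/2)\overline{f(x-y/2)}e^{-i\langle y,\xi\rangle}dy$. For $a\in\Gamma_{t,s}^{s,t;0}(\mathbf R^{2d})$ it is known that $a^w(x,D)$ is continuous on $\Sigma_t^s(\mathbf R^d)$ and extends uniquely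 to a continuous operator on $(\Sigma_t^s)'(\mathbf R^d)$, with $(a^w(x,D)u,f)=(u,\overline a^{\,w}(x,D)f)$ for $f\in\Sigma_t^s(\mathbf R^d)$. *)

theory Defs
  imports "HOL-Analysis.Analysis"
begin

section \<open>Smooth functions and multi-indices\<close>

primrec C_k :: "nat \<Rightarrow> ('a::real_normed_vector \<Rightarrow> 'b::real_normed_vector) \<Rightarrow> bool" where
  "C_k 0 f \<longleftrightarrow> continuous_on UNIV f"
| "C_k (Suc k) f \<longleftrightarrow>
     (\<forall>x. f differentiable at x) \<and> (\<forall>v. C_k k (\<lambda>x. frechet_derivative f (at x) v))"

definition smooth :: "('a::real_normed_vector \<Rightarrow> 'b::real_normed_vector) \<Rightarrow> bool" where
  "smooth f \<longleftrightarrow> (\<forall>k. C_k k f)"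

type_synonym 'n multi_index = "'n \<Rightarrow> nat"

definition mi_size :: "'n::finite multi_index \<Rightarrow> nat" where
  "mi_size \<alpha> = (\<Sum>i\<in>UNIV. \<alpha> i)"

definition mi_fact :: "'n::finite multi_index \<Rightarrow> real" where
  "mi_fact \<alpha> = (\<Prod>i\<in>UNIV. fact (\<alpha> i))"

definition mi_power :: "real ^ 'n \<Rightarrow> 'n::finite multi_index \<Rightarrow> real" where
  "mi_power x \<alpha> = (\<Prod>i\<in>UNIV. (x $ i) ^ \<alpha> i)"

text \<open>The index type carries no order, so the partial derivatives making up a multi-index
  derivative are taken in an arbitrary but fixed order. It is immaterial for smooth functions.\<close>

definition mi_list :: "'n::finite multi_index \<Rightarrow> 'n list" where
  "mi_list \<alpha> = (SOME is. \<forall>i. count_list is i = \<alpha> i)"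

lemma count_list_mi_list: "count_list (mi_list \<alpha>) i = \<alpha> i"
proof -
  obtain "is" where "mset is = Abs_multiset \<alpha>"
    using ex_mset by blast
  then have "\<forall>i. count_list is i = \<alpha> i"
    by (metis (mono_tags, lifting) Abs_multiset_inverse count_mset finite mem_Collect_eq)
  then have "\<forall>i. count_list (mi_list \<alpha>) i = \<alpha> i"
    unfolding mi_list_def by (rule someI)
  then show ?thesis by blast
qed

text \<open>The derivative of multi-index \<open>\<alpha>\<close> in the directions \<open>e i\<close>.\<close>

definition mi_deriv ::
  "('n::finite \<Rightarrow> 'a::real_normed_vector) \<Rightarrow> 'n multi_index \<Rightarrow>
   ('a \<Rightarrow> 'b::real_normed_vector) \<Rightarrow> 'a \<Rightarrow> 'b" where
  "mi_deriv e \<alpha> f = foldr (\<lambda>i g x. frechet_derivative g (at x) (e i)) (mi_list \<alpha>) f"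

definition D_op :: "'n::finite multi_index \<Rightarrow> (real ^ 'n \<Rightarrow> complex) \<Rightarrow> real ^ 'n \<Rightarrow> complex" where
  "D_op \<beta> f x = (- \<i>) ^ mi_size \<beta> * mi_deriv (\<lambda>i. axis i 1) \<beta> f x"

section \<open>Gelfand--Shilov spaces and their duals\<close>

definition GS_quot ::
  "real \<Rightarrow> real \<Rightarrow> real \<Rightarrow> (real ^ 'n \<Rightarrow> complex) \<Rightarrow>
   'n::finite multi_index \<times> 'n multi_index \<times> (real ^ 'n) \<Rightarrow> real" where
  "GS_quot t s h f = (\<lambda>(\<alpha>, \<beta>, x).
     norm (of_real (mi_power x \<alpha>) * D_op \<beta> f x) /
       (h ^ mi_size (\<lambda>i. \<alpha> i + \<beta> i) * mi_fact \<alpha> powr t * mi_fact \<beta> powr s))"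

definition GS_norm :: "real \<Rightarrow> real \<Rightarrow> real \<Rightarrow> (real ^ 'n::finite \<Rightarrow> complex) \<Rightarrow> real" where
  "GS_norm t s h f = Sup (range (GS_quot t s h f))"

text \<open>Finiteness of the supremum must be required explicitly, as \<open>Sup\<close> on the reals is
  unspecified for unbounded sets.\<close>

definition GS :: "real \<Rightarrow> real \<Rightarrow> (real ^ 'n::finite \<Rightarrow> complex) set" where
  "GS t s = {f. smooth f \<and> (\<forall>h>0. bdd_above (range (GS_quot t s h f)))}"

definition GS_topology :: "real \<Rightarrow> real \<Rightarrow> (real ^ 'n::finite \<Rightarrow> complex) topology" where
  "GS_topology t s = topology_generated_by
     {{f \<in> GS t s. GS_norm t s h (\<lambda>x. f x - g x) < \<epsilon>} | g h \<epsilon>. g \<in> GS t s \<and> 0 < h \<and> 0 < \<epsilon>}"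

text \<open>Continuous conjugate linear functionals; \<open>u \<phi>\<close> is the pairing \<open>(u, \<phi>)\<close>. The values of
  \<open>u\<close> outside \<open>GS t s\<close> are irrelevant and left unconstrained.\<close>

definition GS_dual :: "real \<Rightarrow> real \<Rightarrow> ((real ^ 'n::finite \<Rightarrow> complex) \<Rightarrow> complex) set" where
  "GS_dual t s = {u.
     (\<forall>f\<in>GS t s. \<forall>g\<in>GS t s. u (\<lambda>x. f x + g x) = u f + u g) \<and>
     (\<forall>c. \<forall>f\<in>GS t s. u (\<lambda>x. c * f x) = cnj c * u f) \<and>
     continuous_map (GS_topology t s) euclidean u}"

section \<open>Short-time Fourier transform and wave front set\<close>

definition translation :: "real ^ 'n \<Rightarrow> (real ^ 'n \<Rightarrow> complex) \<Rightarrow> real ^ 'n::finite \<Rightarrow> complex" where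
  "translation x f = (\<lambda>y. f (y - x))"

definition modulation :: "real ^ 'n \<Rightarrow> (real ^ 'n \<Rightarrow> complex) \<Rightarrow> real ^ 'n::finite \<Rightarrow> complex" where
  "modulation \<xi> f = (\<lambda>y. exp (\<i> * of_real (y \<bullet> \<xi>)) * f y)"

definition STFT ::
  "(real ^ 'n::finite \<Rightarrow> complex) \<Rightarrow> ((real ^ 'n \<Rightarrow> complex) \<Rightarrow> complex) \<Rightarrow>
   (real ^ 'n) \<times> (real ^ 'n) \<Rightarrow> complex" where
  "STFT \<psi> u = (\<lambda>(x, \<xi>).
     of_real ((2 * pi) powr (- (real CARD('n) / 2))) * u (modulation \<xi> (translation x \<psi>)))"

text \<open>The cotangent bundle is identified with the phase space \<open>(real ^ 'n) \<times> (real ^ 'n)\<close>, from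
  which only the origin is removed. The window \<open>\<psi>\<close> is a parameter.\<close>

definition WF ::
  "real \<Rightarrow> real \<Rightarrow> (real ^ 'n::finite \<Rightarrow> complex) \<Rightarrow> ((real ^ 'n \<Rightarrow> complex) \<Rightarrow> complex) \<Rightarrow>
   ((real ^ 'n) \<times> (real ^ 'n)) set" where
  "WF t s \<psi> u = {z. z \<noteq> 0 \<and>
     \<not> (\<exists>U. open U \<and> U \<subseteq> - {0} \<and> z \<in> U \<and>
          (\<forall>r>0. bdd_above {exp (r * \<rho>) * norm (STFT \<psi> u (\<rho> powr t *\<^sub>R x, \<rho> powr s *\<^sub>R \<xi>)) | \<rho> x \<xi>.
                   0 < \<rho> \<and> (x, \<xi>) \<in> U}))}"

section \<open>Symbols and Weyl quantization\<close>

definition symbol_class ::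
  "real \<Rightarrow> real \<Rightarrow> ((real ^ 'n::finite) \<times> (real ^ 'n) \<Rightarrow> complex) set" where
  "symbol_class t s = {a. smooth a \<and>
     (\<exists>\<mu>>0. \<forall>h>0. \<exists>C>0. \<forall>\<alpha> \<beta> x \<xi>.
        norm (mi_deriv (\<lambda>i. (axis i 1, 0)) \<alpha> (mi_deriv (\<lambda>i. (0, axis i 1)) \<beta> a) (x, \<xi>))
          \<le> C * h ^ mi_size (\<lambda>i. \<alpha> i + \<beta> i) * mi_fact \<alpha> powr s * mi_fact \<beta> powr t *
             exp (\<mu> * (norm x powr (1 / t) + norm \<xi> powr (1 / s))))}"

definition Wigner ::
  "(real ^ 'n::finite \<Rightarrow> complex) \<Rightarrow> (real ^ 'n \<Rightarrow> complex) \<Rightarrow> (real ^ 'n) \<times> (real ^ 'n) \<Rightarrow> complex" where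
  "Wigner g f = (\<lambda>(x, \<xi>). LINT y|lborel.
     g (x + (1 / 2) *\<^sub>R y) * cnj (f (x - (1 / 2) *\<^sub>R y)) * exp (- \<i> * of_real (y \<bullet> \<xi>)))"

definition L2_pairing :: "('a::euclidean_space \<Rightarrow> complex) \<Rightarrow> ('a \<Rightarrow> complex) \<Rightarrow> complex" where
  "L2_pairing f g = (LINT x|lborel. f x * cnj (g x))"

text \<open>The Weyl operator on test functions, in its weak form. A function in \<open>GS t s\<close> is determined
  by its pairings with \<open>GS t s\<close>. For \<open>a\<close> in the symbol class above, existence is the known
  fact that the Weyl operator maps \<open>GS t s\<close> into itself.\<close>

definition weyl ::
  "real \<Rightarrow> real \<Rightarrow> ((real ^ 'n::finite) \<times> (real ^ 'n) \<Rightarrow> complex) \<Rightarrow>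
   (real ^ 'n \<Rightarrow> complex) \<Rightarrow> real ^ 'n \<Rightarrow> complex" where
  "weyl t s a f = (THE F. F \<in> GS t s \<and>
     (\<forall>g\<in>GS t s. L2_pairing F g =
        of_real ((2 * pi) powr (- real CARD('n))) * L2_pairing a (Wigner g f)))"

text \<open>Its extension to the dual space, by duality with the conjugate symbol.\<close>

definition weyl_dual ::
  "real \<Rightarrow> real \<Rightarrow> ((real ^ 'n::finite) \<times> (real ^ 'n) \<Rightarrow> complex) \<Rightarrow>
   ((real ^ 'n \<Rightarrow> complex) \<Rightarrow> complex) \<Rightarrow> (real ^ 'n \<Rightarrow> complex) \<Rightarrow> complex" where
  "weyl_dual t s a u = (\<lambda>f. u (weyl t s (\<lambda>z. cnj (a z)) f))"

end

theory Submission
  imports Defs "HOL-Probability.Probability"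
begin

text \<open>
  Write \<open>\<pi> w\<close> for the time-frequency shift by \<open>w\<close> in phase space,
  \<open>q (x, \<xi>) = |x| powr (1 / t) + |\<xi>| powr (1 / s)\<close>, and \<open>b\<close> for the conjugate of the symbol \<open>a\<close>.
  Up to a phase, the Wigner distribution of \<open>\<pi> w \<psi>\<close> and \<open>\<pi> z \<psi>\<close> is that of \<open>\<psi>\<close> with itself, translated to
  \<open>(z + w) / 2\<close> and multiplied by the plane wave whose frequency is \<open>w - z\<close>, rotated by the symplectic form.
  Integration by parts against the symbol therefore bounds the kernel \<open>K z w\<close>, the pairing of
  \<open>b^w(x, D) (\<pi> z \<psi>)\<close> with \<open>\<pi> w \<psi>\<close>, by \<open>C exp (\<nu> q z) exp (- r q (w - z))\<close>, where \<open>\<nu>\<close> is fixed and \<open>r\<close> arbitrary.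
  By the reconstruction formula \<open>b^w(x, D) (\<pi> z \<psi>)\<close> is a multiple of \<open>\<integral> K z w \<cdot> \<pi> w \<psi> dw\<close>, so that
  up to a constant the short-time Fourier transform of \<open>a^w(x, D) u\<close> at \<open>z\<close> is at most \<open>\<integral> |K z w| |V u w| dw\<close>.
  Let \<open>z\<close> be the anisotropic dilate by \<open>\<lambda>\<close> of a point near \<open>z0\<close>. Then either the dilate of \<open>w\<close> by \<open>1 / \<lambda>\<close> lies
  in the neighbourhood of \<open>z0\<close> where \<open>V u\<close> decays superexponentially in \<open>\<lambda>\<close>, or \<open>q (w - z) \<ge> \<kappa> \<lambda>\<close> and the
  kernel does.
\<close>

section \<open>Iterated directional derivatives\<close>

text \<open>Small \<open>h\<close> in a factorial bound and a large rate \<open>r\<close> in an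
  exponential bound are interchangeable, and since bounds are available for all \<open>h\<close>,
  every decay rate is. Against this stand the growth rates of the symbol, of \<open>u\<close> and of
  the kernel in \<open>z\<close>, which are fixed once and for all. Dilates by
  \<open>\<lambda>\<close> of a bounded set have gauge at most a constant times
  \<open>\<lambda>\<close>, so fixed growth is outweighed by choosing \<open>r\<close> afterwards.
  Hence the order of quantifiers in all estimates: the growth rate first, \<open>h\<close> or
  \<open>r\<close> later.

  The Wigner distribution is a partial Fourier transform. A derivative in position falls on the
  windows and has order \<open>s\<close>; a derivative in frequency multiplies by the integration
  variable, and the decay of the windows turns this into order \<open>t\<close>. The latter is where
  \<open>s + t > 1\<close> enters.

  The Weyl operator is a definite description and \<open>u\<close> a bare functional, so neither
  passes through an integral by definition. The superposition is therefore exhibited as a test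
  function and identified by its pairings, and \<open>u\<close> is estimated on it by approximation
  in a single seminorm.\<close>

definition iter_deriv :: "'a::real_normed_vector list \<Rightarrow> ('a \<Rightarrow> 'b::real_normed_vector) \<Rightarrow> 'a \<Rightarrow> 'b" where
  "iter_deriv vs f = foldr (\<lambda>v g x. frechet_derivative g (at x) v) vs f"

lemma iter_deriv_Nil [simp]: "iter_deriv [] f = f"
  by (simp add: iter_deriv_def)

lemma iter_deriv_Cons: "iter_deriv (v # vs) f = (\<lambda>x. frechet_derivative (iter_deriv vs f) (at x) v)"
  by (simp add: iter_deriv_def)

lemma iter_deriv_append: "iter_deriv (us @ vs) f = iter_deriv us (iter_deriv vs f)"
  by (simp add: iter_deriv_def)

lemma mi_deriv_eq_iter_deriv: "mi_deriv e \<alpha> f = iter_deriv (map e (mi_list \<alpha>)) f"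
  by (simp add: iter_deriv_def mi_deriv_def foldr_map comp_def)

text \<open>\<open>C_k\<close> removes the innermost derivative first, which is the last entry of
  the list; the first implication is therefore proved by induction from the end of the list.\<close>

lemma smooth_iff_iter_deriv: "smooth f \<longleftrightarrow> (\<forall>vs x. iter_deriv vs f differentiable at x)"
proof
  have "C_k (Suc (length vs)) f \<Longrightarrow> iter_deriv vs f differentiable at x" for vs x
  proof (induction vs arbitrary: f rule: rev_induct)
    case (snoc v vs)
    from snoc.prems have "C_k (Suc (length vs)) (iter_deriv [v] f)"
      by (simp add: iter_deriv_Cons)
    from snoc.IH[OF this] show ?case
      by (simp only: iter_deriv_append)
  qed simp
  then show "smooth f \<Longrightarrow> \<forall>vs x. iter_deriv vs f differentiable at x"
    by (simp add: smooth_def)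
next
  have "C_k k f" if "\<forall>vs x. iter_deriv vs f differentiable at x" for k
    using that
  proof (induction k arbitrary: f)
    case 0
    then have "\<forall>x. f differentiable at x"
      by (metis iter_deriv_Nil)
    then show ?case
      by (simp add: continuous_at_imp_continuous_on differentiable_imp_continuous_within)
  next
    case (Suc k)
    have "C_k k (iter_deriv [v] f)" for v
      by (rule Suc.IH) (metis Suc.prems iter_deriv_append)
    moreover have "\<forall>x. f differentiable at x"
      using Suc.prems by (metis iter_deriv_Nil)
    ultimately show ?case
      by (simp add: iter_deriv_Cons)
  qed
  then show "\<forall>vs x. iter_deriv vs f differentiable at x \<Longrightarrow> smooth f"
    by (simp add: smooth_def)
qed

lemma iter_deriv_has_derivative:
  assumes "smooth f"
  shows "(iter_deriv vs f has_derivative (\<lambda>v. iter_deriv (v # vs) f x)) (at x)"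
proof -
  have "iter_deriv vs f differentiable at x"
    using assms smooth_iff_iter_deriv by blast
  then have "(iter_deriv vs f has_derivative frechet_derivative (iter_deriv vs f) (at x)) (at x)"
    by (simp add: frechet_derivative_works)
  then show ?thesis
    by (simp add: iter_deriv_Cons)
qed

lemma smooth_iter_deriv: "smooth f \<Longrightarrow> smooth (iter_deriv vs f)"
  by (simp add: smooth_iff_iter_deriv flip: iter_deriv_append)

lemma continuous_on_iter_deriv: "smooth f \<Longrightarrow> continuous_on A (iter_deriv vs f)"
  by (metis continuous_at_imp_continuous_on iter_deriv_has_derivative has_derivative_continuous)

text \<open>To compute all iterated derivatives of a function it suffices to guess them: a family indexed by
  lists of directions that is closed under differentiation consists of the derivatives of its
  member at \<open>[]\<close>.\<close>

lemma iter_deriv_jet: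
  assumes "\<And>vs x. (G vs has_derivative (\<lambda>v. G (v # vs) x)) (at x)"
  shows "iter_deriv vs (G []) = G vs"
proof (induction vs)
  case (Cons v vs)
  have "frechet_derivative (G vs) (at x) = (\<lambda>v. G (v # vs) x)" for x
    using frechet_derivative_at[OF assms] by simp
  then show ?case
    by (simp add: iter_deriv_Cons Cons)
qed simp

lemma smooth_jet:
  assumes "\<And>vs x. (G vs has_derivative (\<lambda>v. G (v # vs) x)) (at x)"
  shows "smooth (G [])"
  unfolding smooth_iff_iter_deriv iter_deriv_jet[OF assms] using assms differentiableI by blast

lemma
  assumes "bounded_linear L" "smooth f"
  shows smooth_linear_image: "smooth (\<lambda>x. L (f x))"
    and iter_deriv_linear_image: "iter_deriv vs (\<lambda>x. L (f x)) = (\<lambda>x. L (iter_deriv vs f x))"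
proof -
  have *: "((\<lambda>x. L (iter_deriv vs f x)) has_derivative (\<lambda>v. L (iter_deriv (v # vs) f x))) (at x)" for vs x
    by (rule bounded_linear.has_derivative[OF assms(1) iter_deriv_has_derivative[OF assms(2)]])
  show "smooth (\<lambda>x. L (f x))" "iter_deriv vs (\<lambda>x. L (f x)) = (\<lambda>x. L (iter_deriv vs f x))"
    using smooth_jet[of "\<lambda>vs x. L (iter_deriv vs f x)", OF *] iter_deriv_jet[of "\<lambda>vs x. L (iter_deriv vs f x)", OF *] by simp_all
qed

lemma
  assumes "bounded_linear L" "smooth f"
  shows smooth_affine_comp: "smooth (\<lambda>x. f (L x + c))"
    and iter_deriv_affine_comp: "iter_deriv vs (\<lambda>x. f (L x + c)) = (\<lambda>x. iter_deriv (map L vs) f (L x + c))"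
proof -
  have *: "((\<lambda>x. iter_deriv (map L vs) f (L x + c)) has_derivative (\<lambda>v. iter_deriv (map L (v # vs)) f (L x + c))) (at x)" for vs x
  proof -
    have L: "((\<lambda>x. L x + c) has_derivative L) (at x)"
      using bounded_linear_imp_has_derivative[OF assms(1)] by (auto intro!: derivative_eq_intros)
    show ?thesis
      using has_derivative_compose[OF L iter_deriv_has_derivative[OF assms(2)]] by simp
  qed
  show "smooth (\<lambda>x. f (L x + c))" "iter_deriv vs (\<lambda>x. f (L x + c)) = (\<lambda>x. iter_deriv (map L vs) f (L x + c))"
    using smooth_jet[of "\<lambda>vs x. iter_deriv (map L vs) f (L x + c)", OF *]
      iter_deriv_jet[of "\<lambda>vs x. iter_deriv (map L vs) f (L x + c)", OF *] by simp_all
qed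

lemma
  assumes "smooth f" "smooth g"
  shows smooth_add: "smooth (\<lambda>x. f x + g x)"
    and iter_deriv_add: "iter_deriv vs (\<lambda>x. f x + g x) = (\<lambda>x. iter_deriv vs f x + iter_deriv vs g x)"
proof -
  have *: "((\<lambda>x. iter_deriv vs f x + iter_deriv vs g x) has_derivative (\<lambda>v. iter_deriv (v # vs) f x + iter_deriv (v # vs) g x)) (at x)" for vs x
    by (intro has_derivative_add iter_deriv_has_derivative assms)
  show "smooth (\<lambda>x. f x + g x)" "iter_deriv vs (\<lambda>x. f x + g x) = (\<lambda>x. iter_deriv vs f x + iter_deriv vs g x)"
    using smooth_jet[of "\<lambda>vs x. iter_deriv vs f x + iter_deriv vs g x", OF *]
      iter_deriv_jet[of "\<lambda>vs x. iter_deriv vs f x + iter_deriv vs g x", OF *] by simp_all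
qed

lemma
  assumes "smooth f" "smooth g"
  shows smooth_diff: "smooth (\<lambda>x. f x - g x)"
    and iter_deriv_diff: "iter_deriv vs (\<lambda>x. f x - g x) = (\<lambda>x. iter_deriv vs f x - iter_deriv vs g x)"
proof -
  have *: "((\<lambda>x. iter_deriv vs f x - iter_deriv vs g x) has_derivative (\<lambda>v. iter_deriv (v # vs) f x - iter_deriv (v # vs) g x)) (at x)" for vs x
    by (intro has_derivative_diff iter_deriv_has_derivative assms)
  show "smooth (\<lambda>x. f x - g x)" "iter_deriv vs (\<lambda>x. f x - g x) = (\<lambda>x. iter_deriv vs f x - iter_deriv vs g x)"
    using smooth_jet[of "\<lambda>vs x. iter_deriv vs f x - iter_deriv vs g x", OF *]
      iter_deriv_jet[of "\<lambda>vs x. iter_deriv vs f x - iter_deriv vs g x", OF *] by simp_all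
qed

lemma
  assumes "\<And>i. i \<in> I \<Longrightarrow> smooth (f i)"
  shows smooth_sum: "smooth (\<lambda>x. \<Sum>i\<in>I. f i x)"
    and iter_deriv_sum: "iter_deriv vs (\<lambda>x. \<Sum>i\<in>I. f i x) = (\<lambda>x. \<Sum>i\<in>I. iter_deriv vs (f i) x)"
proof -
  have *: "((\<lambda>x. \<Sum>i\<in>I. iter_deriv vs (f i) x) has_derivative (\<lambda>v. \<Sum>i\<in>I. iter_deriv (v # vs) (f i) x)) (at x)" for vs x
    by (intro has_derivative_sum iter_deriv_has_derivative assms)
  show "smooth (\<lambda>x. \<Sum>i\<in>I. f i x)" "iter_deriv vs (\<lambda>x. \<Sum>i\<in>I. f i x) = (\<lambda>x. \<Sum>i\<in>I. iter_deriv vs (f i) x)"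
    using smooth_jet[of "\<lambda>vs x. \<Sum>i\<in>I. iter_deriv vs (f i) x", OF *]
      iter_deriv_jet[of "\<lambda>vs x. \<Sum>i\<in>I. iter_deriv vs (f i) x", OF *] by simp_all
qed

lemma
  fixes f :: "'a::real_normed_vector \<Rightarrow> 'b::real_normed_algebra"
  assumes "smooth f"
  shows smooth_cmult: "smooth (\<lambda>x. c * f x)"
    and iter_deriv_cmult: "iter_deriv vs (\<lambda>x. c * f x) = (\<lambda>x. c * iter_deriv vs f x)"
  using smooth_linear_image[OF bounded_linear_mult_right assms] iter_deriv_linear_image[OF bounded_linear_mult_right assms]
  by blast+

lemma
  assumes "smooth f"
  shows smooth_cnj: "smooth (\<lambda>x. cnj (f x))"
    and iter_deriv_cnj: "iter_deriv vs (\<lambda>x. cnj (f x)) = (\<lambda>x. cnj (iter_deriv vs f x))"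
  using smooth_linear_image[OF bounded_linear_cnj assms] iter_deriv_linear_image[OF bounded_linear_cnj assms]
  by blast+

text \<open>The ways to distribute a list over two factors, keeping the order in each. Summing over them
  gives the Leibniz rule without binomial coefficients.\<close>

fun splits :: "'a list \<Rightarrow> ('a list \<times> 'a list) list" where
  "splits [] = [([], [])]"
| "splits (v # vs) = map (\<lambda>(a, b). (v # a, b)) (splits vs) @ map (\<lambda>(a, b). (a, v # b)) (splits vs)"

lemma length_splits [simp]: "length (splits vs) = 2 ^ length vs"
  by (induction vs) auto

lemma splits_length: "(a, b) \<in> set (splits vs) \<Longrightarrow> length a + length b = length vs"
  by (induction vs arbitrary: a b) auto

lemma splits_subset: "(a, b) \<in> set (splits vs) \<Longrightarrow> set a \<subseteq> set vs \<and> set b \<subseteq> set vs"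
  by (induction vs arbitrary: a b) (auto; blast)+

lemma has_derivative_sum_list:
  assumes "\<And>p. p \<in> set ps \<Longrightarrow> (f p has_derivative f' p) F"
  shows "((\<lambda>x. \<Sum>p\<leftarrow>ps. f p x) has_derivative (\<lambda>v. \<Sum>p\<leftarrow>ps. f' p v)) F"
  using assms by (induction ps) (auto intro: has_derivative_add)

lemma
  fixes f g :: "'a::real_normed_vector \<Rightarrow> 'b::real_normed_algebra"
  assumes "smooth f" "smooth g"
  shows smooth_mult: "smooth (\<lambda>x. f x * g x)"
    and iter_deriv_mult: "iter_deriv vs (\<lambda>x. f x * g x) = (\<lambda>x. \<Sum>p\<leftarrow>splits vs. iter_deriv (fst p) f x * iter_deriv (snd p) g x)"
proof -
  define G where "G = (\<lambda>vs x. \<Sum>p\<leftarrow>splits vs. iter_deriv (fst p) f x * iter_deriv (snd p) g x)"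
  have *: "(G vs has_derivative (\<lambda>v. G (v # vs) x)) (at x)" for vs x
  proof -
    have "(G vs has_derivative (\<lambda>v. \<Sum>p\<leftarrow>splits vs. iter_deriv (fst p) f x * iter_deriv (v # snd p) g x + iter_deriv (v # fst p) f x * iter_deriv (snd p) g x)) (at x)"
      unfolding G_def by (intro has_derivative_sum_list has_derivative_mult iter_deriv_has_derivative assms)
    also have "(\<lambda>v. \<Sum>p\<leftarrow>splits vs. iter_deriv (fst p) f x * iter_deriv (v # snd p) g x + iter_deriv (v # fst p) f x * iter_deriv (snd p) g x) = (\<lambda>v. G (v # vs) x)"
      by (simp add: G_def sum_list_addf case_prod_beta o_def add.commute)
    finally show ?thesis .
  qed
  show "smooth (\<lambda>x. f x * g x)"
    "iter_deriv vs (\<lambda>x. f x * g x) = (\<lambda>x. \<Sum>p\<leftarrow>splits vs. iter_deriv (fst p) f x * iter_deriv (snd p) g x)"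
    using smooth_jet[of G, OF *] iter_deriv_jet[of G, OF *] by (simp_all add: G_def)
qed

text \<open>Each derivative in a direction \<open>v\<close> contributes the number
  \<open>l v\<close> and raises the order in the one-variable jet \<open>\<phi>\<close>. Plane waves
  and powers of a coordinate both have this form.\<close>

lemma
  fixes \<phi> :: "nat \<Rightarrow> real \<Rightarrow> complex"
  assumes l: "bounded_linear l" and \<phi>: "\<And>k \<tau>. (\<phi> k has_vector_derivative \<phi> (Suc k) \<tau>) (at \<tau>)"
  shows smooth_ridge: "smooth (\<lambda>x. \<phi> 0 (l x))"
    and iter_deriv_ridge: "iter_deriv vs (\<lambda>x. \<phi> 0 (l x)) = (\<lambda>x. of_real (\<Prod>v\<leftarrow>vs. l v) * \<phi> (length vs) (l x))"
proof -
  define G where "G = (\<lambda>vs x. of_real (\<Prod>v\<leftarrow>vs. l v) * \<phi> (length vs) (l x))"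
  have *: "(G vs has_derivative (\<lambda>v. G (v # vs) x)) (at x)" for vs x
  proof -
    have "(\<phi> k has_derivative (\<lambda>h. h *\<^sub>R \<phi> (Suc k) (l x))) (at (l x))" for k
      using \<phi>[of k "l x"] by (simp add: has_vector_derivative_def)
    from has_derivative_compose[OF bounded_linear_imp_has_derivative[OF l] this]
    have "((\<lambda>x. \<phi> k (l x)) has_derivative (\<lambda>v. l v *\<^sub>R \<phi> (Suc k) (l x))) (at x)" for k .
    then show ?thesis
      unfolding G_def by (auto intro!: derivative_eq_intros simp: scaleR_conv_of_real algebra_simps)
  qed
  show "smooth (\<lambda>x. \<phi> 0 (l x))"
    "iter_deriv vs (\<lambda>x. \<phi> 0 (l x)) = (\<lambda>x. of_real (\<Prod>v\<leftarrow>vs. l v) * \<phi> (length vs) (l x))"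
    using smooth_jet[of G, OF *] iter_deriv_jet[of G, OF *] by (simp_all add: G_def)
qed

section \<open>Symmetry of mixed derivatives and Gevrey bounds\<close>

lemma iter_deriv_line:
  assumes "smooth f"
  shows "((\<lambda>\<tau>. iter_deriv vs f (x + \<tau> *\<^sub>R v)) has_vector_derivative iter_deriv (v # vs) f (x + \<tau> *\<^sub>R v)) (at \<tau>)"
proof -
  have "((\<lambda>\<tau>. x + \<tau> *\<^sub>R v) has_derivative (\<lambda>h. h *\<^sub>R v)) (at \<tau>)"
    by (auto intro!: derivative_eq_intros)
  from has_derivative_compose[OF this iter_deriv_has_derivative[OF assms]]
  have "((\<lambda>\<tau>. iter_deriv vs f (x + \<tau> *\<^sub>R v)) has_derivative (\<lambda>h. iter_deriv (h *\<^sub>R v # vs) f (x + \<tau> *\<^sub>R v))) (at \<tau>)" .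
  moreover have "iter_deriv (h *\<^sub>R v # vs) f y = h *\<^sub>R iter_deriv (v # vs) f y" for h y
    by (rule linear_scale[OF has_derivative_linear[OF iter_deriv_has_derivative[OF assms]]])
  ultimately show ?thesis
    by (simp add: has_vector_derivative_def)
qed

text \<open>The second difference at \<open>x\<close> with steps \<open>h *\<^sub>R v\<close> and
  \<open>h *\<^sub>R w\<close> is symmetric in \<open>v\<close> and \<open>w\<close>. Two
  applications of the mean value theorem write it as \<open>h * h\<close> times a mixed derivative
  at an intermediate point, in either order of the directions; continuity at \<open>x\<close> gives
  equality in the limit.\<close>

lemma iter_deriv_swap_real:
  fixes f :: "'a::real_normed_vector \<Rightarrow> real"
  assumes f: "smooth f"
  shows "iter_deriv [v, w] f x = iter_deriv [w, v] f x"
proof -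
  have D: "((\<lambda>\<tau>. iter_deriv vs f (y + \<tau> *\<^sub>R u)) has_real_derivative iter_deriv (u # vs) f (y + \<tau> *\<^sub>R u)) (at \<tau>)" for vs y u \<tau>
    unfolding has_real_derivative_iff_has_vector_derivative by (rule iter_deriv_line[OF f])
  have key: "\<exists>a b. 0 < a \<and> a < h \<and> 0 < b \<and> b < h \<and>
      f (x + h *\<^sub>R v + h *\<^sub>R w) - f (x + h *\<^sub>R v) - f (x + h *\<^sub>R w) + f x = h * (h * iter_deriv [w, v] f (x + a *\<^sub>R v + b *\<^sub>R w))"
    if "h > 0" for h v w
  proof -
    define \<phi> where "\<phi> = (\<lambda>\<tau>. f ((x + h *\<^sub>R w) + \<tau> *\<^sub>R v) - f (x + \<tau> *\<^sub>R v))"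
    have D\<phi>: "DERIV \<phi> \<tau> :> iter_deriv [v] f ((x + h *\<^sub>R w) + \<tau> *\<^sub>R v) - iter_deriv [v] f (x + \<tau> *\<^sub>R v)" for \<tau>
      unfolding \<phi>_def by (intro DERIV_diff D[of "[]", unfolded iter_deriv_Nil])
    from MVT2[of 0 h \<phi>, OF \<open>h > 0\<close> D\<phi>] obtain a where a: "0 < a" "a < h"
      "\<phi> h - \<phi> 0 = (h - 0) * (iter_deriv [v] f ((x + h *\<^sub>R w) + a *\<^sub>R v) - iter_deriv [v] f (x + a *\<^sub>R v))"
      by (elim exE conjE) (rule that)
    from MVT2[of 0 h "\<lambda>\<tau>. iter_deriv [v] f ((x + a *\<^sub>R v) + \<tau> *\<^sub>R w)", OF \<open>h > 0\<close> D]
    obtain b where b: "0 < b" "b < h"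
      "iter_deriv [v] f ((x + a *\<^sub>R v) + h *\<^sub>R w) - iter_deriv [v] f ((x + a *\<^sub>R v) + 0 *\<^sub>R w) = (h - 0) * iter_deriv [w, v] f ((x + a *\<^sub>R v) + b *\<^sub>R w)"
      by (elim exE conjE) (rule that)
    have "f (x + h *\<^sub>R v + h *\<^sub>R w) - f (x + h *\<^sub>R v) - f (x + h *\<^sub>R w) + f x = \<phi> h - \<phi> 0"
      by (simp add: \<phi>_def algebra_simps)
    also have "\<dots> = h * (h * iter_deriv [w, v] f (x + a *\<^sub>R v + b *\<^sub>R w))"
      using a(3) b(3) by (simp add: add_ac)
    finally show ?thesis using a b by blast
  qed
  define h where "h = (\<lambda>n. inverse (real (Suc n)))"
  have h: "h n > 0" for n by (simp add: h_def)
  have h0: "h \<longlonglongrightarrow> 0"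
    unfolding h_def by (rule LIMSEQ_inverse_real_of_nat)
  define Q where "Q = (\<lambda>v w n a b. 0 < a \<and> a < h n \<and> 0 < b \<and> b < h n \<and>
      f (x + h n *\<^sub>R v + h n *\<^sub>R w) - f (x + h n *\<^sub>R v) - f (x + h n *\<^sub>R w) + f x = h n * (h n * iter_deriv [w, v] f (x + a *\<^sub>R v + b *\<^sub>R w)))"
  have Q: "\<exists>a b. \<forall>n. Q v w n (a n) (b n)" for v w
  proof -
    have "\<forall>n. \<exists>p. Q v w n (fst p) (snd p)"
      using key[OF h] unfolding Q_def by simp
    from choice[OF this] obtain p where "\<forall>n. Q v w n (fst (p n)) (snd (p n))" ..
    then show ?thesis
      by (intro exI[of _ "\<lambda>n. fst (p n)"] exI[of _ "\<lambda>n. snd (p n)"])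
  qed
  obtain a b where "\<forall>n. Q v w n (a n) (b n)" using Q by blast
  then have ab: "0 < a n \<and> a n < h n \<and> 0 < b n \<and> b n < h n \<and>
      f (x + h n *\<^sub>R v + h n *\<^sub>R w) - f (x + h n *\<^sub>R v) - f (x + h n *\<^sub>R w) + f x = h n * (h n * iter_deriv [w, v] f (x + a n *\<^sub>R v + b n *\<^sub>R w))" for n
    by (simp add: Q_def)
  obtain c d where "\<forall>n. Q w v n (c n) (d n)" using Q by blast
  then have cd: "0 < c n \<and> c n < h n \<and> 0 < d n \<and> d n < h n \<and>
      f (x + h n *\<^sub>R w + h n *\<^sub>R v) - f (x + h n *\<^sub>R w) - f (x + h n *\<^sub>R v) + f x = h n * (h n * iter_deriv [v, w] f (x + c n *\<^sub>R w + d n *\<^sub>R v))" for n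
    by (simp add: Q_def)
  have eq: "iter_deriv [w, v] f (x + a n *\<^sub>R v + b n *\<^sub>R w) = iter_deriv [v, w] f (x + c n *\<^sub>R w + d n *\<^sub>R v)" for n
  proof -
    have "h n * (h n * iter_deriv [w, v] f (x + a n *\<^sub>R v + b n *\<^sub>R w)) = h n * (h n * iter_deriv [v, w] f (x + c n *\<^sub>R w + d n *\<^sub>R v))"
    proof -
      have "x + h n *\<^sub>R v + h n *\<^sub>R w = x + h n *\<^sub>R w + h n *\<^sub>R v" by (simp add: add_ac)
      then have "f (x + h n *\<^sub>R v + h n *\<^sub>R w) = f (x + h n *\<^sub>R w + h n *\<^sub>R v)" by (rule arg_cong)
      then show ?thesis using ab[of n] cd[of n] by linarith
    qed
    then show ?thesis using h[of n] by simp
  qed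
  have z: "e \<longlonglongrightarrow> 0" if "\<And>n. 0 < e n \<and> e n < h n" for e :: "nat \<Rightarrow> real"
    by (rule tendsto_sandwich[OF _ _ tendsto_const h0]) (use that in \<open>auto intro!: always_eventually less_imp_le\<close>)
  have "(\<lambda>n. x + a n *\<^sub>R v + b n *\<^sub>R w) \<longlonglongrightarrow> x + 0 *\<^sub>R v + 0 *\<^sub>R w" "(\<lambda>n. x + c n *\<^sub>R w + d n *\<^sub>R v) \<longlonglongrightarrow> x + 0 *\<^sub>R w + 0 *\<^sub>R v"
    using ab cd by (intro tendsto_intros z; blast)+
  then have t: "(\<lambda>n. x + a n *\<^sub>R v + b n *\<^sub>R w) \<longlonglongrightarrow> x" "(\<lambda>n. x + c n *\<^sub>R w + d n *\<^sub>R v) \<longlonglongrightarrow> x"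
    by simp_all
  have c: "isCont (iter_deriv vs f) x" for vs
    using iter_deriv_has_derivative[OF f] by (rule has_derivative_continuous)
  show ?thesis
    using isCont_tendsto_compose[OF c t(1), of "[w, v]"] isCont_tendsto_compose[OF c t(2), of "[v, w]"]
    unfolding eq by (rule LIMSEQ_unique[symmetric])
qed

text \<open>The mean value theorem needs real values, so real and imaginary parts are treated
  separately.\<close>

lemma iter_deriv_swap:
  fixes f :: "'a::real_normed_vector \<Rightarrow> complex"
  assumes f: "smooth f"
  shows "iter_deriv (v # w # vs) f = iter_deriv (w # v # vs) f"
proof -
  let ?g = "iter_deriv vs f"
  have g: "smooth ?g" by (rule smooth_iter_deriv[OF f])
  have "iter_deriv [v, w] ?g x = iter_deriv [w, v] ?g x" for x
  proof (rule complex_eqI)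
    show "Re (iter_deriv [v, w] ?g x) = Re (iter_deriv [w, v] ?g x)"
      using iter_deriv_swap_real[OF smooth_linear_image[OF bounded_linear_Re g], of v w x]
      by (simp only: iter_deriv_linear_image[OF bounded_linear_Re g])
    show "Im (iter_deriv [v, w] ?g x) = Im (iter_deriv [w, v] ?g x)"
      using iter_deriv_swap_real[OF smooth_linear_image[OF bounded_linear_Im g], of v w x]
      by (simp only: iter_deriv_linear_image[OF bounded_linear_Im g])
  qed
  then show ?thesis
    by (simp add: fun_eq_iff flip: iter_deriv_append)
qed

lemma iter_deriv_move:
  fixes f :: "'a::real_normed_vector \<Rightarrow> complex"
  assumes f: "smooth f"
  shows "iter_deriv (us @ v # vs) f = iter_deriv (v # us @ vs) f"
proof (induction us)
  case (Cons u us)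
  have "iter_deriv ((u # us) @ v # vs) f = iter_deriv [u] (iter_deriv (us @ v # vs) f)"
    by (simp flip: iter_deriv_append)
  also have "\<dots> = iter_deriv (u # v # us @ vs) f"
    unfolding Cons by (simp flip: iter_deriv_append)
  also have "\<dots> = iter_deriv (v # (u # us) @ vs) f"
    using iter_deriv_swap[OF f, of u v "us @ vs"] by (simp only: append_Cons)
  finally show ?case .
qed simp

text \<open>The order of \<open>mi_list\<close> is an arbitrary choice. This makes a multi-index
  derivative comparable with any list of basis directions that has the same counts.\<close>

lemma iter_deriv_perm:
  fixes f :: "'a::real_normed_vector \<Rightarrow> complex"
  assumes f: "smooth f" and "mset us = mset vs"
  shows "iter_deriv us f = iter_deriv vs f"
  using assms(2)
proof (induction us arbitrary: vs)
  case (Cons u us)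
  then have "u \<in> set vs"
    by (metis list.set_intros(1) mset_eq_setD)
  then obtain as bs where vs: "vs = as @ u # bs"
    by (meson split_list)
  with Cons.prems have "mset us = mset (as @ bs)"
    by simp
  then have "iter_deriv us f = iter_deriv (as @ bs) f" by (rule Cons.IH)
  then show ?case
    unfolding vs iter_deriv_move[OF f] by (simp add: iter_deriv_Cons)
qed simp

lemma iter_deriv_scale_list:
  assumes f: "smooth f"
  shows "iter_deriv (map (\<lambda>v. c v *\<^sub>R g v) vs) f x = (\<Prod>v\<leftarrow>vs. c v) *\<^sub>R iter_deriv (map g vs) f x"
proof (induction vs arbitrary: x)
  case (Cons v vs)
  let ?k = "\<Prod>v\<leftarrow>vs. c v"
  have "iter_deriv (map (\<lambda>v. c v *\<^sub>R g v) vs) f = (\<lambda>x. ?k *\<^sub>R iter_deriv (map g vs) f x)"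
    using Cons by blast
  then have "iter_deriv (map (\<lambda>v. c v *\<^sub>R g v) (v # vs)) f x = iter_deriv [c v *\<^sub>R g v] (\<lambda>x. ?k *\<^sub>R iter_deriv (map g vs) f x) x"
    by (simp add: iter_deriv_Cons)
  also have "\<dots> = ?k *\<^sub>R iter_deriv (c v *\<^sub>R g v # map g vs) f x"
    using iter_deriv_linear_image[OF bounded_linear_scaleR_right smooth_iter_deriv[OF f], of "[c v *\<^sub>R g v]"]
    by (metis append_Cons append_Nil iter_deriv_append)
  also have "iter_deriv (c v *\<^sub>R g v # map g vs) f x = c v *\<^sub>R iter_deriv (g v # map g vs) f x"
    by (rule linear_scale[OF has_derivative_linear[OF iter_deriv_has_derivative[OF f]]])
  finally show ?case by simp
qed simp

lemma iter_deriv_scale: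
  assumes "smooth f"
  shows "iter_deriv (map (\<lambda>v. c *\<^sub>R v) vs) f x = c ^ length vs *\<^sub>R iter_deriv vs f x"
  using iter_deriv_scale_list[OF assms, of "\<lambda>_. c" "\<lambda>v. v" vs x] by (simp add: map_replicate_const)

text \<open>Each direction in the unit ball is expanded in the family \<open>e\<close> with
  coefficients at most 1, beginning with the innermost one, which then joins \<open>js\<close>. The
  price is a factor \<open>card I\<close> per derivative; being geometric in the order, it can be
  absorbed by a smaller \<open>h\<close>.\<close>

lemma iter_deriv_expand:
  fixes f :: "'a::real_normed_vector \<Rightarrow> complex" and e :: "'i \<Rightarrow> 'a"
  assumes f: "smooth f" and I: "finite I"
    and e: "\<And>w. norm w \<le> 1 \<Longrightarrow> \<exists>c. (\<forall>i\<in>I. \<bar>c i\<bar> \<le> 1) \<and> w = (\<Sum>i\<in>I. c i *\<^sub>R e i)"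
    and B: "\<And>js. set js \<subseteq> I \<Longrightarrow> norm (iter_deriv (map e js) f x) \<le> B (length js)"
    and "\<forall>w\<in>set ws. norm w \<le> 1" "set js \<subseteq> I"
  shows "norm (iter_deriv (ws @ map e js) f x) \<le> real (card I) ^ length ws * B (length ws + length js)"
  using assms(5,6)
proof (induction ws arbitrary: js rule: rev_induct)
  case Nil
  then show ?case using B by simp
next
  case (snoc w ws)
  then obtain c where c: "\<forall>i\<in>I. \<bar>c i\<bar> \<le> 1" "w = (\<Sum>i\<in>I. c i *\<^sub>R e i)"
    using e[of w] by auto
  let ?g = "iter_deriv (map e js) f"
  have g: "smooth ?g" by (rule smooth_iter_deriv[OF f])
  have s: "smooth (iter_deriv [e i] ?g)" for i by (rule smooth_iter_deriv[OF g])
  have "iter_deriv [w] ?g = (\<lambda>x. \<Sum>i\<in>I. of_real (c i) * iter_deriv [e i] ?g x)"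
  proof
    fix x
    interpret bounded_linear "\<lambda>v. iter_deriv [v] ?g x"
      using has_derivative_bounded_linear[OF iter_deriv_has_derivative[OF g, of "[]"]] by simp
    show "iter_deriv [w] ?g x = (\<Sum>i\<in>I. of_real (c i) * iter_deriv [e i] ?g x)"
      unfolding c(2) sum scaleR by (simp add: scaleR_conv_of_real)
  qed
  then have "iter_deriv ((ws @ [w]) @ map e js) f x = iter_deriv ws (\<lambda>x. \<Sum>i\<in>I. of_real (c i) * iter_deriv [e i] ?g x) x"
    by (simp only: iter_deriv_append)
  also have "\<dots> = (\<Sum>i\<in>I. of_real (c i) * iter_deriv (ws @ map e (i # js)) f x)"
    using s by (simp add: iter_deriv_sum smooth_cmult iter_deriv_cmult flip: iter_deriv_append)
  also have "norm \<dots> \<le> (\<Sum>i\<in>I. real (card I) ^ length ws * B (length ws + Suc (length js)))"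
  proof (rule sum_norm_le)
    fix i assume i: "i \<in> I"
    have "norm (iter_deriv (ws @ map e (i # js)) f x) \<le> real (card I) ^ length ws * B (length ws + length (i # js))"
      using snoc i by (intro snoc.IH) auto
    moreover have "norm (of_real (c i) * iter_deriv (ws @ map e (i # js)) f x) \<le> 1 * norm (iter_deriv (ws @ map e (i # js)) f x)"
      unfolding norm_mult using c i by (intro mult_right_mono) auto
    ultimately show "norm (of_real (c i) * iter_deriv (ws @ map e (i # js)) f x) \<le> real (card I) ^ length ws * B (length ws + Suc (length js))"
      by simp
  qed
  also have "\<dots> = real (card I) ^ length (ws @ [w]) * B (length (ws @ [w]) + length js)"
    by simp
  finally show ?case .
qed

text \<open>Gevrey bounds of order \<open>s\<close>. The weight \<open>\<omega>\<close> is a function of the point, so that weights multiply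
  under products of functions.\<close>

definition gevrey :: "real \<Rightarrow> real \<Rightarrow> ('a::real_normed_vector \<Rightarrow> real) \<Rightarrow> ('a \<Rightarrow> complex) \<Rightarrow> bool" where
  "gevrey s h \<omega> f \<longleftrightarrow> (\<forall>vs x. (\<forall>v\<in>set vs. norm v \<le> 1) \<longrightarrow>
     norm (iter_deriv vs f x) \<le> \<omega> x * h ^ length vs * fact (length vs) powr s)"

lemma gevreyI:
  assumes "\<And>vs x. (\<And>v. v \<in> set vs \<Longrightarrow> norm v \<le> 1) \<Longrightarrow> norm (iter_deriv vs f x) \<le> \<omega> x * h ^ length vs * fact (length vs) powr s"
  shows "gevrey s h \<omega> f"
  using assms by (simp add: gevrey_def)

lemma gevreyD:
  "gevrey s h \<omega> f \<Longrightarrow> (\<And>v. v \<in> set vs \<Longrightarrow> norm v \<le> 1) \<Longrightarrow>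
    norm (iter_deriv vs f x) \<le> \<omega> x * h ^ length vs * fact (length vs) powr s"
  by (simp add: gevrey_def)

lemma gevrey_norm: "gevrey s h \<omega> f \<Longrightarrow> norm (f x) \<le> \<omega> x"
  using gevreyD[of s h \<omega> f "[]" x] by simp

lemma gevrey_nonneg: "gevrey s h \<omega> f \<Longrightarrow> 0 \<le> \<omega> x"
  using gevrey_norm[of s h \<omega> f x] norm_ge_zero order_trans by blast

lemma gevrey_mono:
  assumes "gevrey s h \<omega> f" "\<And>x. \<omega> x \<le> \<omega>' x" "0 \<le> h" "h \<le> h'"
  shows "gevrey s h' \<omega>' f"
proof (rule gevreyI)
  fix vs :: "'a list" and x assume "\<And>v. v \<in> set vs \<Longrightarrow> norm v \<le> 1"
  with assms(1) have "norm (iter_deriv vs f x) \<le> \<omega> x * h ^ length vs * fact (length vs) powr s"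
    by (rule gevreyD)
  also have "\<dots> \<le> \<omega>' x * h' ^ length vs * fact (length vs) powr s"
    using assms gevrey_nonneg[OF assms(1), of x] order_trans[OF gevrey_nonneg[OF assms(1), of x] assms(2)]
    by (intro mult_mono power_mono) auto
  finally show "norm (iter_deriv vs f x) \<le> \<omega>' x * h' ^ length vs * fact (length vs) powr s" .
qed

lemma norm_sum_list_bound:
  assumes "\<And>p. p \<in> set ps \<Longrightarrow> norm (f p) \<le> c"
  shows "norm (\<Sum>p\<leftarrow>ps. f p) \<le> real (length ps) * c"
  using assms
proof (induction ps)
  case (Cons p ps)
  then have "norm (f p + (\<Sum>p\<leftarrow>ps. f p)) \<le> c + real (length ps) * c"
    by (intro norm_triangle_mono) auto
  then show ?case
    by (simp add: algebra_simps)
qed simp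

lemma fact_mult_powr_le: "0 \<le> s \<Longrightarrow> fact a powr s * fact b powr s \<le> fact (a + b) powr (s::real)"
proof -
  assume "0 \<le> s"
  have "fact a * fact b \<le> (fact (a + b) :: real)"
  proof -
    have "fact a * fact b dvd (fact (a + b) :: nat)" by (rule fact_fact_dvd_fact)
    then have "fact a * fact b \<le> (fact (a + b) :: nat)" by (rule dvd_imp_le) simp
    then show ?thesis by (metis of_nat_fact of_nat_le_iff of_nat_mult)
  qed
  then have "(fact a * fact b) powr s \<le> fact (a + b) powr (s::real)"
    using \<open>0 \<le> s\<close> by (intro powr_mono2) auto
  then show ?thesis by (simp add: powr_mult)
qed

text \<open>The Leibniz sum over \<open>n\<close> directions has \<open>2 ^ n\<close> terms, and in
  each of them the two factorials multiply to at most the full one; hence only \<open>h\<close>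
  doubles.\<close>

lemma gevrey_mult:
  assumes "smooth f" "smooth g" "gevrey s h \<omega> f" "gevrey s h \<omega>' g" "0 \<le> h" "0 \<le> s"
  shows "gevrey s (2 * h) (\<lambda>x. \<omega> x * \<omega>' x) (\<lambda>x. f x * g x)"
proof (rule gevreyI)
  fix vs :: "'a list" and x assume vs: "\<And>v. v \<in> set vs \<Longrightarrow> norm v \<le> 1"
  let ?n = "length vs"
  have nn: "0 \<le> \<omega> x" "0 \<le> \<omega>' x"
    using gevrey_nonneg assms by blast+
  have "norm (\<Sum>p\<leftarrow>splits vs. iter_deriv (fst p) f x * iter_deriv (snd p) g x)
      \<le> real (length (splits vs)) * (\<omega> x * \<omega>' x * h ^ ?n * fact ?n powr s)"
  proof (rule norm_sum_list_bound)
    fix p assume p: "p \<in> set (splits vs)"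
    obtain a b where ab: "p = (a, b)" by (cases p)
    have n: "?n = length a + length b" and sub: "set a \<subseteq> set vs" "set b \<subseteq> set vs"
      using splits_length splits_subset p ab by (metis, metis, metis)
    have "norm (iter_deriv a f x * iter_deriv b g x) \<le> (\<omega> x * h ^ length a * fact (length a) powr s) * (\<omega>' x * h ^ length b * fact (length b) powr s)"
      unfolding norm_mult using sub vs nn assms(5)
      by (intro mult_mono gevreyD[OF assms(3)] gevreyD[OF assms(4)]) auto
    also have "\<dots> = \<omega> x * \<omega>' x * h ^ ?n * (fact (length a) powr s * fact (length b) powr s)"
      by (simp add: n power_add)
    also have "\<dots> \<le> \<omega> x * \<omega>' x * h ^ ?n * fact ?n powr s"
      unfolding n using nn assms(5,6) by (intro mult_left_mono fact_mult_powr_le) auto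
    finally show "norm (iter_deriv (fst p) f x * iter_deriv (snd p) g x) \<le> \<omega> x * \<omega>' x * h ^ ?n * fact ?n powr s"
      by (simp add: ab)
  qed
  then show "norm (iter_deriv vs (\<lambda>x. f x * g x) x) \<le> \<omega> x * \<omega>' x * (2 * h) ^ ?n * fact ?n powr s"
    by (simp add: iter_deriv_mult[OF assms(1,2)] power_mult_distrib mult_ac)
qed

text \<open>The directions \<open>L v\<close> are divided by \<open>c\<close> to return to the unit
  ball; homogeneity gives back one factor \<open>c\<close> per derivative.\<close>

lemma gevrey_affine:
  assumes L: "bounded_linear L" and c: "\<And>v. norm (L v) \<le> c * norm v" "0 < c"
    and f: "smooth f" "gevrey s h \<omega> f"
  shows "gevrey s (c * h) (\<lambda>x. \<omega> (L x + d)) (\<lambda>x. f (L x + d))"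
proof (rule gevreyI)
  fix vs :: "'a list" and x assume vs: "\<And>v. v \<in> set vs \<Longrightarrow> norm v \<le> 1"
  define us where "us = map (\<lambda>v. (1 / c) *\<^sub>R L v) vs"
  have us: "norm u \<le> 1" if "u \<in> set us" for u
  proof -
    from that obtain v where v: "v \<in> set vs" "u = (1 / c) *\<^sub>R L v" by (auto simp: us_def)
    have "norm (L v) \<le> c"
      using c(1)[of v] vs[OF v(1)] c(2) by (smt (verit) mult_left_le)
    then show ?thesis using c(2) v(2) by (simp add: field_simps)
  qed
  have "map L vs = map (\<lambda>v. c *\<^sub>R v) us"
    using c(2) by (simp add: us_def)
  then have "norm (iter_deriv vs (\<lambda>x. f (L x + d)) x) = c ^ length vs * norm (iter_deriv us f (L x + d))"
    using c(2) by (simp add: iter_deriv_affine_comp[OF L f(1)] iter_deriv_scale[OF f(1)] us_def del: map_map)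
  also have "\<dots> \<le> c ^ length vs * (\<omega> (L x + d) * h ^ length us * fact (length us) powr s)"
    using c(2) us f by (intro mult_left_mono gevreyD) auto
  finally show "norm (iter_deriv vs (\<lambda>x. f (L x + d)) x) \<le> \<omega> (L x + d) * (c * h) ^ length vs * fact (length vs) powr s"
    by (simp add: us_def power_mult_distrib mult_ac)
qed

lemma gevrey_cnj: "smooth f \<Longrightarrow> gevrey s h \<omega> f \<Longrightarrow> gevrey s h \<omega> (\<lambda>x. cnj (f x))"
  by (simp add: gevrey_def iter_deriv_cnj)

lemma gevrey_cmult:
  assumes "smooth f" "gevrey s h \<omega> f"
  shows "gevrey s h (\<lambda>x. norm c * \<omega> x) (\<lambda>x. c * f x)"
proof (rule gevreyI)
  fix vs :: "'a list" and x assume "\<And>v. v \<in> set vs \<Longrightarrow> norm v \<le> 1"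
  from mult_left_mono[OF gevreyD[OF assms(2) this] norm_ge_zero[of c]]
  show "norm (iter_deriv vs (\<lambda>x. c * f x) x) \<le> norm c * \<omega> x * h ^ length vs * fact (length vs) powr s"
    by (simp add: iter_deriv_cmult[OF assms(1)] norm_mult mult.assoc)
qed

lemma gevrey_add:
  assumes "smooth f" "smooth g" "gevrey s h \<omega> f" "gevrey s h \<omega>' g"
  shows "gevrey s h (\<lambda>x. \<omega> x + \<omega>' x) (\<lambda>x. f x + g x)"
proof (rule gevreyI)
  fix vs :: "'a list" and x assume "\<And>v. v \<in> set vs \<Longrightarrow> norm v \<le> 1"
  from norm_triangle_mono[OF gevreyD[OF assms(3) this] gevreyD[OF assms(4) this]]
  show "norm (iter_deriv vs (\<lambda>x. f x + g x) x) \<le> (\<omega> x + \<omega>' x) * h ^ length vs * fact (length vs) powr s"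
    by (simp add: iter_deriv_add[OF assms(1,2)] algebra_simps)
qed

section \<open>Gelfand--Shilov seminorms and exponential decay\<close>

lemma power_div_fact_le_exp: "0 \<le> (y::real) \<Longrightarrow> y ^ M / fact M \<le> exp y"
proof -
  assume y: "0 \<le> y"
  have "sum (\<lambda>n. y ^ n /\<^sub>R fact n) {M} \<le> (\<Sum>n. y ^ n /\<^sub>R fact n)"
    by (rule sum_le_suminf[OF summable_exp_generic]) (use y in auto)
  then show ?thesis by (simp add: exp_def divide_inverse mult.commute)
qed

text \<open>A single term of the exponential series at \<open>(\<tau> / h) powr (1 / s)\<close>,
  raised to the power \<open>s\<close>. It trades powers for exponential growth;
  \<open>le_exp_of_power_bounds\<close> goes in the opposite direction.\<close>

lemma power_le_exp_powr:
  fixes \<tau> h s :: real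
  assumes "0 < s" "0 < h" "0 \<le> \<tau>"
  shows "\<tau> ^ M \<le> h ^ M * fact M powr s * exp (s * (\<tau> / h) powr (1 / s))"
proof (cases "\<tau> = 0")
  case True
  then show ?thesis using assms by (cases M) auto
next
  case False
  then have \<tau>: "0 < \<tau>" using assms by simp
  define y where "y = (\<tau> / h) powr (1 / s)"
  have "y ^ M \<le> fact M * exp y"
    using power_div_fact_le_exp[of y M] by (simp add: y_def field_simps)
  then have "(y ^ M) powr s \<le> (fact M * exp y) powr s"
    using assms by (intro powr_mono2) (auto simp: y_def)
  moreover have "(y ^ M) powr s = (\<tau> / h) ^ M"
  proof -
    have "y ^ M = (\<tau> / h) powr (real M / s)"
      using \<tau> assms by (simp add: y_def powr_powr flip: powr_realpow)
    then show ?thesis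
      using \<tau> assms by (simp add: powr_powr flip: powr_realpow)
  qed
  moreover have "(fact M * exp y) powr s = fact M powr s * exp (s * y)"
    by (simp add: powr_mult exp_powr_real mult.commute)
  ultimately have "(\<tau> / h) ^ M \<le> fact M powr s * exp (s * y)"
    by simp
  then have "h ^ M * (\<tau> / h) ^ M \<le> h ^ M * (fact M powr s * exp (s * y))"
    using assms by (intro mult_left_mono) auto
  moreover have "h ^ M * (\<tau> / h) ^ M = \<tau> ^ M"
    using assms by (simp flip: power_mult_distrib)
  ultimately show ?thesis
    by (simp add: y_def mult.assoc)
qed

text \<open>The bounds for all \<open>M\<close> are raised to the power \<open>1 / s\<close>,
  divided by \<open>2 ^ M * fact M\<close> and summed: the left sides form an exponential series at
  half the argument, the right sides a geometric series with sum 2. Undoing the root leaves the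
  factor \<open>2 powr s\<close> and half the rate.\<close>

lemma le_exp_of_power_bounds:
  fixes \<tau> h s :: real
  assumes s: "0 < s" "0 < h" "0 \<le> \<tau>" "0 \<le> X" "0 \<le> B"
    and le: "\<And>M. \<tau> ^ M * X \<le> B * h ^ M * fact M powr s"
  shows "X \<le> 2 powr s * B * exp (- (s / 2 * (\<tau> / h) powr (1 / s)))"
proof -
  define y where "y = (\<tau> / h) powr (1 / s)"
  have y0: "0 \<le> y" by (simp add: y_def)
  have key: "(y / 2) ^ M / fact M * X powr (1 / s) \<le> B powr (1 / s) * (1 / 2) ^ M" for M
  proof -
    have "(\<tau> / h) ^ M * X \<le> B * fact M powr s"
      using le[of M] s by (simp add: power_divide field_simps)
    then have "((\<tau> / h) ^ M * X) powr (1 / s) \<le> (B * fact M powr s) powr (1 / s)"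
      using s by (intro powr_mono2) auto
    moreover have "((\<tau> / h) ^ M) powr (1 / s) = y ^ M"
    proof (cases "\<tau> = 0")
      case True
      then show ?thesis by (cases M) (auto simp: y_def)
    next
      case False
      then show ?thesis using s
        by (simp add: y_def powr_powr flip: powr_realpow)
    qed
    moreover have "(fact M powr s) powr (1 / s) = fact M"
      using s by (simp add: powr_powr)
    ultimately have "y ^ M * X powr (1 / s) \<le> B powr (1 / s) * fact M"
      using s by (simp add: powr_mult)
    then show ?thesis by (simp add: power_divide field_simps)
  qed
  have s1: "(\<lambda>M. (y / 2) ^ M / fact M * X powr (1 / s)) sums (exp (y / 2) * X powr (1 / s))"
  proof -
    have "z ^ M / fact M = z ^ M /\<^sub>R fact M" for z :: real and M
      by (simp add: divide_inverse mult.commute)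
    then show ?thesis
      using sums_mult2[OF exp_converges[of "y / 2"], of "X powr (1 / s)"] by (simp only:)
  qed
  have s2: "(\<lambda>M. B powr (1 / s) * (1 / 2) ^ M) sums (B powr (1 / s) * 2)"
    using sums_mult[OF geometric_sums[of "1 / 2 :: real"], of "B powr (1 / s)"] by simp
  have "exp (y / 2) * X powr (1 / s) \<le> B powr (1 / s) * 2"
    by (rule sums_le[OF key s1 s2])
  then have "(exp (y / 2) * X powr (1 / s)) powr s \<le> (B powr (1 / s) * 2) powr s"
    using s by (intro powr_mono2) auto
  then have "exp (s / 2 * y) * X \<le> 2 powr s * B"
    using s by (simp add: powr_mult exp_powr_real powr_powr mult_ac)
  then show ?thesis
    by (simp add: y_def exp_minus field_simps)
qed

lemma ex_component_ge:
  fixes x :: "real ^ 'n::finite"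
  shows "\<exists>k. norm x \<le> real CARD('n) * \<bar>x $ k\<bar>"
proof (rule ccontr)
  assume "\<not> ?thesis"
  then have *: "real CARD('n) * \<bar>x $ k\<bar> < norm x" for k by (simp add: not_le)
  have "(\<Sum>k\<in>UNIV. real CARD('n) * \<bar>x $ k\<bar>) < (\<Sum>k\<in>(UNIV::'n set). norm x)"
    using * by (intro sum_strict_mono) auto
  then have "(\<Sum>k\<in>UNIV. \<bar>x $ k\<bar>) < norm x"
    by (simp flip: sum_distrib_left)
  with norm_le_l1_cart[of x] show False by linarith
qed

text \<open>The exchange of \<open>h\<close> for a rate in several variables. Some coordinate
  controls the norm up to the dimension, so bounds along each coordinate suffice; \<open>h\<close>
  is fixed before the point and the constants.\<close>

lemma ex_power_bounds_imp_exp: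
  assumes "0 < (s::real)" "0 < r"
  shows "\<exists>h>0. \<forall>(x::real ^ 'n::finite) X B. 0 \<le> X \<longrightarrow> 0 \<le> B \<longrightarrow>
    (\<forall>k M. \<bar>x $ k\<bar> ^ M * X \<le> B * h ^ M * fact M powr s) \<longrightarrow> X \<le> 2 powr s * B * exp (- (r * norm x powr (1 / s)))"
proof -
  define d where "d = real CARD('n)"
  have d: "d > 0" by (simp add: d_def)
  \<comment> \<open>Solves \<open>s / 2 * (1 / (d * h)) powr (1 / s) = r\<close>; the factor
    \<open>d\<close> comes from comparing the norm with a single coordinate.\<close>
  define h where "h = (2 * r / s) powr (- s) / d"
  have h: "h > 0" using assms d by (simp add: h_def)
  have hh: "s / 2 * (1 / (d * h)) powr (1 / s) = r"
  proof -
    have "1 / (d * h) = (2 * r / s) powr s"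
      using d assms by (simp add: h_def powr_minus field_simps)
    then show ?thesis using assms by (simp add: powr_powr)
  qed
  show ?thesis
  proof (intro exI[of _ h] conjI h allI impI)
    fix x :: "real ^ 'n" and X B assume X: "0 \<le> X" and B: "0 \<le> B" and
      le: "\<forall>k M. \<bar>x $ k\<bar> ^ M * X \<le> B * h ^ M * fact M powr s"
    obtain k where k: "norm x \<le> d * \<bar>x $ k\<bar>"
      using ex_component_ge[of x] by (auto simp: d_def)
    have "X \<le> 2 powr s * B * exp (- (s / 2 * (\<bar>x $ k\<bar> / h) powr (1 / s)))"
      using assms X B h le by (intro le_exp_of_power_bounds) auto
    also have "\<dots> \<le> 2 powr s * B * exp (- (r * norm x powr (1 / s)))"
    proof -
      have "r * norm x powr (1 / s) = s / 2 * ((1 / (d * h)) * norm x) powr (1 / s)"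
        using d h by (subst hh[symmetric], subst powr_mult) auto
      also have "\<dots> \<le> s / 2 * (\<bar>x $ k\<bar> / h) powr (1 / s)"
        using k d h assms by (intro mult_left_mono powr_mono2) (auto simp: field_simps)
      finally show ?thesis using B by (intro mult_left_mono) auto
    qed
    finally show "X \<le> 2 powr s * B * exp (- (r * norm x powr (1 / s)))" .
  qed
qed

lemma fact_add_le: "fact (a + b) \<le> (2::real) ^ (a + b) * (fact a * fact b)"
proof -
  have "fact a * fact b * ((a + b) choose a) = (fact (a + b) :: nat)"
    using binomial_fact_lemma[of a "a + b", OF le_add1] by (simp only: diff_add_inverse)
  from arg_cong[OF this, of real] have "fact (a + b) = fact a * fact b * real ((a + b) choose a)"
    by (simp only: of_nat_mult of_nat_fact)
  also have "\<dots> \<le> fact a * fact b * 2 ^ (a + b)"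
    using binomial_le_pow2[of "a + b" a] by (intro mult_left_mono) (auto simp flip: of_nat_power)
  finally show ?thesis by (simp add: mult_ac)
qed

text \<open>Together with \<open>prod_fact_le\<close> this makes the factorial of a multi-index and
  the factorial of its order interchangeable up to a geometric factor.\<close>

lemma fact_sum_le:
  assumes "finite I"
  shows "fact (\<Sum>i\<in>I. \<alpha> i) \<le> ((2::real) ^ card I) ^ (\<Sum>i\<in>I. \<alpha> i) * (\<Prod>i\<in>I. fact (\<alpha> i))"
  using assms
proof (induction I rule: finite_induct)
  case (insert i I)
  let ?S = "\<Sum>i\<in>I. \<alpha> i"
  have "fact (\<alpha> i + ?S) \<le> (2::real) ^ (\<alpha> i + ?S) * (fact (\<alpha> i) * fact ?S)"
    by (rule fact_add_le)
  also have "\<dots> \<le> (2::real) ^ (\<alpha> i + ?S) * (fact (\<alpha> i) * ((2 ^ card I) ^ (\<alpha> i + ?S) * (\<Prod>i\<in>I. fact (\<alpha> i))))"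
  proof (intro mult_left_mono)
    have "((2::real) ^ card I) ^ ?S \<le> (2 ^ card I) ^ (\<alpha> i + ?S)"
      by (intro power_increasing) auto
    then show "fact ?S \<le> (2 ^ card I) ^ (\<alpha> i + ?S) * (\<Prod>i\<in>I. fact (\<alpha> i) :: real)"
      using insert.IH by (smt (verit) mult_right_mono prod_nonneg fact_ge_zero)
  qed auto
  also have "\<dots> = (2 ^ card (insert i I)) ^ (\<Sum>i\<in>insert i I. \<alpha> i) * (\<Prod>i\<in>insert i I. fact (\<alpha> i))"
    using insert by (simp add: power_mult_distrib mult_ac)
  finally show ?case using insert by simp
qed simp

lemma prod_fact_le:
  assumes "finite I"
  shows "(\<Prod>i\<in>I. fact (\<alpha> i)) \<le> (fact (\<Sum>i\<in>I. \<alpha> i) :: real)"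
  using assms
proof (induction I rule: finite_induct)
  case (insert i I)
  have "(\<Prod>i\<in>insert i I. fact (\<alpha> i)) \<le> fact (\<alpha> i) * (fact (\<Sum>i\<in>I. \<alpha> i) :: real)"
    using insert by simp
  also have "\<dots> \<le> fact (\<alpha> i + (\<Sum>i\<in>I. \<alpha> i))"
    using fact_mult_powr_le[of 1] by simp
  finally show ?case using insert by simp
qed simp

definition decay :: "real \<Rightarrow> real \<Rightarrow> 'a::real_normed_vector \<Rightarrow> real" where
  "decay p r x = exp (- (r * norm x powr p))"

lemma decay_pos [simp]: "decay p r x > 0" and decay_nonneg [simp]: "decay p r x \<ge> 0"
  by (simp_all add: decay_def)

lemma decay_le_1: "0 \<le> r \<Longrightarrow> decay p r x \<le> 1"
  by (simp add: decay_def)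

lemma decay_mono: "r \<le> r' \<Longrightarrow> decay p r' x \<le> decay p r x"
  by (simp add: decay_def mult_right_mono)

lemma decay_mult: "decay p r x * decay p r' x = decay p (r + r') x"
  by (simp add: decay_def algebra_simps flip: exp_add)

section \<open>Gelfand--Shilov seminorms as weighted Gevrey bounds\<close>

lemma count_list_sum_UNIV: "(\<Sum>i\<in>UNIV. count_list js i) = length (js :: 'n::finite list)"
proof (induction js)
  case (Cons j js)
  have "(\<Sum>i\<in>UNIV. count_list (j # js) i) = (\<Sum>i\<in>UNIV. count_list js i + (if j = i then 1 else 0))"
    by (intro sum.cong) auto
  then show ?case
    using Cons by (simp add: sum.distrib)
qed simp

lemma mset_mi_list_count: "mset (mi_list (count_list js)) = mset js"
  by (intro multiset_eqI) (simp add: count_mset count_list_mi_list)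

lemma length_mi_list: "length (mi_list \<beta>) = mi_size \<beta>"
  unfolding mi_size_def using count_list_sum_UNIV[of "mi_list \<beta>"] by (simp add: count_list_mi_list)

lemma norm_D_op: "norm (D_op \<beta> f x) = norm (iter_deriv (map (\<lambda>i. axis i 1) (mi_list \<beta>)) f x)"
  by (simp add: D_op_def mi_deriv_eq_iter_deriv norm_mult norm_power)

lemma GS_smooth: "f \<in> GS t s \<Longrightarrow> smooth f"
  by (simp add: GS_def)

lemma GS_quot_nonneg: "0 < h \<Longrightarrow> 0 \<le> GS_quot t s h f idx"
  by (auto simp: GS_quot_def split: prod.split intro!: divide_nonneg_nonneg mult_nonneg_nonneg)

text \<open>For a fixed derivative the powers of the coordinates yield decay at rate
  \<open>r\<close>. The bounds so obtained along coordinate directions are then extended to all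
  directions in the unit ball.\<close>

lemma GS_imp_gevrey:
  fixes f :: "real ^ 'n::finite \<Rightarrow> complex"
  assumes "0 < s" "0 < t" "f \<in> GS t s" "0 < h" "0 < r"
  shows "\<exists>C\<ge>0. gevrey s h (\<lambda>x. C * decay (1 / t) r x) f"
proof -
  have f: "smooth f" using assms GS_smooth by blast
  define d where "d = real CARD('n)"
  have d: "d > 0" by (simp add: d_def)
  obtain h0 where h0: "h0 > 0" and dec: "\<And>(x::real^'n) X B. 0 \<le> X \<Longrightarrow> 0 \<le> B \<Longrightarrow>
    (\<And>k M. \<bar>x $ k\<bar> ^ M * X \<le> B * h0 ^ M * fact M powr t) \<Longrightarrow> X \<le> 2 powr t * B * exp (- (r * norm x powr (1 / t)))"
    using ex_power_bounds_imp_exp[OF assms(2,5)] by blast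
  \<comment> \<open>Small enough for the rate \<open>r\<close>, and smaller than \<open>h\<close> by
    the factor \<open>d\<close> that expanding a direction in the standard basis costs per
    derivative.\<close>
  define \<eta> where "\<eta> = min h0 (h / d)"
  have \<eta>: "\<eta> > 0" "\<eta> \<le> h0" "d * \<eta> \<le> h"
    using h0 assms d by (auto simp: \<eta>_def min_def field_simps)
  obtain C where C: "\<And>idx. GS_quot t s \<eta> f idx \<le> C"
  proof -
    have "bdd_above (range (GS_quot t s \<eta> f))"
      using assms(3) \<eta>(1) by (simp add: GS_def)
    then show ?thesis using that by (meson bdd_above.E rangeI)
  qed
  have C0: "0 \<le> C" using C[of undefined] GS_quot_nonneg[OF \<eta>(1)] order_trans by blast
  have basis: "norm (iter_deriv (map (\<lambda>i. axis i 1) js) f x) \<le> 2 powr t * C * \<eta> ^ length js * fact (length js) powr s * decay (1 / t) r x" for js x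
  proof -
    let ?\<beta> = "count_list js" and ?X = "norm (iter_deriv (map (\<lambda>i. axis i 1) js) f x)"
    have "mset (map (\<lambda>i. axis i 1) (mi_list ?\<beta>)) = (mset (map (\<lambda>i. axis i 1) js) :: (real^'n) multiset)"
      by (simp add: mset_mi_list_count)
    from iter_deriv_perm[OF f this] have D: "norm (D_op ?\<beta> f x) = ?X"
       by (simp only: norm_D_op)
    have "\<bar>x $ k\<bar> ^ M * ?X \<le> (C * \<eta> ^ length js * fact (length js) powr s) * h0 ^ M * fact M powr t" for k M
    proof -
      \<comment> \<open>Powers of one coordinate suffice, since the decay is measured by a single
        coordinate.\<close>
      let ?\<alpha> = "\<lambda>i. if i = k then M else 0"
      have size: "mi_size (\<lambda>i. ?\<alpha> i + ?\<beta> i) = M + length js"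
        by (simp add: mi_size_def sum.distrib count_list_sum_UNIV)
      have fact: "mi_fact ?\<alpha> = fact M"
        by (simp add: mi_fact_def if_distrib prod.If_cases)
      have pow: "mi_power x ?\<alpha> = (x $ k) ^ M"
        by (simp add: mi_power_def if_distrib prod.If_cases)
      have pos: "0 < mi_fact ?\<beta>" by (auto simp: mi_fact_def intro!: prod_pos)
      have "GS_quot t s \<eta> f (?\<alpha>, ?\<beta>, x) = \<bar>x $ k\<bar> ^ M * ?X / (\<eta> ^ (M + length js) * fact M powr t * mi_fact ?\<beta> powr s)"
        unfolding GS_quot_def by (simp add: norm_mult D size fact pow power_abs)
      with C[of "(?\<alpha>, ?\<beta>, x)"] have "\<bar>x $ k\<bar> ^ M * ?X \<le> C * (\<eta> ^ (M + length js) * fact M powr t * mi_fact ?\<beta> powr s)"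
        using \<eta> pos by (simp add: pos_divide_le_eq)
      also have "\<dots> \<le> C * (h0 ^ M * \<eta> ^ length js * fact M powr t * fact (length js) powr s)"
        unfolding power_add
      proof (intro mult_mono power_mono powr_mono2 \<eta> C0)
        show "mi_fact ?\<beta> \<le> fact (length js)"
          using prod_fact_le[of UNIV ?\<beta>] by (simp add: mi_fact_def count_list_sum_UNIV)
      qed (use \<eta> h0 pos assms in auto)
      finally show ?thesis by (simp add: mult_ac)
    qed
    then have "?X \<le> 2 powr t * (C * \<eta> ^ length js * fact (length js) powr s) * exp (- (r * norm x powr (1 / t)))"
      using C0 \<eta> by (intro dec) auto
    then show ?thesis by (simp add: decay_def mult_ac)
  qed
  have "gevrey s (d * \<eta>) (\<lambda>x. (2 powr t * C) * decay (1 / t) r x) f"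
  proof (rule gevreyI)
    fix vs :: "(real^'n) list" and x assume vs: "\<And>v. v \<in> set vs \<Longrightarrow> norm v \<le> 1"
    have e: "\<exists>c. (\<forall>i\<in>UNIV. \<bar>c i\<bar> \<le> 1) \<and> w = (\<Sum>i\<in>UNIV. c i *\<^sub>R axis i 1)" if "norm w \<le> 1" for w :: "real^'n"
    proof (intro exI[of _ "\<lambda>i. w $ i"] conjI ballI)
      show "\<bar>w $ i\<bar> \<le> 1" for i using component_le_norm_cart[of w i] that by linarith
      show "w = (\<Sum>i\<in>UNIV. w $ i *\<^sub>R axis i 1)"
        using basis_expansion[of w] by (simp add: scalar_mult_eq_scaleR)
    qed
    have "norm (iter_deriv (vs @ map (\<lambda>i. axis i 1) []) f x)
      \<le> real (card (UNIV :: 'n set)) ^ length vs * (2 powr t * C * \<eta> ^ (length vs + length ([]::'n list)) * fact (length vs + length ([]::'n list)) powr s * decay (1 / t) r x)"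
      by (rule iter_deriv_expand[OF f finite e]) (use basis vs in auto)
    then show "norm (iter_deriv vs f x) \<le> (2 powr t * C) * decay (1 / t) r x * (d * \<eta>) ^ length vs * fact (length vs) powr s"
      by (simp add: d_def power_mult_distrib mult_ac)
  qed
  from gevrey_mono[OF this _ _ \<eta>(3)] show ?thesis
    using C0 d \<eta> by (intro exI[of _ "2 powr t * C"]) auto
qed

text \<open>\<open>h'\<close> and \<open>r\<close> are chosen before \<open>f\<close>, and the
  constant \<open>A\<close> is passed on unchanged. Estimates for functionals need this uniformity;
  mere membership in \<open>GS t s\<close> would not be enough.\<close>

lemma gevrey_imp_GS_quot:
  assumes "0 < s" "0 < t" "0 < h"
  shows "\<exists>h'>0. \<exists>r>0. \<forall>(f::real ^ 'n::finite \<Rightarrow> complex) A.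
    gevrey s h' (\<lambda>x. A * decay (1 / t) r x) f \<longrightarrow> (\<forall>idx. GS_quot t s h f idx \<le> A)"
proof -
  \<comment> \<open>The factorial of an order \<open>N\<close> exceeds the factorial of the
    multi-index by at most \<open>D ^ N\<close>, by \<open>fact_sum_le\<close>; \<open>h'\<close>
    and \<open>c\<close> are reduced accordingly.\<close>
  define D where "D = (2::real) ^ CARD('n)"
  have D: "D \<ge> 1" by (simp add: D_def)
  define c where "c = h / D powr t"
  have c: "c > 0" using D assms by (simp add: c_def)
  \<comment> \<open>The rate that \<open>power_le_exp_powr\<close> produces at \<open>c\<close>;
    with it the growth of the monomial and the decay of \<open>f\<close> cancel exactly.\<close>
  define r where "r = t * (1 / c) powr (1 / t)"
  define h' where "h' = h / D powr s"
  have h': "h' > 0" and r: "r > 0" using D assms c by (simp_all add: h'_def r_def)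
  have fact: "fact (mi_size \<alpha>) powr \<sigma> \<le> (D powr \<sigma>) ^ mi_size \<alpha> * mi_fact \<alpha> powr \<sigma>" if "\<sigma> > 0" for \<alpha> :: "'n multi_index" and \<sigma>
  proof -
    have "fact (mi_size \<alpha>) \<le> D ^ mi_size \<alpha> * mi_fact \<alpha>"
      using fact_sum_le[of UNIV \<alpha>] by (simp add: mi_size_def mi_fact_def D_def)
    then have "fact (mi_size \<alpha>) powr \<sigma> \<le> (D ^ mi_size \<alpha> * mi_fact \<alpha>) powr \<sigma>"
      using that by (intro powr_mono2) auto
    also have "\<dots> = (D ^ mi_size \<alpha>) powr \<sigma> * mi_fact \<alpha> powr \<sigma>"
      using D by (intro powr_mult)
    also have "(D ^ mi_size \<alpha>) powr \<sigma> = (D powr \<sigma>) ^ mi_size \<alpha>"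
      using D by (simp add: powr_powr mult.commute flip: powr_realpow)
    finally show ?thesis .
  qed
  have quot: "GS_quot t s h f (\<alpha>, \<beta>, x) \<le> A"
    if gevrey: "gevrey s h' (\<lambda>x. A * decay (1 / t) r x) f" for f :: "real^'n \<Rightarrow> complex" and A \<alpha> \<beta> x
  proof -
    have A: "0 \<le> A" using gevrey_nonneg[OF gevrey, of x] by (simp add: zero_le_mult_iff decay_def)
    have pos: "0 < mi_fact \<gamma>" for \<gamma> :: "'n multi_index" by (auto simp: mi_fact_def intro!: prod_pos)
    have "\<bar>mi_power x \<alpha>\<bar> \<le> (\<Prod>i\<in>UNIV. norm x ^ \<alpha> i)"
      unfolding mi_power_def abs_prod power_abs
      by (intro prod_mono conjI power_mono component_le_norm_cart) auto
    also have "\<dots> = norm x ^ mi_size \<alpha>"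
      by (simp add: mi_size_def power_sum)
    also have "\<dots> \<le> c ^ mi_size \<alpha> * fact (mi_size \<alpha>) powr t * exp (t * (norm x / c) powr (1 / t))"
      using assms c by (intro power_le_exp_powr) auto
    also have "t * (norm x / c) powr (1 / t) = r * norm x powr (1 / t)"
      using c by (simp add: r_def powr_divide)
    also have "c ^ mi_size \<alpha> * fact (mi_size \<alpha>) powr t \<le> c ^ mi_size \<alpha> * ((D powr t) ^ mi_size \<alpha> * mi_fact \<alpha> powr t)"
      using fact[of t \<alpha>] assms c by (intro mult_left_mono) auto
    also have "\<dots> = h ^ mi_size \<alpha> * mi_fact \<alpha> powr t"
      using D by (simp add: c_def power_divide)
    finally have 1: "\<bar>mi_power x \<alpha>\<bar> \<le> h ^ mi_size \<alpha> * mi_fact \<alpha> powr t * exp (r * norm x powr (1 / t))"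
      by (simp add: mult_right_mono)
    have "norm (D_op \<beta> f x) \<le> A * decay (1 / t) r x * h' ^ mi_size \<beta> * fact (mi_size \<beta>) powr s"
    proof -
      have "norm v \<le> 1" if "v \<in> set (map (\<lambda>i. axis i 1) (mi_list \<beta>))" for v :: "real^'n"
        using that by (auto simp: norm_axis_1)
      from gevreyD[OF gevrey this, of "map (\<lambda>i. axis i 1) (mi_list \<beta>)" x] show ?thesis
        by (simp add: norm_D_op length_mi_list)
    qed
    also have "\<dots> \<le> A * decay (1 / t) r x * h' ^ mi_size \<beta> * ((D powr s) ^ mi_size \<beta> * mi_fact \<beta> powr s)"
      using fact[of s \<beta>] assms A h' by (intro mult_left_mono) auto
    also have "\<dots> = A * decay (1 / t) r x * h ^ mi_size \<beta> * mi_fact \<beta> powr s"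
      using D by (simp add: h'_def power_divide)
    finally have 2: "norm (D_op \<beta> f x) \<le> A * decay (1 / t) r x * h ^ mi_size \<beta> * mi_fact \<beta> powr s" .
    have "\<bar>mi_power x \<alpha>\<bar> * norm (D_op \<beta> f x) \<le>
        (h ^ mi_size \<alpha> * mi_fact \<alpha> powr t * exp (r * norm x powr (1 / t))) * (A * decay (1 / t) r x * h ^ mi_size \<beta> * mi_fact \<beta> powr s)"
      using 1 2 assms by (intro mult_mono) auto
    also have "\<dots> = A * (h ^ mi_size (\<lambda>i. \<alpha> i + \<beta> i) * mi_fact \<alpha> powr t * mi_fact \<beta> powr s) * (exp (r * norm x powr (1 / t)) * decay (1 / t) r x)"
      by (simp add: mi_size_def sum.distrib power_add mult_ac)
    also have "exp (r * norm x powr (1 / t)) * decay (1 / t) r x = 1"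
      by (simp add: decay_def flip: exp_add)
    finally have 3: "\<bar>mi_power x \<alpha>\<bar> * norm (D_op \<beta> f x) \<le> A * (h ^ mi_size (\<lambda>i. \<alpha> i + \<beta> i) * mi_fact \<alpha> powr t * mi_fact \<beta> powr s)"
      by simp
    have 4: "0 < h ^ mi_size (\<lambda>i. \<alpha> i + \<beta> i) * mi_fact \<alpha> powr t * mi_fact \<beta> powr s"
      using pos[of \<alpha>] pos[of \<beta>] assms by auto
    from 3 show ?thesis
      unfolding GS_quot_def prod.case norm_mult norm_of_real pos_divide_le_eq[OF 4] .
  qed
  show ?thesis
    by (intro exI[of _ h'] exI[of _ r] conjI h' r allI impI) (use quot in force)
qed

lemma GS_iff_gevrey:
  fixes f :: "real ^ 'n::finite \<Rightarrow> complex"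
  assumes "0 < s" "0 < t"
  shows "f \<in> GS t s \<longleftrightarrow> smooth f \<and> (\<forall>h>0. \<forall>r>0. \<exists>C\<ge>0. gevrey s h (\<lambda>x. C * decay (1 / t) r x) f)"
proof
  assume "f \<in> GS t s"
  then show "smooth f \<and> (\<forall>h>0. \<forall>r>0. \<exists>C\<ge>0. gevrey s h (\<lambda>x. C * decay (1 / t) r x) f)"
    using GS_imp_gevrey[OF assms] GS_smooth by blast
next
  assume f: "smooth f \<and> (\<forall>h>0. \<forall>r>0. \<exists>C\<ge>0. gevrey s h (\<lambda>x. C * decay (1 / t) r x) f)"
  have "bdd_above (range (GS_quot t s h f))" if h: "h > 0" for h
  proof -
    obtain h' r where "h' > 0" "r > 0" and q: "\<And>(f::real ^ 'n \<Rightarrow> complex) A.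
      gevrey s h' (\<lambda>x. A * decay (1 / t) r x) f \<Longrightarrow> (\<forall>idx. GS_quot t s h f idx \<le> A)"
      using gevrey_imp_GS_quot[OF assms h] by blast
    then obtain C where "gevrey s h' (\<lambda>x. C * decay (1 / t) r x) f" using f by blast
    from q[OF this] show ?thesis by (auto simp: bdd_above_def)
  qed
  with f show "f \<in> GS t s" by (simp add: GS_def)
qed

section \<open>Seminorm bounds for functionals; Lebesgue integrals on Euclidean spaces\<close>

lemma GS_quot_mono:
  assumes "0 < h" "h \<le> h'"
  shows "GS_quot t s h' f idx \<le> GS_quot t s h f idx"
proof -
  obtain \<alpha> \<beta> x where idx: "idx = (\<alpha>, \<beta>, x)" by (cases idx)
  have pos: "0 < mi_fact \<gamma>" for \<gamma> :: "'a multi_index" by (auto simp: mi_fact_def intro!: prod_pos)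
  show ?thesis
    unfolding idx GS_quot_def prod.case
    using assms pos[of \<alpha>] pos[of \<beta>]
    by (intro divide_left_mono mult_right_mono power_mono mult_pos_pos) auto
qed

text \<open>The term \<open>0 - g x\<close> is kept in this form because it is what membership of
  zero in a generating set of the topology speaks about.\<close>

lemma GS_quot_diff_le:
  assumes "smooth f" "smooth g" "0 < h"
  shows "GS_quot t s h (\<lambda>x. f x - g x) idx \<le> GS_quot t s h f idx + GS_quot t s h (\<lambda>x. 0 - g x) idx"
proof -
  obtain \<alpha> \<beta> x where idx: "idx = (\<alpha>, \<beta>, x)" by (cases idx)
  have pos: "0 \<le> mi_fact \<gamma>" for \<gamma> :: "'a multi_index" by (auto simp: mi_fact_def intro!: prod_nonneg)
  have neg: "smooth (\<lambda>x. 0 - g x)" "iter_deriv vs (\<lambda>x. 0 - g x) = (\<lambda>x. - iter_deriv vs g x)" for vs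
    using smooth_cmult[OF assms(2), of "-1"] iter_deriv_cmult[OF assms(2), of vs "-1"] by simp_all
  have "D_op \<beta> (\<lambda>x. f x - g x) x = D_op \<beta> f x + D_op \<beta> (\<lambda>x. 0 - g x) x"
    unfolding D_op_def mi_deriv_eq_iter_deriv iter_deriv_diff[OF assms(1,2)] neg by (simp add: algebra_simps)
  then have "norm (of_real (mi_power x \<alpha>) * D_op \<beta> (\<lambda>x. f x - g x) x) \<le>
    norm (of_real (mi_power x \<alpha>) * D_op \<beta> f x) + norm (of_real (mi_power x \<alpha>) * D_op \<beta> (\<lambda>x. 0 - g x) x)"
    by (metis distrib_left norm_triangle_ineq)
  then show ?thesis
    unfolding idx GS_quot_def prod.case add_divide_distrib[symmetric]
    using assms pos[of \<alpha>] pos[of \<beta>] by (intro divide_right_mono mult_nonneg_nonneg) auto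
qed

lemma smooth_zero: "smooth (\<lambda>x. 0)" and iter_deriv_zero: "iter_deriv vs (\<lambda>x. 0) = (\<lambda>x. 0)"
  using smooth_sum[of "{}"] iter_deriv_sum[of "{}"] by simp_all

lemma zero_in_GS: "0 < s \<Longrightarrow> 0 < t \<Longrightarrow> (\<lambda>x. 0) \<in> GS t s"
  by (subst GS_iff_gevrey) (auto intro!: exI[of _ 0] simp: gevrey_def iter_deriv_zero smooth_zero)

lemma GS_cmult:
  assumes "0 < s" "0 < t" "f \<in> GS t s"
  shows "(\<lambda>x. c * f x) \<in> GS t s"
  unfolding GS_iff_gevrey[OF assms(1,2)]
proof (intro conjI allI impI)
  have f: "smooth f" using assms(3) GS_smooth by blast
  then show "smooth (\<lambda>x. c * f x)" by (rule smooth_cmult)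
  fix h r :: real assume "0 < h" "0 < r"
  then obtain C where "C \<ge> 0" "gevrey s h (\<lambda>x. C * decay (1 / t) r x) f"
    using GS_imp_gevrey assms by blast
  with gevrey_cmult[OF f this(2), of c] show "\<exists>C\<ge>0. gevrey s h (\<lambda>x. C * decay (1 / t) r x) (\<lambda>x. c * f x)"
    by (intro exI[of _ "norm c * C"]) (simp add: mult.assoc)
qed

lemma GS_add:
  assumes "0 < s" "0 < t" "f \<in> GS t s" "g \<in> GS t s"
  shows "(\<lambda>x. f x + g x) \<in> GS t s"
  unfolding GS_iff_gevrey[OF assms(1,2)]
proof (intro conjI allI impI)
  have sm: "smooth f" "smooth g" using assms GS_smooth by blast+
  then show "smooth (\<lambda>x. f x + g x)" by (rule smooth_add)
  fix h r :: real assume hr: "0 < h" "0 < r"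
  obtain C where C: "C \<ge> 0" "gevrey s h (\<lambda>x. C * decay (1 / t) r x) f"
    using GS_imp_gevrey[OF assms(1,2,3) hr] by blast
  obtain C' where C': "C' \<ge> 0" "gevrey s h (\<lambda>x. C' * decay (1 / t) r x) g"
    using GS_imp_gevrey[OF assms(1,2,4) hr] by blast
  from gevrey_add[OF sm C(2) C'(2)] C(1) C'(1) show "\<exists>C\<ge>0. gevrey s h (\<lambda>x. C * decay (1 / t) r x) (\<lambda>x. f x + g x)"
    by (intro exI[of _ "C + C'"]) (simp add: distrib_right)
qed

lemma GS_diff:
  assumes "0 < s" "0 < t" "f \<in> GS t s" "g \<in> GS t s"
  shows "(\<lambda>x. f x - g x) \<in> GS t s"
  using GS_add[OF assms(1,2,3) GS_cmult[OF assms(1,2,4), of "-1"]] by simp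

text \<open>The topology is generated by balls around arbitrary centres. Induction over its
  generation shows that a single seminorm already controls a neighbourhood of zero: for an
  intersection the smaller \<open>h\<close> gives the stronger seminorm, and a ball about
  \<open>g\<close> that contains zero leaves some room there.\<close>

lemma GS_nbhd_zero:
  fixes V :: "(real ^ 'n::finite \<Rightarrow> complex) set"
  assumes st: "0 < s" "0 < t" and V: "openin (GS_topology t s) V" and "(\<lambda>x. 0) \<in> V"
  shows "\<exists>h>0. \<exists>\<epsilon>>0. \<forall>f\<in>GS t s. (\<forall>idx. GS_quot t s h f idx \<le> \<epsilon>) \<longrightarrow> f \<in> V"
proof -
  let ?S = "{{f \<in> GS t s. GS_norm t s h (\<lambda>x. f x - g x) < \<epsilon>} | g h \<epsilon>. g \<in> GS t s \<and> 0 < h \<and> 0 < \<epsilon>} :: (real ^ 'n \<Rightarrow> complex) set set"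
  from V have "generate_topology_on ?S V"
    unfolding GS_topology_def by (rule openin_topology_generated_by)
  then show ?thesis using assms(4)
  proof (induction rule: generate_topology_on.induct)
    case Empty
    then show ?case by simp
  next
    case (Int a b)
    then obtain h1 e1 h2 e2 where 1: "h1 > 0" "e1 > 0" "\<And>f. f \<in> GS t s \<Longrightarrow> (\<forall>idx. GS_quot t s h1 f idx \<le> e1) \<Longrightarrow> f \<in> a"
      and 2: "h2 > 0" "e2 > 0" "\<And>f. f \<in> GS t s \<Longrightarrow> (\<forall>idx. GS_quot t s h2 f idx \<le> e2) \<Longrightarrow> f \<in> b"
      by blast
    show ?case
    proof (rule exI[of _ "min h1 h2"], intro conjI, use 1 2 in simp, rule exI[of _ "min e1 e2"], intro conjI ballI impI)
      show "0 < min e1 e2" using 1 2 by simp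
      fix f :: "real ^ 'n \<Rightarrow> complex" assume f: "f \<in> GS t s" "\<forall>idx. GS_quot t s (min h1 h2) f idx \<le> min e1 e2"
      have "GS_quot t s h1 f idx \<le> e1" for idx
        using GS_quot_mono[of "min h1 h2" h1 t s f idx] f(2) 1 2 by (metis min.boundedE min_def min.cobounded1 order_trans)
      moreover have "GS_quot t s h2 f idx \<le> e2" for idx
        using GS_quot_mono[of "min h1 h2" h2 t s f idx] f(2) 1 2 by (metis min.boundedE min_def min.cobounded2 order_trans)
      ultimately show "f \<in> a \<inter> b" using 1(3) 2(3) f(1) by blast
    qed
  next
    case (UN K)
    then obtain k where k: "k \<in> K" "(\<lambda>x. 0) \<in> k" by blast
    from UN.IH[OF this] obtain h e where "h > 0" "e > 0" "\<forall>f\<in>GS t s. (\<forall>idx. GS_quot t s h f idx \<le> e) \<longrightarrow> f \<in> k"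
      by (elim exE conjE) (rule that)
    with k(1) show ?case
      by (metis UnionI)
  next
    case (Basis V)
    then obtain g h e where g: "g \<in> GS t s" "0 < h" "0 < e" and V: "V = {f \<in> GS t s. GS_norm t s h (\<lambda>x. f x - g x) < e}"
      by blast
    define N where "N = GS_norm t s h (\<lambda>x. 0 - g x)"
    have N: "N < e" using Basis.prems by (simp add: V N_def)
    have g': "(\<lambda>x. 0 - g x) \<in> GS t s"
      using GS_cmult[OF st g(1), of "-1"] by simp
    have quot: "GS_quot t s h (\<lambda>x. 0 - g x) idx \<le> N" for idx
      unfolding N_def GS_norm_def by (rule cSup_upper) (use g' g(2) in \<open>auto simp: GS_def\<close>)
    show ?case
    \<comment> \<open>Half of the room that the ball about \<open>g\<close> leaves at zero, so that
      the final inequality is strict.\<close>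
    proof (rule exI[of _ h], intro conjI g(2), rule exI[of _ "(e - N) / 2"], intro conjI ballI impI)
      show "0 < (e - N) / 2" using N by simp
      fix f :: "real ^ 'n \<Rightarrow> complex" assume f: "f \<in> GS t s" "\<forall>idx. GS_quot t s h f idx \<le> (e - N) / 2"
      have "GS_quot t s h (\<lambda>x. f x - g x) idx \<le> (e - N) / 2 + N" for idx
        using GS_quot_diff_le[OF GS_smooth[OF f(1)] GS_smooth[OF g(1)] g(2), of t s idx] f(2)[rule_format, of idx] quot[of idx]
        by linarith
      then have "GS_norm t s h (\<lambda>x. f x - g x) \<le> (e - N) / 2 + N"
        unfolding GS_norm_def by (intro cSup_least) auto
      also have "\<dots> < e" using N by (simp add: field_simps)
      finally show "f \<in> V" using f V by simp
    qed
  qed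
qed

text \<open>Continuity at zero bounds \<open>u\<close> on a seminorm ball, homogeneity turns this
  into a linear estimate, and the seminorm is replaced by a Gevrey weight with fixed
  \<open>h\<close> and \<open>r\<close>.\<close>

lemma GS_dual_bounded:
  fixes u :: "(real ^ 'n::finite \<Rightarrow> complex) \<Rightarrow> complex"
  assumes st: "0 < s" "0 < t" and u: "u \<in> GS_dual t s"
  shows "\<exists>h>0. \<exists>r>0. \<exists>C>0. \<forall>f\<in>GS t s. \<forall>A. gevrey s h (\<lambda>x. A * decay (1 / t) r x) f \<longrightarrow> norm (u f) \<le> C * A"
proof -
  have scale: "u (\<lambda>x. c * f x) = cnj c * u f" if "f \<in> GS t s" for c f
    using u that by (simp add: GS_dual_def)
  have u0: "u (\<lambda>x. 0) = 0"
    using scale[OF zero_in_GS[OF st], of 0] by simp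
  have cont: "continuous_map (GS_topology t s) euclidean u"
    using u by (simp add: GS_dual_def)
  \<comment> \<open>Preimages under a continuous map are open relative to the carrier of the
    topology, which is the union of the generating sets; zero has to be located in one of
    them.\<close>
  have top: "(\<lambda>x. 0) \<in> topspace (GS_topology t s :: (real ^ 'n \<Rightarrow> complex) topology)"
  proof -
    have "GS_norm t s 1 (\<lambda>x::real^'n. 0 - 0) \<le> 0"
      unfolding GS_norm_def
      by (rule cSup_least) (auto simp: GS_quot_def D_op_def mi_deriv_eq_iter_deriv iter_deriv_zero)
    then have "{f \<in> GS t s. GS_norm t s 1 (\<lambda>x::real^'n. f x - 0) < 1} \<in>
      {{f \<in> GS t s. GS_norm t s h (\<lambda>x. f x - g x) < \<epsilon>} | g h \<epsilon>. g \<in> GS t s \<and> 0 < h \<and> 0 < \<epsilon>}"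
      "(\<lambda>x. 0) \<in> {f \<in> GS t s. GS_norm t s 1 (\<lambda>x::real^'n. f x - 0) < 1}"
      using zero_in_GS[OF st] by (auto intro!: exI[of _ "\<lambda>x. 0"] exI[of _ "1::real"])
    then show ?thesis
      unfolding GS_topology_def topology_generated_by_topspace by blast
  qed
  define V where "V = {f \<in> topspace (GS_topology t s). u f \<in> ball 0 1}"
  have op: "openin (GS_topology t s) V"
    unfolding V_def using cont by (rule openin_continuous_map_preimage) simp
  have mem: "(\<lambda>x. 0) \<in> V" using top u0 by (simp add: V_def)
  from GS_nbhd_zero[OF st op mem] obtain h e where h: "h > 0" and e: "e > 0" and
    V': "\<forall>f\<in>GS t s. (\<forall>idx. GS_quot t s h f idx \<le> e) \<longrightarrow> f \<in> V"
    by (elim exE conjE) (rule that)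
  have V: "f \<in> V" if "f \<in> GS t s" "\<forall>idx. GS_quot t s h f idx \<le> e" for f
    using V' that by simp
  obtain h' r where h': "h' > 0" and r: "r > 0" and q: "\<And>(f::real ^ 'n \<Rightarrow> complex) A.
      gevrey s h' (\<lambda>x. A * decay (1 / t) r x) f \<Longrightarrow> (\<forall>idx. GS_quot t s h f idx \<le> A)"
    using gevrey_imp_GS_quot[OF st h] by blast
  have le: "norm (u f) \<le> 1 / e * A" if f: "f \<in> GS t s" and gevrey: "gevrey s h' (\<lambda>x. A * decay (1 / t) r x) f" for f A
  proof (rule field_le_epsilon)
    fix d :: real assume d: "d > 0"
    \<comment> \<open>\<open>A\<close> may be zero. Adding \<open>d * e\<close> makes the rescaling
      by \<open>e / A'\<close> possible and costs only \<open>d\<close> in the end.\<close>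
    define A' where "A' = A + d * e"
    have "0 \<le> A" using gevrey_nonneg[OF gevrey, of 0] by (simp add: zero_le_mult_iff decay_def)
    then have A': "A' > 0" using d e by (simp add: A'_def add_nonneg_pos)
    have gb': "gevrey s h' (\<lambda>x. A' * decay (1 / t) r x) f"
      using d e h' by (intro gevrey_mono[OF gevrey]) (auto simp: A'_def)
    have "gevrey s h' (\<lambda>x. e * decay (1 / t) r x) (\<lambda>x. of_real (e / A') * f x)"
      using gevrey_cmult[OF GS_smooth[OF f] gb', of "of_real (e / A')"] e A' by (simp add: norm_divide mult.assoc)
    from q[OF this] have "(\<lambda>x. of_real (e / A') * f x) \<in> V"
      by (intro V GS_cmult st f)
    then have "norm (u (\<lambda>x. of_real (e / A') * f x)) < 1"
      by (simp add: V_def)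
    then have "e / A' * norm (u f) < 1"
      using scale[OF f, of "of_real (e / A')"] e A' by (simp add: norm_mult norm_divide)
    then have "norm (u f) < A' / e" using e A' by (simp add: field_simps)
    then show "norm (u f) \<le> 1 / e * A + d" using e by (simp add: A'_def field_simps)
  qed
  show ?thesis
    by (intro exI[of _ h'] exI[of _ r] exI[of _ "1 / e"] conjI h' r ballI allI impI le) (use e in auto)
qed

section \<open>Integrals of products and of decay weights, affine substitutions, Fubini\<close>

lemma
  fixes h :: "'a::euclidean_space \<Rightarrow> real \<Rightarrow> 'b::{real_normed_field,banach,second_countable_topology}"
  assumes "\<And>b. b \<in> Basis \<Longrightarrow> integrable lborel (h b)"
  shows integrable_prod_Basis: "integrable lborel (\<lambda>x. \<Prod>b\<in>Basis. h b (x \<bullet> b))"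
    and integral_prod_Basis: "(LINT x|lborel. (\<Prod>b\<in>Basis. h b (x \<bullet> b))) = (\<Prod>b\<in>Basis. (LINT y|lborel. h b y))"
proof -
  interpret product_sigma_finite "\<lambda>b::'a. lborel :: real measure" ..
  have [measurable]: "b \<in> Basis \<Longrightarrow> h b \<in> borel_measurable borel" for b
    using assms[of b] by (auto dest: borel_measurable_integrable)
  have eq: "(\<Prod>b\<in>Basis. h b ((\<Sum>b\<in>Basis. f b *\<^sub>R b) \<bullet> b)) = (\<Prod>b\<in>Basis. h b (f b))" for f
    by (intro prod.cong refl) (simp add: inner_sum_left_Basis)
  have m: "(\<lambda>x::'a. \<Prod>b\<in>Basis. h b (x \<bullet> b)) \<in> borel_measurable borel"
    by measurable
  have m2: "(\<lambda>f. \<Sum>b\<in>Basis. f b *\<^sub>R b) \<in> Pi\<^sub>M Basis (\<lambda>b::'a. lborel) \<rightarrow>\<^sub>M borel"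
    by measurable
  show "integrable lborel (\<lambda>x. \<Prod>b\<in>Basis. h b (x \<bullet> b))"
    unfolding lborel_eq[where 'a='a] integrable_distr_eq[OF m2 m] eq
    by (rule product_integrable_prod) (use assms in auto)
  show "(LINT x|lborel. (\<Prod>b\<in>Basis. h b (x \<bullet> b))) = (\<Prod>b\<in>Basis. (LINT y|lborel. h b y))"
    unfolding lborel_eq[where 'a='a] integral_distr[OF m2 m] eq
    by (rule product_integral_prod) (use assms in auto)
qed

lemma borel_measurable_decay [measurable]: "decay p r \<in> borel_measurable borel"
  unfolding decay_def[abs_def] by measurable

lemma integrable_decay_real:
  assumes "0 < p" "0 < r"
  shows "integrable lborel (decay p r :: real \<Rightarrow> real)"
proof -
  \<comment> \<open>Makes \<open>power_le_exp_powr\<close> with exponent \<open>1 / p\<close>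
    produce the rate \<open>r\<close>; its case \<open>M = 2\<close> then gives the integrable
    majorant \<open>C * inverse (1 + x\<^sup>2)\<close>.\<close>
  define h where "h = ((1 / p) / r) powr (1 / p)"
  have h: "h > 0" using assms by (simp add: h_def)
  have hr: "1 / p * (1 / h) powr p = r"
  proof -
    have "h powr p = (1 / p) / r" using assms by (simp add: h_def powr_powr)
    then show ?thesis using h assms by (simp add: powr_divide)
  qed
  define C where "C = 1 + h ^ 2 * fact 2 powr (1 / p)"
  have C: "C \<ge> 0" by (simp add: C_def)
  have le: "(1 + x\<^sup>2) * decay p r x \<le> C" for x :: real
  proof -
    have "norm x ^ 2 \<le> h ^ 2 * fact 2 powr (1 / p) * exp (1 / p * (norm x / h) powr (1 / (1 / p)))"
      using assms h by (intro power_le_exp_powr) auto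
    also have "1 / p * (norm x / h) powr (1 / (1 / p)) = r * norm x powr p"
      using h by (subst hr[symmetric]) (simp add: powr_divide)
    finally have "x ^ 2 * decay p r x \<le> h ^ 2 * fact 2 powr (1 / p)"
      by (simp add: decay_def exp_minus field_simps)
    moreover have "decay p r x \<le> 1" using assms by (intro decay_le_1) simp
    ultimately show ?thesis by (simp add: C_def algebra_simps)
  qed
  have int: "integrable lborel (\<lambda>x::real. C * inverse (1 + x\<^sup>2))"
    using integrable_inverse_1_plus_square by (simp add: set_integrable_def)
  show ?thesis
  proof (rule Bochner_Integration.integrable_bound[OF int])
    show "AE x in lborel. norm (decay p r x) \<le> norm (C * inverse (1 + x\<^sup>2))"
    proof (intro AE_I2)
      fix x :: real
      have "1 + x\<^sup>2 > 0" by (simp add: add_pos_nonneg)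
      then show "norm (decay p r x) \<le> norm (C * inverse (1 + x\<^sup>2))"
        using le[of x] C by (simp add: field_simps)
    qed
  qed measurable
qed

lemma integrable_decay:
  assumes "0 < p" "0 < r"
  shows "integrable lborel (decay p r :: 'a::euclidean_space \<Rightarrow> real)"
proof -
  define n where "n = real DIM('a)"
  have n: "n > 0" by (simp add: n_def)
  have "integrable lborel (\<lambda>x::'a. \<Prod>b\<in>Basis. decay p (r / n) (x \<bullet> b))"
    using assms n by (intro integrable_prod_Basis integrable_decay_real) auto
  then show ?thesis
  proof (rule Bochner_Integration.integrable_bound)
    \<comment> \<open>Each coordinate is at most the norm, so the rate can be shared equally among
      the \<open>n\<close> coordinates and the integral splits into one-dimensional ones.\<close>
    have "decay p r x \<le> (\<Prod>b\<in>Basis. decay p (r / n) (x \<bullet> b))" for x :: 'a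
    proof -
      have "(\<Sum>b\<in>Basis. r / n * norm (x \<bullet> b) powr p) \<le> (\<Sum>b\<in>(Basis::'a set). r / n * norm x powr p)"
        using assms n by (intro sum_mono mult_left_mono powr_mono2) (auto simp: Basis_le_norm)
      also have "\<dots> = r * norm x powr p" using n by (simp add: n_def)
      finally have "exp (- (r * norm x powr p)) \<le> exp (- (\<Sum>b\<in>(Basis::'a set). r / n * norm (x \<bullet> b) powr p))"
        by simp
      also have "\<dots> = (\<Prod>b\<in>Basis. decay p (r / n) (x \<bullet> b))"
        by (simp add: decay_def exp_sum flip: sum_negf)
      finally show ?thesis by (simp add: decay_def)
    qed
    moreover have "0 \<le> (\<Prod>b\<in>Basis. decay p (r / n) (x \<bullet> b))" for x :: 'a by (intro prod_nonneg) simp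
    ultimately show "AE x::'a in lborel. norm (decay p r x) \<le> norm (\<Prod>b\<in>Basis. decay p (r / n) (x \<bullet> b))"
      by simp
  qed measurable
qed

lemma
  fixes f :: "'a::euclidean_space \<Rightarrow> 'b::{banach, second_countable_topology}"
  assumes f: "f \<in> borel_measurable borel" and c: "c \<noteq> 0"
  shows lborel_integral_affine: "(LINT x|lborel. f x) = \<bar>c\<bar> ^ DIM('a) *\<^sub>R (LINT x|lborel. f (t + c *\<^sub>R x))"
    and lborel_integrable_affine_iff: "integrable lborel (\<lambda>x. f (t + c *\<^sub>R x)) \<longleftrightarrow> integrable lborel f"
proof -
  note [measurable] = f
  show "(LINT x|lborel. f x) = \<bar>c\<bar> ^ DIM('a) *\<^sub>R (LINT x|lborel. f (t + c *\<^sub>R x))"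
    by (subst lborel_affine[OF c, of t], subst integral_density) (auto simp: integral_distr)
  show "integrable lborel (\<lambda>x. f (t + c *\<^sub>R x)) \<longleftrightarrow> integrable lborel f"
  proof -
    let ?k = "\<bar>c\<bar> ^ DIM('a)" and ?g = "\<lambda>x. f (t + c *\<^sub>R x)"
    have "integrable lborel f \<longleftrightarrow> integrable lborel (\<lambda>x. ?k *\<^sub>R ?g x)"
      by (subst lborel_affine[OF c, of t], subst integrable_density) (auto simp: integrable_distr_eq)
    also have "\<dots> \<longleftrightarrow> integrable lborel ?g"
      using integrable_scaleR_right[of "inverse ?k" lborel "\<lambda>x. ?k *\<^sub>R ?g x"]
        integrable_scaleR_right[of ?k lborel ?g] c by auto
    finally show ?thesis by blast
  qed
qed

lemma
  fixes f :: "'a::euclidean_space \<Rightarrow> 'b::{banach, second_countable_topology}"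
  assumes f: "f \<in> borel_measurable borel"
  shows lborel_integral_translate: "(LINT x|lborel. f (x + a)) = (LINT x|lborel. f x)"
    and lborel_integrable_translate_iff: "integrable lborel (\<lambda>x. f (x + a)) \<longleftrightarrow> integrable lborel f"
    and lborel_integral_reflect: "(LINT x|lborel. f (a - x)) = (LINT x|lborel. f x)"
  using lborel_integral_affine[OF f, of 1 a] lborel_integrable_affine_iff[OF f, of 1 a] lborel_integral_affine[OF f, of "-1" a]
  by (simp_all add: add.commute)

lemma integrable_prod_dominated:
  fixes f :: "'a::euclidean_space \<times> 'b::euclidean_space \<Rightarrow> 'c::{banach, second_countable_topology}"
  assumes [measurable]: "f \<in> borel_measurable borel"
    and A: "integrable lborel A" and B: "integrable lborel B"
    and le: "\<And>x y. norm (f (x, y)) \<le> A x * B y"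
  shows "integrable lborel f"
proof -
  have [measurable]: "A \<in> borel_measurable borel" "B \<in> borel_measurable borel"
    using A B by (auto dest: borel_measurable_integrable)
  have "integrable (lborel \<Otimes>\<^sub>M lborel) (\<lambda>p. A (fst p) * B (snd p))"
  proof (rule lborel_pair.Fubini_integrable)
    show "integrable lborel (\<lambda>x. LINT y|lborel. norm (A (fst (x, y)) * B (snd (x, y))))"
      using A by (simp add: abs_mult)
    show "AE x in lborel. integrable lborel (\<lambda>y. A (fst (x, y)) * B (snd (x, y)))"
      using B by simp
  qed measurable
  then have "integrable lborel (\<lambda>p. A (fst p) * B (snd p))"
    by (simp add: lborel_prod)
  then show ?thesis
  proof (rule Bochner_Integration.integrable_bound)
    show "AE p in lborel. norm (f p) \<le> norm (A (fst p) * B (snd p))"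
      using le by (intro AE_I2) (metis abs_ge_self order_trans prod.collapse real_norm_def)
  qed measurable
qed

lemma
  fixes f :: "'a::euclidean_space \<times> 'b::euclidean_space \<Rightarrow> 'c::{banach, second_countable_topology}"
  assumes "integrable lborel f"
  shows lborel_Fubini: "(LINT y|lborel. LINT x|lborel. f (x, y)) = (LINT x|lborel. LINT y|lborel. f (x, y))"
    and lborel_integral_fst: "(LINT x|lborel. LINT y|lborel. f (x, y)) = (LINT p|lborel. f p)"
proof -
  have f: "integrable (lborel \<Otimes>\<^sub>M lborel) f" using assms by (simp add: lborel_prod)
  show "(LINT y|lborel. LINT x|lborel. f (x, y)) = (LINT x|lborel. LINT y|lborel. f (x, y))"
    using lborel_pair.Fubini_integral[of "\<lambda>x y. f (x, y)"] f by simp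
  show "(LINT x|lborel. LINT y|lborel. f (x, y)) = (LINT p|lborel. f p)"
    using lborel_pair.integral_fst'[OF f] by (simp add: lborel_prod)
qed

section \<open>Differentiation under the integral and integration by parts\<close>

text \<open>By multilinearity, each direction is its norm times a direction in the unit ball. In
  this form the bound is linear in every direction, as differentiation under the integral
  requires.\<close>

lemma gevrey_bound_list:
  assumes f: "smooth f" and gevrey: "gevrey s h \<omega> f"
  shows "norm (iter_deriv vs f x) \<le> \<omega> x * h ^ length vs * fact (length vs) powr s * (\<Prod>v\<leftarrow>vs. norm v)"
proof -
  have vs: "map (\<lambda>v. norm v *\<^sub>R sgn v) vs = vs"
  proof (rule map_idI)
    show "norm v *\<^sub>R sgn v = v" for v :: 'a
      by (cases "v = 0") (simp_all add: sgn_div_norm)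
  qed
  have pos: "0 \<le> (\<Prod>v\<leftarrow>vs. norm v)" by (induction vs) auto
  have "norm (iter_deriv vs f x) = (\<Prod>v\<leftarrow>vs. norm v) * norm (iter_deriv (map sgn vs) f x)"
    using iter_deriv_scale_list[OF f, of norm sgn vs x] pos unfolding vs by simp
  also have "\<dots> \<le> (\<Prod>v\<leftarrow>vs. norm v) * (\<omega> x * h ^ length (map sgn vs) * fact (length (map sgn vs)) powr s)"
    using pos by (intro mult_left_mono gevreyD[OF gevrey]) (auto simp: norm_sgn)
  finally show ?thesis by (simp add: mult_ac)
qed

text \<open>Dominated convergence for the remainder quotient along sequences. The majorant
  \<open>2 * b\<close> consists of one share for the increment, by the mean value inequality, and
  one for the linear part.\<close>

lemma has_derivative_LINT:
  fixes g :: "'w \<Rightarrow> 'a::real_normed_vector \<Rightarrow> complex"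
  assumes D: "\<And>w x. (g w has_derivative g' w x) (at x)"
    and m: "\<And>x. (\<lambda>w. g w x) \<in> borel_measurable M" "\<And>x v. (\<lambda>w. g' w x v) \<in> borel_measurable M"
    and b: "\<And>w x v. norm (g' w x v) \<le> b w * norm v" "integrable M b"
    and i: "\<And>x. integrable M (\<lambda>w. g w x)"
  shows "((\<lambda>x. LINT w|M. g w x) has_derivative (\<lambda>v. LINT w|M. g' w x v)) (at x)"
proof -
  have lin: "bounded_linear (g' w x)" for w x
    using D has_derivative_bounded_linear by blast
  have b0: "0 \<le> b w * norm v" for w and v :: 'a
    using b(1) norm_ge_zero order_trans by blast
  have i': "integrable M (\<lambda>w. g' w x v)" for x v
  proof (rule Bochner_Integration.integrable_bound[OF _ m(2)])
    show "integrable M (\<lambda>w. b w * norm v)" using b(2) by simp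
    show "AE w in M. norm (g' w x v) \<le> norm (b w * norm v)"
      using b(1) b0 by (intro AE_I2) auto
  qed
  have mv: "norm (g w (x + h) - g w x) \<le> b w * norm h" for w h
  \<comment> \<open>Only a nonzero vector forces \<open>b w\<close> to be nonnegative, which the
    operator norm bound requires.\<close>
  proof (cases "h = 0")
    case False
    with b0[of w h] have bw: "0 \<le> b w" by (simp add: zero_le_mult_iff)
    have "norm (g w (x + h) - g w x) \<le> b w * norm ((x + h) - x)"
    proof (rule differentiable_bound[OF convex_UNIV])
      show "(g w has_derivative g' w x) (at x within UNIV)" for x using D by simp
      show "onorm (g' w x) \<le> b w" for x by (intro onorm_bound bw b)
    qed auto
    then show ?thesis by simp
  qed simp
  show ?thesis
    unfolding has_derivative_at
  proof
    show "bounded_linear (\<lambda>v. LINT w|M. g' w x v)"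
    proof
      show "(LINT w|M. g' w x (u + v)) = (LINT w|M. g' w x u) + (LINT w|M. g' w x v)" for u v
        using i' lin by (simp add: linear_add[OF bounded_linear.linear[OF lin]])
      show "(LINT w|M. g' w x (r *\<^sub>R v)) = r *\<^sub>R (LINT w|M. g' w x v)" for r v
        using i' by (simp add: linear_scale[OF bounded_linear.linear[OF lin]])
      show "\<exists>K. \<forall>v. norm (LINT w|M. g' w x v) \<le> norm v * K"
      proof (intro exI[of _ "LINT w|M. b w"] allI)
        fix v
        have "norm (LINT w|M. g' w x v) \<le> (LINT w|M. norm (g' w x v))"
          by (rule integral_norm_bound)
        also have "\<dots> \<le> (LINT w|M. b w * norm v)"
          using b i' by (intro integral_mono integrable_norm) auto
        finally show "norm (LINT w|M. g' w x v) \<le> norm v * (LINT w|M. b w)"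
          by (simp add: mult.commute)
      qed
    qed
    show "(\<lambda>h. norm ((LINT w|M. g w (x + h)) - (LINT w|M. g w x) - (LINT w|M. g' w x h)) / norm h) \<midarrow>0\<rightarrow> 0"
      unfolding tendsto_at_iff_sequentially
    proof (intro allI impI)
      fix X :: "nat \<Rightarrow> 'a" assume X: "\<forall>n. X n \<in> UNIV - {0}" "X \<longlonglongrightarrow> 0"
      have "(\<lambda>n. LINT w|M. (g w (x + X n) - g w x - g' w x (X n)) /\<^sub>R norm (X n)) \<longlonglongrightarrow> (LINT w|M. 0)"
      proof (rule integral_dominated_convergence)
        show "integrable M (\<lambda>w. 2 * b w)" using b by simp
        show "AE w in M. (\<lambda>n. (g w (x + X n) - g w x - g' w x (X n)) /\<^sub>R norm (X n)) \<longlonglongrightarrow> 0"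
        proof (rule AE_I2)
          fix w
          have "(\<lambda>h. norm (g w (x + h) - g w x - g' w x h) / norm h) \<midarrow>0\<rightarrow> 0"
            using D[of w x] by (simp add: has_derivative_at)
          then have "(\<lambda>n. norm (g w (x + X n) - g w x - g' w x (X n)) / norm (X n)) \<longlonglongrightarrow> 0"
            unfolding tendsto_at_iff_sequentially using X by (auto simp: comp_def)
          then show "(\<lambda>n. (g w (x + X n) - g w x - g' w x (X n)) /\<^sub>R norm (X n)) \<longlonglongrightarrow> 0"
            by (subst tendsto_norm_zero_iff[symmetric]) (simp add: divide_inverse mult.commute)
        qed
        show "AE w in M. norm ((g w (x + X n) - g w x - g' w x (X n)) /\<^sub>R norm (X n)) \<le> 2 * b w" for n
        proof (rule AE_I2)
          fix w
          have *: "norm (g w (x + X n) - g w x - g' w x (X n)) \<le> b w * norm (X n) + b w * norm (X n)"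
            by (rule norm_triangle_le_diff[OF add_mono[OF mv b(1)]])
          show "norm ((g w (x + X n) - g w x - g' w x (X n)) /\<^sub>R norm (X n)) \<le> 2 * b w"
          proof -
            have "norm (X n) > 0" using X by simp
            then show ?thesis
              using * unfolding norm_scaleR by (simp add: pos_divide_le_eq inverse_eq_divide algebra_simps)
          qed
        qed
      qed (use m in measurable)
      then have "(\<lambda>n. norm (LINT w|M. (g w (x + X n) - g w x - g' w x (X n)) /\<^sub>R norm (X n))) \<longlonglongrightarrow> 0"
        unfolding integral_zero by (rule tendsto_norm_zero)
      moreover have "norm (LINT w|M. (g w (x + X n) - g w x - g' w x (X n)) /\<^sub>R norm (X n)) =
          norm ((LINT w|M. g w (x + X n)) - (LINT w|M. g w x) - (LINT w|M. g' w x (X n))) / norm (X n)" for n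
        using i i' by (simp add: divide_inverse mult.commute)
      ultimately show "((\<lambda>h. norm ((LINT w|M. g w (x + h)) - (LINT w|M. g w x) - (LINT w|M. g' w x h)) / norm h) \<circ> X) \<longlonglongrightarrow> 0"
        by (simp add: comp_def)
    qed
  qed
qed

text \<open>The majorant carries the product of the norms of the directions, so that at each order
  the next derivative has a bound linear in the new direction.\<close>

lemma
  fixes \<Phi> :: "'w \<Rightarrow> 'a::real_normed_vector \<Rightarrow> complex"
  assumes sm: "\<And>w. smooth (\<Phi> w)"
    and m: "\<And>vs y. (\<lambda>w. iter_deriv vs (\<Phi> w) y) \<in> borel_measurable M"
    and b: "\<And>n. \<exists>b. integrable M b \<and> (\<forall>vs w y. length vs = n \<longrightarrow> norm (iter_deriv vs (\<Phi> w) y) \<le> b w * (\<Prod>v\<leftarrow>vs. norm v))"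
  shows smooth_LINT: "smooth (\<lambda>y. LINT w|M. \<Phi> w y)"
    and iter_deriv_LINT: "iter_deriv vs (\<lambda>y. LINT w|M. \<Phi> w y) = (\<lambda>y. LINT w|M. iter_deriv vs (\<Phi> w) y)"
proof -
  have i: "integrable M (\<lambda>w. iter_deriv vs (\<Phi> w) y)" for vs y
  proof -
    obtain b where b: "integrable M b" "\<forall>w y. norm (iter_deriv vs (\<Phi> w) y) \<le> b w * (\<Prod>v\<leftarrow>vs. norm v)"
      using b[of "length vs"] by blast
    show ?thesis
    proof (rule Bochner_Integration.integrable_bound[OF _ m])
      show "integrable M (\<lambda>w. b w * (\<Prod>v\<leftarrow>vs. norm v))" using b(1) by simp
      show "AE w in M. norm (iter_deriv vs (\<Phi> w) y) \<le> norm (b w * (\<Prod>v\<leftarrow>vs. norm v))"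
        using b(2) by (intro AE_I2) (metis abs_ge_self order_trans real_norm_def)
    qed
  qed
  have *: "((\<lambda>y. LINT w|M. iter_deriv vs (\<Phi> w) y) has_derivative (\<lambda>v. LINT w|M. iter_deriv (v # vs) (\<Phi> w) y)) (at y)" for vs y
  proof -
    obtain b where b: "integrable M b" "\<And>us w y. length us = Suc (length vs) \<Longrightarrow> norm (iter_deriv us (\<Phi> w) y) \<le> b w * (\<Prod>v\<leftarrow>us. norm v)"
      using b[of "Suc (length vs)"] by blast
    show ?thesis
    proof (rule has_derivative_LINT[OF iter_deriv_has_derivative[OF sm] m m _ _ i])
      show "norm (iter_deriv (v # vs) (\<Phi> w) x) \<le> (b w * (\<Prod>v\<leftarrow>vs. norm v)) * norm v" for w x v
        using b(2)[of "v # vs" w x] by (simp add: mult_ac)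
      show "integrable M (\<lambda>w. b w * (\<Prod>v\<leftarrow>vs. norm v))" using b(1) by simp
    qed
  qed
  show "smooth (\<lambda>y. LINT w|M. \<Phi> w y)" "iter_deriv vs (\<lambda>y. LINT w|M. \<Phi> w y) = (\<lambda>y. LINT w|M. iter_deriv vs (\<Phi> w) y)"
    using smooth_jet[of "\<lambda>vs y. LINT w|M. iter_deriv vs (\<Phi> w) y", OF *]
      iter_deriv_jet[of "\<lambda>vs y. LINT w|M. iter_deriv vs (\<Phi> w) y", OF *] by simp_all
qed

text \<open>Differentiability in the single direction \<open>e\<close>, without joint regularity:
  integration by parts along \<open>e\<close> asks for no more, and for partial Fourier transforms
  this is what will be established. Knowing the derivative at \<open>0\<close> for every base point
  gives it along the whole line.\<close>

definition dir_deriv :: "'a::real_normed_vector \<Rightarrow> ('a \<Rightarrow> complex) \<Rightarrow> ('a \<Rightarrow> complex) \<Rightarrow> bool" where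
  "dir_deriv e f f' \<longleftrightarrow> (\<forall>x. ((\<lambda>\<tau>. f (x + \<tau> *\<^sub>R e)) has_vector_derivative f' x) (at 0))"

lemma dir_deriv_at:
  assumes "dir_deriv e f f'"
  shows "((\<lambda>\<tau>. f (x + \<tau> *\<^sub>R e)) has_vector_derivative f' (x + \<tau> *\<^sub>R e)) (at \<tau>)"
proof -
  have "((\<lambda>\<sigma>. f ((x + \<tau> *\<^sub>R e) + \<sigma> *\<^sub>R e)) has_vector_derivative f' (x + \<tau> *\<^sub>R e)) (at (\<tau> - \<tau>))"
    using assms by (simp add: dir_deriv_def)
  moreover have "((\<lambda>\<sigma>. \<sigma> - \<tau>) has_vector_derivative 1) (at \<tau>)"
    by (auto intro!: derivative_eq_intros)
  ultimately have "((\<lambda>\<sigma>. f ((x + \<tau> *\<^sub>R e) + \<sigma> *\<^sub>R e)) \<circ> (\<lambda>\<sigma>. \<sigma> - \<tau>) has_vector_derivative 1 *\<^sub>R f' (x + \<tau> *\<^sub>R e)) (at \<tau>)"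
    by (intro vector_diff_chain_at)
  then show ?thesis
    by (simp add: comp_def algebra_simps)
qed

lemma dir_deriv_continuous:
  assumes "dir_deriv e f f'"
  shows "continuous_on A (\<lambda>\<tau>. f (x + \<tau> *\<^sub>R e))"
  using dir_deriv_at[OF assms] by (intro continuous_at_imp_continuous_on) (auto intro: has_vector_derivative_continuous)

lemma dir_deriv_iter_deriv: "smooth f \<Longrightarrow> dir_deriv e (iter_deriv vs f) (iter_deriv (e # vs) f)"
  using iter_deriv_line[of f vs _ e 0] by (simp add: dir_deriv_def)

lemma dir_deriv_mult: "dir_deriv e f f' \<Longrightarrow> dir_deriv e g g' \<Longrightarrow> dir_deriv e (\<lambda>x. f x * g x) (\<lambda>x. f x * g' x + f' x * g x)"
  unfolding dir_deriv_def using has_vector_derivative_mult by fastforce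

lemma dir_deriv_translate: "dir_deriv e f f' \<Longrightarrow> dir_deriv e (\<lambda>x. f (x - m)) (\<lambda>x. f' (x - m))"
proof -
  assume "dir_deriv e f f'"
  moreover have "x + \<tau> *\<^sub>R e - m = (x - m) + \<tau> *\<^sub>R e" for x \<tau> by simp
  ultimately show ?thesis unfolding dir_deriv_def by (simp only:) simp
qed

text \<open>Integrate \<open>f (x + e) - f x = (\<integral>\<tau>\<in>{0..1}. f' (x + \<tau> e))\<close> over \<open>x\<close>: the left side gives \<open>0\<close> and the right
  side the integral of \<open>f'\<close>, both by translation invariance.\<close>

lemma LINT_dir_deriv_eq_0:
  fixes f f' :: "'a::euclidean_space \<Rightarrow> complex"
  assumes f: "integrable lborel f" and f': "integrable lborel f'"
    and D: "dir_deriv e f f'" and C: "\<And>x. continuous_on {0..1} (\<lambda>\<tau>. f' (x + \<tau> *\<^sub>R e))"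
  shows "(LINT x|lborel. f' x) = 0"
proof -
  have [measurable]: "f \<in> borel_measurable borel" "f' \<in> borel_measurable borel"
    using f f' by (auto dest: borel_measurable_integrable)
  define g where "g = (\<lambda>p::real \<times> 'a. indicator {0..1} (fst p) *\<^sub>R f' (snd p + fst p *\<^sub>R e))"
  have "integrable (lborel \<Otimes>\<^sub>M lborel) g"
  proof (rule lborel_pair.Fubini_integrable)
    show "g \<in> borel_measurable (lborel \<Otimes>\<^sub>M lborel)"
      unfolding g_def by measurable
    have "(LINT x|lborel. norm (g (\<tau>, x))) = indicator {0..1} \<tau> * (LINT x|lborel. norm (f' x))" for \<tau>
      using lborel_integral_translate[of "\<lambda>x. norm (f' x)" "\<tau> *\<^sub>R e"] by (simp add: g_def)
    then show "integrable lborel (\<lambda>\<tau>. LINT x|lborel. norm (g (\<tau>, x)))"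
      by simp
    show "AE \<tau> in lborel. integrable lborel (\<lambda>x. g (\<tau>, x))"
      using f' by (simp add: g_def lborel_integrable_translate_iff)
  qed
  then have g: "integrable lborel g" by (simp add: lborel_prod)
  have "(LINT \<tau>|lborel. g (\<tau>, x)) = f (x + e) - f x" for x
    using integral_FTC_atLeastAtMost[of 0 1 "\<lambda>\<tau>. f (x + \<tau> *\<^sub>R e)" "\<lambda>\<tau>. f' (x + \<tau> *\<^sub>R e)"] C dir_deriv_at[OF D]
    by (simp add: g_def has_vector_derivative_at_within)
  then have "(LINT x|lborel. LINT \<tau>|lborel. g (\<tau>, x)) = 0"
    using f lborel_integral_translate[of f e] by (simp add: lborel_integrable_translate_iff)
  moreover have "(LINT \<tau>|lborel. LINT x|lborel. g (\<tau>, x)) = (LINT \<tau>|lborel. indicator {0..1::real} \<tau> *\<^sub>R (LINT x|lborel. f' x))"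
    using lborel_integral_translate[of f'] by (simp add: g_def)
  ultimately show ?thesis
    using lborel_Fubini[OF g] by simp
qed

definition plane_wave :: "'a::real_inner \<Rightarrow> 'a \<Rightarrow> complex" where
  "plane_wave \<xi> x = exp (\<i> * of_real (x \<bullet> \<xi>))"

lemma norm_plane_wave [simp]: "norm (plane_wave \<xi> x) = 1"
  by (simp add: plane_wave_def)

lemma plane_wave_commute: "plane_wave \<xi> x = plane_wave x \<xi>"
  by (simp add: plane_wave_def inner_commute)

lemma plane_wave_add_left: "plane_wave (\<xi> + \<eta>) x = plane_wave \<xi> x * plane_wave \<eta> x"
  by (simp add: plane_wave_def inner_add_right algebra_simps exp_add)

lemma plane_wave_add_right: "plane_wave \<xi> (x + y) = plane_wave \<xi> x * plane_wave \<xi> y"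
  by (simp add: plane_wave_def inner_add_left algebra_simps exp_add)

lemma plane_wave_scaleR: "plane_wave (c *\<^sub>R \<xi>) x = plane_wave \<xi> (c *\<^sub>R x)"
  by (simp add: plane_wave_def)

lemma plane_wave_minus: "plane_wave (- \<xi>) x = plane_wave \<xi> (- x)" "plane_wave \<xi> (- x) = cnj (plane_wave \<xi> x)"
  by (simp_all add: plane_wave_def exp_cnj)

lemma plane_wave_zero [simp]: "plane_wave 0 x = 1" "plane_wave \<xi> 0 = 1"
  by (simp_all add: plane_wave_def)

lemma continuous_on_plane_wave [continuous_intros]:
  "continuous_on A f \<Longrightarrow> continuous_on A g \<Longrightarrow> continuous_on A (\<lambda>x. plane_wave (f x) (g x))"
  unfolding plane_wave_def by (intro continuous_intros)

lemma borel_measurable_plane_wave [measurable]: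
  fixes f g :: "'b \<Rightarrow> 'a::euclidean_space"
  assumes [measurable]: "f \<in> borel_measurable M" "g \<in> borel_measurable M"
  shows "(\<lambda>x. plane_wave (f x) (g x)) \<in> borel_measurable M"
  unfolding plane_wave_def by measurable

lemma dir_deriv_plane_wave: "dir_deriv e (plane_wave \<kappa>) (\<lambda>x. \<i> * of_real (e \<bullet> \<kappa>) * plane_wave \<kappa> x)"
  unfolding dir_deriv_def plane_wave_def
proof
  fix x
  have "((\<lambda>\<tau>. of_real ((x + \<tau> *\<^sub>R e) \<bullet> \<kappa>) :: complex) has_vector_derivative of_real (e \<bullet> \<kappa>)) (at 0)"
    by (auto intro!: derivative_eq_intros has_vector_derivative_of_real simp: inner_add_left)
  then have "((\<lambda>\<tau>. \<i> * of_real ((x + \<tau> *\<^sub>R e) \<bullet> \<kappa>) :: complex) has_vector_derivative \<i> * of_real (e \<bullet> \<kappa>)) (at 0)"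
    by (rule has_vector_derivative_mult_right)
  from field_vector_diff_chain_at[OF this, of exp] show "((\<lambda>\<tau>. exp (\<i> * of_real ((x + \<tau> *\<^sub>R e) \<bullet> \<kappa>))) has_vector_derivative \<i> * of_real (e \<bullet> \<kappa>) * exp (\<i> * of_real (x \<bullet> \<kappa>))) (at 0)"
    by (simp add: comp_def DERIV_exp)
qed

text \<open>The derivative along \<open>e\<close> of \<open>A N\<close> times the plane wave has
  integral zero. So each integration by parts exchanges a factor \<open>e \<bullet> \<kappa>\<close>
  for one more derivative of the amplitude, and at the end the plane wave is estimated by 1.\<close>

lemma fourier_power_decay:
  fixes A :: "nat \<Rightarrow> 'a::euclidean_space \<Rightarrow> complex"
  assumes D: "\<And>N. dir_deriv e (A N) (A (Suc N))" and int: "\<And>N. integrable lborel (A N)"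
  shows "\<bar>e \<bullet> \<kappa>\<bar> ^ N * norm (LINT x|lborel. A 0 x * plane_wave \<kappa> x) \<le> (LINT x|lborel. norm (A N x))"
proof -
  have i: "integrable lborel (\<lambda>x. A N x * plane_wave \<kappa> x)" for N
    by (rule Bochner_Integration.integrable_bound[OF int[of N]])
      (use int[of N] in \<open>auto simp: norm_mult dest: borel_measurable_integrable\<close>)
  have "(LINT x|lborel. A N x * (\<i> * of_real (e \<bullet> \<kappa>) * plane_wave \<kappa> x) + A (Suc N) x * plane_wave \<kappa> x) = 0" for N
  proof (rule LINT_dir_deriv_eq_0[OF i[of N]])
    have "integrable lborel (\<lambda>x. (\<i> * of_real (e \<bullet> \<kappa>)) * (A N x * plane_wave \<kappa> x) + A (Suc N) x * plane_wave \<kappa> x)"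
      using i by auto
    then show "integrable lborel (\<lambda>x. A N x * (\<i> * of_real (e \<bullet> \<kappa>) * plane_wave \<kappa> x) + A (Suc N) x * plane_wave \<kappa> x)"
      by (simp add: mult_ac)
    show "dir_deriv e (\<lambda>x. A N x * plane_wave \<kappa> x) (\<lambda>x. A N x * (\<i> * of_real (e \<bullet> \<kappa>) * plane_wave \<kappa> x) + A (Suc N) x * plane_wave \<kappa> x)"
      by (rule dir_deriv_mult[OF D dir_deriv_plane_wave])
    show "continuous_on {0..1} (\<lambda>\<tau>. A N (x + \<tau> *\<^sub>R e) * (\<i> * of_real (e \<bullet> \<kappa>) * plane_wave \<kappa> (x + \<tau> *\<^sub>R e)) + A (Suc N) (x + \<tau> *\<^sub>R e) * plane_wave \<kappa> (x + \<tau> *\<^sub>R e))" for x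
      using dir_deriv_continuous[OF D] by (intro continuous_intros)
  qed
  moreover have "(LINT x|lborel. A N x * (\<i> * of_real (e \<bullet> \<kappa>) * plane_wave \<kappa> x) + A (Suc N) x * plane_wave \<kappa> x)
     = \<i> * of_real (e \<bullet> \<kappa>) * (LINT x|lborel. A N x * plane_wave \<kappa> x) + (LINT x|lborel. A (Suc N) x * plane_wave \<kappa> x)" for N
  proof -
    have "(LINT x|lborel. (\<i> * of_real (e \<bullet> \<kappa>)) * (A N x * plane_wave \<kappa> x) + A (Suc N) x * plane_wave \<kappa> x)
     = \<i> * of_real (e \<bullet> \<kappa>) * (LINT x|lborel. A N x * plane_wave \<kappa> x) + (LINT x|lborel. A (Suc N) x * plane_wave \<kappa> x)"
      using i by (subst Bochner_Integration.integral_add) auto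
    then show ?thesis by (simp add: mult_ac)
  qed
  ultimately have "\<i> * of_real (e \<bullet> \<kappa>) * (LINT x|lborel. A N x * plane_wave \<kappa> x) + (LINT x|lborel. A (Suc N) x * plane_wave \<kappa> x) = 0" for N
    by simp
  then have "(LINT x|lborel. A (Suc N) x * plane_wave \<kappa> x) = - (\<i> * of_real (e \<bullet> \<kappa>) * (LINT x|lborel. A N x * plane_wave \<kappa> x))" for N
    unfolding add_eq_0_iff by blast
  then have step: "norm (LINT x|lborel. A (Suc N) x * plane_wave \<kappa> x) = \<bar>e \<bullet> \<kappa>\<bar> * norm (LINT x|lborel. A N x * plane_wave \<kappa> x)" for N
    by (simp add: norm_mult)
  have "\<bar>e \<bullet> \<kappa>\<bar> ^ N * norm (LINT x|lborel. A 0 x * plane_wave \<kappa> x) = norm (LINT x|lborel. A N x * plane_wave \<kappa> x)"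
    by (induction N) (simp_all add: step mult.assoc)
  also have "\<dots> \<le> (LINT x|lborel. norm (A N x * plane_wave \<kappa> x))"
    by (rule integral_norm_bound)
  finally show ?thesis by (simp add: norm_mult)
qed

section \<open>Fourier inversion\<close>

definition gauss :: "'a::real_normed_vector \<Rightarrow> real" where
  "gauss x = exp (- ((norm x)\<^sup>2 / 2))"

lemma borel_measurable_gauss [measurable]: "gauss \<in> borel_measurable borel"
  unfolding gauss_def[abs_def] by measurable

lemma gauss_pos [simp]: "0 \<le> gauss x" "gauss x \<le> 1" "gauss 0 = 1" "gauss (- x) = gauss x"
  by (simp_all add: gauss_def)

text \<open>Up to the factor \<open>sqrt (2 * pi)\<close>, \<open>gauss\<close> is the standard
  normal density, and the integral is its characteristic function.\<close>

lemma
  fixes v :: real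
  shows integrable_gauss_real: "integrable lborel (\<lambda>\<tau>::real. of_real (gauss \<tau>) * plane_wave v \<tau>)"
    and fourier_gauss_real: "(LINT \<tau>|lborel. of_real (gauss \<tau>) * plane_wave v \<tau>) = of_real (sqrt (2 * pi) * gauss v)"
proof -
  have dens: "gauss \<tau> = sqrt (2 * pi) * std_normal_density \<tau>" for \<tau> :: real
    by (simp add: gauss_def std_normal_density_def)
  have i0: "integrable lborel std_normal_density"
    using integrable_normal_density[of 1 0] by simp
  show "integrable lborel (\<lambda>\<tau>::real. of_real (gauss \<tau>) * plane_wave v \<tau>)"
  proof (rule Bochner_Integration.integrable_bound)
    show "integrable lborel (\<lambda>\<tau>. sqrt (2 * pi) * std_normal_density \<tau>)" using i0 by simp
    show "AE \<tau> in lborel. norm (of_real (gauss \<tau>) * plane_wave v \<tau>) \<le> norm (sqrt (2 * pi) * std_normal_density \<tau>)"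
      by (simp add: norm_mult flip: dens)
  qed measurable
  have "(LINT \<tau>|lborel. of_real (gauss \<tau>) * plane_wave v \<tau>) = (LINT \<tau>|lborel. of_real (sqrt (2 * pi)) * (std_normal_density \<tau> *\<^sub>R exp (\<i> * of_real (v * \<tau>))))"
    by (intro Bochner_Integration.integral_cong refl) (simp add: dens plane_wave_def scaleR_conv_of_real mult_ac)
  also have "\<dots> = of_real (sqrt (2 * pi)) * (LINT \<tau>|lborel. std_normal_density \<tau> *\<^sub>R exp (\<i> * of_real (v * \<tau>)))"
    by (rule integral_mult_right_zero)
  also have "(LINT \<tau>|lborel. std_normal_density \<tau> *\<^sub>R exp (\<i> * of_real (v * \<tau>))) = char std_normal_distribution v"
    unfolding char_def by (subst integral_density) auto
  also have "\<dots> = of_real (gauss v)"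
    by (simp add: char_std_normal_distribution gauss_def)
  finally show "(LINT \<tau>|lborel. of_real (gauss \<tau>) * plane_wave v \<tau>) = of_real (sqrt (2 * pi) * gauss v)"
    by simp
qed

lemma
  fixes v :: "'a::euclidean_space"
  shows integrable_gauss_plane_wave: "integrable lborel (\<lambda>x::'a. of_real (gauss x) * plane_wave v x)"
    and fourier_gauss: "(LINT x|lborel. of_real (gauss x) * plane_wave v x) = of_real (sqrt (2 * pi) ^ DIM('a) * gauss v)"
proof -
  have g: "gauss x = (\<Prod>b\<in>Basis. gauss (x \<bullet> b))" for x :: 'a
  proof -
    have "(norm x)\<^sup>2 = (\<Sum>b\<in>Basis. (x \<bullet> b)\<^sup>2)"
      unfolding power2_norm_eq_inner by (subst euclidean_inner) (simp add: power2_eq_square)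
    then show ?thesis
      by (simp add: gauss_def sum_divide_distrib flip: exp_sum sum_negf)
  qed
  have c: "plane_wave v x = (\<Prod>b\<in>Basis. plane_wave (v \<bullet> b) (x \<bullet> b))" for x
  proof -
    have "\<i> * of_real (x \<bullet> v) = (\<Sum>b\<in>Basis. \<i> * of_real ((x \<bullet> b) \<bullet> (v \<bullet> b)))"
      by (subst euclidean_inner) (simp add: sum_distrib_left)
    then show ?thesis
      by (simp add: plane_wave_def exp_sum)
  qed
  have eq: "of_real (gauss x) * plane_wave v x = (\<Prod>b\<in>Basis. of_real (gauss (x \<bullet> b)) * plane_wave (v \<bullet> b) (x \<bullet> b))" for x
    by (simp add: g c prod.distrib)
  show "integrable lborel (\<lambda>x::'a. of_real (gauss x) * plane_wave v x)"
    unfolding eq by (intro integrable_prod_Basis integrable_gauss_real)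
  have "(LINT x|lborel. of_real (gauss x) * plane_wave v x) = (\<Prod>b\<in>Basis. of_real (sqrt (2 * pi) * gauss (v \<bullet> b)))"
    unfolding eq by (subst integral_prod_Basis) (simp_all only: integrable_gauss_real fourier_gauss_real)
  then show "(LINT x|lborel. of_real (gauss x) * plane_wave v x) = of_real (sqrt (2 * pi) ^ DIM('a) * gauss v)"
    by (simp add: g prod.distrib)
qed

lemma integrable_gauss: "integrable lborel (gauss :: 'a::euclidean_space \<Rightarrow> real)"
  using integrable_norm[OF integrable_gauss_plane_wave[of 0]] by (simp add: norm_mult)

lemma fourier_gauss_scaled:
  fixes z :: "'a::euclidean_space"
  assumes "\<epsilon> > 0"
  shows "integrable lborel (\<lambda>\<xi>::'a. of_real (gauss (\<epsilon> *\<^sub>R \<xi>)) * plane_wave \<xi> z)"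
    and "(LINT \<xi>|lborel. of_real (gauss (\<epsilon> *\<^sub>R \<xi>)) * plane_wave \<xi> z) = of_real ((sqrt (2 * pi) / \<epsilon>) ^ DIM('a) * gauss (z /\<^sub>R \<epsilon>))"
proof -
  let ?h = "\<lambda>\<xi>::'a. of_real (gauss (\<epsilon> *\<^sub>R \<xi>)) * plane_wave \<xi> z"
  have m: "?h \<in> borel_measurable borel" by measurable
  have eq: "?h (0 + inverse \<epsilon> *\<^sub>R \<xi>) = of_real (gauss \<xi>) * plane_wave (z /\<^sub>R \<epsilon>) \<xi>" for \<xi>
    using assms by (simp add: plane_wave_scaleR plane_wave_commute[of _ "z /\<^sub>R \<epsilon>"])
  have inv: "inverse \<epsilon> \<noteq> 0" using assms by simp
  show "integrable lborel ?h"
    using lborel_integrable_affine_iff[OF m inv, of 0] integrable_gauss_plane_wave unfolding eq by blast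
  show "(LINT \<xi>|lborel. ?h \<xi>) = of_real ((sqrt (2 * pi) / \<epsilon>) ^ DIM('a) * gauss (z /\<^sub>R \<epsilon>))"
    unfolding lborel_integral_affine[OF m inv, of 0] eq fourier_gauss
    using assms by (simp add: scaleR_conv_of_real power_divide divide_inverse power_inverse power_mult_distrib mult_ac)
qed

text \<open>Gaussian summation. The integral damped by
  \<open>gauss (\<epsilon> k *\<^sub>R \<xi>)\<close> tends to the left side by dominated
  convergence. By Fubini it is also an average of \<open>f\<close> around \<open>y\<close> with a
  Gaussian weight of width \<open>\<epsilon> k\<close>, which tends to the right side.\<close>

theorem fourier_inversion:
  fixes f :: "'a::euclidean_space \<Rightarrow> complex"
  assumes cont: "continuous_on UNIV f" and f: "integrable lborel f" and B: "\<And>x. norm (f x) \<le> B"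
    and F: "integrable lborel (\<lambda>\<xi>. LINT v|lborel. f v * plane_wave (- \<xi>) v)"
  shows "(LINT \<xi>|lborel. (LINT v|lborel. f v * plane_wave (- \<xi>) v) * plane_wave \<xi> y) = of_real ((2 * pi) ^ DIM('a)) * f y"
proof -
  define F where "F = (\<lambda>\<xi>. LINT v|lborel. f v * plane_wave (- \<xi>) v)"
  have [measurable]: "f \<in> borel_measurable borel" "F \<in> borel_measurable borel"
    using f assms(4) by (auto dest: borel_measurable_integrable simp: F_def)
  define \<epsilon> where "\<epsilon> = (\<lambda>k. inverse (real (Suc k)))"
  have \<epsilon>: "\<epsilon> k > 0" for k by (simp add: \<epsilon>_def)
  have \<epsilon>0: "\<epsilon> \<longlonglongrightarrow> 0" unfolding \<epsilon>_def by (rule LIMSEQ_inverse_real_of_nat)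
  define I where "I = (\<lambda>k. LINT \<xi>|lborel. F \<xi> * plane_wave \<xi> y * of_real (gauss (\<epsilon> k *\<^sub>R \<xi>)))"
  have "I \<longlonglongrightarrow> (LINT \<xi>|lborel. F \<xi> * plane_wave \<xi> y)"
    unfolding I_def
  proof (rule integral_dominated_convergence)
    show "integrable lborel (\<lambda>\<xi>. norm (F \<xi>))" using F by (simp add: F_def)
    show "AE \<xi> in lborel. norm (F \<xi> * plane_wave \<xi> y * of_real (gauss (\<epsilon> k *\<^sub>R \<xi>))) \<le> norm (F \<xi>)" for k
      by (intro AE_I2) (simp add: norm_mult mult_left_le)
    show "AE \<xi> in lborel. (\<lambda>k. F \<xi> * plane_wave \<xi> y * of_real (gauss (\<epsilon> k *\<^sub>R \<xi>))) \<longlonglongrightarrow> F \<xi> * plane_wave \<xi> y"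
    proof (rule AE_I2)
      fix \<xi>
      have "(\<lambda>k. F \<xi> * plane_wave \<xi> y * of_real (gauss (\<epsilon> k *\<^sub>R \<xi>))) \<longlonglongrightarrow> F \<xi> * plane_wave \<xi> y * of_real (exp (- ((norm (0 *\<^sub>R \<xi>))\<^sup>2 / 2)))"
        unfolding gauss_def by (intro tendsto_intros \<epsilon>0) auto
      then show "(\<lambda>k. F \<xi> * plane_wave \<xi> y * of_real (gauss (\<epsilon> k *\<^sub>R \<xi>))) \<longlonglongrightarrow> F \<xi> * plane_wave \<xi> y"
        by simp
    qed
  qed measurable
  moreover have "I \<longlonglongrightarrow> of_real ((2 * pi) ^ DIM('a)) * f y"
  proof -
    have I: "I k = of_real (sqrt (2 * pi) ^ DIM('a)) * (LINT u|lborel. f (y + \<epsilon> k *\<^sub>R u) * of_real (gauss u))" for k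
    proof -
      define G where "G = (\<lambda>p. f (snd p) * plane_wave (- fst p) (snd p) * plane_wave (fst p) y * of_real (gauss (\<epsilon> k *\<^sub>R fst p)))"
      have G: "integrable lborel G"
      proof (rule integrable_prod_dominated)
        show "G \<in> borel_measurable borel" unfolding G_def borel_prod[symmetric] by measurable
        show "integrable lborel (\<lambda>\<xi>::'a. gauss (\<epsilon> k *\<^sub>R \<xi>))"
          using integrable_norm[OF fourier_gauss_scaled(1)[OF \<epsilon>, of k 0]] by (simp add: norm_mult)
        show "integrable lborel (\<lambda>v. norm (f v))" using f by simp
        show "norm (G (\<xi>, v)) \<le> gauss (\<epsilon> k *\<^sub>R \<xi>) * norm (f v)" for \<xi> v
          by (simp add: G_def norm_mult)
      qed
      have m: "(\<lambda>v. f v * of_real (gauss ((y - v) /\<^sub>R \<epsilon> k))) \<in> borel_measurable borel" by measurable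
      have "I k = (LINT \<xi>|lborel. LINT v|lborel. G (\<xi>, v))"
        by (simp add: I_def F_def G_def)
      also have "\<dots> = (LINT v|lborel. LINT \<xi>|lborel. G (\<xi>, v))"
        by (rule lborel_Fubini[OF G, symmetric])
      also have "\<dots> = (LINT v|lborel. f v * (LINT \<xi>|lborel. of_real (gauss (\<epsilon> k *\<^sub>R \<xi>)) * plane_wave \<xi> (y - v)))"
      proof (rule Bochner_Integration.integral_cong[OF refl])
        fix v
        have "plane_wave (- \<xi>) v * plane_wave \<xi> y = plane_wave \<xi> (y - v)" for \<xi>
          using plane_wave_add_right[of \<xi> y "- v"] by (simp add: plane_wave_minus(1) mult.commute)
        then have "G (\<xi>, v) = f v * (of_real (gauss (\<epsilon> k *\<^sub>R \<xi>)) * plane_wave \<xi> (y - v))" for \<xi>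
          by (simp add: G_def mult.assoc mult.commute[of "of_real _"])
        then show "(LINT \<xi>|lborel. G (\<xi>, v)) = f v * (LINT \<xi>|lborel. of_real (gauss (\<epsilon> k *\<^sub>R \<xi>)) * plane_wave \<xi> (y - v))"
          by simp
      qed
      also have "\<dots> = (LINT v|lborel. of_real ((sqrt (2 * pi) / \<epsilon> k) ^ DIM('a)) * (f v * of_real (gauss ((y - v) /\<^sub>R \<epsilon> k))))"
        unfolding fourier_gauss_scaled(2)[OF \<epsilon>] by (simp add: mult_ac)
      also have "\<dots> = of_real ((sqrt (2 * pi) / \<epsilon> k) ^ DIM('a)) * (LINT v|lborel. f v * of_real (gauss ((y - v) /\<^sub>R \<epsilon> k)))"
        by (rule integral_mult_right_zero)
      \<comment> \<open>Rescaling about \<open>y\<close> cancels the power of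
        \<open>\<epsilon> k\<close> from the transform of the Gaussian and leaves a fixed weight, so
        that dominated convergence applies.\<close>
      also have "(LINT v|lborel. f v * of_real (gauss ((y - v) /\<^sub>R \<epsilon> k))) = \<bar>\<epsilon> k\<bar> ^ DIM('a) *\<^sub>R (LINT u|lborel. f (y + \<epsilon> k *\<^sub>R u) * of_real (gauss u))"
        using \<epsilon>[of k] by (subst lborel_integral_affine[OF m, of "\<epsilon> k" y]) auto
      finally show ?thesis
        using \<epsilon>[of k] by (simp add: scaleR_conv_of_real power_divide)
    qed
    have "(\<lambda>k. LINT u|lborel. f (y + \<epsilon> k *\<^sub>R u) * of_real (gauss u)) \<longlonglongrightarrow> (LINT u|lborel. f y * of_real (gauss (u::'a)))"
    proof (rule integral_dominated_convergence)
      show "integrable lborel (\<lambda>u::'a. B * gauss u)" by (simp add: integrable_gauss)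
      show "AE u in lborel. norm (f (y + \<epsilon> k *\<^sub>R u) * of_real (gauss u)) \<le> B * gauss u" for k
        using B by (intro AE_I2) (simp add: norm_mult mult_right_mono)
      show "AE u in lborel. (\<lambda>k. f (y + \<epsilon> k *\<^sub>R u) * of_real (gauss u)) \<longlonglongrightarrow> f y * of_real (gauss u)"
      proof (rule AE_I2)
        fix u
        have "(\<lambda>k. y + \<epsilon> k *\<^sub>R u) \<longlonglongrightarrow> y + 0 *\<^sub>R u"
          by (intro tendsto_intros \<epsilon>0)
        then have "(\<lambda>k. f (y + \<epsilon> k *\<^sub>R u)) \<longlonglongrightarrow> f y"
          using cont by (intro isCont_tendsto_compose[of y f]) (auto simp: continuous_on_eq_continuous_at)
        then show "(\<lambda>k. f (y + \<epsilon> k *\<^sub>R u) * of_real (gauss u)) \<longlonglongrightarrow> f y * of_real (gauss u)"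
          by (intro tendsto_intros)
      qed
    qed measurable
    also have "(LINT u|lborel. f y * of_real (gauss (u::'a))) = f y * of_real (sqrt (2 * pi) ^ DIM('a))"
      using fourier_gauss[of "0::'a"] by simp
    finally have "I \<longlonglongrightarrow> of_real (sqrt (2 * pi) ^ DIM('a)) * (f y * of_real (sqrt (2 * pi) ^ DIM('a)))"
      unfolding I by (intro tendsto_intros)
    \<comment> \<open>One factor \<open>sqrt (2 * pi) ^ DIM('a)\<close> comes from the transform of
      the Gaussian, the other from its total mass.\<close>
    moreover have "of_real (sqrt (2 * pi) ^ DIM('a)) * (f y * of_real (sqrt (2 * pi) ^ DIM('a))) = of_real ((2 * pi) ^ DIM('a)) * f y"
    proof -
      have "sqrt (2 * pi) ^ DIM('a) * sqrt (2 * pi) ^ DIM('a) = (2 * pi) ^ DIM('a)"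
        unfolding power_mult_distrib[symmetric] by simp
      then have "of_real ((2 * pi) ^ DIM('a)) = (of_real (sqrt (2 * pi) ^ DIM('a)) * of_real (sqrt (2 * pi) ^ DIM('a)) :: complex)"
        unfolding of_real_mult[symmetric] by simp
      then show ?thesis by (simp only: mult_ac)
    qed
    ultimately show ?thesis by (simp only:)
  qed
  ultimately show ?thesis
    unfolding F_def by (rule LIMSEQ_unique)
qed

section \<open>Superpositions of test functions\<close>

context
  fixes s t :: real and u :: "(real ^ 'n::finite \<Rightarrow> complex) \<Rightarrow> complex"
  assumes st: "0 < s" "0 < t" and u: "u \<in> GS_dual t s"
begin

lemma dual_add: "f \<in> GS t s \<Longrightarrow> g \<in> GS t s \<Longrightarrow> u (\<lambda>x. f x + g x) = u f + u g"
  using u by (simp add: GS_dual_def)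

lemma dual_cmult: "f \<in> GS t s \<Longrightarrow> u (\<lambda>x. c * f x) = cnj c * u f"
  using u by (simp add: GS_dual_def)

lemma dual_diff: "f \<in> GS t s \<Longrightarrow> g \<in> GS t s \<Longrightarrow> u (\<lambda>x. f x - g x) = u f - u g"
  using dual_add[of f "\<lambda>x. - 1 * g x"] dual_cmult[of g "-1"] GS_cmult[OF st, of g "-1"] by simp

lemma
  assumes "\<And>i. i < (m::nat) \<Longrightarrow> f i \<in> GS t s"
  shows GS_lincomb: "(\<lambda>x. \<Sum>i<m. c i * f i x) \<in> GS t s"
    and dual_lincomb: "u (\<lambda>x. \<Sum>i<m. c i * f i x) = (\<Sum>i<m. cnj (c i) * u (f i))"
proof -
  have "(\<lambda>x. \<Sum>i<m. c i * f i x) \<in> GS t s \<and> u (\<lambda>x. \<Sum>i<m. c i * f i x) = (\<Sum>i<m. cnj (c i) * u (f i))"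
    using assms
  proof (induction m)
    case 0
    have z: "(\<lambda>x. 0) \<in> GS t s" using zero_in_GS[OF st] .
    show ?case using z dual_cmult[OF z, of 0] by simp
  next
    case (Suc m)
    then have IH: "(\<lambda>x. \<Sum>i<m. c i * f i x) \<in> GS t s" "u (\<lambda>x. \<Sum>i<m. c i * f i x) = (\<Sum>i<m. cnj (c i) * u (f i))"
      by auto
    have f: "f m \<in> GS t s" using Suc.prems by simp
    have cf: "(\<lambda>x. c m * f m x) \<in> GS t s" by (rule GS_cmult[OF st f])
    show ?case
      using GS_add[OF st IH(1) cf] dual_add[OF IH(1) cf] IH(2) dual_cmult[OF f] by simp
  qed
  then show "(\<lambda>x. \<Sum>i<m. c i * f i x) \<in> GS t s"
    "u (\<lambda>x. \<Sum>i<m. c i * f i x) = (\<Sum>i<m. cnj (c i) * u (f i))" by auto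
qed

end

text \<open>Continuity of \<open>\<Phi>\<close> in one weighted seminorm implies continuity in
  \<open>w\<close> of every derivative at every point, hence measurability.\<close>

lemma measurable_iter_deriv_param:
  fixes \<Phi> :: "'w::euclidean_space \<Rightarrow> real ^ 'n::finite \<Rightarrow> complex"
  assumes sm: "\<And>w. smooth (\<Phi> w)"
    and cont: "\<And>w \<epsilon>. \<epsilon> > 0 \<Longrightarrow>
      \<exists>\<delta>>0. \<forall>w'. dist w w' < \<delta> \<longrightarrow> gevrey s h (\<lambda>x. \<epsilon> * decay p r x) (\<lambda>x. \<Phi> w x - \<Phi> w' x)"
    and "0 < h"
  shows "(\<lambda>w. iter_deriv vs (\<Phi> w) y) \<in> borel_measurable borel"
proof (rule borel_measurable_continuous_onI, unfold continuous_on_eq_continuous_at[OF open_UNIV], intro ballI)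
  fix w
  have P: "0 \<le> (\<Prod>v\<leftarrow>vs. norm v)" by (induction vs) auto
  define k where "k = decay p r y * h ^ length vs * fact (length vs) powr s * (\<Prod>v\<leftarrow>vs. norm v)"
  have k: "k \<ge> 0" using P assms(3) by (simp add: k_def)
  show "isCont (\<lambda>w. iter_deriv vs (\<Phi> w) y) w"
    unfolding continuous_at_eps_delta
  proof (intro allI impI)
    fix e :: real assume e: "e > 0"
    obtain \<delta> where \<delta>: "\<delta> > 0" "\<And>w'. dist w w' < \<delta> \<Longrightarrow> gevrey s h (\<lambda>x. (e / (k + 1)) * decay p r x) (\<lambda>x. \<Phi> w x - \<Phi> w' x)"
      using cont[of "e / (k + 1)" w] e k by auto
    have "dist (iter_deriv vs (\<Phi> w') y) (iter_deriv vs (\<Phi> w) y) < e" if "dist w' w < \<delta>" for w'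
    proof -
      have "norm (iter_deriv vs (\<lambda>x. \<Phi> w x - \<Phi> w' x) y) \<le> (e / (k + 1)) * decay p r y * h ^ length vs * fact (length vs) powr s * (\<Prod>v\<leftarrow>vs. norm v)"
        using that by (intro gevrey_bound_list smooth_diff sm \<delta>) (simp add: dist_commute)
      also have "\<dots> = e * (k / (k + 1))" by (simp add: k_def mult_ac)
      also have "\<dots> < e" using e k by (simp add: field_simps)
      finally show ?thesis
        by (simp add: iter_deriv_diff[OF sm sm] dist_norm norm_minus_commute)
    qed
    then show "\<exists>d>0. \<forall>w'. dist w' w < d \<longrightarrow> dist (iter_deriv vs (\<Phi> w') y) (iter_deriv vs (\<Phi> w) y) < e"
      using \<delta>(1) by blast
  qed
qed

text \<open>Continuity in \<open>w\<close> provides the measurability of the integrands. The weights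
  \<open>b\<close>, integrated against the modulus of \<open>K\<close>, provide the majorants and,
  for each \<open>h\<close> and \<open>r\<close>, the constant of the superposition.\<close>

lemma
  fixes \<Phi> :: "'w::euclidean_space \<Rightarrow> real ^ 'n::finite \<Rightarrow> complex"
  assumes st: "0 < s" "0 < t"
    and K: "K \<in> borel_measurable borel"
    and \<Phi>: "\<And>w. \<Phi> w \<in> GS t s"
    and bound: "\<And>h r. h > 0 \<Longrightarrow> r > 0 \<Longrightarrow>
      \<exists>b. integrable lborel (\<lambda>w. norm (K w) * b w) \<and> (\<forall>w. gevrey s h (\<lambda>x. b w * decay (1 / t) r x) (\<Phi> w))"
    and cont: "\<And>h r w \<epsilon>. h > 0 \<Longrightarrow> r > 0 \<Longrightarrow> \<epsilon> > 0 \<Longrightarrow>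
      \<exists>\<delta>>0. \<forall>w'. dist w w' < \<delta> \<longrightarrow> gevrey s h (\<lambda>x. \<epsilon> * decay (1 / t) r x) (\<lambda>x. \<Phi> w x - \<Phi> w' x)"
  shows GS_superposition: "(\<lambda>y. LINT w|lborel. K w * \<Phi> w y) \<in> GS t s"
    and iter_deriv_superposition: "iter_deriv vs (\<lambda>y. LINT w|lborel. K w * \<Phi> w y) = (\<lambda>y. LINT w|lborel. K w * iter_deriv vs (\<Phi> w) y)"
    and integrable_superposition: "integrable lborel (\<lambda>w. K w * iter_deriv vs (\<Phi> w) y)"
proof -
  note [measurable] = K
  have sm: "smooth (\<Phi> w)" for w using \<Phi> GS_smooth by blast
  have [measurable]: "(\<lambda>w. iter_deriv vs (\<Phi> w) y) \<in> borel_measurable borel" for vs y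
    by (rule measurable_iter_deriv_param[OF sm cont[of 1 1]]) auto
  have b: "\<exists>b. integrable lborel b \<and> (\<forall>vs w y. length vs = n \<longrightarrow> norm (iter_deriv vs (\<lambda>y. K w * \<Phi> w y) y) \<le> b w * (\<Prod>v\<leftarrow>vs. norm v))" for n
  proof -
    obtain b where b: "integrable lborel (\<lambda>w. norm (K w) * b w)" "\<And>w. gevrey s 1 (\<lambda>x. b w * decay (1 / t) 1 x) (\<Phi> w)"
      using bound[of 1 1] by auto
    have "norm (iter_deriv vs (\<lambda>y. K w * \<Phi> w y) y) \<le> (norm (K w) * b w) * fact n powr s * (\<Prod>v\<leftarrow>vs. norm v)" if "length vs = n" for vs w y
    proof -
      have P: "0 \<le> (\<Prod>v\<leftarrow>vs. norm v)" by (induction vs) auto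
      have b0: "0 \<le> b w" using gevrey_nonneg[OF b(2), of w 0] by (simp add: zero_le_mult_iff decay_def)
      have "norm (iter_deriv vs (\<Phi> w) y) \<le> b w * decay (1 / t) 1 y * 1 ^ length vs * fact (length vs) powr s * (\<Prod>v\<leftarrow>vs. norm v)"
        by (rule gevrey_bound_list[OF sm b(2)])
      also have "\<dots> \<le> b w * 1 * 1 ^ length vs * fact (length vs) powr s * (\<Prod>v\<leftarrow>vs. norm v)"
        using b0 P by (intro mult_right_mono mult_left_mono decay_le_1) auto
      finally show ?thesis
        using that by (simp add: iter_deriv_cmult[OF sm] norm_mult mult_left_mono mult.assoc)
    qed
    then show ?thesis
      using b(1) by (intro exI[of _ "\<lambda>w. (norm (K w) * b w) * fact n powr s"]) auto
  qed
  have m: "(\<lambda>w. iter_deriv vs (\<lambda>y. K w * \<Phi> w y) y) \<in> borel_measurable lborel" for vs y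
    unfolding iter_deriv_cmult[OF sm] by measurable
  note F = smooth_LINT[OF smooth_cmult[OF sm] m b] iter_deriv_LINT[OF smooth_cmult[OF sm] m b]
  show iter_deriv: "iter_deriv vs (\<lambda>y. LINT w|lborel. K w * \<Phi> w y) = (\<lambda>y. LINT w|lborel. K w * iter_deriv vs (\<Phi> w) y)" for vs
    using F(2) by (simp add: iter_deriv_cmult[OF sm])
  show int: "integrable lborel (\<lambda>w. K w * iter_deriv vs (\<Phi> w) y)" for vs y
  proof -
    obtain b where b: "integrable lborel b" "\<forall>w y. norm (iter_deriv vs (\<lambda>y. K w * \<Phi> w y) y) \<le> b w * (\<Prod>v\<leftarrow>vs. norm v)"
      using b[of "length vs"] by blast
    show ?thesis
    proof (rule Bochner_Integration.integrable_bound)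
      show "integrable lborel (\<lambda>w. b w * (\<Prod>v\<leftarrow>vs. norm v))" using b(1) by simp
      show "AE w in lborel. norm (K w * iter_deriv vs (\<Phi> w) y) \<le> norm (b w * (\<Prod>v\<leftarrow>vs. norm v))"
        using b(2) unfolding iter_deriv_cmult[OF sm] real_norm_def by (intro AE_I2 order_trans[OF _ abs_ge_self]) blast
    qed measurable
  qed
  show "(\<lambda>y. LINT w|lborel. K w * \<Phi> w y) \<in> GS t s"
    unfolding GS_iff_gevrey[OF st]
  proof (intro conjI allI impI F(1))
    fix h r :: real assume hr: "0 < h" "0 < r"
    obtain b where b: "integrable lborel (\<lambda>w. norm (K w) * b w)" "\<And>w. gevrey s h (\<lambda>x. b w * decay (1 / t) r x) (\<Phi> w)"
      using bound[OF hr] by auto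
    have b0: "0 \<le> b w" for w using gevrey_nonneg[OF b(2), of w 0] by (simp add: zero_le_mult_iff decay_def)
    show "\<exists>C\<ge>0. gevrey s h (\<lambda>x. C * decay (1 / t) r x) (\<lambda>y. LINT w|lborel. K w * \<Phi> w y)"
    proof (intro exI[of _ "LINT w|lborel. norm (K w) * b w"] conjI gevreyI)
      show "0 \<le> (LINT w|lborel. norm (K w) * b w)" using b0 by (intro integral_nonneg_AE) auto
      fix vs :: "(real^'n) list" and x :: "real^'n" assume vs: "\<And>v. v \<in> set vs \<Longrightarrow> norm v \<le> 1"
      have "norm (LINT w|lborel. K w * iter_deriv vs (\<Phi> w) x) \<le> (LINT w|lborel. norm (K w * iter_deriv vs (\<Phi> w) x))"
        by (rule integral_norm_bound)
      also have "\<dots> \<le> (LINT w|lborel. norm (K w) * b w * (decay (1 / t) r x * h ^ length vs * fact (length vs) powr s))"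
      proof (intro integral_mono integrable_norm int integrable_mult_left b(1))
        fix w
        show "norm (K w * iter_deriv vs (\<Phi> w) x) \<le> norm (K w) * b w * (decay (1 / t) r x * h ^ length vs * fact (length vs) powr s)"
          using mult_left_mono[OF gevreyD[OF b(2)[of w] vs, where vs=vs and x=x] norm_ge_zero[of "K w"]] by (simp add: norm_mult mult.assoc)
      qed
      also have "\<dots> = (LINT w|lborel. norm (K w) * b w) * (decay (1 / t) r x * h ^ length vs * fact (length vs) powr s)"
        by (rule integral_mult_left_zero)
      finally show "norm (iter_deriv vs (\<lambda>y. LINT w|lborel. K w * \<Phi> w y) x) \<le> (LINT w|lborel. norm (K w) * b w) * decay (1 / t) r x * h ^ length vs * fact (length vs) powr s"
        by (simp add: iter_deriv mult.assoc)
    qed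
  qed
qed


text \<open>The functional is exchanged with the integral by approximating the integral in the relevant
  seminorm: a large ball is cut into finitely many pieces on each of which \<open>\<Phi>\<close> is nearly constant.\<close>

lemma dual_superposition_le:
  fixes \<Phi> :: "'w::euclidean_space \<Rightarrow> real ^ 'n::finite \<Rightarrow> complex"
  assumes st: "0 < s" "0 < t" and u: "u \<in> GS_dual t s"
    and K: "integrable lborel K"
    and \<Phi>: "\<And>w. \<Phi> w \<in> GS t s"
    and bound: "\<And>h r. h > 0 \<Longrightarrow> r > 0 \<Longrightarrow>
      \<exists>b. integrable lborel (\<lambda>w. norm (K w) * b w) \<and> (\<forall>w. gevrey s h (\<lambda>x. b w * decay (1 / t) r x) (\<Phi> w))"
    and cont: "\<And>h r w \<epsilon>. h > 0 \<Longrightarrow> r > 0 \<Longrightarrow> \<epsilon> > 0 \<Longrightarrow>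
      \<exists>\<delta>>0. \<forall>w'. dist w w' < \<delta> \<longrightarrow> gevrey s h (\<lambda>x. \<epsilon> * decay (1 / t) r x) (\<lambda>x. \<Phi> w x - \<Phi> w' x)"
  shows "norm (u (\<lambda>y. LINT w|lborel. K w * \<Phi> w y)) \<le> (LINT w|lborel. norm (K w) * norm (u (\<Phi> w)))"
    and "integrable lborel (\<lambda>w. norm (K w) * norm (u (\<Phi> w)))"
    and "(\<lambda>w. u (\<Phi> w)) \<in> borel_measurable borel"
proof -
  have Km [measurable]: "K \<in> borel_measurable borel" using K by (auto dest: borel_measurable_integrable)
  define F where "F = (\<lambda>y. LINT w|lborel. K w * \<Phi> w y)"
  note sup = GS_superposition[OF st Km \<Phi> bound cont, folded F_def] iter_deriv_superposition[OF st Km \<Phi> bound cont, folded F_def]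
    integrable_superposition[OF st Km \<Phi> bound cont]
  have F: "F \<in> GS t s" by (rule sup(1))
  have sm: "smooth (\<Phi> w)" for w using \<Phi> GS_smooth by blast
  obtain h r C where h: "h > 0" and r: "r > 0" and C: "C > 0"
    and uC: "\<And>f A. f \<in> GS t s \<Longrightarrow> gevrey s h (\<lambda>x. A * decay (1 / t) r x) f \<Longrightarrow> norm (u f) \<le> C * A"
    using GS_dual_bounded[OF st u] by (elim exE conjE) blast
  obtain b where b: "integrable lborel (\<lambda>w. norm (K w) * b w)" "\<And>w. gevrey s h (\<lambda>x. b w * decay (1 / t) r x) (\<Phi> w)"
    using bound[OF h r] by auto
  have b0: "0 \<le> b w" for w using gevrey_nonneg[OF b(2), of w 0] by (simp add: zero_le_mult_iff decay_def)
  have u\<Phi>: "norm (u (\<Phi> w)) \<le> C * b w" for w by (rule uC[OF \<Phi> b(2)])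
  have udiff: "norm (u (\<Phi> w) - u (\<Phi> w')) \<le> C * \<epsilon>" if "gevrey s h (\<lambda>x. \<epsilon> * decay (1 / t) r x) (\<lambda>x. \<Phi> w x - \<Phi> w' x)" for w w' \<epsilon>
    using uC[OF GS_diff[OF st \<Phi> \<Phi>] that] by (simp add: dual_diff[OF st u \<Phi> \<Phi>])
  have "isCont (\<lambda>w. u (\<Phi> w)) w" for w
    unfolding continuous_at_eps_delta
  proof (intro allI impI)
    fix e :: real assume e: "e > 0"
    obtain \<delta> where \<delta>: "\<delta> > 0" "\<And>w'. dist w w' < \<delta> \<Longrightarrow> gevrey s h (\<lambda>x. (e / (2 * C)) * decay (1 / t) r x) (\<lambda>x. \<Phi> w x - \<Phi> w' x)"
      using cont[OF h r, of "e / (2 * C)" w] e C by auto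
    have "dist (u (\<Phi> w')) (u (\<Phi> w)) < e" if "dist w' w < \<delta>" for w'
      using udiff[OF \<delta>(2), of w'] that e C by (simp add: dist_norm norm_minus_commute dist_commute)
    then show "\<exists>d>0. \<forall>w'. dist w' w < d \<longrightarrow> dist (u (\<Phi> w')) (u (\<Phi> w)) < e"
      using \<delta>(1) by blast
  qed
  then show um [measurable]: "(\<lambda>w. u (\<Phi> w)) \<in> borel_measurable borel"
    by (intro borel_measurable_continuous_onI continuous_at_imp_continuous_on) auto
  show ui: "integrable lborel (\<lambda>w. norm (K w) * norm (u (\<Phi> w)))"
  proof (rule Bochner_Integration.integrable_bound)
    show "integrable lborel (\<lambda>w. C * (norm (K w) * b w))" using b(1) by simp
    show "AE w in lborel. norm (norm (K w) * norm (u (\<Phi> w))) \<le> norm (C * (norm (K w) * b w))"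
    proof (rule AE_I2)
      fix w
      have "norm (K w) * norm (u (\<Phi> w)) \<le> norm (K w) * (C * b w)" by (intro mult_left_mono u\<Phi>) simp
      then show "norm (norm (K w) * norm (u (\<Phi> w))) \<le> norm (C * (norm (K w) * b w))"
        using b0[of w] C by (simp add: abs_mult mult_ac)
    qed
  qed measurable
  define L where "L = (LINT w|lborel. norm (K w))"
  have L: "0 \<le> L" unfolding L_def by (intro integral_nonneg_AE) auto
  \<comment> \<open>The error consists of \<open>C * (L * \<epsilon> + \<epsilon>)\<close> for
    replacing the integral by a finite sum and \<open>L * (C * \<epsilon>)\<close> for comparing the
    values of \<open>u\<close> at the sample points with the integral.\<close>
  have main: "norm (u F) \<le> (LINT w|lborel. norm (K w) * norm (u (\<Phi> w))) + C * (2 * L + 1) * \<epsilon>" if \<epsilon>: "\<epsilon> > 0" for \<epsilon>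
  proof -
    \<comment> \<open>Outside a large ball the mass of \<open>K\<close>, weighted by
      \<open>b\<close>, is below \<open>\<epsilon>\<close>; there the approximating sum may simply
      vanish.\<close>
    have "(\<lambda>k. LINT w|lborel. norm (K w) * b w * indicator (- cball 0 (real k)) w) \<longlonglongrightarrow> (LINT (w::'w)|lborel. 0 :: real)"
    proof (rule integral_dominated_convergence[OF _ _ b(1)])
      show "AE w in lborel. (\<lambda>k. norm (K w) * b w * indicator (- cball 0 (real k)) w) \<longlonglongrightarrow> 0"
      proof (rule AE_I2)
        fix w :: 'w
        have "eventually (\<lambda>k. norm w \<le> real k) sequentially"
          using real_arch_simple[of "norm w"] eventually_sequentially by (meson of_nat_mono order_trans)
        then have "eventually (\<lambda>k. norm (K w) * b w * indicator (- cball 0 (real k)) w = 0) sequentially"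
          by eventually_elim simp
        then show "(\<lambda>k. norm (K w) * b w * indicator (- cball 0 (real k)) w) \<longlonglongrightarrow> 0"
          by (rule tendsto_eventually)
      qed
      show "(\<lambda>w. norm (K w) * b w * indicator (- cball 0 (real k)) w) \<in> borel_measurable lborel" for k
        by (intro borel_measurable_integrable integrable_real_mult_indicator b(1)) auto
      show "AE w in lborel. norm (norm (K w) * b w * indicator (- cball 0 (real k)) w) \<le> norm (K w) * b w" for k
        using b0 by (intro AE_I2) (auto simp: indicator_def)
    qed simp
    then have "eventually (\<lambda>k. (LINT w|lborel. norm (K w) * b w * indicator (- cball 0 (real k)) w) < \<epsilon>) sequentially"
      using \<epsilon> by (intro order_tendstoD(2)[of _ 0]) auto
    then obtain k where k: "(LINT w|lborel. norm (K w) * b w * indicator (- cball 0 (real k)) w) < \<epsilon>"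
      using eventually_happens sequentially_bot by blast
    let ?Q = "cball (0::'w) (real k)"
    obtain \<delta> where \<delta>: "\<And>w. \<delta> w > 0" "\<And>w w'. dist w w' < \<delta> w \<Longrightarrow> gevrey s h (\<lambda>x. \<epsilon> * decay (1 / t) r x) (\<lambda>x. \<Phi> w x - \<Phi> w' x)"
      using cont[OF h r \<epsilon>] by metis
    obtain D where D: "D \<subseteq> ?Q" "finite D" "?Q \<subseteq> (\<Union>w\<in>D. ball w (\<delta> w))"
    proof (rule compactE_image[of ?Q ?Q "\<lambda>w. ball w (\<delta> w)"])
      show "?Q \<subseteq> (\<Union>w\<in>?Q. ball w (\<delta> w))" using \<delta>(1) by force
    qed auto
    obtain ws where ws: "set ws = D" using finite_list[OF D(2)] by blast
    define m where "m = length ws"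
    define B where "B = (\<lambda>i. ball (ws ! i) (\<delta> (ws ! i)))"
    \<comment> \<open>Making the covering balls disjoint leaves Borel pieces, exactly one of which
      contains a given point of the large ball. The centre \<open>ws ! i\<close> is the sample point
      for piece \<open>i\<close>, though it need not lie in that piece.\<close>
    define A where "A = (\<lambda>i. ?Q \<inter> disjointed B i)"
    have [measurable]: "A i \<in> sets borel" for i
      unfolding A_def disjointed_def B_def by measurable
    have A_ball: "gevrey s h (\<lambda>x. \<epsilon> * decay (1 / t) r x) (\<lambda>x. \<Phi> (ws ! i) x - \<Phi> w x)" if "w \<in> A i" for w i
    proof -
      have "w \<in> B i" using that disjointed_subset[of B i] by (auto simp: A_def)
      then show ?thesis by (intro \<delta>(2)) (simp add: B_def)
    qed
    have A_ex: "\<exists>i<m. w \<in> A i \<and> (\<forall>j. w \<in> A j \<longrightarrow> j = i)" if wQ: "w \<in> ?Q" for w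
    proof -
      obtain c where "c \<in> D" "w \<in> ball c (\<delta> c)" using D(3) wQ by blast
      then obtain i where i: "i < m" "w \<in> B i" by (metis B_def in_set_conv_nth m_def ws)
      then have "w \<in> (\<Union>i\<in>{0..<m}. B i)" by auto
      then have "w \<in> (\<Union>i\<in>{0..<m}. disjointed B i)" by (simp only: finite_UN_disjointed_eq)
      then obtain i where i: "i < m" "w \<in> disjointed B i" by auto
      have "w \<in> A i" using wQ i(2) unfolding A_def by (rule IntI)
      moreover have "j = i" if "w \<in> A j" for j
        using disjoint_family_disjointed[of B] i(2) that unfolding disjoint_family_on_def A_def by blast
      ultimately show ?thesis using i(1) by blast
    qed
    have A_none: "w \<notin> A i" if "w \<notin> ?Q" for w i using that by (simp add: A_def)
    have sum_A: "(\<Sum>i<m. indicator (A i) w * X i) = X i" if "i < m" "w \<in> A i" "\<forall>j. w \<in> A j \<longrightarrow> j = i" for w i and X :: "nat \<Rightarrow> 'c::real_normed_field"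
    proof -
      have "(\<Sum>j<m. indicator (A j) w * X j) = (\<Sum>j<m. if j = i then X i else 0)"
      proof (intro sum.cong refl)
        fix j
        show "indicator (A j) w * X j = (if j = i then X i else 0)"
        proof (cases "j = i")
          case False
          then have "w \<notin> A j" using that(3) by blast
          with False show ?thesis by simp
        qed (use that(2) in simp)
      qed
      then show ?thesis using that(1) by simp
    qed
    define c where "c = (\<lambda>i. LINT w|lborel. indicator (A i) w * K w)"
    have ci: "integrable lborel (\<lambda>w. indicator (A i) w * K w)" for i
      by (rule Bochner_Integration.integrable_bound[OF K]) (auto simp: indicator_def)
    define S where "S = (\<lambda>y. \<Sum>i<m. c i * \<Phi> (ws ! i) y)"
    have S: "S \<in> GS t s" unfolding S_def by (rule GS_lincomb[OF st u \<Phi>])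
    have "gevrey s h (\<lambda>x. (L * \<epsilon> + \<epsilon>) * decay (1 / t) r x) (\<lambda>x. F x - S x)"
    proof (rule gevreyI)
      fix vs :: "(real^'n) list" and x :: "real^'n" assume vs: "\<And>v. v \<in> set vs \<Longrightarrow> norm v \<le> 1"
      let ?q = "decay (1 / t) r x * h ^ length vs * fact (length vs) powr s"
      have q: "0 \<le> ?q" using h by simp
      have int: "integrable lborel (\<lambda>w. \<Sum>i<m. indicator (A i) w * K w * iter_deriv vs (\<Phi> (ws ! i)) x)"
        using ci by (intro Bochner_Integration.integrable_sum integrable_mult_left) auto
      have "iter_deriv vs S x = (\<Sum>i<m. c i * iter_deriv vs (\<Phi> (ws ! i)) x)"
        unfolding S_def by (simp add: iter_deriv_sum smooth_cmult sm iter_deriv_cmult)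
      also have "\<dots> = (LINT w|lborel. (\<Sum>i<m. indicator (A i) w * K w * iter_deriv vs (\<Phi> (ws ! i)) x))"
        using ci by (subst Bochner_Integration.integral_sum) (auto simp: c_def)
      finally have "iter_deriv vs (\<lambda>x. F x - S x) x = (LINT w|lborel. K w * iter_deriv vs (\<Phi> w) x - (\<Sum>i<m. indicator (A i) w * K w * iter_deriv vs (\<Phi> (ws ! i)) x))"
        using int sup(3) by (simp add: iter_deriv_diff[OF GS_smooth[OF F] GS_smooth[OF S]] sup(2))
      also have "norm \<dots> \<le> (LINT w|lborel. norm (K w * iter_deriv vs (\<Phi> w) x - (\<Sum>i<m. indicator (A i) w * K w * iter_deriv vs (\<Phi> (ws ! i)) x)))"
        by (rule integral_norm_bound)
      also have "\<dots> \<le> (LINT w|lborel. (norm (K w) * \<epsilon> + norm (K w) * b w * indicator (- ?Q) w) * ?q)"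
      proof (rule integral_mono)
        show "integrable lborel (\<lambda>w. norm (K w * iter_deriv vs (\<Phi> w) x - (\<Sum>i<m. indicator (A i) w * K w * iter_deriv vs (\<Phi> (ws ! i)) x)))"
          by (intro integrable_norm Bochner_Integration.integrable_diff int sup(3))
        have "integrable lborel (\<lambda>w. norm (K w) * b w * indicator (- ?Q) w)"
          by (intro integrable_real_mult_indicator b(1)) auto
        then show "integrable lborel (\<lambda>w. (norm (K w) * \<epsilon> + norm (K w) * b w * indicator (- ?Q) w) * ?q)"
          using K by auto
        fix w
        show "norm (K w * iter_deriv vs (\<Phi> w) x - (\<Sum>i<m. indicator (A i) w * K w * iter_deriv vs (\<Phi> (ws ! i)) x))
          \<le> (norm (K w) * \<epsilon> + norm (K w) * b w * indicator (- ?Q) w) * ?q"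
        proof (cases "w \<in> ?Q")
          case True
          then obtain i where i: "i < m" "w \<in> A i" "\<forall>j. w \<in> A j \<longrightarrow> j = i" using A_ex by blast
          have "(\<Sum>i<m. indicator (A i) w * K w * iter_deriv vs (\<Phi> (ws ! i)) x) = K w * iter_deriv vs (\<Phi> (ws ! i)) x"
            using sum_A[OF i, of "\<lambda>i. K w * iter_deriv vs (\<Phi> (ws ! i)) x"] by (simp add: mult.assoc)
          moreover have "norm (iter_deriv vs (\<lambda>x. \<Phi> (ws ! i) x - \<Phi> w x) x) \<le> \<epsilon> * decay (1 / t) r x * h ^ length vs * fact (length vs) powr s"
            by (rule gevreyD[OF A_ball[OF i(2)] vs])
          ultimately show ?thesis
            using True by (simp add: iter_deriv_diff[OF sm sm] norm_minus_commute norm_mult mult_left_mono mult.assoc flip: right_diff_distrib)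
        next
          case False
          have "norm (iter_deriv vs (\<Phi> w) x) \<le> b w * decay (1 / t) r x * h ^ length vs * fact (length vs) powr s"
            by (rule gevreyD[OF b(2) vs])
          from mult_left_mono[OF this norm_ge_zero[of "K w"]]
          have "norm (K w * iter_deriv vs (\<Phi> w) x) \<le> norm (K w) * b w * ?q"
            by (simp add: norm_mult mult.assoc)
          also have "\<dots> \<le> (norm (K w) * \<epsilon> + norm (K w) * b w) * ?q"
            using q \<epsilon> by (intro mult_right_mono) auto
          finally show ?thesis
            using False A_none by simp
        qed
      qed
      also have "\<dots> = (L * \<epsilon> + (LINT w|lborel. norm (K w) * b w * indicator (- ?Q) w)) * ?q"
      proof -
        have "integrable lborel (\<lambda>w. norm (K w) * b w * indicator (- ?Q) w)"
          by (intro integrable_real_mult_indicator b(1)) auto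
        then show ?thesis using K by (simp add: L_def)
      qed
      also have "\<dots> \<le> (L * \<epsilon> + \<epsilon>) * ?q"
        using k q by (intro mult_right_mono) auto
      finally show "norm (iter_deriv vs (\<lambda>x. F x - S x) x) \<le> (L * \<epsilon> + \<epsilon>) * decay (1 / t) r x * h ^ length vs * fact (length vs) powr s"
        by (simp add: mult.assoc)
    qed
    from uC[OF GS_diff[OF st F S] this] have 1: "norm (u F - u S) \<le> C * (L * \<epsilon> + \<epsilon>)"
      by (simp add: dual_diff[OF st u F S])
    have "norm (u S) = norm (\<Sum>i<m. cnj (c i) * u (\<Phi> (ws ! i)))"
      unfolding S_def by (subst dual_lincomb[OF st u \<Phi>]) simp
    also have "\<dots> \<le> (\<Sum>i<m. norm (c i) * norm (u (\<Phi> (ws ! i))))"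
      by (intro sum_norm_le) (simp add: norm_mult)
    also have "\<dots> \<le> (\<Sum>i<m. (LINT w|lborel. norm (indicator (A i) w * K w)) * norm (u (\<Phi> (ws ! i))))"
      unfolding c_def by (intro sum_mono mult_right_mono integral_norm_bound) auto
    also have "\<dots> = (LINT w|lborel. (\<Sum>i<m. norm (indicator (A i) w * K w) * norm (u (\<Phi> (ws ! i)))))"
      using ci by (subst Bochner_Integration.integral_sum) auto
    also have "\<dots> \<le> (LINT w|lborel. norm (K w) * norm (u (\<Phi> w)) + norm (K w) * (C * \<epsilon>))"
    proof (rule integral_mono)
      show "integrable lborel (\<lambda>w. \<Sum>i<m. norm (indicator (A i) w * K w) * norm (u (\<Phi> (ws ! i))))"
        using integrable_norm[OF ci] by (intro Bochner_Integration.integrable_sum integrable_mult_left) auto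
      show "integrable lborel (\<lambda>w. norm (K w) * norm (u (\<Phi> w)) + norm (K w) * (C * \<epsilon>))"
        using ui K by auto
      fix w
      show "(\<Sum>i<m. norm (indicator (A i) w * K w) * norm (u (\<Phi> (ws ! i)))) \<le> norm (K w) * norm (u (\<Phi> w)) + norm (K w) * (C * \<epsilon>)"
      proof (cases "w \<in> ?Q")
        case True
        then obtain i where i: "i < m" "w \<in> A i" "\<forall>j. w \<in> A j \<longrightarrow> j = i" using A_ex by blast
        have "(\<Sum>i<m. norm (indicator (A i) w * K w) * norm (u (\<Phi> (ws ! i)))) = (\<Sum>i<m. indicator (A i) w * (norm (K w) * norm (u (\<Phi> (ws ! i)))))"
          by (intro sum.cong) (auto simp: indicator_def)
        also have "\<dots> = norm (K w) * norm (u (\<Phi> (ws ! i)))"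
          by (rule sum_A[OF i])
        also have "\<dots> \<le> norm (K w) * (norm (u (\<Phi> w)) + C * \<epsilon>)"
          using udiff[OF A_ball[OF i(2)]] norm_triangle_ineq2[of "u (\<Phi> (ws ! i))" "u (\<Phi> w)"] by (intro mult_left_mono) auto
        finally show ?thesis by (simp add: algebra_simps)
      next
        case False
        then show ?thesis using A_none C \<epsilon> by simp
      qed
    qed
    also have "\<dots> = (LINT w|lborel. norm (K w) * norm (u (\<Phi> w))) + L * (C * \<epsilon>)"
      using ui K by (simp add: L_def)
    finally have 2: "norm (u S) \<le> (LINT w|lborel. norm (K w) * norm (u (\<Phi> w))) + L * (C * \<epsilon>)" .
    have "norm (u F) \<le> norm (u F - u S) + norm (u S)"
      using norm_triangle_ineq[of "u F - u S" "u S"] by simp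
    then show ?thesis using 1 2 by (simp add: algebra_simps)
  qed
  show "norm (u (\<lambda>y. LINT w|lborel. K w * \<Phi> w y)) \<le> (LINT w|lborel. norm (K w) * norm (u (\<Phi> w)))"
    unfolding F_def[symmetric]
  proof (rule field_le_epsilon)
    fix e :: real assume e: "e > 0"
    have p: "C * (2 * L + 1) > 0" using C L by simp
    from p have "C * (2 * L + 1) * (e / (C * (2 * L + 1))) = e"
      unfolding times_divide_eq_right by (intro nonzero_mult_div_cancel_left less_imp_neq[THEN not_sym])
    with main[of "e / (C * (2 * L + 1))"] divide_pos_pos[OF e p]
    show "norm (u F) \<le> (LINT w|lborel. norm (K w) * norm (u (\<Phi> w))) + e"
      by (simp only:)
  qed
qed

section \<open>Partial Fourier transforms\<close>

text \<open>Comparison with the maximum works for every \<open>p > 0\<close>; neither convexity nor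
  subadditivity of the power is available for all of them.\<close>

lemma norm_powr_quasi_triangle:
  assumes "0 < p" "norm x \<le> norm a + norm b"
  shows "norm x powr p \<le> 2 powr p * (norm a powr p + norm b powr p)"
proof -
  have "norm x powr p \<le> (2 * max (norm a) (norm b)) powr p"
    using assms by (intro powr_mono2) auto
  also have "\<dots> = 2 powr p * max (norm a) (norm b) powr p"
    by (rule powr_mult)
  also have "\<dots> \<le> 2 powr p * (norm a powr p + norm b powr p)"
    by (intro mult_left_mono) (auto simp: max_def)
  finally show ?thesis .
qed

lemma decay_mult_le:
  assumes "0 < p" "0 \<le> r" "norm x \<le> norm a + norm b"
  shows "decay p (2 powr p * r) a * decay p (2 powr p * r) b \<le> decay p r x"
  using mult_left_mono[OF norm_powr_quasi_triangle[OF assms(1,3)] assms(2)]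
  by (simp add: decay_def algebra_simps flip: exp_add)

text \<open>Test functions of two variables, with decay of order \<open>t\<close> and regularity of order \<open>s\<close> in both. The
  Wigner distribution and the short-time Fourier transform are their Fourier transforms in the
  second variable.\<close>

definition GS_pair :: "real \<Rightarrow> real \<Rightarrow> ((real ^ 'n::finite) \<times> (real ^ 'n) \<Rightarrow> complex) \<Rightarrow> bool" where
  "GS_pair t s H \<longleftrightarrow> smooth H \<and> (\<forall>h>0. \<forall>r>0. \<exists>C\<ge>0. gevrey s h (\<lambda>z. C * (decay (1 / t) r (fst z) * decay (1 / t) r (snd z))) H)"

text \<open>Each coordinate is dominated by the arguments of the two factors together. Decay of
  \<open>f\<close> and \<open>g\<close> in their own arguments therefore gives decay in both
  coordinates.\<close>

lemma GS_pair_product: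
  fixes f g :: "real ^ 'n::finite \<Rightarrow> complex"
  assumes st: "0 < s" "0 < t" and f: "f \<in> GS t s" and g: "g \<in> GS t s"
    and L: "bounded_linear L" "\<And>z. norm (L z) \<le> 2 * norm z"
    and M: "bounded_linear M" "\<And>z. norm (M z) \<le> 2 * norm z"
    and x: "\<And>z. norm (fst z) \<le> norm (L z) + norm (M z)"
    and y: "\<And>z. norm (snd z) \<le> norm (L z) + norm (M z)"
  shows "GS_pair t s (\<lambda>z. f (L z) * cnj (g (M z)))"
  unfolding GS_pair_def
proof (intro conjI allI impI)
  have sf: "smooth f" and sg: "smooth (\<lambda>x. cnj (g x))"
    using f g GS_smooth smooth_cnj by blast+
  have s1: "smooth (\<lambda>z. f (L z))" using smooth_affine_comp[OF L(1) sf, of 0] by simp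
  have s2: "smooth (\<lambda>z. cnj (g (M z)))" using smooth_affine_comp[OF M(1) sg, of 0] by simp
  show "smooth (\<lambda>z. f (L z) * cnj (g (M z)))" by (rule smooth_mult[OF s1 s2])
  fix h r :: real assume hr: "0 < h" "0 < r"
  \<comment> \<open>Twice the rate that the quasi-triangle inequality asks for: half of the decay of
    the factors pays for \<open>fst z\<close>, the other half for \<open>snd z\<close>.\<close>
  define \<rho> where "\<rho> = 2 * (2 powr (1 / t) * r)"
  have \<rho>: "\<rho> > 0" using hr by (simp add: \<rho>_def)
  \<comment> \<open>\<open>h / 4\<close> doubles under the linear maps and once more in the
    product.\<close>
  obtain C where C: "C \<ge> 0" "gevrey s (h / 4) (\<lambda>x. C * decay (1 / t) \<rho> x) f"
    using GS_imp_gevrey[OF st f, of "h / 4" \<rho>] hr \<rho> by auto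
  obtain C' where C': "C' \<ge> 0" "gevrey s (h / 4) (\<lambda>x. C' * decay (1 / t) \<rho> x) g"
    using GS_imp_gevrey[OF st g, of "h / 4" \<rho>] hr \<rho> by auto
  have 1: "gevrey s (2 * (h / 4)) (\<lambda>z. C * decay (1 / t) \<rho> (L z)) (\<lambda>z. f (L z))"
    using gevrey_affine[OF L, of f s "h / 4" "\<lambda>x. C * decay (1 / t) \<rho> x" 0] sf C by simp
  have 2: "gevrey s (2 * (h / 4)) (\<lambda>z. C' * decay (1 / t) \<rho> (M z)) (\<lambda>z. cnj (g (M z)))"
    using gevrey_affine[OF M, of "\<lambda>x. cnj (g x)" s "h / 4" "\<lambda>x. C' * decay (1 / t) \<rho> x" 0] sg gevrey_cnj[OF GS_smooth[OF g] C'(2)] by simp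
  have "gevrey s (2 * (2 * (h / 4))) (\<lambda>z. C * decay (1 / t) \<rho> (L z) * (C' * decay (1 / t) \<rho> (M z))) (\<lambda>z. f (L z) * cnj (g (M z)))"
    using hr st by (intro gevrey_mult s1 s2 1 2) auto
  then have "gevrey s h (\<lambda>z. (C * C') * (decay (1 / t) r (fst z) * decay (1 / t) r (snd z))) (\<lambda>z. f (L z) * cnj (g (M z)))"
  proof (rule gevrey_mono)
    fix z
    let ?r = "2 powr (1 / t) * r"
    have "decay (1 / t) \<rho> (L z) * decay (1 / t) \<rho> (M z) = (decay (1 / t) ?r (L z) * decay (1 / t) ?r (M z)) * (decay (1 / t) ?r (L z) * decay (1 / t) ?r (M z))"
      by (simp add: decay_def \<rho>_def algebra_simps flip: exp_add)
    also have "\<dots> \<le> decay (1 / t) r (fst z) * decay (1 / t) r (snd z)"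
      using st hr by (intro mult_mono decay_mult_le x y) auto
    finally have "(C * C') * (decay (1 / t) \<rho> (L z) * decay (1 / t) \<rho> (M z)) \<le> (C * C') * (decay (1 / t) r (fst z) * decay (1 / t) r (snd z))"
      using C C' by (intro mult_left_mono) auto
    then show "C * decay (1 / t) \<rho> (L z) * (C' * decay (1 / t) \<rho> (M z)) \<le> (C * C') * (decay (1 / t) r (fst z) * decay (1 / t) r (snd z))"
      by (simp add: mult_ac)
  qed (use hr in auto)
  then show "\<exists>C\<ge>0. gevrey s h (\<lambda>z. C * (decay (1 / t) r (fst z) * decay (1 / t) r (snd z))) (\<lambda>z. f (L z) * cnj (g (M z)))"
    using C C' by (intro exI[of _ "C * C'"]) auto
qed

definition partial_fourier :: "((real ^ 'n::finite) \<times> (real ^ 'n) \<Rightarrow> complex) \<Rightarrow> (real ^ 'n) \<times> (real ^ 'n) \<Rightarrow> complex" where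
  "partial_fourier H = (\<lambda>z. LINT y|lborel. H (fst z, y) * plane_wave (- snd z) y)"

lemma borel_measurable_fst_snd [measurable]:
  "fst \<in> borel_measurable (borel :: ('a::second_countable_topology \<times> 'b::second_countable_topology) measure)"
  "snd \<in> borel_measurable (borel :: ('a::second_countable_topology \<times> 'b::second_countable_topology) measure)"
  by (intro borel_measurable_continuous_onI continuous_intros)+

lemma smooth_measurable: 
  fixes f :: "'a::euclidean_space \<Rightarrow> complex"
  shows "smooth f \<Longrightarrow> f \<in> borel_measurable borel"
  using continuous_on_iter_deriv[of f UNIV "[]"] by (intro borel_measurable_continuous_onI) simp

lemma partial_fourier_measurable:
  assumes [measurable]: "H \<in> borel_measurable borel"
  shows "partial_fourier H \<in> borel_measurable borel"
proof -
  have "(\<lambda>z. LINT y|lborel. H (fst z, y) * plane_wave (- snd z) y) \<in> borel_measurable (borel :: ((real^'a) \<times> (real^'a)) measure)"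
    by (rule lborel.borel_measurable_lebesgue_integral) (unfold case_prod_beta, measurable)
  then show ?thesis by (simp add: partial_fourier_def)
qed

lemma iter_deriv_replicate_bound:
  assumes "smooth H" "gevrey s h \<omega> H" "norm e \<le> 1"
  shows "norm (iter_deriv (replicate M e) H z) \<le> \<omega> z * h ^ M * fact M powr s"
  using gevreyD[OF assms(2), of "replicate M e" z] assms(3) by auto

text \<open>Integration by parts in the second variable. The constants are fixed before
  \<open>H\<close>, because the estimate is applied to whole sequences of functions: the derivatives
  of one function, and its products with monomials.\<close>

lemma partial_fourier_bound:
  assumes st: "0 < s" "0 < t" and r: "0 < r"
  shows "\<exists>h>0. \<exists>C\<ge>0. \<forall>(H :: (real ^ 'n::finite) \<times> (real ^ 'n) \<Rightarrow> complex) A. smooth H \<longrightarrow>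
    gevrey s h (\<lambda>z. A * (decay (1 / t) r (fst z) * decay (1 / t) r (snd z))) H \<longrightarrow>
    (\<forall>x \<eta>. norm (partial_fourier H (x, \<eta>)) \<le> C * A * (decay (1 / t) r x * decay (1 / s) r \<eta>))"
proof -
  obtain h where h: "h > 0" and dec: "\<And>(x::real^'n) X B. 0 \<le> X \<Longrightarrow> 0 \<le> B \<Longrightarrow>
    (\<And>k M. \<bar>x $ k\<bar> ^ M * X \<le> B * h ^ M * fact M powr s) \<Longrightarrow> X \<le> 2 powr s * B * exp (- (r * norm x powr (1 / s)))"
    using ex_power_bounds_imp_exp[OF st(1) r] by blast
  define I where "I = (LINT y|lborel. decay (1 / t) r (y::real^'n))"
  have int: "integrable lborel (decay (1 / t) r :: real^'n \<Rightarrow> real)"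
    using st r by (intro integrable_decay) auto
  have I: "I \<ge> 0" unfolding I_def by (intro integral_nonneg_AE) auto
  show ?thesis
  proof (rule exI[of _ h], intro conjI h, rule exI[of _ "2 powr s * I"], intro conjI allI impI)
    show "0 \<le> 2 powr s * I" using I by simp
    fix H :: "(real ^ 'n) \<times> (real ^ 'n) \<Rightarrow> complex" and A x \<eta>
    assume H: "smooth H" and gevrey: "gevrey s h (\<lambda>z. A * (decay (1 / t) r (fst z) * decay (1 / t) r (snd z))) H"
    have A: "0 \<le> A" using gevrey_nonneg[OF gevrey, of 0] by (simp add: decay_def zero_le_mult_iff)
    have "\<bar>\<eta> $ k\<bar> ^ M * norm (partial_fourier H (x, \<eta>)) \<le> (A * decay (1 / t) r x * I) * h ^ M * fact M powr s" for k M
    proof -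
      define D where "D = (\<lambda>N y. iter_deriv (replicate N (0, axis k 1)) H (x, y))"
      have e: "norm ((0, axis k 1) :: (real^'n) \<times> (real^'n)) \<le> 1" by (simp add: norm_prod_def)
      have b: "norm (D N y) \<le> (A * decay (1 / t) r x * h ^ N * fact N powr s) * decay (1 / t) r y" for N y
        using iter_deriv_replicate_bound[OF H gevrey e, of N "(x, y)"] by (simp add: D_def mult_ac)
      have m: "D N \<in> borel_measurable borel" for N
        unfolding D_def by (intro borel_measurable_continuous_onI continuous_on_compose2[OF continuous_on_iter_deriv[OF H, of UNIV]] continuous_intros) auto
      have i: "integrable lborel (D N)" for N
      proof (rule Bochner_Integration.integrable_bound)
        show "integrable lborel (\<lambda>y. (A * decay (1 / t) r x * h ^ N * fact N powr s) * decay (1 / t) r (y::real^'n))"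
          using int by simp
        show "AE y in lborel. norm (D N y) \<le> norm ((A * decay (1 / t) r x * h ^ N * fact N powr s) * decay (1 / t) r y)"
          using b by (intro AE_I2) (metis abs_ge_self order_trans real_norm_def)
      qed (use m in simp)
      have d: "dir_deriv (axis k 1) (D N) (D (Suc N))" for N
        unfolding dir_deriv_def
      proof
        fix y
        have "((\<lambda>\<tau>. iter_deriv (replicate N (0, axis k 1)) H ((x, y) + \<tau> *\<^sub>R (0, axis k 1))) has_vector_derivative
            iter_deriv ((0, axis k 1) # replicate N (0, axis k 1)) H (x, y)) (at 0)"
          using dir_deriv_iter_deriv[OF H] unfolding dir_deriv_def by blast
        then show "((\<lambda>\<tau>. D N (y + \<tau> *\<^sub>R axis k 1)) has_vector_derivative D (Suc N) y) (at 0)"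
          by (simp add: D_def)
      qed
      have "\<bar>\<eta> $ k\<bar> ^ M * norm (partial_fourier H (x, \<eta>)) = \<bar>axis k 1 \<bullet> (- \<eta>)\<bar> ^ M * norm (LINT y|lborel. D 0 y * plane_wave (- \<eta>) y)"
        by (simp add: partial_fourier_def D_def inner_axis')
      also have "\<dots> \<le> (LINT y|lborel. norm (D M y))"
        by (rule fourier_power_decay[of "axis k 1" D, OF d i])
      also have "\<dots> \<le> (LINT y|lborel. (A * decay (1 / t) r x * h ^ M * fact M powr s) * decay (1 / t) r (y::real^'n))"
        using b int by (intro integral_mono integrable_norm i) auto
      also have "\<dots> = (A * decay (1 / t) r x * I) * h ^ M * fact M powr s"
        by (simp add: I_def mult_ac)
      finally show ?thesis .
    qed
    then have "norm (partial_fourier H (x, \<eta>)) \<le> 2 powr s * (A * decay (1 / t) r x * I) * exp (- (r * norm \<eta> powr (1 / s)))"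
      using A I by (intro dec) auto
    then show "norm (partial_fourier H (x, \<eta>)) \<le> 2 powr s * I * A * (decay (1 / t) r x * decay (1 / s) r \<eta>)"
      by (simp add: decay_def mult_ac)
  qed
qed

definition phase_decay :: "real \<Rightarrow> real \<Rightarrow> real \<Rightarrow> ('a::real_normed_vector) \<times> ('b::real_normed_vector) \<Rightarrow> real" where
  "phase_decay t s r z = decay (1 / t) r (fst z) * decay (1 / s) r (snd z)"

lemma phase_decay_pos [simp]: "0 < phase_decay t s r z" "0 \<le> phase_decay t s r z"
  by (simp_all add: phase_decay_def)

lemma borel_measurable_phase_decay [measurable]:
  "phase_decay t s r \<in> borel_measurable (borel :: ('a::euclidean_space \<times> 'b::euclidean_space) measure)"
  unfolding phase_decay_def[abs_def] by measurable

text \<open>The constant is uniform in the order \<open>N\<close>. Only pure derivatives in one direction are recorded;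
  these are all that integration by parts needs.\<close>

definition decaying_jet :: "real \<Rightarrow> real \<Rightarrow> real \<Rightarrow> (real ^ 'n::finite) \<times> (real ^ 'n) \<Rightarrow>
    (nat \<Rightarrow> (real ^ 'n) \<times> (real ^ 'n) \<Rightarrow> complex) \<Rightarrow> bool" where
  "decaying_jet t s \<sigma> e G \<longleftrightarrow> (\<forall>N. dir_deriv e (G N) (G (Suc N))) \<and> (\<forall>N. G N \<in> borel_measurable borel) \<and>
    (\<forall>h>0. \<forall>r>0. \<exists>C\<ge>0. \<forall>N z. norm (G N z) \<le> C * h ^ N * fact N powr \<sigma> * phase_decay t s r z)"

text \<open>Differentiation under the integral for directions in either variable: for
  \<open>e2 = 0\<close> the derivative falls on \<open>H\<close>, for \<open>e1 = 0\<close> on the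
  Fourier kernel, and \<open>H'\<close> is the factor that results.\<close>

lemma dir_deriv_partial_fourier:
  fixes H H' :: "(real ^ 'n::finite) \<times> (real ^ 'n) \<Rightarrow> complex"
  assumes t: "0 < t" and m [measurable]: "H \<in> borel_measurable borel" "H' \<in> borel_measurable borel"
    and b: "\<And>x y. norm (H (x, y)) \<le> C * decay (1 / t) 1 y" "\<And>x y. norm (H' (x, y)) \<le> C * decay (1 / t) 1 y"
    and D: "\<And>x \<eta> y \<tau>. ((\<lambda>\<tau>. H (x + \<tau> *\<^sub>R e1, y) * plane_wave (- (\<eta> + \<tau> *\<^sub>R e2)) y) has_vector_derivative
      H' (x + \<tau> *\<^sub>R e1, y) * plane_wave (- (\<eta> + \<tau> *\<^sub>R e2)) y) (at \<tau>)"
  shows "dir_deriv (e1, e2) (partial_fourier H) (partial_fourier H')"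
  unfolding dir_deriv_def
proof
  fix z :: "(real^'n) \<times> (real^'n)"
  obtain x \<eta> where z: "z = (x, \<eta>)" by (cases z)
  have int: "integrable lborel (\<lambda>y. C * decay (1 / t) 1 (y::real^'n))"
    using t by (intro integrable_mult_right integrable_decay) auto
  have C: "0 \<le> C * decay (1 / t) 1 y" for y :: "real^'n" using b(1)[of 0 y] norm_ge_zero order_trans by blast
  have "((\<lambda>\<tau>. LINT y|lborel. H (x + \<tau> *\<^sub>R e1, y) * plane_wave (- (\<eta> + \<tau> *\<^sub>R e2)) y) has_derivative
    (\<lambda>v. LINT y|lborel. v *\<^sub>R (H' (x + 0 *\<^sub>R e1, y) * plane_wave (- (\<eta> + 0 *\<^sub>R e2)) y))) (at 0)"
  proof (rule has_derivative_LINT[where g = "\<lambda>y \<tau>. H (x + \<tau> *\<^sub>R e1, y) * plane_wave (- (\<eta> + \<tau> *\<^sub>R e2)) y"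
        and g' = "\<lambda>y \<tau> v. v *\<^sub>R (H' (x + \<tau> *\<^sub>R e1, y) * plane_wave (- (\<eta> + \<tau> *\<^sub>R e2)) y)" and x = "0::real"])
    show "((\<lambda>\<tau>. H (x + \<tau> *\<^sub>R e1, y) * plane_wave (- (\<eta> + \<tau> *\<^sub>R e2)) y) has_derivative
      (\<lambda>v. v *\<^sub>R (H' (x + \<tau> *\<^sub>R e1, y) * plane_wave (- (\<eta> + \<tau> *\<^sub>R e2)) y))) (at \<tau>)" for y \<tau>
      using D[where x=x and \<eta>=\<eta> and y=y and \<tau>=\<tau>] by (simp add: has_vector_derivative_def)
    show "(\<lambda>y. H (x + \<tau> *\<^sub>R e1, y) * plane_wave (- (\<eta> + \<tau> *\<^sub>R e2)) y) \<in> borel_measurable lborel" for \<tau> by measurable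
    show "(\<lambda>y. v *\<^sub>R (H' (x + \<tau> *\<^sub>R e1, y) * plane_wave (- (\<eta> + \<tau> *\<^sub>R e2)) y)) \<in> borel_measurable lborel" for \<tau> v by measurable
    show "norm (v *\<^sub>R (H' (x + \<tau> *\<^sub>R e1, y) * plane_wave (- (\<eta> + \<tau> *\<^sub>R e2)) y)) \<le> (C * decay (1 / t) 1 y) * norm v" for y \<tau> v
      using mult_left_mono[OF b(2)[of "x + \<tau> *\<^sub>R e1" y] norm_ge_zero[of v]] by (simp add: norm_mult mult.commute)
    show "integrable lborel (\<lambda>y. C * decay (1 / t) 1 (y::real^'n))" by (rule int)
    show "integrable lborel (\<lambda>y. H (x + \<tau> *\<^sub>R e1, y) * plane_wave (- (\<eta> + \<tau> *\<^sub>R e2)) y)" for \<tau>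
      by (rule Bochner_Integration.integrable_bound[OF int]) (use b C in \<open>auto simp: norm_mult\<close>)
  qed
  then show "((\<lambda>\<tau>. partial_fourier H (z + \<tau> *\<^sub>R (e1, e2))) has_vector_derivative partial_fourier H' z) (at 0)"
    by (simp add: has_vector_derivative_def partial_fourier_def z)
qed

text \<open>The factorial of the total order is split by \<open>fact_add_le\<close>; starting from
  \<open>h / 2 powr s\<close> compensates for the powers of 2 that this costs.\<close>

lemma gevrey_iter_deriv:
  assumes H: "smooth H" and gevrey: "gevrey s (h / 2 powr s) \<omega> H" and us: "\<And>u. u \<in> set us \<Longrightarrow> norm u \<le> 1" and "0 < h" "0 \<le> s"
  shows "gevrey s h (\<lambda>z. \<omega> z * (h ^ length us * fact (length us) powr s)) (iter_deriv us H)"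
proof (rule gevreyI)
  fix vs :: "'a list" and z assume vs: "\<And>v. v \<in> set vs \<Longrightarrow> norm v \<le> 1"
  let ?m = "length vs" and ?n = "length us"
  have "norm (iter_deriv (vs @ us) H z) \<le> \<omega> z * (h / 2 powr s) ^ (?m + ?n) * fact (?m + ?n) powr s"
    using gevreyD[OF gevrey, of "vs @ us" z] us vs by auto
  also have "\<dots> \<le> \<omega> z * (h / 2 powr s) ^ (?m + ?n) * ((2 powr s) ^ (?m + ?n) * (fact ?m powr s * fact ?n powr s))"
  proof (intro mult_left_mono)
    have "fact (?m + ?n) powr s \<le> (2 ^ (?m + ?n) * (fact ?m * fact ?n)) powr s"
      using assms(5) by (intro powr_mono2 fact_add_le) auto
    also have "\<dots> = (2 ^ (?m + ?n)) powr s * (fact ?m powr s * fact ?n powr s)"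
      by (simp add: powr_mult)
    also have "(2 ^ (?m + ?n)) powr s = (2 powr s) ^ (?m + ?n)"
      by (simp add: powr_powr mult.commute flip: powr_realpow)
    finally show "fact (?m + ?n) powr s \<le> (2 powr s) ^ (?m + ?n) * (fact ?m powr s * fact ?n powr s)" .
  qed (use gevrey_nonneg[OF gevrey] assms in auto)
  also have "\<dots> = \<omega> z * ((h / 2 powr s) ^ (?m + ?n) * (2 powr s) ^ (?m + ?n)) * (fact ?m powr s * fact ?n powr s)"
    by (simp only: mult_ac)
  also have "(h / 2 powr s) ^ (?m + ?n) * (2 powr s) ^ (?m + ?n) = h ^ (?m + ?n)"
    by (simp flip: power_mult_distrib)
  also have "\<omega> z * h ^ (?m + ?n) * (fact ?m powr s * fact ?n powr s) =
      \<omega> z * (h ^ ?n * fact ?n powr s) * h ^ ?m * fact ?m powr s"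
    by (simp add: power_add mult_ac)
  finally show "norm (iter_deriv vs (iter_deriv us H) z) \<le> \<omega> z * (h ^ ?n * fact ?n powr s) * h ^ ?m * fact ?m powr s"
    by (simp add: iter_deriv_append)
qed

text \<open>Derivatives in position fall on \<open>H\<close>, so the growth in the order
  \<open>N\<close> is that of the regularity of \<open>H\<close>, namely \<open>s\<close>.\<close>

lemma decaying_jet_partial_fourier_x:
  fixes H :: "(real ^ 'n::finite) \<times> (real ^ 'n) \<Rightarrow> complex"
  assumes st: "0 < s" "0 < t" and H: "GS_pair t s H"
  shows "\<exists>G. G 0 = partial_fourier H \<and> decaying_jet t s s (axis j 1, 0) G"
proof -
  have sm: "smooth H" using H by (simp add: GS_pair_def)
  let ?e = "(axis j 1, 0) :: (real^'n) \<times> (real^'n)"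
  have e: "norm ?e \<le> 1" by (simp add: norm_prod_def)
  define G where "G = (\<lambda>N. partial_fourier (iter_deriv (replicate N ?e) H))"
  have "decaying_jet t s s ?e G"
    unfolding decaying_jet_def
  proof (intro conjI allI impI)
    fix N
    have smd: "smooth (iter_deriv (replicate N ?e) H)" for N by (rule smooth_iter_deriv[OF sm])
    show "G N \<in> borel_measurable borel"
      unfolding G_def by (intro partial_fourier_measurable smooth_measurable smd)
    obtain C where C: "C \<ge> 0" "gevrey s 1 (\<lambda>z. C * (decay (1 / t) 1 (fst z) * decay (1 / t) 1 (snd z))) H"
      using H unfolding GS_pair_def by (meson zero_less_one)
    \<comment> \<open>Differentiation under the integral needs a common majorant for two consecutive
      orders.\<close>
    define K where "K = max (C * fact N powr s) (C * fact (Suc N) powr s)"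
    have b: "norm (iter_deriv (replicate M ?e) H (x, y)) \<le> K * decay (1 / t) 1 y" if "M = N \<or> M = Suc N" for x y M
    proof -
      have "norm (iter_deriv (replicate M ?e) H (x, y)) \<le> C * (decay (1 / t) 1 x * decay (1 / t) 1 y) * 1 ^ M * fact M powr s"
        using iter_deriv_replicate_bound[OF sm C(2) e, of M "(x, y)"] by simp
      also have "\<dots> = (C * fact M powr s * decay (1 / t) 1 y) * decay (1 / t) 1 x" by simp
      also have "\<dots> \<le> (C * fact M powr s * decay (1 / t) 1 y) * 1"
        using C(1) by (intro mult_left_mono decay_le_1) auto
      also have "\<dots> \<le> K * decay (1 / t) 1 y"
        using that by (auto simp: K_def intro!: mult_right_mono)
      finally show ?thesis .
    qed
    show "dir_deriv ?e (G N) (G (Suc N))"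
      unfolding G_def
    proof (rule dir_deriv_partial_fourier[OF st(2) smooth_measurable[OF smd] smooth_measurable[OF smd]])
      show "norm (iter_deriv (replicate N ?e) H (x, y)) \<le> K * decay (1 / t) 1 y"
        "norm (iter_deriv (replicate (Suc N) ?e) H (x, y)) \<le> K * decay (1 / t) 1 y" for x y
        by (intro b; simp)+
      fix x \<eta> y \<tau>
      have "((\<lambda>\<tau>. iter_deriv (replicate N ?e) H ((x, y) + \<tau> *\<^sub>R ?e)) has_vector_derivative iter_deriv (?e # replicate N ?e) H ((x, y) + \<tau> *\<^sub>R ?e)) (at \<tau>)"
        by (rule iter_deriv_line[OF sm])
      from has_vector_derivative_mult_left[OF this, of "plane_wave (- \<eta>) y"]
      show "((\<lambda>\<tau>. iter_deriv (replicate N ?e) H (x + \<tau> *\<^sub>R axis j 1, y) * plane_wave (- (\<eta> + \<tau> *\<^sub>R 0)) y) has_vector_derivative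
        iter_deriv (replicate (Suc N) ?e) H (x + \<tau> *\<^sub>R axis j 1, y) * plane_wave (- (\<eta> + \<tau> *\<^sub>R 0)) y) (at \<tau>)"
        by simp
    qed
  next
    fix h r :: real assume hr: "0 < h" "0 < r"
    obtain h0 C0 where h0: "h0 > 0" and C0: "C0 \<ge> 0" and P: "\<And>(H :: (real ^ 'n) \<times> (real ^ 'n) \<Rightarrow> complex) A. smooth H \<Longrightarrow>
      gevrey s h0 (\<lambda>z. A * (decay (1 / t) r (fst z) * decay (1 / t) r (snd z))) H \<Longrightarrow>
      (\<forall>x \<eta>. norm (partial_fourier H (x, \<eta>)) \<le> C0 * A * (decay (1 / t) r x * decay (1 / s) r \<eta>))"
      using partial_fourier_bound[OF st hr(2)] by (elim exE conjE) blast
    \<comment> \<open>The bound by \<open>h\<close> serves the order \<open>N\<close>, the bound by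
      \<open>h0\<close> the further derivatives that \<open>partial_fourier_bound\<close>
      takes.\<close>
    define k where "k = min h h0"
    have k: "k > 0" "k \<le> h" "k \<le> h0" using hr h0 by (auto simp: k_def)
    obtain C where C: "C \<ge> 0" "gevrey s (k / 2 powr s) (\<lambda>z. C * (decay (1 / t) r (fst z) * decay (1 / t) r (snd z))) H"
    proof -
      have "0 < k / 2 powr s" using k by simp
      then show ?thesis using H hr that unfolding GS_pair_def by blast
    qed
    show "\<exists>C\<ge>0. \<forall>N z. norm (G N z) \<le> C * h ^ N * fact N powr s * phase_decay t s r z"
    proof (intro exI[of _ "C0 * C"] conjI allI)
      show "0 \<le> C0 * C" using C C0 by simp
      fix N z
      let ?A = "C * (k ^ N * fact N powr s)"
      have "gevrey s k (\<lambda>z. (C * (decay (1 / t) r (fst z) * decay (1 / t) r (snd z))) * (k ^ length (replicate N ?e) * fact (length (replicate N ?e)) powr s)) (iter_deriv (replicate N ?e) H)"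
        by (rule gevrey_iter_deriv[OF sm C(2)]) (use e k st in auto)
      then have "gevrey s h0 (\<lambda>z. ?A * (decay (1 / t) r (fst z) * decay (1 / t) r (snd z))) (iter_deriv (replicate N ?e) H)"
        by (rule gevrey_mono) (use k in auto)
      from P[OF smooth_iter_deriv[OF sm] this] have "norm (G N z) \<le> C0 * ?A * phase_decay t s r z"
        by (cases z) (simp add: G_def phase_decay_def)
      also have "\<dots> \<le> C0 * (C * (h ^ N * fact N powr s)) * phase_decay t s r z"
        using k C C0 by (intro mult_right_mono mult_left_mono power_mono) auto
      finally show "norm (G N z) \<le> C0 * C * h ^ N * fact N powr s * phase_decay t s r z"
        by (simp add: mult_ac)
    qed
  qed
  then show ?thesis by (intro exI[of _ G]) (simp add: G_def)
qed

text \<open>The derivatives of \<open>\<tau> \<mapsto> (- \<i> * \<tau>) ^ N\<close>, the factor produced by differentiating the Fourier kernel.\<close>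

definition monomial_jet :: "nat \<Rightarrow> nat \<Rightarrow> real \<Rightarrow> complex" where
  "monomial_jet N k \<tau> = (- \<i>) ^ N * of_real (if k \<le> N then fact N / fact (N - k) * \<tau> ^ (N - k) else 0)"

lemma monomial_jet_0: "monomial_jet N 0 \<tau> = (- \<i> * of_real \<tau>) ^ N"
  by (simp add: monomial_jet_def flip: power_mult_distrib)

lemma monomial_jet_deriv: "(monomial_jet N k has_vector_derivative monomial_jet N (Suc k) \<tau>) (at \<tau>)"
proof -
  define f where "f = (\<lambda>k \<tau>::real. if k \<le> N then fact N / fact (N - k) * \<tau> ^ (N - k) else (0::real))"
  have "(f k has_real_derivative f (Suc k) \<tau>) (at \<tau>)"
  proof (cases "k < N")
    case True
    then obtain m where m: "N - k = Suc m" "N - Suc k = m" by (metis Suc_diff_Suc)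
    have "((\<lambda>\<tau>. fact N / fact (N - k) * \<tau> ^ (N - k)) has_real_derivative fact N / fact (Suc m) * (real (Suc m) * \<tau> ^ m)) (at \<tau>)"
      unfolding m by (rule DERIV_cmult) (use DERIV_pow[of "Suc m" \<tau>] in simp)
    moreover have "fact N / fact (Suc m) * (real (Suc m) * \<tau> ^ m) = fact N / fact m * \<tau> ^ m"
      by (simp add: fact_Suc del: of_nat_Suc)
    ultimately show ?thesis using True by (simp add: f_def m(2))
  next
    case False
    then show ?thesis by (cases "k = N") (auto simp: f_def)
  qed
  then have "((\<lambda>\<tau>. (- \<i>) ^ N * of_real (f k \<tau>)) has_vector_derivative (- \<i>) ^ N * of_real (f (Suc k) \<tau>)) (at \<tau>)"
    by (intro has_vector_derivative_mult_right has_vector_derivative_of_real) (simp add: has_real_derivative_iff_has_vector_derivative)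
  then show ?thesis
    by (simp add: monomial_jet_def[abs_def] f_def)
qed

text \<open>This is the step that uses \<open>s + t > 1\<close>: the factor \<open>m!\<close> produced by differentiating a
  monomial \<open>m\<close> times is absorbed into \<open>m! powr s * m! powr t\<close>.\<close>
lemma fact_absorb:
  assumes "1 < s + (t::real)" "0 < h"
  shows "\<exists>K\<ge>1. \<forall>m. fact m \<le> K * h ^ m * (fact m powr s * fact m powr t)"
proof -
  define \<epsilon> where "\<epsilon> = s + t - 1"
  have \<epsilon>: "\<epsilon> > 0" using assms by (simp add: \<epsilon>_def)
  \<comment> \<open>An upper bound for \<open>(1 / h) ^ m / fact m powr \<epsilon>\<close> over all
    \<open>m\<close>, from \<open>power_le_exp_powr\<close> with exponent
    \<open>\<epsilon>\<close>.\<close>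
  define K where "K = exp (\<epsilon> * (1 / h) powr (1 / \<epsilon>))"
  show ?thesis
  proof (intro exI[of _ K] conjI allI)
    show "1 \<le> K" using \<epsilon> by (simp add: K_def)
    fix m
    have "(1 / h) ^ m \<le> 1 ^ m * fact m powr \<epsilon> * exp (\<epsilon> * ((1 / h) / 1) powr (1 / \<epsilon>))"
      using \<epsilon> assms by (intro power_le_exp_powr) auto
    then have "(1 / h) ^ m \<le> fact m powr \<epsilon> * K" by (simp add: K_def)
    then have "1 \<le> K * h ^ m * fact m powr \<epsilon>"
      using assms by (simp add: power_divide field_simps)
    then have "fact m * 1 \<le> fact m * (K * h ^ m * fact m powr \<epsilon>)"
      by (intro mult_left_mono) auto
    then have "fact m \<le> K * h ^ m * (fact m * fact m powr \<epsilon>)"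
      by (simp only: mult_ac mult_1_right mult_1)
    moreover have "fact m * fact m powr \<epsilon> = fact m powr s * fact m powr (t::real)"
    proof -
      have "fact m * fact m powr \<epsilon> = fact m powr (1 + \<epsilon>)" by (simp add: powr_add)
      also have "1 + \<epsilon> = s + t" by (simp add: \<epsilon>_def)
      finally show ?thesis by (simp add: powr_add)
    qed
    ultimately show "fact m \<le> K * h ^ m * (fact m powr s * fact m powr t)"
      by (simp only:)
  qed
qed

text \<open>The derivative of order \<open>m\<close> has the coefficient
  \<open>fact N / fact (N - m)\<close>, which is at most \<open>fact m * 2 ^ N\<close>. Here
  \<open>fact m\<close> is split into the orders \<open>s\<close> and \<open>t\<close>; the part of
  order \<open>t\<close> combines with \<open>fact (N - m) powr t\<close>, which the remaining power
  of \<open>\<tau>\<close> contributes, to order \<open>t\<close> in \<open>N\<close>.\<close>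

lemma monomial_jet_bound:
  assumes st: "0 < s" "0 < t" "1 < s + t" and hN: "0 < hN" "0 < h"
  shows "\<exists>K\<ge>1. \<exists>\<rho>>0. \<forall>N m \<tau>. norm (monomial_jet N m \<tau>) \<le> K * hN ^ N * fact N powr t * h ^ m * fact m powr s * exp (\<rho> * \<bar>\<tau>\<bar> powr (1 / t))"
proof -
  \<comment> \<open>Half of \<open>hN\<close> compensates for the binomial bound
    \<open>2 ^ N\<close>; using \<open>k * h\<close> when \<open>fact m\<close> is absorbed supplies
    the missing \<open>k ^ m\<close>.\<close>
  define k where "k = hN / 2"
  have k: "k > 0" using hN by (simp add: k_def)
  obtain K where K: "K \<ge> 1" and abs: "\<And>m. fact m \<le> K * (k * h) ^ m * (fact m powr s * fact m powr t)"
    using fact_absorb[OF st(3), of "k * h"] k hN by auto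
  define \<rho> where "\<rho> = t * (1 / k) powr (1 / t)"
  have \<rho>: "\<rho> > 0" using st k by (simp add: \<rho>_def)
  have "norm (monomial_jet N m \<tau>) \<le> K * hN ^ N * fact N powr t * h ^ m * fact m powr s * exp (\<rho> * \<bar>\<tau>\<bar> powr (1 / t))" for N m \<tau>
  proof (cases "m \<le> N")
    case True
    have "fact N / fact (N - m) = fact m * real (N choose m)"
      using binomial_fact[OF True, where 'a=real] by simp
    also have "\<dots> \<le> fact m * 2 ^ N"
      using binomial_le_pow2[of N m] by (intro mult_left_mono) (auto simp flip: of_nat_power)
    finally have 1: "fact N / fact (N - m) \<le> (fact m * 2 ^ N :: real)" .
    have "\<bar>\<tau>\<bar> ^ (N - m) \<le> k ^ (N - m) * fact (N - m) powr t * exp (t * (\<bar>\<tau>\<bar> / k) powr (1 / t))"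
      using st k by (intro power_le_exp_powr) auto
    also have "t * (\<bar>\<tau>\<bar> / k) powr (1 / t) = \<rho> * \<bar>\<tau>\<bar> powr (1 / t)"
      using k by (simp add: \<rho>_def powr_divide)
    finally have 2: "\<bar>\<tau>\<bar> ^ (N - m) \<le> k ^ (N - m) * fact (N - m) powr t * exp (\<rho> * \<bar>\<tau>\<bar> powr (1 / t))" .
    let ?E = "exp (\<rho> * \<bar>\<tau>\<bar> powr (1 / t))"
    have "norm (monomial_jet N m \<tau>) = fact N / fact (N - m) * \<bar>\<tau>\<bar> ^ (N - m)"
      using True by (simp add: monomial_jet_def norm_mult norm_power power_abs norm_divide)
    also have "\<dots> \<le> (fact m * 2 ^ N) * (k ^ (N - m) * fact (N - m) powr t * ?E)"
      by (intro mult_mono 1 2) auto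
    also have "\<dots> \<le> ((K * (k * h) ^ m * (fact m powr s * fact m powr t)) * 2 ^ N) * (k ^ (N - m) * fact (N - m) powr t * ?E)"
      using k by (intro mult_right_mono abs) auto
    also have "\<dots> = K * h ^ m * fact m powr s * (2 ^ N * (k ^ m * k ^ (N - m))) * ?E * (fact m powr t * fact (N - m) powr t)"
      by (simp add: power_mult_distrib mult_ac)
    also have "\<dots> \<le> K * h ^ m * fact m powr s * (2 ^ N * (k ^ m * k ^ (N - m))) * ?E * fact (m + (N - m)) powr t"
      using K k hN st by (intro mult_left_mono fact_mult_powr_le) auto
    also have "2 ^ N * (k ^ m * k ^ (N - m)) = hN ^ N"
      using True by (simp add: k_def power_divide flip: power_add)
    finally show ?thesis using True by (simp add: mult_ac)
  next
    case False
    then show ?thesis using K hN by (simp add: monomial_jet_def)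
  qed
  then show ?thesis using K \<rho> by blast
qed

lemma prod_list_abs_le_1:
  assumes "\<And>v. v \<in> set vs \<Longrightarrow> \<bar>l v\<bar> \<le> (1::real)"
  shows "\<bar>\<Prod>v\<leftarrow>vs. l v\<bar> \<le> 1"
  using assms by (induction vs) (auto simp: abs_mult intro!: mult_le_one)

text \<open>The derivatives of the monomial grow like
  \<open>exp (\<rho> * norm (snd z) powr (1 / t))\<close> with \<open>\<rho>\<close> independent of
  \<open>N\<close>; taking the decay of \<open>H\<close> at the rate \<open>r + \<rho>\<close> pays
  for this.\<close>

lemma
  fixes H :: "(real ^ 'n::finite) \<times> (real ^ 'n) \<Rightarrow> complex"
  assumes H: "GS_pair t s H"
  shows smooth_monomial_mult: "smooth (\<lambda>z. monomial_jet N 0 (snd z $ j) * H z)"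
    and gevrey_monomial_mult: "0 < s \<Longrightarrow> 0 < t \<Longrightarrow> 1 < s + t \<Longrightarrow> 0 < h \<Longrightarrow> 0 < hN \<Longrightarrow> 0 < r \<Longrightarrow> \<exists>C\<ge>0. \<forall>N.
      gevrey s h (\<lambda>z. C * (hN ^ N * fact N powr t) * (decay (1 / t) r (fst z) * decay (1 / t) r (snd z))) (\<lambda>z. monomial_jet N 0 (snd z $ j) * H z)"
proof -
  have sm: "smooth H" using H by (simp add: GS_pair_def)
  let ?l = "\<lambda>z :: (real ^ 'n) \<times> (real ^ 'n). snd z $ j"
  have l: "bounded_linear ?l"
    by (rule bounded_linear_compose[OF bounded_linear_vec_nth bounded_linear_snd])
  have ln: "\<bar>?l z\<bar> \<le> norm (snd z)" for z by (rule component_le_norm_cart)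
  have l1: "\<bar>?l z\<bar> \<le> norm z" for z using ln[of z] norm_snd_le[of "snd z" "fst z"] by simp
  have sM: "smooth (\<lambda>z. monomial_jet N 0 (?l z))" for N
    by (rule smooth_ridge[where \<phi> = "monomial_jet N", OF l monomial_jet_deriv])
  show "smooth (\<lambda>z. monomial_jet N 0 (?l z) * H z)" for N
    by (rule smooth_mult[OF sM sm])
  assume st: "0 < s" "0 < t" "1 < s + t" and hs: "0 < h" "0 < hN" "0 < r"
  obtain K \<rho> where K: "K \<ge> 1" and \<rho>: "\<rho> > 0" and mj: "\<And>N m \<tau>. norm (monomial_jet N m \<tau>) \<le>
      K * hN ^ N * fact N powr t * (h / 2) ^ m * fact m powr s * exp (\<rho> * \<bar>\<tau>\<bar> powr (1 / t))"
    using monomial_jet_bound[OF st hs(2), of "h / 2"] hs(1) by auto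
  have gM: "gevrey s (h / 2) (\<lambda>z. K * (hN ^ N * fact N powr t) * exp (\<rho> * norm (snd z) powr (1 / t))) (\<lambda>z. monomial_jet N 0 (?l z))" for N
  proof (rule gevreyI)
    fix vs :: "((real ^ 'n) \<times> (real ^ 'n)) list" and z assume vs: "\<And>v. v \<in> set vs \<Longrightarrow> norm v \<le> 1"
    let ?m = "length vs"
    have "\<bar>\<Prod>v\<leftarrow>vs. ?l v\<bar> \<le> 1"
      by (intro prod_list_abs_le_1 order_trans[OF l1 vs])
    then have "norm (iter_deriv vs (\<lambda>z. monomial_jet N 0 (?l z)) z) \<le> 1 * norm (monomial_jet N ?m (?l z))"
      unfolding iter_deriv_ridge[where \<phi> = "monomial_jet N", OF l monomial_jet_deriv] norm_mult norm_of_real by (intro mult_right_mono) auto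
    also have "\<dots> \<le> K * hN ^ N * fact N powr t * (h / 2) ^ ?m * fact ?m powr s * exp (\<rho> * \<bar>?l z\<bar> powr (1 / t))"
      using mj by simp
    also have "\<dots> \<le> K * hN ^ N * fact N powr t * (h / 2) ^ ?m * fact ?m powr s * exp (\<rho> * norm (snd z) powr (1 / t))"
      using K hs \<rho> ln[of z] st by (intro mult_left_mono) (auto intro!: powr_mono2)
    finally show "norm (iter_deriv vs (\<lambda>z. monomial_jet N 0 (?l z)) z) \<le> K * (hN ^ N * fact N powr t) * exp (\<rho> * norm (snd z) powr (1 / t)) * (h / 2) ^ ?m * fact ?m powr s"
      by (simp add: mult_ac)
  qed
  obtain C where C: "C \<ge> 0" "gevrey s (h / 2) (\<lambda>z. C * (decay (1 / t) (r + \<rho>) (fst z) * decay (1 / t) (r + \<rho>) (snd z))) H"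
  proof -
    have "0 < h / 2" "0 < r + \<rho>" using hs \<rho> by auto
    then show ?thesis using H that unfolding GS_pair_def by blast
  qed
  show "\<exists>C\<ge>0. \<forall>N. gevrey s h (\<lambda>z. C * (hN ^ N * fact N powr t) * (decay (1 / t) r (fst z) * decay (1 / t) r (snd z))) (\<lambda>z. monomial_jet N 0 (?l z) * H z)"
  proof (intro exI[of _ "K * C"] conjI allI)
    show "0 \<le> K * C" using K C by simp
    fix N
    have "gevrey s (2 * (h / 2)) (\<lambda>z. K * (hN ^ N * fact N powr t) * exp (\<rho> * norm (snd z) powr (1 / t)) *
      (C * (decay (1 / t) (r + \<rho>) (fst z) * decay (1 / t) (r + \<rho>) (snd z)))) (\<lambda>z. monomial_jet N 0 (?l z) * H z)"
      using hs st by (intro gevrey_mult sM sm gM C(2)) auto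
    then show "gevrey s h (\<lambda>z. K * C * (hN ^ N * fact N powr t) * (decay (1 / t) r (fst z) * decay (1 / t) r (snd z))) (\<lambda>z. monomial_jet N 0 (?l z) * H z)"
    proof (rule gevrey_mono)
      fix z :: "(real ^ 'n) \<times> (real ^ 'n)"
      have "exp (\<rho> * norm (snd z) powr (1 / t)) * decay (1 / t) (r + \<rho>) (snd z) = decay (1 / t) r (snd z)"
        by (simp add: decay_def algebra_simps flip: exp_add)
      moreover have "decay (1 / t) (r + \<rho>) (fst z) \<le> decay (1 / t) r (fst z)"
        using \<rho> by (intro decay_mono) auto
      ultimately have "decay (1 / t) (r + \<rho>) (fst z) * (exp (\<rho> * norm (snd z) powr (1 / t)) * decay (1 / t) (r + \<rho>) (snd z))
        \<le> decay (1 / t) r (fst z) * decay (1 / t) r (snd z)"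
        by (simp add: mult_right_mono)
      then have "(K * C * (hN ^ N * fact N powr t)) * (decay (1 / t) (r + \<rho>) (fst z) * (exp (\<rho> * norm (snd z) powr (1 / t)) * decay (1 / t) (r + \<rho>) (snd z)))
        \<le> (K * C * (hN ^ N * fact N powr t)) * (decay (1 / t) r (fst z) * decay (1 / t) r (snd z))"
        using K C hs by (intro mult_left_mono) auto
      then show "K * (hN ^ N * fact N powr t) * exp (\<rho> * norm (snd z) powr (1 / t)) *
        (C * (decay (1 / t) (r + \<rho>) (fst z) * decay (1 / t) (r + \<rho>) (snd z))) \<le> K * C * (hN ^ N * fact N powr t) * (decay (1 / t) r (fst z) * decay (1 / t) r (snd z))"
        by (simp only: mult_ac)
    qed (use hs in auto)
  qed
qed

text \<open>Derivatives in frequency act on the Fourier kernel and multiply \<open>H\<close> by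
  powers of \<open>- \<i> * y $ j\<close>, so the growth in \<open>N\<close> has order
  \<open>t\<close>, unlike the order \<open>s\<close> for position. The symbol class has the same
  two orders.\<close>

lemma decaying_jet_partial_fourier_xi:
  fixes H :: "(real ^ 'n::finite) \<times> (real ^ 'n) \<Rightarrow> complex"
  assumes st: "0 < s" "0 < t" "1 < s + t" and H: "GS_pair t s H"
  shows "\<exists>G. G 0 = partial_fourier H \<and> decaying_jet t s t (0, axis j 1) G"
proof -
  have sm: "smooth H" using H by (simp add: GS_pair_def)
  define HN where "HN = (\<lambda>N z. monomial_jet N 0 (snd z $ j) * H z)"
  have smN: "smooth (HN N)" for N unfolding HN_def by (rule smooth_monomial_mult[OF H])
  define G where "G = (\<lambda>N. partial_fourier (HN N))"
  have "decaying_jet t s t (0, axis j 1) G"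
    unfolding decaying_jet_def
  proof (intro conjI allI impI)
    fix N
    show "G N \<in> borel_measurable borel"
      unfolding G_def by (intro partial_fourier_measurable smooth_measurable smN)
    obtain C where C: "C \<ge> 0" "\<And>N. gevrey s 1 (\<lambda>z. C * (1 ^ N * fact N powr t) * (decay (1 / t) 1 (fst z) * decay (1 / t) 1 (snd z))) (HN N)"
      using gevrey_monomial_mult[OF H st, of 1 1 1 j] unfolding HN_def by auto
    define K where "K = max (C * fact N powr t) (C * fact (Suc N) powr t)"
    have b: "norm (HN M (x, y)) \<le> K * decay (1 / t) 1 y" if "M = N \<or> M = Suc N" for x y M
    proof -
      have "norm (HN M (x, y)) \<le> C * (1 ^ M * fact M powr t) * (decay (1 / t) 1 x * decay (1 / t) 1 y)"
        using gevrey_norm[OF C(2), of M "(x, y)"] by simp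
      also have "\<dots> = (C * fact M powr t * decay (1 / t) 1 y) * decay (1 / t) 1 x" by simp
      also have "\<dots> \<le> (C * fact M powr t * decay (1 / t) 1 y) * 1"
        using C(1) by (intro mult_left_mono decay_le_1) auto
      also have "\<dots> \<le> K * decay (1 / t) 1 y"
        using that by (auto simp: K_def intro!: mult_right_mono)
      finally show ?thesis .
    qed
    show "dir_deriv (0, axis j 1) (G N) (G (Suc N))"
      unfolding G_def
    proof (rule dir_deriv_partial_fourier[OF st(2) smooth_measurable[OF smN] smooth_measurable[OF smN]])
      show "norm (HN N (x, y)) \<le> K * decay (1 / t) 1 y" "norm (HN (Suc N) (x, y)) \<le> K * decay (1 / t) 1 y" for x y
        by (intro b; simp)+
      fix x \<eta> y :: "real^'n" and \<tau> :: real
      have "((\<lambda>\<tau>. plane_wave y (- \<eta> + \<tau> *\<^sub>R (- axis j 1))) has_vector_derivative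
        \<i> * of_real ((- axis j 1) \<bullet> y) * plane_wave y (- \<eta> + \<tau> *\<^sub>R (- axis j 1))) (at \<tau>)"
        by (rule dir_deriv_at[OF dir_deriv_plane_wave])
      from has_vector_derivative_mult_right[OF this, of "HN N (x, y)"]
      show "((\<lambda>\<tau>. HN N (x + \<tau> *\<^sub>R 0, y) * plane_wave (- (\<eta> + \<tau> *\<^sub>R axis j 1)) y) has_vector_derivative
        HN (Suc N) (x + \<tau> *\<^sub>R 0, y) * plane_wave (- (\<eta> + \<tau> *\<^sub>R axis j 1)) y) (at \<tau>)"
        by (simp add: HN_def monomial_jet_0 inner_axis' plane_wave_commute[of _ y] mult_ac)
    qed
  next
    fix h r :: real assume hr: "0 < h" "0 < r"
    obtain h0 C0 where h0: "h0 > 0" and C0: "C0 \<ge> 0" and P: "\<And>(H :: (real ^ 'n) \<times> (real ^ 'n) \<Rightarrow> complex) A. smooth H \<Longrightarrow>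
      gevrey s h0 (\<lambda>z. A * (decay (1 / t) r (fst z) * decay (1 / t) r (snd z))) H \<Longrightarrow>
      (\<forall>x \<eta>. norm (partial_fourier H (x, \<eta>)) \<le> C0 * A * (decay (1 / t) r x * decay (1 / s) r \<eta>))"
      using partial_fourier_bound[OF st(1,2) hr(2)] by (elim exE conjE) blast
    obtain C where C: "C \<ge> 0" "\<And>N. gevrey s h0 (\<lambda>z. C * (h ^ N * fact N powr t) * (decay (1 / t) r (fst z) * decay (1 / t) r (snd z))) (HN N)"
      using gevrey_monomial_mult[OF H st h0 hr, of j] unfolding HN_def by auto
    show "\<exists>C\<ge>0. \<forall>N z. norm (G N z) \<le> C * h ^ N * fact N powr t * phase_decay t s r z"
    proof (intro exI[of _ "C0 * C"] conjI allI)
      show "0 \<le> C0 * C" using C C0 by simp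
      fix N z
      from P[OF smN C(2)] show "norm (G N z) \<le> C0 * C * h ^ N * fact N powr t * phase_decay t s r z"
        by (cases z) (simp add: G_def phase_decay_def mult_ac)
    qed
  qed
  moreover have "HN 0 = H" by (simp add: HN_def monomial_jet_0 fun_eq_iff)
  ultimately show ?thesis by (intro exI[of _ G]) (simp add: G_def)
qed

text \<open>The exponent in the growth of symbols. It is homogeneous of degree 1 under the dilations
  by \<open>\<rho> powr t\<close> and \<open>\<rho> powr s\<close> that define the wave front set,
  and satisfies the triangle inequality up to the factor \<open>gauge_const t s\<close>.\<close>

definition phase_gauge :: "real \<Rightarrow> real \<Rightarrow> ('a::real_normed_vector) \<times> ('b::real_normed_vector) \<Rightarrow> real" where
  "phase_gauge t s z = norm (fst z) powr (1 / t) + norm (snd z) powr (1 / s)"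

lemma phase_gauge_nonneg [simp]: "0 \<le> phase_gauge t s z" by (simp add: phase_gauge_def)

lemma phase_decay_phase_gauge: "phase_decay t s r z = exp (- (r * phase_gauge t s z))"
  by (simp add: phase_decay_def decay_def phase_gauge_def algebra_simps flip: exp_add)

lemma phase_gauge_minus [simp]: "phase_gauge t s (- z) = phase_gauge t s z" by (simp add: phase_gauge_def)

definition gauge_const :: "real \<Rightarrow> real \<Rightarrow> real" where
  "gauge_const t s = 2 powr (1 / t) + 2 powr (1 / s)"

lemma gauge_const_pos: "gauge_const t s > 0" by (simp add: gauge_const_def add_pos_pos)

lemma phase_gauge_add_le:
  assumes "0 < s" "0 < t"
  shows "phase_gauge t s (a + b) \<le> gauge_const t s * (phase_gauge t s a + phase_gauge t s b)"
proof -
  have "norm (fst (a + b)) powr (1 / t) \<le> 2 powr (1 / t) * (norm (fst a) powr (1 / t) + norm (fst b) powr (1 / t))"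
    using assms by (intro norm_powr_quasi_triangle) (auto intro: norm_triangle_ineq)
  also have "\<dots> \<le> gauge_const t s * (norm (fst a) powr (1 / t) + norm (fst b) powr (1 / t))"
    by (intro mult_right_mono) (auto simp: gauge_const_def)
  finally have 1: "norm (fst (a + b)) powr (1 / t) \<le> gauge_const t s * (norm (fst a) powr (1 / t) + norm (fst b) powr (1 / t))" .
  have "norm (snd (a + b)) powr (1 / s) \<le> 2 powr (1 / s) * (norm (snd a) powr (1 / s) + norm (snd b) powr (1 / s))"
    using assms by (intro norm_powr_quasi_triangle) (auto intro: norm_triangle_ineq)
  also have "\<dots> \<le> gauge_const t s * (norm (snd a) powr (1 / s) + norm (snd b) powr (1 / s))"
    by (intro mult_right_mono) (auto simp: gauge_const_def)
  finally show ?thesis using 1 by (simp add: phase_gauge_def algebra_simps)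
qed

section \<open>Pure derivatives of the symbol and the Leibniz rule for jets\<close>

lemma mi_list_single: "mi_list (\<lambda>i. if i = j then N else 0) = replicate N j"
proof -
  have m: "mset (mi_list (\<lambda>i. if i = j then N else 0)) = replicate_mset N j"
    by (intro multiset_eqI) (simp add: count_mset count_list_mi_list)
  show ?thesis
  proof (rule replicate_eqI)
    show "length (mi_list (\<lambda>i. if i = j then N else 0)) = N"
      using arg_cong[OF m, of size] by simp
    fix y assume "y \<in> set (mi_list (\<lambda>i. if i = j then N else 0))"
    then have "y \<in># replicate_mset N j" unfolding m[symmetric] by simp
    then show "y = j" by (simp split: if_splits)
  qed
qed

lemma mi_list_zero: "mi_list (\<lambda>_. 0) = []"
  using mi_list_single[of undefined 0] by simp

text \<open>Only derivatives along one coordinate axis are retained. Their orders, \<open>s\<close>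
  in position and \<open>t\<close> in frequency, agree with those of the two jets of the Wigner
  distribution, so products of the jets keep them. The growth rate \<open>\<mu>\<close> precedes
  \<open>h\<close>.\<close>

lemma symbol_bounds:
  fixes a :: "(real ^ 'n::finite) \<times> (real ^ 'n) \<Rightarrow> complex"
  assumes a: "a \<in> symbol_class t s"
  shows "\<exists>\<mu>>0. \<forall>h>0. \<exists>C>0. \<forall>N z j.
    norm (iter_deriv (replicate N (axis j 1, 0)) a z) \<le> C * h ^ N * fact N powr s * exp (\<mu> * phase_gauge t s z) \<and>
    norm (iter_deriv (replicate N (0, axis j 1)) a z) \<le> C * h ^ N * fact N powr t * exp (\<mu> * phase_gauge t s z)"
proof -
  obtain \<mu> where \<mu>: "\<mu> > 0" "\<forall>h>0. \<exists>C>0. \<forall>\<alpha> \<beta> x \<xi>.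
        norm (mi_deriv (\<lambda>i. (axis i 1, 0)) \<alpha> (mi_deriv (\<lambda>i. (0, axis i 1)) \<beta> a) (x, \<xi>))
          \<le> C * h ^ mi_size (\<lambda>i. \<alpha> i + \<beta> i) * mi_fact \<alpha> powr s * mi_fact \<beta> powr t *
             exp (\<mu> * (norm x powr (1 / t) + norm \<xi> powr (1 / s)))"
    using a by (auto simp: symbol_class_def)
  show ?thesis
  proof (rule exI[of _ \<mu>], intro conjI \<mu>(1) allI impI)
    fix h :: real assume "h > 0"
    with \<mu>(2) obtain C where C: "C > 0" "\<And>\<alpha> \<beta> x \<xi>.
        norm (mi_deriv (\<lambda>i. (axis i 1, 0)) \<alpha> (mi_deriv (\<lambda>i. (0, axis i 1)) \<beta> a) (x, \<xi>))
          \<le> C * h ^ mi_size (\<lambda>i. \<alpha> i + \<beta> i) * mi_fact \<alpha> powr s * mi_fact \<beta> powr t *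
             exp (\<mu> * (norm x powr (1 / t) + norm \<xi> powr (1 / s)))"
      by blast
    have f: "mi_fact (\<lambda>i. if i = j then N else 0) = fact N" "mi_fact (\<lambda>_. 0) = 1"
      "mi_size (\<lambda>i. if i = j then N else 0) = N" for j :: 'n and N
      by (simp_all add: mi_fact_def mi_size_def if_distrib prod.If_cases)
    show "\<exists>C>0. \<forall>N z j.
      norm (iter_deriv (replicate N (axis j 1, 0)) a z) \<le> C * h ^ N * fact N powr s * exp (\<mu> * phase_gauge t s z) \<and>
      norm (iter_deriv (replicate N (0, axis j 1)) a z) \<le> C * h ^ N * fact N powr t * exp (\<mu> * phase_gauge t s z)"
    proof (rule exI[of _ C], intro conjI C(1) allI)
      fix N z j
      show "norm (iter_deriv (replicate N (axis j 1, 0)) a z) \<le> C * h ^ N * fact N powr s * exp (\<mu> * phase_gauge t s z)"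
        using C(2)[of "\<lambda>i. if i = j then N else 0" "\<lambda>_. 0" "fst z" "snd z"]
        by (simp add: mi_deriv_eq_iter_deriv mi_list_single mi_list_zero f phase_gauge_def)
      show "norm (iter_deriv (replicate N (0, axis j 1)) a z) \<le> C * h ^ N * fact N powr t * exp (\<mu> * phase_gauge t s z)"
        using C(2)[of "\<lambda>_. 0" "\<lambda>i. if i = j then N else 0" "fst z" "snd z"]
        by (simp add: mi_deriv_eq_iter_deriv mi_list_single mi_list_zero f phase_gauge_def)
    qed
  qed
qed

text \<open>The Leibniz rule along one direction for families given only as jets.
  \<open>splits (replicate N e)\<close> enumerates the binomial terms with multiplicity; only the
  lengths of the two parts matter.\<close>

definition leibniz_sum :: "'a \<Rightarrow> (nat \<Rightarrow> 'a \<Rightarrow> complex) \<Rightarrow> (nat \<Rightarrow> 'a \<Rightarrow> complex) \<Rightarrow> nat \<Rightarrow> 'a \<Rightarrow> complex" where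
  "leibniz_sum e a g N x = (\<Sum>p\<leftarrow>splits (replicate N e). a (length (fst p)) x * g (length (snd p)) x)"

lemma leibniz_sum_0 [simp]: "leibniz_sum e a g 0 x = a 0 x * g 0 x"
  by (simp add: leibniz_sum_def)

lemma dir_deriv_leibniz_sum:
  assumes "\<And>N. dir_deriv e (a N) (a (Suc N))" "\<And>N. dir_deriv e (g N) (g (Suc N))"
  shows "dir_deriv e (leibniz_sum e a g N) (leibniz_sum e a g (Suc N))"
  unfolding dir_deriv_def
proof
  fix x
  have "((\<lambda>\<tau>. \<Sum>p\<leftarrow>ps. a (length (fst p)) (x + \<tau> *\<^sub>R e) * g (length (snd p)) (x + \<tau> *\<^sub>R e)) has_vector_derivative
    (\<Sum>p\<leftarrow>ps. a (length (fst p)) x * g (Suc (length (snd p))) x + a (Suc (length (fst p))) x * g (length (snd p)) x)) (at 0)" for ps :: "('a list \<times> 'a list) list"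
  proof (induction ps)
    case (Cons p ps)
    have "dir_deriv e (\<lambda>x. a (length (fst p)) x * g (length (snd p)) x) (\<lambda>x. a (length (fst p)) x * g (Suc (length (snd p))) x + a (Suc (length (fst p))) x * g (length (snd p)) x)"
      by (intro dir_deriv_mult assms)
    with Cons show ?case unfolding dir_deriv_def by (auto intro!: has_vector_derivative_add)
  qed simp
  from this[of "splits (replicate N e)"]
  show "((\<lambda>\<tau>. leibniz_sum e a g N (x + \<tau> *\<^sub>R e)) has_vector_derivative leibniz_sum e a g (Suc N) x) (at 0)"
    by (simp add: leibniz_sum_def sum_list_addf case_prod_beta o_def add.commute)
qed

section \<open>Decay of the phase space kernel\<close>

lemma integrable_phase_decay:
  assumes "0 < s" "0 < t" "0 < r"
  shows "integrable lborel (phase_decay t s r :: ('a::euclidean_space) \<times> ('b::euclidean_space) \<Rightarrow> real)"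
  by (rule integrable_prod_dominated[where A = "decay (1 / t) r" and B = "decay (1 / s) r"])
    (use assms in \<open>auto intro!: integrable_decay simp: phase_decay_def\<close>)

lemma integrable_translate:
  fixes f :: "'a::euclidean_space \<Rightarrow> 'b::{banach, second_countable_topology}"
  assumes "integrable lborel f"
  shows "integrable lborel (\<lambda>x. f (x - m))" "(LINT x|lborel. f (x - m)) = (LINT x|lborel. f x)"
  using lborel_integrable_translate_iff[of f "- m"] lborel_integral_translate[of f "- m"] assms borel_measurable_integrable[OF assms]
  by simp_all

lemma leibniz_sum_measurable:
  assumes "\<And>N. a N \<in> borel_measurable M" "\<And>N. g N \<in> borel_measurable M"
  shows "leibniz_sum e a g N \<in> borel_measurable M"
proof -
  have "(\<lambda>x. \<Sum>p\<leftarrow>ps. a (length (fst p)) x * g (length (snd p)) x) \<in> borel_measurable M" for ps :: "('a list \<times> 'a list) list"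
    using assms by (induction ps) (auto intro!: borel_measurable_add borel_measurable_times)
  then show ?thesis by (simp add: leibniz_sum_def[abs_def])
qed

lemma leibniz_sum_bound:
  assumes "\<And>N. norm (a N x) \<le> A * h ^ N * fact N powr \<sigma>" "\<And>N. norm (g N x) \<le> B * h ^ N * fact N powr \<sigma>"
    and "0 \<le> h" "0 \<le> \<sigma>" "0 \<le> A" "0 \<le> B"
  shows "norm (leibniz_sum e a g N x) \<le> A * B * (2 * h) ^ N * fact N powr \<sigma>"
proof -
  have "norm (leibniz_sum e a g N x) \<le> real (length (splits (replicate N e))) * (A * B * h ^ N * fact N powr \<sigma>)"
    unfolding leibniz_sum_def
  proof (rule norm_sum_list_bound)
    fix p assume "p \<in> set (splits (replicate N e))"
    then have n: "length (fst p) + length (snd p) = N"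
      using splits_length[of "fst p" "snd p"] by simp
    let ?i = "length (fst p)" and ?j = "length (snd p)"
    have "norm (a ?i x * g ?j x) \<le> (A * h ^ ?i * fact ?i powr \<sigma>) * (B * h ^ ?j * fact ?j powr \<sigma>)"
      unfolding norm_mult using assms by (intro mult_mono) auto
    also have "\<dots> = A * B * h ^ (?i + ?j) * (fact ?i powr \<sigma> * fact ?j powr \<sigma>)"
      by (simp add: power_add)
    also have "\<dots> \<le> A * B * h ^ (?i + ?j) * fact (?i + ?j) powr \<sigma>"
      using assms by (intro mult_left_mono fact_mult_powr_le) auto
    finally show "norm (a ?i x * g ?j x) \<le> A * B * h ^ N * fact N powr \<sigma>" by (simp add: n)
  qed
  then show ?thesis by (simp add: power_mult_distrib mult_ac)
qed

text \<open>The quasi-triangle inequality distributes the growth of the symbol at \<open>p\<close>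
  over \<open>m\<close> and \<open>p - m\<close>. The first share goes into the bound, the second is
  absorbed by the decay of \<open>G\<close> at \<open>p - m\<close>; hence the uniformity in
  \<open>m\<close> and \<open>\<kappa>\<close>.\<close>

lemma jet_product_decay:
  fixes a :: "(real ^ 'n::finite) \<times> (real ^ 'n) \<Rightarrow> complex"
  assumes st: "0 < s" "0 < t" and a: "smooth a" and \<sigma>: "0 \<le> \<sigma>" and \<mu>: "0 \<le> \<mu>" and h: "0 < h"
    and ab: "\<And>h. h > 0 \<Longrightarrow> \<exists>C\<ge>0. \<forall>N z. norm (iter_deriv (replicate N e) a z) \<le> C * h ^ N * fact N powr \<sigma> * exp (\<mu> * phase_gauge t s z)"
    and G: "decaying_jet t s \<sigma> e G"
  shows "\<exists>C\<ge>0. \<forall>m \<kappa> N. \<bar>e \<bullet> \<kappa>\<bar> ^ N * norm (LINT p|lborel. a p * G 0 (p - m) * plane_wave \<kappa> p)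
    \<le> C * exp (\<mu> * gauge_const t s * phase_gauge t s m) * h ^ N * fact N powr \<sigma>"
proof -
  \<comment> \<open>\<open>h / 2\<close> for both factors, since the Leibniz sum doubles it.\<close>
  obtain C1 where C1: "C1 \<ge> 0" "\<And>N z. norm (iter_deriv (replicate N e) a z) \<le> C1 * (h / 2) ^ N * fact N powr \<sigma> * exp (\<mu> * phase_gauge t s z)"
    using ab[of "h / 2"] h by auto
  \<comment> \<open>One unit of rate beyond the absorbed growth remains for integrability.\<close>
  define r where "r = \<mu> * gauge_const t s + 1"
  have r: "r > 0" using \<mu> gauge_const_pos[of t s] by (simp add: r_def add_nonneg_pos)
  obtain C2 where C2: "C2 \<ge> 0" "\<And>N z. norm (G N z) \<le> C2 * (h / 2) ^ N * fact N powr \<sigma> * phase_decay t s r z"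
    using G h r unfolding decaying_jet_def by (meson half_gt_zero)
  have Gd: "dir_deriv e (G N) (G (Suc N))" and Gm [measurable]: "G N \<in> borel_measurable borel" for N
    using G by (auto simp: decaying_jet_def)
  define I where "I = (LINT z|lborel. phase_decay t s 1 (z :: (real^'n) \<times> (real^'n)))"
  have int: "integrable lborel (phase_decay t s 1 :: (real^'n) \<times> (real^'n) \<Rightarrow> real)" using st by (intro integrable_phase_decay) auto
  have I: "0 \<le> I" unfolding I_def by (intro integral_nonneg_AE) auto
  show ?thesis
  proof (intro exI[of _ "C1 * C2 * I"] conjI allI)
    show "0 \<le> C1 * C2 * I" using C1 C2 I by simp
    fix m \<kappa> N
    define A where "A = leibniz_sum e (\<lambda>N. iter_deriv (replicate N e) a) (\<lambda>N p. G N (p - m))"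
    define E where "E = exp (\<mu> * gauge_const t s * phase_gauge t s m)"
    have bound: "norm (A N p) \<le> (C1 * C2 * E * h ^ N * fact N powr \<sigma>) * phase_decay t s 1 (p - m)" for N p
    proof -
      have "norm (A N p) \<le> (C1 * exp (\<mu> * phase_gauge t s p)) * (C2 * phase_decay t s r (p - m)) * (2 * (h / 2)) ^ N * fact N powr \<sigma>"
        unfolding A_def
      proof (rule leibniz_sum_bound)
        show "norm (iter_deriv (replicate N e) a p) \<le> C1 * exp (\<mu> * phase_gauge t s p) * (h / 2) ^ N * fact N powr \<sigma>" for N
          using C1(2)[of N p] by (simp only: mult_ac)
        show "norm (G N (p - m)) \<le> C2 * phase_decay t s r (p - m) * (h / 2) ^ N * fact N powr \<sigma>" for N
          using C2(2)[of N "p - m"] by (simp only: mult_ac)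
      qed (use C1(1) C2(1) h \<sigma> in auto)
      also have "\<dots> = (C1 * C2 * h ^ N * fact N powr \<sigma>) * (exp (\<mu> * phase_gauge t s p) * phase_decay t s r (p - m))"
        by (simp add: mult_ac)
      also have "\<dots> \<le> (C1 * C2 * h ^ N * fact N powr \<sigma>) * (E * phase_decay t s 1 (p - m))"
      proof (intro mult_left_mono)
        have "phase_gauge t s p \<le> gauge_const t s * (phase_gauge t s (p - m) + phase_gauge t s m)"
          using phase_gauge_add_le[OF st, of "p - m" m] by simp
        from mult_left_mono[OF this \<mu>]
        have "\<mu> * phase_gauge t s p - r * phase_gauge t s (p - m) \<le> \<mu> * gauge_const t s * phase_gauge t s m - phase_gauge t s (p - m)"
          by (simp add: r_def algebra_simps)
        then show "exp (\<mu> * phase_gauge t s p) * phase_decay t s r (p - m) \<le> E * phase_decay t s 1 (p - m)"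
          by (simp add: E_def phase_decay_phase_gauge flip: exp_add)
      qed (use C1 C2 h in auto)
      finally show ?thesis by (simp add: mult_ac)
    qed
    have i2: "integrable lborel (\<lambda>p. (C1 * C2 * E * h ^ N * fact N powr \<sigma>) * phase_decay t s 1 (p - m))" for N
      using integrable_translate(1)[OF int] by (intro integrable_mult_right)
    have i: "integrable lborel (A N)" for N
    proof (rule Bochner_Integration.integrable_bound[OF i2[of N]])
      show "A N \<in> borel_measurable lborel"
        unfolding A_def by (intro leibniz_sum_measurable) (auto intro!: smooth_measurable smooth_iter_deriv a)
      show "AE p in lborel. norm (A N p) \<le> norm ((C1 * C2 * E * h ^ N * fact N powr \<sigma>) * phase_decay t s 1 (p - m))"
        using bound by (intro AE_I2) (metis abs_ge_self order_trans real_norm_def)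
    qed
    have d: "dir_deriv e (A N) (A (Suc N))" for N
      unfolding A_def using dir_deriv_iter_deriv[OF a, of e "replicate _ e"]
      by (intro dir_deriv_leibniz_sum dir_deriv_translate Gd) simp
    have "\<bar>e \<bullet> \<kappa>\<bar> ^ N * norm (LINT p|lborel. A 0 p * plane_wave \<kappa> p) \<le> (LINT p|lborel. norm (A N p))"
      by (rule fourier_power_decay[of e A, OF d i])
    also have "\<dots> \<le> (LINT p|lborel. (C1 * C2 * E * h ^ N * fact N powr \<sigma>) * phase_decay t s 1 (p - m))"
      using bound by (intro integral_mono integrable_norm i i2)
    also have "\<dots> = C1 * C2 * I * E * h ^ N * fact N powr \<sigma>"
      using integrable_translate(2)[OF int, of m] by (simp add: I_def)
    finally show "\<bar>e \<bullet> \<kappa>\<bar> ^ N * norm (LINT p|lborel. a p * G 0 (p - m) * plane_wave \<kappa> p)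
      \<le> C1 * C2 * I * exp (\<mu> * gauge_const t s * phase_gauge t s m) * h ^ N * fact N powr \<sigma>"
      by (simp add: A_def E_def)
  qed
qed

text \<open>Derivatives in position give decay in \<open>fst \<kappa>\<close> with exponent
  \<open>1 / s\<close>, derivatives in frequency give decay in \<open>snd \<kappa>\<close> with
  exponent \<open>1 / t\<close>; hence the exchanged pair in the gauge.\<close>

lemma symbol_partial_fourier_decay:
  fixes a H :: "(real ^ 'n::finite) \<times> (real ^ 'n) \<Rightarrow> complex"
  assumes st: "0 < s" "0 < t" "1 < s + t" and a: "a \<in> symbol_class t s" and H: "GS_pair t s H"
  shows "\<exists>\<nu>\<ge>0. \<forall>r>0. \<exists>C\<ge>0. \<forall>m \<kappa>. norm (LINT p|lborel. a p * partial_fourier H (p - m) * plane_wave \<kappa> p)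
    \<le> C * exp (\<nu> * phase_gauge t s m) * exp (- (r * phase_gauge t s (snd \<kappa>, fst \<kappa>)))"
proof -
  have sa: "smooth a" using a by (simp add: symbol_class_def)
  obtain \<mu> where \<mu>: "\<mu> > 0" and ab: "\<And>h. h > 0 \<Longrightarrow> \<exists>C>0. \<forall>N z j.
    norm (iter_deriv (replicate N (axis j 1, 0)) a z) \<le> C * h ^ N * fact N powr s * exp (\<mu> * phase_gauge t s z) \<and>
    norm (iter_deriv (replicate N (0, axis j 1)) a z) \<le> C * h ^ N * fact N powr t * exp (\<mu> * phase_gauge t s z)"
    using symbol_bounds[OF a] by blast
  define \<nu> where "\<nu> = \<mu> * gauge_const t s"
  have \<nu>: "\<nu> \<ge> 0" using \<mu> gauge_const_pos[of t s] by (simp add: \<nu>_def)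
  define J where "J = (\<lambda>m \<kappa>. LINT p|lborel. a p * partial_fourier H (p - m) * plane_wave \<kappa> p)"
  have x: "\<exists>C\<ge>0. \<forall>m \<kappa> N. \<bar>fst \<kappa> $ j\<bar> ^ N * norm (J m \<kappa>) \<le> C * exp (\<nu> * phase_gauge t s m) * h ^ N * fact N powr s" if "h > 0" for h j
  proof -
    obtain G where G: "G 0 = partial_fourier H" "decaying_jet t s s (axis j 1, 0) G" using decaying_jet_partial_fourier_x[OF st(1,2) H] by blast
    have "\<exists>C\<ge>0. \<forall>N z. norm (iter_deriv (replicate N (axis j 1, 0)) a z) \<le> C * h ^ N * fact N powr s * exp (\<mu> * phase_gauge t s z)" if "h > 0" for h
      using ab[OF that] by (meson less_imp_le)
    from jet_product_decay[OF st(1,2) sa less_imp_le[OF st(1)] less_imp_le[OF \<mu>] \<open>h > 0\<close> this G(2)]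
    show ?thesis by (simp add: G(1) J_def \<nu>_def inner_prod_def inner_axis')
  qed
  have xi: "\<exists>C\<ge>0. \<forall>m \<kappa> N. \<bar>snd \<kappa> $ j\<bar> ^ N * norm (J m \<kappa>) \<le> C * exp (\<nu> * phase_gauge t s m) * h ^ N * fact N powr t" if "h > 0" for h j
  proof -
    obtain G where G: "G 0 = partial_fourier H" "decaying_jet t s t (0, axis j 1) G" using decaying_jet_partial_fourier_xi[OF st H] by blast
    have "\<exists>C\<ge>0. \<forall>N z. norm (iter_deriv (replicate N (0, axis j 1)) a z) \<le> C * h ^ N * fact N powr t * exp (\<mu> * phase_gauge t s z)" if "h > 0" for h
      using ab[OF that] by (meson less_imp_le)
    from jet_product_decay[OF st(1,2) sa less_imp_le[OF st(2)] less_imp_le[OF \<mu>] \<open>h > 0\<close> this G(2)]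
    show ?thesis by (simp add: G(1) J_def \<nu>_def inner_prod_def inner_axis')
  qed
  \<comment> \<open>\<open>P\<close> stands for either component of \<open>\<kappa>\<close>. Adding
    the constants over the coordinates gives one constant for all axes, as the passage from powers
    to exponentials requires.\<close>
  have exp_decay: "\<exists>C\<ge>0. \<forall>m \<kappa>. norm (J m \<kappa>) \<le> C * exp (\<nu> * phase_gauge t s m) * exp (- (r * norm (P \<kappa>) powr (1 / \<sigma>)))"
    if \<sigma>: "\<sigma> > 0" and r: "r > 0" and dec: "\<And>h j. h > 0 \<Longrightarrow> \<exists>C\<ge>0. \<forall>m \<kappa> N. \<bar>P \<kappa> $ j\<bar> ^ N * norm (J m \<kappa>) \<le> C * exp (\<nu> * phase_gauge t s m) * h ^ N * fact N powr \<sigma>"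
    for \<sigma> r and P :: "(real^'n) \<times> (real^'n) \<Rightarrow> real^'n"
  proof -
    obtain h where h: "h > 0" and d: "\<And>(x::real^'n) X B. 0 \<le> X \<Longrightarrow> 0 \<le> B \<Longrightarrow>
      (\<And>k M. \<bar>x $ k\<bar> ^ M * X \<le> B * h ^ M * fact M powr \<sigma>) \<Longrightarrow> X \<le> 2 powr \<sigma> * B * exp (- (r * norm x powr (1 / \<sigma>)))"
      using ex_power_bounds_imp_exp[OF \<sigma> r] by blast
    have "\<forall>j. \<exists>C\<ge>0. \<forall>m \<kappa> N. \<bar>P \<kappa> $ j\<bar> ^ N * norm (J m \<kappa>) \<le> C * exp (\<nu> * phase_gauge t s m) * h ^ N * fact N powr \<sigma>"
      using dec[OF h] by blast
    from choice[OF this] obtain C where C: "\<forall>j. C j \<ge> 0 \<and> (\<forall>m \<kappa> N. \<bar>P \<kappa> $ j\<bar> ^ N * norm (J m \<kappa>) \<le> C j * exp (\<nu> * phase_gauge t s m) * h ^ N * fact N powr \<sigma>)" ..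
    define C' where "C' = (\<Sum>j\<in>UNIV. C j)"
    have C': "C j \<le> C'" for j unfolding C'_def using C by (intro member_le_sum) auto
    have C'0: "C' \<ge> 0" unfolding C'_def using C by (intro sum_nonneg) auto
    have "norm (J m \<kappa>) \<le> 2 powr \<sigma> * (C' * exp (\<nu> * phase_gauge t s m)) * exp (- (r * norm (P \<kappa>) powr (1 / \<sigma>)))" for m \<kappa>
    proof (rule d)
      fix k M
      have "\<bar>P \<kappa> $ k\<bar> ^ M * norm (J m \<kappa>) \<le> C k * exp (\<nu> * phase_gauge t s m) * h ^ M * fact M powr \<sigma>" using C by blast
      also have "\<dots> \<le> C' * exp (\<nu> * phase_gauge t s m) * h ^ M * fact M powr \<sigma>"
        using h C' by (intro mult_right_mono) auto
      finally show "\<bar>P \<kappa> $ k\<bar> ^ M * norm (J m \<kappa>) \<le> C' * exp (\<nu> * phase_gauge t s m) * h ^ M * fact M powr \<sigma>" .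
    qed (use C'0 in auto)
    then show ?thesis using C'0 by (intro exI[of _ "2 powr \<sigma> * C'"]) (auto simp: mult_ac)
  qed
  have "\<exists>C\<ge>0. \<forall>m \<kappa>. norm (J m \<kappa>) \<le> C * exp (\<nu> * phase_gauge t s m) * exp (- (r * phase_gauge t s (snd \<kappa>, fst \<kappa>)))" if r: "r > 0" for r
  proof -
    \<comment> \<open>The larger of the two terms of the gauge, taken at the rate
      \<open>2 * r\<close>, dominates their sum at the rate \<open>r\<close>.\<close>
    have r2: "2 * r > 0" using r by simp
    obtain C1 where C1: "C1 \<ge> 0" "\<And>m \<kappa>. norm (J m \<kappa>) \<le> C1 * exp (\<nu> * phase_gauge t s m) * exp (- (2 * r * norm (snd \<kappa>) powr (1 / t)))"
      using exp_decay[OF st(2) r2, of snd] xi by blast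
    obtain C2 where C2: "C2 \<ge> 0" "\<And>m \<kappa>. norm (J m \<kappa>) \<le> C2 * exp (\<nu> * phase_gauge t s m) * exp (- (2 * r * norm (fst \<kappa>) powr (1 / s)))"
      using exp_decay[OF st(1) r2, of fst] x by blast
    have "norm (J m \<kappa>) \<le> (C1 + C2) * exp (\<nu> * phase_gauge t s m) * exp (- (r * phase_gauge t s (snd \<kappa>, fst \<kappa>)))" for m \<kappa>
    proof -
      let ?\<alpha> = "norm (snd \<kappa>) powr (1 / t)" and ?\<beta> = "norm (fst \<kappa>) powr (1 / s)"
      have q: "r * phase_gauge t s (snd \<kappa>, fst \<kappa>) = r * ?\<alpha> + r * ?\<beta>" by (simp add: phase_gauge_def algebra_simps)
      show ?thesis
      proof (cases "?\<alpha> \<ge> ?\<beta>")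
        case True
        then have "exp (- (2 * r * ?\<alpha>)) \<le> exp (- (r * phase_gauge t s (snd \<kappa>, fst \<kappa>)))"
          using mult_left_mono[OF True less_imp_le[OF r]] unfolding q by simp
        then have "C1 * exp (\<nu> * phase_gauge t s m) * exp (- (2 * r * ?\<alpha>)) \<le> (C1 + C2) * exp (\<nu> * phase_gauge t s m) * exp (- (r * phase_gauge t s (snd \<kappa>, fst \<kappa>)))"
          using C1 C2 by (intro mult_mono) auto
        then show ?thesis using C1(2)[of m \<kappa>] by linarith
      next
        case False
        then have "exp (- (2 * r * ?\<beta>)) \<le> exp (- (r * phase_gauge t s (snd \<kappa>, fst \<kappa>)))"
          using mult_left_mono[of ?\<alpha> ?\<beta> r] r unfolding q by simp
        then have "C2 * exp (\<nu> * phase_gauge t s m) * exp (- (2 * r * ?\<beta>)) \<le> (C1 + C2) * exp (\<nu> * phase_gauge t s m) * exp (- (r * phase_gauge t s (snd \<kappa>, fst \<kappa>)))"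
          using C1 C2 by (intro mult_mono) auto
        then show ?thesis using C2(2)[of m \<kappa>] by linarith
      qed
    qed
    then show ?thesis using C1 C2 by (intro exI[of _ "C1 + C2"]) auto
  qed
  then show ?thesis using \<nu> unfolding J_def by blast
qed

section \<open>Covariance of the Wigner distribution and the kernel estimate\<close>

definition tf_shift :: "(real ^ 'n::finite \<Rightarrow> complex) \<Rightarrow> (real ^ 'n) \<times> (real ^ 'n) \<Rightarrow> real ^ 'n \<Rightarrow> complex" where
  "tf_shift \<psi> w = modulation (snd w) (translation (fst w) \<psi>)"

lemma tf_shift_apply: "tf_shift \<psi> w y = plane_wave (snd w) y * \<psi> (y - fst w)"
  by (simp add: tf_shift_def modulation_def translation_def plane_wave_def)

lemma Wigner_eq_partial_fourier: "Wigner g f = partial_fourier (\<lambda>z. g (fst z + (1 / 2) *\<^sub>R snd z) * cnj (f (fst z - (1 / 2) *\<^sub>R snd z)))"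
  by (simp add: fun_eq_iff Wigner_def partial_fourier_def plane_wave_def)

lemma GS_pair_Wigner:
  assumes st: "0 < s" "0 < t" and g: "g \<in> GS t s" and f: "f \<in> GS t s"
  shows "GS_pair t s (\<lambda>z. g (fst z + (1 / 2) *\<^sub>R snd z) * cnj (f (fst z - (1 / 2) *\<^sub>R snd z)))"
proof (rule GS_pair_product[OF st g f])
  show "bounded_linear (\<lambda>z::(real^'a) \<times> (real^'a). fst z + (1 / 2) *\<^sub>R snd z)" "bounded_linear (\<lambda>z::(real^'a) \<times> (real^'a). fst z - (1 / 2) *\<^sub>R snd z)"
    by (intro bounded_linear_intros)+
  fix z :: "(real^'a) \<times> (real^'a)"
  have n: "norm (fst z) \<le> norm z" "norm (snd z) \<le> norm z"
    using norm_fst_le[of "fst z" "snd z"] norm_snd_le[of "snd z" "fst z"] by simp_all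
  have n: "norm (fst z) \<le> norm z" "norm (snd z) / 2 \<le> norm z"
    using n norm_ge_zero[of "snd z"] by linarith+
  show "norm (fst z + (1 / 2) *\<^sub>R snd z) \<le> 2 * norm z"
    using norm_triangle_ineq[of "fst z" "(1 / 2) *\<^sub>R snd z"] n by (simp; linarith)
  show "norm (fst z - (1 / 2) *\<^sub>R snd z) \<le> 2 * norm z"
    using norm_triangle_ineq4[of "fst z" "(1 / 2) *\<^sub>R snd z"] n by (simp; linarith)
  have "2 *\<^sub>R fst z = (fst z + (1 / 2) *\<^sub>R snd z) + (fst z - (1 / 2) *\<^sub>R snd z)"
    by (simp add: scaleR_2)
  then have "2 * norm (fst z) \<le> norm (fst z + (1 / 2) *\<^sub>R snd z) + norm (fst z - (1 / 2) *\<^sub>R snd z)"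
    using norm_triangle_ineq[of "fst z + (1 / 2) *\<^sub>R snd z" "fst z - (1 / 2) *\<^sub>R snd z"]
    by (metis abs_numeral norm_scaleR)
  then show "norm (fst z) \<le> norm (fst z + (1 / 2) *\<^sub>R snd z) + norm (fst z - (1 / 2) *\<^sub>R snd z)"
    using norm_ge_zero[of "fst z"] by linarith
  have "snd z = (fst z + (1 / 2) *\<^sub>R snd z) - (fst z - (1 / 2) *\<^sub>R snd z)"
    by (simp flip: scaleR_left_distrib)
  then show "norm (snd z) \<le> norm (fst z + (1 / 2) *\<^sub>R snd z) + norm (fst z - (1 / 2) *\<^sub>R snd z)"
    using norm_triangle_ineq4[of "fst z + (1 / 2) *\<^sub>R snd z" "fst z - (1 / 2) *\<^sub>R snd z"] by simp
qed

lemma borel_measurable_cnj_fun [measurable]: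
  "f \<in> borel_measurable M \<Longrightarrow> (\<lambda>x. cnj (f x)) \<in> borel_measurable M"
  by (rule measurable_compose[OF _ borel_measurable_continuous_onI]) (auto intro: continuous_intros)

lemma borel_measurable_plane_wave_right [measurable]: "plane_wave (\<xi> :: 'a::euclidean_space) \<in> borel_measurable borel"
  by (intro borel_measurable_plane_wave) auto

text \<open>Substituting \<open>y + d\<close> for \<open>y\<close> recentres both windows at the
  first component of \<open>p\<close> minus the midpoint of \<open>z\<close> and \<open>w\<close>.
  The remaining exponentials collect into a constant phase, a plane wave in \<open>p\<close>, and
  the shift of the frequency in the kernel.\<close>

lemma Wigner_tf_shift:
  assumes \<psi>: "\<psi> \<in> borel_measurable borel"
  shows "Wigner (tf_shift \<psi> w) (tf_shift \<psi> z) p = plane_wave ((1 / 2) *\<^sub>R (snd z + snd w)) (fst w - fst z) *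
    (plane_wave (snd w - snd z, - (fst w - fst z)) p * Wigner \<psi> \<psi> (p - (1 / 2) *\<^sub>R (z + w)))"
proof -
  obtain x \<eta> where p: "p = (x, \<eta>)" by (cases p)
  define d where "d = fst w - fst z"
  define m where "m = (1 / 2) *\<^sub>R (fst z + fst w)"
  note [measurable] = \<psi>
  let ?F = "\<lambda>y. tf_shift \<psi> w (x + (1 / 2) *\<^sub>R y) * cnj (tf_shift \<psi> z (x - (1 / 2) *\<^sub>R y)) * plane_wave (- \<eta>) y"
  let ?c = "plane_wave ((1 / 2) *\<^sub>R (snd z + snd w)) d * plane_wave (snd w - snd z, - d) p"
  have F: "?F \<in> borel_measurable borel"
    unfolding tf_shift_apply by measurable
  have eq: "?F (y + d) = ?c * (\<psi> (x - m + (1 / 2) *\<^sub>R y) * cnj (\<psi> (x - m - (1 / 2) *\<^sub>R y)) * plane_wave (- (\<eta> - (1 / 2) *\<^sub>R (snd z + snd w))) y)" for y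
  proof -
    have half: "(1 / 2) *\<^sub>R v + (1 / 2) *\<^sub>R v = v" for v :: "real^'a"
      by (simp flip: scaleR_left_distrib)
    have a1: "x + (1 / 2) *\<^sub>R (y + d) - fst w = x - m + (1 / 2) *\<^sub>R y"
      using half[of "fst w"] by (simp add: d_def m_def algebra_simps)
    have a2: "x - (1 / 2) *\<^sub>R (y + d) - fst z = x - m - (1 / 2) *\<^sub>R y"
      using half[of "fst z"] by (simp add: d_def m_def algebra_simps)
    \<comment> \<open>Compared in the exponent, this is an identity between sums of inner
      products.\<close>
    have ph: "plane_wave (snd w) (x + (1 / 2) *\<^sub>R (y + d)) * cnj (plane_wave (snd z) (x - (1 / 2) *\<^sub>R (y + d))) * plane_wave (- \<eta>) (y + d)
      = ?c * plane_wave (- (\<eta> - (1 / 2) *\<^sub>R (snd z + snd w))) y"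
      unfolding plane_wave_minus(2)[symmetric] unfolding plane_wave_def p exp_add[symmetric]
      by (rule arg_cong[where f = exp], simp only: distrib_left[symmetric] of_real_add[symmetric], rule arg_cong[where f = "\<lambda>r. \<i> * of_real r"])
        (simp add: inner_add_left inner_add_right inner_diff_left inner_diff_right inner_prod_def algebra_simps inner_commute)
    show ?thesis
      unfolding tf_shift_apply a1 a2 complex_cnj_mult
      using ph by (simp add: mult_ac)
  qed
  have "Wigner (tf_shift \<psi> w) (tf_shift \<psi> z) p = (LINT y|lborel. ?F y)"
    by (simp add: Wigner_eq_partial_fourier partial_fourier_def p)
  also have "\<dots> = (LINT y|lborel. ?F (y + d))"
    by (rule lborel_integral_translate[OF F, symmetric])
  also have "\<dots> = ?c * (LINT y|lborel. \<psi> (x - m + (1 / 2) *\<^sub>R y) * cnj (\<psi> (x - m - (1 / 2) *\<^sub>R y)) * plane_wave (- (\<eta> - (1 / 2) *\<^sub>R (snd z + snd w))) y)"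
    unfolding eq by (rule integral_mult_right_zero)
  also have "(LINT y|lborel. \<psi> (x - m + (1 / 2) *\<^sub>R y) * cnj (\<psi> (x - m - (1 / 2) *\<^sub>R y)) * plane_wave (- (\<eta> - (1 / 2) *\<^sub>R (snd z + snd w))) y)
      = Wigner \<psi> \<psi> (p - (1 / 2) *\<^sub>R (z + w))"
    by (simp add: Wigner_eq_partial_fourier partial_fourier_def p m_def)
  finally show ?thesis by (simp add: d_def mult.assoc)
qed

text \<open>By covariance the modulus is that of an integral as in
  \<open>symbol_partial_fourier_decay\<close>, with \<open>m\<close> the midpoint and with
  \<open>(snd \<kappa>, fst \<kappa>)\<close> equal to \<open>w - z\<close> up to signs. The growth
  at the midpoint is charged to \<open>z\<close> and to \<open>w - z\<close>.\<close>

lemma Weyl_kernel_bound: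
  fixes a :: "(real ^ 'n::finite) \<times> (real ^ 'n) \<Rightarrow> complex"
  assumes st: "0 < s" "0 < t" "1 < s + t" and a: "a \<in> symbol_class t s" and \<psi>: "\<psi> \<in> GS t s"
  shows "\<exists>\<nu>\<ge>0. \<forall>r>0. \<exists>C\<ge>0. \<forall>z w. norm (L2_pairing (\<lambda>p. cnj (a p)) (Wigner (tf_shift \<psi> w) (tf_shift \<psi> z)))
    \<le> C * exp (\<nu> * phase_gauge t s z) * exp (- (r * phase_gauge t s (w - z)))"
proof -
  obtain \<nu> where \<nu>: "\<nu> \<ge> 0" and J: "\<And>r. r > 0 \<Longrightarrow> \<exists>C\<ge>0. \<forall>m \<kappa>. norm (LINT p|lborel. a p * Wigner \<psi> \<psi> (p - m) * plane_wave \<kappa> p)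
    \<le> C * exp (\<nu> * phase_gauge t s m) * exp (- (r * phase_gauge t s (snd \<kappa>, fst \<kappa>)))"
    using symbol_partial_fourier_decay[OF st a GS_pair_Wigner[OF st(1,2) \<psi> \<psi>]] unfolding Wigner_eq_partial_fourier[symmetric] by blast
  have \<psi>m: "\<psi> \<in> borel_measurable borel" using \<psi> GS_smooth smooth_measurable by blast
  show ?thesis
  proof (rule exI[of _ "\<nu> * gauge_const t s"], intro conjI allI impI)
    show "0 \<le> \<nu> * gauge_const t s" using \<nu> gauge_const_pos[of t s] by simp
    fix r :: real assume r: "r > 0"
    \<comment> \<open>The additional \<open>\<nu> * gauge_const t s\<close> pays for moving the
      growth from the midpoint to \<open>z\<close>.\<close>
    have r': "r + \<nu> * gauge_const t s > 0" using r \<nu> gauge_const_pos[of t s] by (simp add: add_pos_nonneg)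
    obtain C where C: "C \<ge> 0" and Cb: "\<And>m \<kappa>. norm (LINT p|lborel. a p * Wigner \<psi> \<psi> (p - m) * plane_wave \<kappa> p)
      \<le> C * exp (\<nu> * phase_gauge t s m) * exp (- ((r + \<nu> * gauge_const t s) * phase_gauge t s (snd \<kappa>, fst \<kappa>)))"
      using J[OF r'] by blast
    have "norm (L2_pairing (\<lambda>p. cnj (a p)) (Wigner (tf_shift \<psi> w) (tf_shift \<psi> z)))
      \<le> C * exp (\<nu> * gauge_const t s * phase_gauge t s z) * exp (- (r * phase_gauge t s (w - z)))" for z w
    proof -
      define m where "m = (1 / 2) *\<^sub>R (z + w)"
      define \<kappa> where "\<kappa> = (snd w - snd z, - (fst w - fst z))"
      define c where "c = plane_wave ((1 / 2) *\<^sub>R (snd z + snd w)) (fst w - fst z)"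
      have "L2_pairing (\<lambda>p. cnj (a p)) (Wigner (tf_shift \<psi> w) (tf_shift \<psi> z)) = cnj (LINT p|lborel. a p * Wigner (tf_shift \<psi> w) (tf_shift \<psi> z) p)"
        unfolding L2_pairing_def complex_cnj_mult[symmetric] by (rule Bochner_Integration.integral_cnj)
      also have "(LINT p|lborel. a p * Wigner (tf_shift \<psi> w) (tf_shift \<psi> z) p) = (LINT p|lborel. c * (a p * Wigner \<psi> \<psi> (p - m) * plane_wave \<kappa> p))"
        by (simp add: Wigner_tf_shift[OF \<psi>m] m_def \<kappa>_def c_def mult_ac)
      also have "\<dots> = c * (LINT p|lborel. a p * Wigner \<psi> \<psi> (p - m) * plane_wave \<kappa> p)"
        by (rule integral_mult_right_zero)
      finally have "norm (L2_pairing (\<lambda>p. cnj (a p)) (Wigner (tf_shift \<psi> w) (tf_shift \<psi> z))) = norm (LINT p|lborel. a p * Wigner \<psi> \<psi> (p - m) * plane_wave \<kappa> p)"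
        by (simp add: norm_mult c_def)
      also have "\<dots> \<le> C * exp (\<nu> * phase_gauge t s m) * exp (- ((r + \<nu> * gauge_const t s) * phase_gauge t s (snd \<kappa>, fst \<kappa>)))"
        by (rule Cb)
      also have "phase_gauge t s (snd \<kappa>, fst \<kappa>) = phase_gauge t s (w - z)"
        by (simp add: \<kappa>_def phase_gauge_def norm_minus_commute)
      also have "C * exp (\<nu> * phase_gauge t s m) * exp (- ((r + \<nu> * gauge_const t s) * phase_gauge t s (w - z))) \<le> C * exp (\<nu> * gauge_const t s * phase_gauge t s z) * exp (- (r * phase_gauge t s (w - z)))"
      proof -
        have "m = z + (1 / 2) *\<^sub>R (w - z)"
        proof -
          have "z = (1 / 2) *\<^sub>R z + (1 / 2) *\<^sub>R z" by (simp flip: scaleR_left_distrib)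
          then show ?thesis by (simp add: m_def algebra_simps)
        qed
        then have "phase_gauge t s m \<le> gauge_const t s * (phase_gauge t s z + phase_gauge t s ((1 / 2) *\<^sub>R (w - z)))"
          using phase_gauge_add_le[OF st(1,2)] by simp
        also have "phase_gauge t s ((1 / 2) *\<^sub>R (w - z)) \<le> phase_gauge t s (w - z)"
          unfolding phase_gauge_def using st by (intro add_mono powr_mono2) auto
        finally have "phase_gauge t s m \<le> gauge_const t s * (phase_gauge t s z + phase_gauge t s (w - z))"
          using gauge_const_pos[of t s] by simp
        from mult_left_mono[OF this \<nu>]
        have "\<nu> * phase_gauge t s m + - ((r + \<nu> * gauge_const t s) * phase_gauge t s (w - z)) \<le> \<nu> * gauge_const t s * phase_gauge t s z + - (r * phase_gauge t s (w - z))"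
          by (simp add: algebra_simps)
        then show ?thesis using C by (simp add: mult.assoc mult_left_mono flip: exp_add)
      qed
      finally show ?thesis .
    qed
    then show "\<exists>C\<ge>0. \<forall>z w. norm (L2_pairing (\<lambda>p. cnj (a p)) (Wigner (tf_shift \<psi> w) (tf_shift \<psi> z)))
      \<le> C * exp (\<nu> * gauge_const t s * phase_gauge t s z) * exp (- (r * phase_gauge t s (w - z)))"
      using C by blast
  qed
qed

section \<open>Time-frequency shifts\<close>

definition plane_wave_jet :: "nat \<Rightarrow> real \<Rightarrow> complex" where
  "plane_wave_jet k \<tau> = \<i> ^ k * exp (\<i> * of_real \<tau>)"

lemma plane_wave_jet_deriv: "(plane_wave_jet k has_vector_derivative plane_wave_jet (Suc k) \<tau>) (at \<tau>)"
proof -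
  have "((\<lambda>\<tau>. \<i> * of_real \<tau>) has_vector_derivative \<i> * of_real 1) (at \<tau>)"
    by (intro has_vector_derivative_mult_right has_vector_derivative_of_real) (auto intro!: derivative_eq_intros)
  from field_vector_diff_chain_at[OF this, of exp] have "((\<lambda>\<tau>. exp (\<i> * of_real \<tau>)) has_vector_derivative \<i> * exp (\<i> * of_real \<tau>)) (at \<tau>)"
    by (simp add: comp_def DERIV_exp)
  from has_vector_derivative_mult_right[OF this, of "\<i> ^ k"] show ?thesis
    by (simp add: plane_wave_jet_def[abs_def] mult_ac)
qed

lemma plane_wave_eq_jet: "plane_wave \<xi> = (\<lambda>y. plane_wave_jet 0 (y \<bullet> \<xi>))"
  by (simp add: plane_wave_def plane_wave_jet_def fun_eq_iff)

lemma
  shows smooth_plane_wave: "smooth (plane_wave \<xi>)"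
    and norm_iter_deriv_plane_wave_le: "(\<And>v. v \<in> set vs \<Longrightarrow> norm v \<le> 1) \<Longrightarrow> norm (iter_deriv vs (plane_wave \<xi>) y) \<le> norm \<xi> ^ length vs"
proof -
  have l: "bounded_linear (\<lambda>y. y \<bullet> \<xi>)" by (rule bounded_linear_inner_left)
  show "smooth (plane_wave \<xi>)"
    unfolding plane_wave_eq_jet by (rule smooth_ridge[where \<phi> = plane_wave_jet, OF l plane_wave_jet_deriv])
  assume vs: "\<And>v. v \<in> set vs \<Longrightarrow> norm v \<le> 1"
  have "norm (iter_deriv vs (plane_wave \<xi>) y) = \<bar>\<Prod>v\<leftarrow>vs. v \<bullet> \<xi>\<bar>"
    unfolding plane_wave_eq_jet iter_deriv_ridge[where \<phi> = plane_wave_jet, OF l plane_wave_jet_deriv]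
    by (simp add: norm_mult plane_wave_jet_def norm_power)
  also have "\<dots> \<le> norm \<xi> ^ length vs"
    using vs
  proof (induction vs)
    case (Cons v vs)
    have "\<bar>v \<bullet> \<xi>\<bar> \<le> norm v * norm \<xi>" by (rule Cauchy_Schwarz_ineq2)
    also have "\<dots> \<le> norm \<xi>" using Cons.prems[of v] by (intro mult_left_le_one_le) auto
    finally show ?case using Cons by (auto simp: abs_mult intro!: mult_mono)
  qed simp
  finally show "norm (iter_deriv vs (plane_wave \<xi>) y) \<le> norm \<xi> ^ length vs" .
qed

text \<open>Each derivative costs a factor \<open>norm \<xi>\<close>, and
  \<open>power_le_exp_powr\<close> trades these powers for a bound with arbitrary \<open>h\<close>,
  at the price of exponential growth in the frequency.\<close>

lemma gevrey_plane_wave: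
  assumes "0 < s" "0 < h"
  shows "gevrey s h (\<lambda>y. exp (s * (norm \<xi> / h) powr (1 / s))) (plane_wave \<xi>)"
proof (rule gevreyI)
  fix vs :: "'a list" and y assume vs: "\<And>v. v \<in> set vs \<Longrightarrow> norm v \<le> 1"
  have "norm (iter_deriv vs (plane_wave \<xi>) y) \<le> norm \<xi> ^ length vs" by (rule norm_iter_deriv_plane_wave_le[OF vs])
  also have "\<dots> \<le> h ^ length vs * fact (length vs) powr s * exp (s * (norm \<xi> / h) powr (1 / s))"
    using assms by (intro power_le_exp_powr) auto
  finally show "norm (iter_deriv vs (plane_wave \<xi>) y) \<le> exp (s * (norm \<xi> / h) powr (1 / s)) * h ^ length vs * fact (length vs) powr s"
    by (simp add: mult_ac)
qed

lemma norm_plane_wave_diff_le: "norm (plane_wave \<zeta> y - 1) \<le> norm \<zeta> * norm y"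
proof -
  have "norm (plane_wave \<zeta> y - plane_wave \<zeta> 0) \<le> norm \<zeta> * norm (y - 0)"
  proof (rule differentiable_bound[OF convex_UNIV])
    show "(plane_wave \<zeta> has_derivative (\<lambda>v. iter_deriv [v] (plane_wave \<zeta>) x)) (at x within UNIV)" for x
      using iter_deriv_has_derivative[OF smooth_plane_wave, of "[]" \<zeta> x] by simp
    show "onorm (\<lambda>v. iter_deriv [v] (plane_wave \<zeta>) x) \<le> norm \<zeta>" for x
    proof (rule onorm_bound)
      fix v
      have "norm (iter_deriv [v] (plane_wave \<zeta>) x) \<le> norm \<zeta> * norm v"
        unfolding plane_wave_eq_jet iter_deriv_ridge[where \<phi> = plane_wave_jet, OF bounded_linear_inner_left plane_wave_jet_deriv]
        using Cauchy_Schwarz_ineq2[of v \<zeta>] by (simp add: norm_mult plane_wave_jet_def mult.commute)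
      then show "norm (iter_deriv [v] (plane_wave \<zeta>) x) \<le> norm \<zeta> * norm v" .
    qed simp
  qed auto
  then show ?thesis by simp
qed

text \<open>The function itself is estimated by the mean value inequality, which brings the
  unbounded factor \<open>norm y\<close>. In its derivatives the constant 1 drops out, and
  \<open>norm \<zeta> \<le> 1\<close> allows one factor \<open>norm \<zeta>\<close> to be kept and
  the others to be discarded.\<close>

lemma gevrey_plane_wave_diff:
  assumes s: "0 < s" and h: "0 < h" and "norm \<zeta> \<le> 1"
  shows "gevrey s h (\<lambda>y. norm \<zeta> * (norm y + exp (s * (1 / h) powr (1 / s)))) (\<lambda>y. plane_wave \<zeta> y - 1)"
proof (rule gevreyI)
  fix vs :: "'a list" and y assume vs: "\<And>v. v \<in> set vs \<Longrightarrow> norm v \<le> 1"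
  let ?K = "exp (s * (1 / h) powr (1 / s))"
  show "norm (iter_deriv vs (\<lambda>y. plane_wave \<zeta> y - 1) y) \<le> norm \<zeta> * (norm y + ?K) * h ^ length vs * fact (length vs) powr s"
  proof (cases vs)
    case Nil
    have "norm (plane_wave \<zeta> y - 1) \<le> norm \<zeta> * norm y" by (rule norm_plane_wave_diff_le)
    also have "\<dots> \<le> norm \<zeta> * (norm y + ?K)" by (intro mult_left_mono) auto
    finally show ?thesis by (simp add: Nil)
  next
    case (Cons v us)
    have "iter_deriv vs (\<lambda>y. plane_wave \<zeta> y - plane_wave 0 y) y = iter_deriv vs (plane_wave \<zeta>) y - iter_deriv vs (plane_wave 0) y"
      by (simp only: iter_deriv_diff[OF smooth_plane_wave smooth_plane_wave])
    moreover have "norm (iter_deriv vs (plane_wave (0::'a)) y) \<le> norm (0::'a) ^ length vs"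
      by (rule norm_iter_deriv_plane_wave_le[OF vs])
    ultimately have "norm (iter_deriv vs (\<lambda>y. plane_wave \<zeta> y - 1) y) = norm (iter_deriv vs (plane_wave \<zeta>) y)"
      by (simp add: Cons)
    also have "\<dots> \<le> norm \<zeta> ^ length vs" by (rule norm_iter_deriv_plane_wave_le[OF vs])
    also have "\<dots> \<le> norm \<zeta> * 1 ^ length us"
      using mult_left_le[OF power_le_one[OF norm_ge_zero assms(3)] norm_ge_zero[of \<zeta>], of "length us"] by (simp add: Cons)
    also have "\<dots> \<le> norm \<zeta> * (?K * h ^ length vs * fact (length vs) powr s)"
    proof -
      have "1 ^ length vs \<le> h ^ length vs * fact (length vs) powr s * exp (s * (1 / h) powr (1 / s))"
        using s h by (intro power_le_exp_powr) auto
      then show ?thesis by (intro mult_left_mono) (auto simp: mult_ac)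
    qed
    also have "\<dots> = (norm \<zeta> * ?K) * (h ^ length vs * fact (length vs) powr s)" by (simp add: mult_ac)
    also have "\<dots> \<le> (norm \<zeta> * (norm y + ?K)) * (h ^ length vs * fact (length vs) powr s)"
      using h by (intro mult_right_mono mult_left_mono) auto
    finally show ?thesis by (simp add: mult.assoc)
  qed
qed

lemma decay_shift:
  assumes "0 < p" "0 \<le> r"
  shows "decay p (2 powr p * r) (y - x) \<le> exp (2 powr p * r * norm x powr p) * decay p r y"
proof -
  have "decay p (2 powr p * r) (y - x) * decay p (2 powr p * r) x \<le> decay p r y"
    using assms norm_triangle_ineq[of "y - x" x] by (intro decay_mult_le) auto
  then show ?thesis by (simp add: decay_def exp_minus field_simps)
qed

context
  fixes s t :: real and f :: "real ^ 'n::finite \<Rightarrow> complex"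
  assumes st: "0 < s" "0 < t" and f: "f \<in> GS t s"
begin

lemma smooth_translate: "smooth (\<lambda>y. f (y - x))"
  using smooth_affine_comp[OF bounded_linear_ident GS_smooth[OF f], of "- x"] by simp

lemma iter_deriv_translate: "iter_deriv vs (\<lambda>y. f (y - x)) y = iter_deriv vs f (y - x)"
  using iter_deriv_affine_comp[OF bounded_linear_ident GS_smooth[OF f], of vs "- x"] by simp

lemma gevrey_translate:
  assumes hr: "0 < h" "0 < r"
  shows "\<exists>C\<ge>0. \<forall>x. gevrey s h (\<lambda>y. C * exp (2 powr (1 / t) * r * norm x powr (1 / t)) * decay (1 / t) r y) (\<lambda>y. f (y - x))"
proof -
  have "2 powr (1 / t) * r > 0" using hr by simp
  from GS_imp_gevrey[OF st f hr(1) this] obtain C where C: "C \<ge> 0" "gevrey s h (\<lambda>y. C * decay (1 / t) (2 powr (1 / t) * r) y) f"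
    by blast
  have "gevrey s h (\<lambda>y. C * exp (2 powr (1 / t) * r * norm x powr (1 / t)) * decay (1 / t) r y) (\<lambda>y. f (y - x))" for x
  proof (rule gevreyI)
    fix vs :: "(real^'n) list" and y :: "real^'n" assume vs: "\<And>v. v \<in> set vs \<Longrightarrow> norm v \<le> 1"
    have "norm (iter_deriv vs f (y - x)) \<le> C * decay (1 / t) (2 powr (1 / t) * r) (y - x) * h ^ length vs * fact (length vs) powr s"
      by (rule gevreyD[OF C(2) vs])
    also have "\<dots> \<le> C * (exp (2 powr (1 / t) * r * norm x powr (1 / t)) * decay (1 / t) r y) * h ^ length vs * fact (length vs) powr s"
      using C(1) hr st by (intro mult_right_mono mult_left_mono decay_shift) auto
    finally show "norm (iter_deriv vs (\<lambda>y. f (y - x)) y) \<le> C * exp (2 powr (1 / t) * r * norm x powr (1 / t)) * decay (1 / t) r y * h ^ length vs * fact (length vs) powr s"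
      by (simp add: iter_deriv_translate mult.assoc)
  qed
  then show ?thesis using C(1) by blast
qed

text \<open>The mean value inequality along the segment between the two translated points brings one
  more derivative; its cost and the shift of the weight are absorbed in the constant, leaving a
  factor \<open>norm (x' - x)\<close>.\<close>

lemma gevrey_translate_diff:
  assumes hr: "0 < h" "0 < r"
  shows "\<exists>C\<ge>0. \<forall>x'. norm (x' - x) \<le> 1 \<longrightarrow> gevrey s h (\<lambda>y. norm (x' - x) * C * decay (1 / t) r y) (\<lambda>y. f (y - x) - f (y - x'))"
proof -
  \<comment> \<open>Compensates for the powers of \<open>2 powr s\<close> with which the factorial
    of \<open>m + 1\<close> is reduced to that of \<open>m\<close>.\<close>
  define h1 where "h1 = h / 2 powr s"
  have h1: "h1 > 0" using hr by (simp add: h1_def)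
  have "2 powr (1 / t) * r > 0" using hr by simp
  from GS_imp_gevrey[OF st f h1 this] obtain C where C: "C \<ge> 0" "gevrey s h1 (\<lambda>y. C * decay (1 / t) (2 powr (1 / t) * r) y) f"
    by blast
  have sm: "smooth f" using f GS_smooth by blast
  \<comment> \<open>Serves all points of the segment: they are translates of \<open>y\<close> by
    vectors of norm at most \<open>norm x + 1\<close>.\<close>
  define E where "E = exp (2 powr (1 / t) * r * (norm x + 1) powr (1 / t))"
  have "gevrey s h (\<lambda>y. norm (x' - x) * (C * E * h) * decay (1 / t) r y) (\<lambda>y. f (y - x) - f (y - x'))" if x': "norm (x' - x) \<le> 1" for x'
  proof (rule gevreyI)
    fix vs :: "(real^'n) list" and y :: "real^'n" assume vs: "\<And>v. v \<in> set vs \<Longrightarrow> norm v \<le> 1"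
    let ?m = "length vs"
    define B where "B = C * E * h * decay (1 / t) r y * h ^ ?m * fact ?m powr s"
    have B0: "0 \<le> B" using C(1) hr by (simp add: B_def E_def)
    have "norm (iter_deriv vs f (y - x) - iter_deriv vs f (y - x')) \<le> B * norm ((y - x) - (y - x'))"
    proof (rule differentiable_bound[OF convex_closed_segment[of "y - x" "y - x'"]])
      fix \<zeta> assume "\<zeta> \<in> closed_segment (y - x) (y - x')"
      then obtain \<theta> where \<theta>: "0 \<le> \<theta>" "\<theta> \<le> 1" and \<zeta>: "\<zeta> = (1 - \<theta>) *\<^sub>R (y - x) + \<theta> *\<^sub>R (y - x')"
        by (auto simp: closed_segment_def)
      define c where "c = x + \<theta> *\<^sub>R (x' - x)"
      have \<zeta>c: "\<zeta> = y - c" by (simp add: \<zeta> c_def algebra_simps)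
      have "norm c \<le> norm x + \<theta> * norm (x' - x)"
        unfolding c_def using norm_triangle_ineq[of x "\<theta> *\<^sub>R (x' - x)"] \<theta> by simp
      also have "\<dots> \<le> norm x + 1" using \<theta> x' by (simp add: mult_le_one)
      finally have c: "norm c \<le> norm x + 1" .
      show "(iter_deriv vs f has_derivative (\<lambda>v. iter_deriv (v # vs) f \<zeta>)) (at \<zeta> within closed_segment (y - x) (y - x'))"
        using iter_deriv_has_derivative[OF sm] by (rule has_derivative_at_withinI)
      show "onorm (\<lambda>v. iter_deriv (v # vs) f \<zeta>) \<le> B"
      proof (rule onorm_bound[OF B0])
        fix v :: "real^'n"
        have P: "(\<Prod>v\<leftarrow>vs. norm v) \<le> 1"
          using prod_list_abs_le_1[of vs norm] vs by simp
        have P0: "0 \<le> (\<Prod>v\<leftarrow>vs. norm v)" by (induction vs) auto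
        have Pv: "norm v * (\<Prod>v\<leftarrow>vs. norm v) \<le> norm v" by (rule mult_left_le[OF P norm_ge_zero])
        have "norm (iter_deriv (v # vs) f \<zeta>) \<le> C * decay (1 / t) (2 powr (1 / t) * r) \<zeta> * h1 ^ length (v # vs) * fact (length (v # vs)) powr s * (\<Prod>v\<leftarrow>v # vs. norm v)"
          by (rule gevrey_bound_list[OF sm C(2)])
        also have "\<dots> \<le> C * (E * decay (1 / t) r y) * h1 ^ (?m + 1) * ((2 powr s) ^ (?m + 1) * fact ?m powr s) * (norm v * 1)"
        proof -
          have w: "decay (1 / t) (2 powr (1 / t) * r) \<zeta> \<le> E * decay (1 / t) r y"
          proof -
            have "decay (1 / t) (2 powr (1 / t) * r) \<zeta> \<le> exp (2 powr (1 / t) * r * norm c powr (1 / t)) * decay (1 / t) r y"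
              unfolding \<zeta>c using st hr by (intro decay_shift) auto
            also have "\<dots> \<le> E * decay (1 / t) r y"
              unfolding E_def using c st hr by (intro mult_right_mono) (auto intro!: mult_left_mono powr_mono2)
            finally show ?thesis .
          qed
          have fa: "fact (?m + 1) powr s \<le> (2 powr s) ^ (?m + 1) * fact ?m powr s"
          proof -
            have "fact (?m + 1) powr s \<le> (2 ^ (?m + 1) * (fact ?m * fact 1)) powr s"
              using st by (intro powr_mono2 fact_add_le) auto
            also have "\<dots> = (2 ^ (?m + 1)) powr s * fact ?m powr s" by (simp add: powr_mult)
            also have "(2 ^ (?m + 1)) powr s = (2 powr s) ^ (?m + 1)"
              by (simp add: powr_powr mult.commute del: power_Suc flip: powr_realpow)
            finally show ?thesis .
          qed
          show ?thesis
            using C(1) h1 w fa Pv P0 by (simp del: power_Suc fact_Suc, intro mult_mono mult_nonneg_nonneg) (auto simp: E_def)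
        qed
        also have "\<dots> = B * norm v"
          by (simp add: B_def h1_def power_divide mult_ac)
        finally show "norm (iter_deriv (v # vs) f \<zeta>) \<le> B * norm v" .
      qed
    qed auto
    then show "norm (iter_deriv vs (\<lambda>y. f (y - x) - f (y - x')) y) \<le> norm (x' - x) * (C * E * h) * decay (1 / t) r y * h ^ ?m * fact ?m powr s"
      unfolding iter_deriv_diff[OF smooth_translate smooth_translate] iter_deriv_translate by (simp add: B_def mult_ac)
  qed
  then show ?thesis using C(1) hr by (intro exI[of _ "C * E * h"]) (auto simp: E_def)
qed

lemma smooth_tf_shift: "smooth (tf_shift f w)"
proof -
  have "tf_shift f w = (\<lambda>y. plane_wave (snd w) y * f (y - fst w))" by (simp add: tf_shift_apply fun_eq_iff)
  then show ?thesis using smooth_mult[OF smooth_plane_wave smooth_translate] by simp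
qed

text \<open>Modulation costs exponential growth in \<open>snd w\<close>, translation in
  \<open>fst w\<close>. The rate \<open>\<rho>\<close> depends on \<open>h\<close> and
  \<open>r\<close>, which is why the phase space kernel will have to be integrable against every
  such rate.\<close>

lemma gevrey_tf_shift:
  assumes hr: "0 < h" "0 < r"
  shows "\<exists>\<rho>>0. \<exists>C\<ge>0. \<forall>w. gevrey s h (\<lambda>y. C * exp (\<rho> * phase_gauge t s w) * decay (1 / t) r y) (tf_shift f w)"
proof -
  obtain C where C: "C \<ge> 0" "\<And>x. gevrey s (h / 2) (\<lambda>y. C * exp (2 powr (1 / t) * r * norm x powr (1 / t)) * decay (1 / t) r y) (\<lambda>y. f (y - x))"
    using gevrey_translate[of "h / 2" r] hr by auto
  define \<rho> where "\<rho> = max (s * (1 / (h / 2)) powr (1 / s)) (2 powr (1 / t) * r)"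
  have \<rho>: "\<rho> > 0" using hr by (simp add: \<rho>_def less_max_iff_disj)
  have "gevrey s h (\<lambda>y. C * exp (\<rho> * phase_gauge t s w) * decay (1 / t) r y) (tf_shift f w)" for w
  proof -
    let ?e1 = "exp (s * (norm (snd w) / (h / 2)) powr (1 / s))" and ?e2 = "exp (2 powr (1 / t) * r * norm (fst w) powr (1 / t))"
    have "gevrey s (2 * (h / 2)) (\<lambda>y. ?e1 * (C * ?e2 * decay (1 / t) r y)) (\<lambda>y. plane_wave (snd w) y * f (y - fst w))"
      using st hr by (intro gevrey_mult smooth_plane_wave smooth_translate gevrey_plane_wave C(2)) auto
    moreover have "(\<lambda>y. plane_wave (snd w) y * f (y - fst w)) = tf_shift f w" by (simp add: tf_shift_apply fun_eq_iff)
    ultimately have "gevrey s (2 * (h / 2)) (\<lambda>y. ?e1 * (C * ?e2 * decay (1 / t) r y)) (tf_shift f w)" by simp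
    then show ?thesis
    proof (rule gevrey_mono)
      fix y
      have "s * (norm (snd w) / (h / 2)) powr (1 / s) = (s * (1 / (h / 2)) powr (1 / s)) * norm (snd w) powr (1 / s)"
        using hr by (simp add: powr_divide powr_mult)
      also have "\<dots> \<le> \<rho> * norm (snd w) powr (1 / s)" by (intro mult_right_mono) (auto simp: \<rho>_def)
      finally have 1: "s * (norm (snd w) / (h / 2)) powr (1 / s) \<le> \<rho> * norm (snd w) powr (1 / s)" .
      have 2: "2 powr (1 / t) * r * norm (fst w) powr (1 / t) \<le> \<rho> * norm (fst w) powr (1 / t)" by (intro mult_right_mono) (auto simp: \<rho>_def)
      have "?e1 * ?e2 \<le> exp (\<rho> * phase_gauge t s w)"
        using add_mono[OF 1 2] by (simp add: phase_gauge_def algebra_simps flip: exp_add)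
      then have "(C * decay (1 / t) r y) * (?e1 * ?e2) \<le> (C * decay (1 / t) r y) * exp (\<rho> * phase_gauge t s w)"
        using C(1) by (intro mult_left_mono) auto
      then show "?e1 * (C * ?e2 * decay (1 / t) r y) \<le> C * exp (\<rho> * phase_gauge t s w) * decay (1 / t) r y" by (simp only: mult_ac)
    qed (use hr in auto)
  qed
  then show ?thesis using \<rho> C(1) by blast
qed

lemma tf_shift_GS: "tf_shift f w \<in> GS t s"
  unfolding GS_iff_gevrey[OF st]
proof (intro conjI allI impI smooth_tf_shift)
  fix h r :: real assume "0 < h" "0 < r"
  from gevrey_tf_shift[OF this] obtain \<rho> C where "C \<ge> 0" "gevrey s h (\<lambda>y. C * exp (\<rho> * phase_gauge t s w) * decay (1 / t) r y) (tf_shift f w)" by blast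
  then show "\<exists>C\<ge>0. gevrey s h (\<lambda>x. C * decay (1 / t) r x) (tf_shift f w)"
    by (intro exI[of _ "C * exp (\<rho> * phase_gauge t s w)"]) auto
qed

lemma tf_shift_continuous:
  assumes h: "0 < h" and r: "0 < r" and \<epsilon>: "0 < \<epsilon>"
  shows "\<exists>\<delta>>0. \<forall>w'. dist w w' < \<delta> \<longrightarrow> gevrey s h (\<lambda>y. \<epsilon> * decay (1 / t) r y) (\<lambda>y. tf_shift f w y - tf_shift f w' y)"
proof -
  obtain x \<xi> where w: "w = (x, \<xi>)" by (cases w)
  define e1 where "e1 = exp (s * (norm \<xi> / (h / 2)) powr (1 / s))"
  obtain C1 where C1: "C1 \<ge> 0" "\<And>x'. norm (x' - x) \<le> 1 \<Longrightarrow> gevrey s (h / 2) (\<lambda>y. norm (x' - x) * C1 * decay (1 / t) r y) (\<lambda>y. f (y - x) - f (y - x'))"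
    using gevrey_translate_diff[of "h / 2" r x] h r by auto
  obtain C2 where C2: "C2 \<ge> 0" "\<And>x. gevrey s (h / 4) (\<lambda>y. C2 * exp (2 powr (1 / t) * (r + 1) * norm x powr (1 / t)) * decay (1 / t) (r + 1) y) (\<lambda>y. f (y - x))"
    using gevrey_translate[of "h / 4" "r + 1"] h r by auto
  define e2 where "e2 = exp (2 powr (1 / t) * (r + 1) * (norm x + 1) powr (1 / t))"
  define K where "K = exp (s * (1 / (h / 4)) powr (1 / s))"
  \<comment> \<open>With this value \<open>norm y * decay (1 / t) 1 y \<le> k\<close>. The rate
    \<open>r + 1\<close> of the translates reserves the one unit of decay that the factor
    \<open>norm y\<close> consumes.\<close>
  define k where "k = t powr t"
  have k: "k > 0" using st by (simp add: k_def)
  have y_le: "norm y * decay (1 / t) 1 y \<le> k" for y :: "real^'n"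
  proof -
    have "norm y ^ 1 \<le> k ^ 1 * fact 1 powr t * exp (t * (norm y / k) powr (1 / t))"
      using st k by (intro power_le_exp_powr) auto
    also have "t * (norm y / k) powr (1 / t) = norm y powr (1 / t)"
      using st k by (simp add: powr_divide k_def powr_powr)
    finally show ?thesis by (simp add: decay_def exp_minus field_simps)
  qed
  define T where "T = e1 * (C1 + C2 * e2 * (k + K))"
  have T: "0 \<le> T" using C1 C2 k by (simp add: T_def e1_def e2_def K_def)
  \<comment> \<open>At most 1, as the estimates for differences of translates and of plane waves
    require; the \<open>+ 1\<close> in the denominator guards against \<open>T = 0\<close>.\<close>
  define \<delta> where "\<delta> = min 1 (\<epsilon> / (T + 1))"
  have \<delta>: "\<delta> > 0" using \<epsilon> T by (simp add: \<delta>_def)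
  have "gevrey s h (\<lambda>y. \<epsilon> * decay (1 / t) r y) (\<lambda>y. tf_shift f w y - tf_shift f w' y)" if d: "dist w w' < \<delta>" for w'
  proof -
    obtain x' \<xi>' where w': "w' = (x', \<xi>')" by (cases w')
    define \<zeta> where "\<zeta> = \<xi>' - \<xi>"
    have dn: "norm (x' - x) < \<delta>" "norm \<zeta> < \<delta>"
      using d dist_fst_le[of w w'] dist_snd_le[of w w'] unfolding w w' \<zeta>_def by (auto simp: dist_norm norm_minus_commute)
    have d1: "norm (x' - x) \<le> 1" "norm \<zeta> \<le> 1" using dn by (auto simp: \<delta>_def)
    \<comment> \<open>With the modulation by \<open>\<xi>\<close> factored out, the difference
      splits into a difference of translates and a plane wave close to 1, minus 1, acting on a
      single translate.\<close>
    have eq: "tf_shift f w y - tf_shift f w' y = plane_wave \<xi> y * ((f (y - x) - f (y - x')) + (- 1) * ((plane_wave \<zeta> y - 1) * f (y - x')))" for y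
    proof -
      have "plane_wave \<xi>' y = plane_wave \<xi> y * plane_wave \<zeta> y" using plane_wave_add_left[of \<xi> \<zeta> y] by (simp add: \<zeta>_def)
      then show ?thesis by (simp add: w w' tf_shift_apply algebra_simps)
    qed
    have sE: "smooth (\<lambda>y. plane_wave \<zeta> y - 1)"
      using smooth_diff[OF smooth_plane_wave[of \<zeta>] smooth_plane_wave[of 0]] by simp
    have sET: "smooth (\<lambda>y. (plane_wave \<zeta> y - 1) * f (y - x'))" by (rule smooth_mult[OF sE smooth_translate])
    have sD: "smooth (\<lambda>y. f (y - x) - f (y - x'))" by (rule smooth_diff[OF smooth_translate smooth_translate])
    have "gevrey s (2 * (h / 4)) (\<lambda>y. (norm \<zeta> * (norm y + K)) * (C2 * exp (2 powr (1 / t) * (r + 1) * norm x' powr (1 / t)) * decay (1 / t) (r + 1) y)) (\<lambda>y. (plane_wave \<zeta> y - 1) * f (y - x'))"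
      unfolding K_def using st h d1 by (intro gevrey_mult sE smooth_translate gevrey_plane_wave_diff C2(2)) auto
    then have ET: "gevrey s (h / 2) (\<lambda>y. \<delta> * (C2 * e2 * (k + K)) * decay (1 / t) r y) (\<lambda>y. (plane_wave \<zeta> y - 1) * f (y - x'))"
    proof (rule gevrey_mono)
      fix y :: "real^'n"
      have "norm x' \<le> norm x + 1" using d1(1) norm_triangle_ineq[of x "x' - x"] by simp
      then have e: "exp (2 powr (1 / t) * (r + 1) * norm x' powr (1 / t)) \<le> e2"
        unfolding e2_def using st r by (auto intro!: mult_left_mono powr_mono2)
      have "(norm y + K) * decay (1 / t) (r + 1) y = (norm y * decay (1 / t) 1 y + K * decay (1 / t) 1 y) * decay (1 / t) r y"
        by (simp add: algebra_simps flip: decay_mult)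
      also have "\<dots> \<le> (k + K * 1) * decay (1 / t) r y"
        using y_le[of y] by (intro mult_right_mono add_mono mult_left_mono decay_le_1) (auto simp: K_def)
      finally have 2: "(norm y + K) * decay (1 / t) (r + 1) y \<le> (k + K) * decay (1 / t) r y" by simp
      have 1: "norm \<zeta> * (C2 * exp (2 powr (1 / t) * (r + 1) * norm x' powr (1 / t))) \<le> \<delta> * (C2 * e2)"
        using dn C2(1) \<delta> by (intro mult_mono mult_left_mono e) auto
      have "norm \<zeta> * (C2 * exp (2 powr (1 / t) * (r + 1) * norm x' powr (1 / t))) * ((norm y + K) * decay (1 / t) (r + 1) y)
        \<le> \<delta> * (C2 * e2) * ((k + K) * decay (1 / t) r y)"
        using C2(1) \<delta> by (intro mult_mono[OF 1 2]) (auto simp: K_def e2_def)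
      then show "(norm \<zeta> * (norm y + K)) * (C2 * exp (2 powr (1 / t) * (r + 1) * norm x' powr (1 / t)) * decay (1 / t) (r + 1) y)
        \<le> \<delta> * (C2 * e2 * (k + K)) * decay (1 / t) r y"
        by (simp only: mult_ac)
    qed (use h in auto)
    have Df: "gevrey s (h / 2) (\<lambda>y. \<delta> * C1 * decay (1 / t) r y) (\<lambda>y. f (y - x) - f (y - x'))"
      using C1(1) dn h by (intro gevrey_mono[OF C1(2)[OF d1(1)]]) (auto intro!: mult_right_mono)
    have "gevrey s (h / 2) (\<lambda>y. \<delta> * C1 * decay (1 / t) r y + norm (- 1 :: complex) * (\<delta> * (C2 * e2 * (k + K)) * decay (1 / t) r y))
      (\<lambda>y. (f (y - x) - f (y - x')) + (- 1) * ((plane_wave \<zeta> y - 1) * f (y - x')))"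
      by (intro gevrey_add sD smooth_cmult sET Df gevrey_cmult ET)
    then have "gevrey s (2 * (h / 2)) (\<lambda>y. e1 * (\<delta> * C1 * decay (1 / t) r y + norm (- 1 :: complex) * (\<delta> * (C2 * e2 * (k + K)) * decay (1 / t) r y)))
      (\<lambda>y. plane_wave \<xi> y * ((f (y - x) - f (y - x')) + (- 1) * ((plane_wave \<zeta> y - 1) * f (y - x'))))"
      unfolding e1_def using st h by (intro gevrey_mult smooth_plane_wave smooth_add sD smooth_cmult sET gevrey_plane_wave) auto
    then show ?thesis
      unfolding eq
    proof (rule gevrey_mono)
      fix y :: "real^'n"
      have "\<delta> * T \<le> \<epsilon> / (T + 1) * T" using T by (intro mult_right_mono) (auto simp: \<delta>_def)
      also have "\<dots> \<le> \<epsilon>" using T \<epsilon> by (simp add: field_simps)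
      finally have "\<delta> * T * decay (1 / t) r y \<le> \<epsilon> * decay (1 / t) r y" by (intro mult_right_mono) auto
      then show "e1 * (\<delta> * C1 * decay (1 / t) r y + norm (- 1 :: complex) * (\<delta> * (C2 * e2 * (k + K)) * decay (1 / t) r y)) \<le> \<epsilon> * decay (1 / t) r y"
        by (simp add: T_def algebra_simps)
    qed (use h in auto)
  qed
  then show ?thesis using \<delta> by blast
qed

end

section \<open>The reconstruction formula\<close>

text \<open>The zero set is closed and has full measure, hence is everything.\<close>

lemma continuous_eq_0_if_LINT_norm_sq:
  fixes f :: "'a::euclidean_space \<Rightarrow> complex"
  assumes f: "continuous_on UNIV f" and i: "integrable lborel (\<lambda>x. (norm (f x))\<^sup>2)" and z: "(LINT x|lborel. (norm (f x))\<^sup>2) = 0"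
  shows "f x = 0"
proof -
  have "AE x in lborel. (norm (f x))\<^sup>2 = 0"
    using z integral_nonneg_eq_0_iff_AE[OF i] by simp
  then have "AE x in lborel. x \<in> {x. f x = 0}" by simp
  then have "AE x in lebesgue. x \<in> {x. f x = 0}" by (rule AE_completion)
  moreover have "closed {x. f x = 0}" using f by (intro closed_Collect_eq) (auto intro: continuous_intros)
  ultimately show ?thesis using mem_closed_if_AE_lebesgue by blast
qed

lemma GS_pair_measurable: "GS_pair t s H \<Longrightarrow> H \<in> borel_measurable borel"
  by (simp add: GS_pair_def smooth_measurable)

lemma GS_pair_partial_fourier_bound:
  assumes "0 < s" "0 < t" "GS_pair t s H" "0 < r"
  shows "\<exists>C\<ge>0. \<forall>z. norm (partial_fourier H z) \<le> C * phase_decay t s r z"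
proof -
  obtain G where G: "G 0 = partial_fourier H" "decaying_jet t s s (axis undefined 1, 0) G" using decaying_jet_partial_fourier_x[OF assms(1-3)] by blast
  then obtain C where C: "C \<ge> 0" "\<forall>N z. norm (G N z) \<le> C * 1 ^ N * fact N powr s * phase_decay t s r z"
    unfolding decaying_jet_def using assms(4) zero_less_one by blast
  show ?thesis using C(1) C(2)[rule_format, of 0] by (auto simp: G(1))
qed

lemma GS_decay:
  assumes "0 < s" "0 < t" "f \<in> GS t s"
  shows "\<exists>C\<ge>0. \<forall>x. norm (f x) \<le> C * decay (1 / t) 1 x"
  using GS_imp_gevrey[OF assms, of 1 1] gevrey_norm by fastforce

lemma GS_continuous: "f \<in> GS t s \<Longrightarrow> continuous_on A f"
  using continuous_on_iter_deriv[OF GS_smooth, of f t s A "[]"] by simp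

lemma GS_measurable: "f \<in> GS t s \<Longrightarrow> f \<in> borel_measurable borel"
  using GS_smooth smooth_measurable by blast

lemma GS_integrable:
  assumes "0 < s" "0 < t" "f \<in> GS t s"
  shows "integrable lborel f"
proof -
  obtain C where C: "C \<ge> 0" "\<And>x. norm (f x) \<le> C * decay (1 / t) 1 x" using GS_decay[OF assms] by blast
  have "integrable lborel (\<lambda>x::real^'a. C * decay (1 / t) 1 x)" using assms by (intro integrable_mult_right integrable_decay) auto
  then show ?thesis
    by (rule Bochner_Integration.integrable_bound) (use C GS_measurable[OF assms(3)] in auto)
qed

lemma GS_bounded:
  assumes "0 < s" "0 < t" "f \<in> GS t s"
  shows "\<exists>B\<ge>0. \<forall>x. norm (f x) \<le> B"
proof -
  obtain C where C: "C \<ge> 0" "\<And>x. norm (f x) \<le> C * decay (1 / t) 1 x" using GS_decay[OF assms] by blast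
  have "norm (f x) \<le> C" for x
    using C(2)[of x] mult_left_mono[OF decay_le_1[of 1 "1 / t" x] C(1)] by simp
  then show ?thesis using C(1) by blast
qed

lemma GS_mult_cnj_integrable:
  assumes "0 < s" "0 < t" "f \<in> GS t s" "g \<in> GS t s"
  shows "integrable lborel (\<lambda>x. f x * cnj (g x))"
proof -
  obtain B where B: "B \<ge> 0" "\<And>x. norm (g x) \<le> B" using GS_bounded[OF assms(1,2,4)] by blast
  note [measurable] = GS_measurable[OF assms(3)] GS_measurable[OF assms(4)]
  show ?thesis
  proof (rule Bochner_Integration.integrable_bound)
    show "integrable lborel (\<lambda>x. B * norm (f x))" using GS_integrable[OF assms(1-3)] by simp
    show "AE x in lborel. norm (f x * cnj (g x)) \<le> norm (B * norm (f x))"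
    proof (rule AE_I2)
      fix x
      show "norm (f x * cnj (g x)) \<le> norm (B * norm (f x))"
        using mult_right_mono[OF B(2)[of x] norm_ge_zero[of "f x"]] B(1) by (simp add: norm_mult mult.commute)
    qed
  qed measurable
qed

text \<open>The short-time Fourier transform of a function rather than a functional, without the
  normalising power of \<open>2 * pi\<close> in \<open>STFT\<close>.\<close>

definition stft :: "(real ^ 'n::finite \<Rightarrow> complex) \<Rightarrow> (real ^ 'n \<Rightarrow> complex) \<Rightarrow> (real ^ 'n) \<times> (real ^ 'n) \<Rightarrow> complex" where
  "stft \<psi> g w = (LINT y|lborel. g y * cnj (tf_shift \<psi> w y))"

lemma stft_eq_partial_fourier: "stft \<psi> g = partial_fourier (\<lambda>z. g (snd z) * cnj (\<psi> (snd z - fst z)))"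
  by (simp add: fun_eq_iff stft_def partial_fourier_def tf_shift_apply plane_wave_minus mult_ac)

lemma GS_pair_stft:
  assumes st: "0 < s" "0 < t" and g: "g \<in> GS t s" and \<psi>: "\<psi> \<in> GS t s"
  shows "GS_pair t s (\<lambda>z. g (snd z) * cnj (\<psi> (snd z - fst z)))"
proof (rule GS_pair_product[OF st g \<psi>])
  show "bounded_linear (snd :: (real^'a) \<times> (real^'a) \<Rightarrow> real^'a)" "bounded_linear (\<lambda>z::(real^'a) \<times> (real^'a). snd z - fst z)"
    by (intro bounded_linear_intros)+
  fix z :: "(real^'a) \<times> (real^'a)"
  have n: "norm (fst z) \<le> norm z" "norm (snd z) \<le> norm z"
    using norm_fst_le[of "fst z" "snd z"] norm_snd_le[of "snd z" "fst z"] by simp_all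
  show "norm (snd z) \<le> 2 * norm z"
    using n norm_ge_zero[of z] by linarith
  show "norm (snd z - fst z) \<le> 2 * norm z"
    using norm_triangle_ineq4[of "snd z" "fst z"] n by linarith
  show "norm (fst z) \<le> norm (snd z) + norm (snd z - fst z)"
    using norm_triangle_ineq4[of "snd z" "snd z - fst z"] by simp
  show "norm (snd z) \<le> norm (snd z) + norm (snd z - fst z)" by simp
qed

text \<open>For a fixed translation \<open>x\<close> the integral over the modulations is Fourier
  inversion for \<open>g\<close> times a conjugated translate of the window; the remaining integral
  over \<open>x\<close> produces the squared norm of the window.\<close>

lemma reconstruction:
  fixes g \<psi> :: "real ^ 'n::finite \<Rightarrow> complex"
  assumes st: "0 < s" "0 < t" and g: "g \<in> GS t s" and \<psi>: "\<psi> \<in> GS t s"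
  shows "(LINT w|lborel. stft \<psi> g w * tf_shift \<psi> w y) = of_real ((2 * pi) ^ CARD('n)) * (LINT v|lborel. \<psi> v * cnj (\<psi> v)) * g y"
proof -
  note [measurable] = GS_measurable[OF g] GS_measurable[OF \<psi>]
  define H where "H = (\<lambda>z. g (snd z) * cnj (\<psi> (snd z - fst z)))"
  have H: "GS_pair t s H" unfolding H_def by (rule GS_pair_stft[OF st g \<psi>])
  have stft: "stft \<psi> g = partial_fourier H" by (simp add: stft_eq_partial_fourier H_def)
  have [measurable]: "partial_fourier H \<in> borel_measurable borel" by (rule partial_fourier_measurable[OF GS_pair_measurable[OF H]])
  obtain C where C: "C \<ge> 0" "\<And>z. norm (partial_fourier H z) \<le> C * phase_decay t s 1 z" using GS_pair_partial_fourier_bound[OF st H, of 1] by auto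
  obtain B where B: "B \<ge> 0" "\<And>x. norm (\<psi> x) \<le> B" using GS_bounded[OF st \<psi>] by blast
  obtain Bg where Bg: "Bg \<ge> 0" "\<And>x. norm (g x) \<le> Bg" using GS_bounded[OF st g] by blast
  have int: "integrable lborel (\<lambda>w. partial_fourier H w * tf_shift \<psi> w y)"
  proof (rule Bochner_Integration.integrable_bound)
    show "integrable lborel (\<lambda>w::(real^'n) \<times> (real^'n). C * B * phase_decay t s 1 w)"
      using st by (intro integrable_mult_right integrable_phase_decay) auto
    show "(\<lambda>w. partial_fourier H w * tf_shift \<psi> w y) \<in> borel_measurable lborel" unfolding tf_shift_apply by measurable
    show "AE w in lborel. norm (partial_fourier H w * tf_shift \<psi> w y) \<le> norm (C * B * phase_decay t s 1 w)"
    proof (rule AE_I2)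
      fix w
      have "norm (partial_fourier H w * tf_shift \<psi> w y) \<le> (C * phase_decay t s 1 w) * B"
        unfolding norm_mult tf_shift_apply using C B by (intro mult_mono) auto
      then show "norm (partial_fourier H w * tf_shift \<psi> w y) \<le> norm (C * B * phase_decay t s 1 w)"
        using C(1) B(1) by (simp add: mult_ac)
    qed
  qed
  have inner: "(LINT \<xi>|lborel. partial_fourier H (x, \<xi>) * tf_shift \<psi> (x, \<xi>) y) = of_real ((2 * pi) ^ CARD('n)) * g y * (\<psi> (y - x) * cnj (\<psi> (y - x)))" for x
  proof -
    define f where "f = (\<lambda>v. g v * cnj (\<psi> (v - x)))"
    have "(LINT \<xi>|lborel. (LINT v|lborel. f v * plane_wave (- \<xi>) v) * plane_wave \<xi> y) = of_real ((2 * pi) ^ DIM(real^'n)) * f y"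
    proof (rule fourier_inversion)
      show "continuous_on UNIV f"
        unfolding f_def by (intro continuous_intros GS_continuous[OF g] continuous_on_compose2[OF GS_continuous[OF \<psi>, of UNIV]]) auto
      have b: "norm (f v) \<le> norm (g v) * B" for v
        unfolding f_def norm_mult using B by (intro mult_left_mono) auto
      show "integrable lborel f"
      proof (rule Bochner_Integration.integrable_bound)
        show "integrable lborel (\<lambda>v. norm (g v) * B)" using GS_integrable[OF st g] by simp
        show "f \<in> borel_measurable lborel" unfolding f_def by measurable
        show "AE v in lborel. norm (f v) \<le> norm (norm (g v) * B)" using b B(1) by simp
      qed
      show "norm (f v) \<le> Bg * B" for v
        using b[of v] mult_right_mono[OF Bg(2) B(1), of v] by linarith
      show "integrable lborel (\<lambda>\<xi>. LINT v|lborel. f v * plane_wave (- \<xi>) v)"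
      proof (rule Bochner_Integration.integrable_bound)
        show "integrable lborel (\<lambda>\<xi>::real^'n. C * decay (1 / t) 1 x * decay (1 / s) 1 \<xi>)"
          using st by (intro integrable_mult_right integrable_decay) auto
        have eq: "(LINT v|lborel. f v * plane_wave (- \<xi>) v) = partial_fourier H (x, \<xi>)" for \<xi> by (simp add: f_def partial_fourier_def H_def)
        show "(\<lambda>\<xi>. LINT v|lborel. f v * plane_wave (- \<xi>) v) \<in> borel_measurable lborel" unfolding eq by measurable
        show "AE \<xi> in lborel. norm (LINT v|lborel. f v * plane_wave (- \<xi>) v) \<le> norm (C * decay (1 / t) 1 x * decay (1 / s) 1 \<xi>)"
        proof (rule AE_I2)
          fix \<xi>
          show "norm (LINT v|lborel. f v * plane_wave (- \<xi>) v) \<le> norm (C * decay (1 / t) 1 x * decay (1 / s) 1 \<xi>)"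
            unfolding eq using C(1) C(2)[of "(x, \<xi>)"] by (simp add: phase_decay_def mult.assoc)
        qed
      qed
    qed
    moreover have "(LINT \<xi>|lborel. partial_fourier H (x, \<xi>) * tf_shift \<psi> (x, \<xi>) y) = (LINT \<xi>|lborel. \<psi> (y - x) * ((LINT v|lborel. f v * plane_wave (- \<xi>) v) * plane_wave \<xi> y))"
      by (simp add: f_def partial_fourier_def H_def tf_shift_apply mult_ac)
    moreover have "\<dots> = \<psi> (y - x) * (LINT \<xi>|lborel. (LINT v|lborel. f v * plane_wave (- \<xi>) v) * plane_wave \<xi> y)"
      by (rule integral_mult_right_zero)
    ultimately show ?thesis by (simp add: f_def mult_ac)
  qed
  have m: "(\<lambda>v. \<psi> v * cnj (\<psi> v)) \<in> borel_measurable borel" by measurable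
  have "(LINT w|lborel. stft \<psi> g w * tf_shift \<psi> w y) = (LINT x|lborel. LINT \<xi>|lborel. partial_fourier H (x, \<xi>) * tf_shift \<psi> (x, \<xi>) y)"
    unfolding stft by (rule lborel_integral_fst[OF int, symmetric])
  also have "\<dots> = of_real ((2 * pi) ^ CARD('n)) * g y * (LINT x|lborel. \<psi> (y - x) * cnj (\<psi> (y - x)))"
    unfolding inner by (rule integral_mult_right_zero)
  also have "(LINT x|lborel. \<psi> (y - x) * cnj (\<psi> (y - x))) = (LINT v|lborel. \<psi> v * cnj (\<psi> v))"
    by (rule lborel_integral_reflect[OF m])
  finally show ?thesis by (simp add: mult_ac)
qed

lemma LINT_mult_cnj: "(LINT v|lborel. \<psi> v * cnj (\<psi> v)) = of_real (LINT v|lborel. (norm (\<psi> v))\<^sup>2)"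
  by (simp add: complex_norm_square[symmetric] flip: of_real_power)

lemma GS_eq_0_if_self_pairing:
  assumes st: "0 < s" "0 < t" and f: "f \<in> GS t s" and z: "(LINT v|lborel. f v * cnj (f v)) = 0"
  shows "f = (\<lambda>x. 0)"
proof
  fix x
  have "integrable lborel (\<lambda>v. Re (f v * cnj (f v)))"
    by (rule integrable_bounded_linear[OF bounded_linear_Re GS_mult_cnj_integrable[OF st f f]])
  then have "integrable lborel (\<lambda>v. (norm (f v))\<^sup>2)"
    by (simp only: complex_norm_square[symmetric] Re_complex_of_real)
  then show "f x = 0"
    using z unfolding LINT_mult_cnj by (intro continuous_eq_0_if_LINT_norm_sq[OF GS_continuous[OF f]]) auto
qed

section \<open>The Weyl operator on time-frequency shifts\<close>

text \<open>Besides \<open>(2 * pi) ^ n\<close> from the Weyl quantization, the constant contains the \<open>(2 * pi) ^ n\<close> and the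
  squared norm of \<open>\<psi>\<close> from the reconstruction formula.\<close>

definition phase_kernel :: "((real ^ 'n::finite) \<times> (real ^ 'n) \<Rightarrow> complex) \<Rightarrow> (real ^ 'n \<Rightarrow> complex) \<Rightarrow>
    (real ^ 'n) \<times> (real ^ 'n) \<Rightarrow> (real ^ 'n) \<times> (real ^ 'n) \<Rightarrow> complex" where
  "phase_kernel a \<psi> z w = of_real (1 / ((2 * pi) ^ CARD('n) * (2 * pi) ^ CARD('n) * (LINT v|lborel. (norm (\<psi> v))\<^sup>2))) *
     L2_pairing (\<lambda>p. cnj (a p)) (Wigner (tf_shift \<psi> w) (tf_shift \<psi> z))"

context
  fixes s t :: real and a :: "(real ^ 'n::finite) \<times> (real ^ 'n) \<Rightarrow> complex" and \<psi> :: "real ^ 'n \<Rightarrow> complex"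
  assumes st: "0 < s" "0 < t" "1 < s + t" and a: "a \<in> symbol_class t s" and \<psi>: "\<psi> \<in> GS t s" and \<psi>0: "\<psi> \<noteq> (\<lambda>x. 0)"
begin

lemma a_measurable [measurable]: "a \<in> borel_measurable borel"
  using a smooth_measurable by (auto simp: symbol_class_def)

lemma \<psi>_measurable [measurable]: "\<psi> \<in> borel_measurable borel"
  using GS_measurable \<psi> by blast

lemma Wigner_measurable [measurable]: "Wigner \<psi> \<psi> \<in> borel_measurable borel"
  unfolding Wigner_eq_partial_fourier by (rule partial_fourier_measurable[OF GS_pair_measurable[OF GS_pair_Wigner[OF st(1,2) \<psi> \<psi>]]])

lemma Wigner_tf_shift_measurable [measurable]:
  "(\<lambda>x. Wigner (tf_shift \<psi> (fst x)) (tf_shift \<psi> z) (snd x)) \<in> borel_measurable (borel \<Otimes>\<^sub>M borel)"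
  unfolding Wigner_tf_shift[OF \<psi>_measurable] by measurable

lemma phase_kernel_measurable [measurable]: "phase_kernel a \<psi> z \<in> borel_measurable borel"
proof -
  have "(\<lambda>w. LINT p|lborel. cnj (a p) * cnj (Wigner (tf_shift \<psi> w) (tf_shift \<psi> z) p)) \<in> borel_measurable borel"
    by (rule lborel.borel_measurable_lebesgue_integral) (unfold case_prod_beta, measurable)
  then show ?thesis
    unfolding phase_kernel_def[abs_def] L2_pairing_def by (intro borel_measurable_times) auto
qed

lemma phase_kernel_bound:
  "\<exists>\<nu>\<ge>0. \<forall>r>0. \<exists>C\<ge>0. \<forall>z w. norm (phase_kernel a \<psi> z w) \<le> C * exp (\<nu> * phase_gauge t s z) * exp (- (r * phase_gauge t s (w - z)))"
proof -
  let ?c = "1 / ((2 * pi) ^ CARD('n) * (2 * pi) ^ CARD('n) * (LINT v|lborel. (norm (\<psi> v))\<^sup>2))"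
  obtain \<nu> where \<nu>: "\<nu> \<ge> 0" "\<And>r. r > 0 \<Longrightarrow> \<exists>C\<ge>0. \<forall>z w. norm (L2_pairing (\<lambda>p. cnj (a p)) (Wigner (tf_shift \<psi> w) (tf_shift \<psi> z)))
    \<le> C * exp (\<nu> * phase_gauge t s z) * exp (- (r * phase_gauge t s (w - z)))"
    using Weyl_kernel_bound[OF st a \<psi>] by blast
  have "\<exists>C\<ge>0. \<forall>z w. norm (phase_kernel a \<psi> z w) \<le> C * exp (\<nu> * phase_gauge t s z) * exp (- (r * phase_gauge t s (w - z)))" if r: "r > 0" for r
  proof -
    obtain C where C: "C \<ge> 0" "\<And>z w. norm (L2_pairing (\<lambda>p. cnj (a p)) (Wigner (tf_shift \<psi> w) (tf_shift \<psi> z)))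
      \<le> C * exp (\<nu> * phase_gauge t s z) * exp (- (r * phase_gauge t s (w - z)))" using \<nu>(2)[OF r] by blast
    have "norm (phase_kernel a \<psi> z w) \<le> \<bar>?c\<bar> * C * exp (\<nu> * phase_gauge t s z) * exp (- (r * phase_gauge t s (w - z)))" for z w
      using mult_left_mono[OF C(2)[where z=z and w=w] abs_ge_zero[of ?c]]
      unfolding phase_kernel_def norm_mult norm_of_real by (simp only: mult.assoc)
    then show ?thesis using C(1) by (intro exI[of _ "\<bar>?c\<bar> * C"]) auto
  qed
  then show ?thesis using \<nu>(1) by blast
qed

lemma phase_kernel_integrable:
  assumes "0 \<le> \<rho>"
  shows "integrable lborel (\<lambda>w. norm (phase_kernel a \<psi> z w) * exp (\<rho> * phase_gauge t s w))"
proof -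
  obtain \<nu> where \<nu>: "\<nu> \<ge> 0" "\<And>r. r > 0 \<Longrightarrow> \<exists>C\<ge>0. \<forall>z w. norm (phase_kernel a \<psi> z w) \<le> C * exp (\<nu> * phase_gauge t s z) * exp (- (r * phase_gauge t s (w - z)))"
    using phase_kernel_bound by blast
  \<comment> \<open>The growth in \<open>w\<close> is distributed over \<open>z\<close> and
    \<open>w - z\<close>. Kernel decay at this rate absorbs the second share and leaves one unit for
    integrability.\<close>
  have "\<rho> * gauge_const t s + 1 > 0" using assms gauge_const_pos[of t s] by (simp add: add_nonneg_pos)
  from \<nu>(2)[OF this] obtain C where C: "C \<ge> 0" "\<And>w. norm (phase_kernel a \<psi> z w) \<le> C * exp (\<nu> * phase_gauge t s z) * exp (- ((\<rho> * gauge_const t s + 1) * phase_gauge t s (w - z)))"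
    by blast
  have i: "integrable lborel (\<lambda>w. (C * exp (\<nu> * phase_gauge t s z) * exp (\<rho> * gauge_const t s * phase_gauge t s z)) * phase_decay t s 1 (w - z))"
    using st by (intro integrable_mult_right integrable_translate(1) integrable_phase_decay) auto
  have Qm: "(\<lambda>w. exp (\<rho> * phase_gauge t s w)) \<in> borel_measurable (borel :: ((real^'n) \<times> (real^'n)) measure)"
    unfolding phase_gauge_def by measurable
  show ?thesis
  proof (rule Bochner_Integration.integrable_bound[OF i])
    show "(\<lambda>w. norm (phase_kernel a \<psi> z w) * exp (\<rho> * phase_gauge t s w)) \<in> borel_measurable lborel"
      using Qm by measurable
    show "AE w in lborel. norm (norm (phase_kernel a \<psi> z w) * exp (\<rho> * phase_gauge t s w)) \<le> norm ((C * exp (\<nu> * phase_gauge t s z) * exp (\<rho> * gauge_const t s * phase_gauge t s z)) * phase_decay t s 1 (w - z))"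
    proof (rule AE_I2)
      fix w
      have "phase_gauge t s w \<le> gauge_const t s * (phase_gauge t s (w - z) + phase_gauge t s z)" using phase_gauge_add_le[OF st(1,2), of "w - z" z] by simp
      from mult_left_mono[OF this assms]
      have q: "\<rho> * phase_gauge t s w \<le> \<rho> * gauge_const t s * phase_gauge t s (w - z) + \<rho> * gauge_const t s * phase_gauge t s z" by (simp add: algebra_simps)
      have "norm (phase_kernel a \<psi> z w) * exp (\<rho> * phase_gauge t s w) \<le>
        (C * exp (\<nu> * phase_gauge t s z) * exp (- ((\<rho> * gauge_const t s + 1) * phase_gauge t s (w - z)))) * exp (\<rho> * gauge_const t s * phase_gauge t s (w - z) + \<rho> * gauge_const t s * phase_gauge t s z)"
        using C q by (intro mult_mono) auto
      also have "\<dots> = (C * exp (\<nu> * phase_gauge t s z) * exp (\<rho> * gauge_const t s * phase_gauge t s z)) * phase_decay t s 1 (w - z)"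
        by (simp add: phase_decay_phase_gauge algebra_simps flip: exp_add)
      finally show "norm (norm (phase_kernel a \<psi> z w) * exp (\<rho> * phase_gauge t s w)) \<le> norm ((C * exp (\<nu> * phase_gauge t s z) * exp (\<rho> * gauge_const t s * phase_gauge t s z)) * phase_decay t s 1 (w - z))"
        using C(1) by simp
    qed
  qed
qed

lemma integrable_phase_kernel: "integrable lborel (phase_kernel a \<psi> z)"
  using phase_kernel_integrable[of 0 z] by (simp add: integrable_norm_iff)

lemma kernel_times_tf_shift_bound:
  "0 < h \<Longrightarrow> 0 < r \<Longrightarrow> \<exists>b. integrable lborel (\<lambda>w. norm (phase_kernel a \<psi> z w) * b w) \<and> (\<forall>w. gevrey s h (\<lambda>x. b w * decay (1 / t) r x) (tf_shift \<psi> w))"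
proof -
  assume "0 < h" "0 < r"
  from gevrey_tf_shift[OF st(1,2) \<psi> this] obtain \<rho> C where \<rho>: "\<rho> > 0" and C: "C \<ge> 0" "\<And>w. gevrey s h (\<lambda>y. C * exp (\<rho> * phase_gauge t s w) * decay (1 / t) r y) (tf_shift \<psi> w)"
    by blast
  have "integrable lborel (\<lambda>w. C * (norm (phase_kernel a \<psi> z w) * exp (\<rho> * phase_gauge t s w)))"
    using \<rho> by (intro integrable_mult_right phase_kernel_integrable) auto
  then show ?thesis
    using C(2) by (intro exI[of _ "\<lambda>w. C * exp (\<rho> * phase_gauge t s w)"]) (simp add: mult_ac)
qed

text \<open>Both sides reduce to an integral over phase space against the conjugate transform of
  \<open>g\<close>: the left one by exchanging integrals, the right one by inserting the
  reconstruction of \<open>g\<close> into the Wigner distribution. The constant in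
  \<open>phase_kernel\<close> is the one that makes them agree.\<close>

lemma weyl_weak_identity:
  assumes g: "g \<in> GS t s"
  shows "L2_pairing (\<lambda>y. LINT w|lborel. phase_kernel a \<psi> z w * tf_shift \<psi> w y) g =
    of_real ((2 * pi) powr (- real CARD('n))) * L2_pairing (\<lambda>p. cnj (a p)) (Wigner g (tf_shift \<psi> z))"
proof -
  note [measurable] = GS_measurable[OF g]
  define K where "K = phase_kernel a \<psi> z"
  define f where "f = tf_shift \<psi> z"
  define V where "V = stft \<psi> g"
  define \<pi>n where "\<pi>n = (2 * pi) ^ CARD('n)"
  define N2 where "N2 = (LINT v|lborel. (norm (\<psi> v))\<^sup>2)"
  have [measurable]: "K \<in> borel_measurable borel" unfolding K_def by (rule phase_kernel_measurable)
  have Ki: "integrable lborel K" unfolding K_def by (rule integrable_phase_kernel)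
  have fGS: "f \<in> GS t s" unfolding f_def by (rule tf_shift_GS[OF st(1,2) \<psi>])
  note [measurable] = GS_measurable[OF fGS]
  have V: "V = partial_fourier (\<lambda>z. g (snd z) * cnj (\<psi> (snd z - fst z)))" unfolding V_def by (rule stft_eq_partial_fourier)
  note gH = GS_pair_stft[OF st(1,2) g \<psi>]
  have [measurable]: "V \<in> borel_measurable borel" unfolding V by (rule partial_fourier_measurable[OF GS_pair_measurable[OF gH]])
  have Vb: "\<exists>C\<ge>0. \<forall>w. norm (V w) \<le> C * phase_decay t s r w" if "r > 0" for r
    unfolding V by (rule GS_pair_partial_fourier_bound[OF st(1,2) gH that])
  have Vi: "integrable lborel V"
  proof -
    obtain C where C: "C \<ge> 0" "\<And>w. norm (V w) \<le> C * phase_decay t s 1 w" using Vb[of 1] by auto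
    have "integrable lborel (\<lambda>w::(real^'n) \<times> (real^'n). C * phase_decay t s 1 w)" using st by (intro integrable_mult_right integrable_phase_decay) auto
    then show ?thesis by (rule Bochner_Integration.integrable_bound) (use C in auto)
  qed
  obtain B where B: "B \<ge> 0" "\<And>x. norm (\<psi> x) \<le> B" using GS_bounded[OF st(1,2) \<psi>] by blast
  have gwB: "norm (tf_shift \<psi> w y) \<le> B" for w y using B by (simp add: tf_shift_apply norm_mult)
  have gwm [measurable]: "(\<lambda>x. tf_shift \<psi> (W x) (Y x)) \<in> borel_measurable M"
    if [measurable]: "W \<in> borel_measurable M" "Y \<in> borel_measurable M" for M :: "'m measure" and W Y
    unfolding tf_shift_apply by measurable
  have N2: "N2 \<noteq> 0"
    using GS_eq_0_if_self_pairing[OF st(1,2) \<psi>] \<psi>0 unfolding LINT_mult_cnj N2_def by auto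
  have \<pi>n: "\<pi>n > 0" by (simp add: \<pi>n_def)
  define c0 where "c0 = 1 / (\<pi>n * N2)"
  have rec: "g y = of_real c0 * (LINT w|lborel. V w * tf_shift \<psi> w y)" for y
    unfolding V_def reconstruction[OF st(1,2) g \<psi>] LINT_mult_cnj using N2 \<pi>n
    by (simp add: c0_def N2_def \<pi>n_def del: of_real_power)
  have L: "L2_pairing (\<lambda>y. LINT w|lborel. K w * tf_shift \<psi> w y) g = (LINT w|lborel. K w * cnj (V w))"
  proof -
    define G where "G = (\<lambda>x::(real^'n) \<times> ((real^'n) \<times> (real^'n)). K (snd x) * tf_shift \<psi> (snd x) (fst x) * cnj (g (fst x)))"
    have G: "integrable lborel G"
    proof (rule integrable_prod_dominated)
      show "G \<in> borel_measurable borel" unfolding G_def by measurable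
      show "integrable lborel (\<lambda>y. B * norm (g y))" using GS_integrable[OF st(1,2) g] by simp
      show "integrable lborel (\<lambda>w. norm (K w))" using Ki by simp
      show "norm (G (y, w)) \<le> B * norm (g y) * norm (K w)" for y w
        using mult_right_mono[OF gwB[of w y], of "norm (g y) * norm (K w)"] by (simp add: G_def norm_mult mult_ac)
    qed
    have "L2_pairing (\<lambda>y. LINT w|lborel. K w * tf_shift \<psi> w y) g = (LINT y|lborel. LINT w|lborel. G (y, w))"
      by (simp add: L2_pairing_def G_def)
    also have "\<dots> = (LINT w|lborel. LINT y|lborel. G (y, w))" by (rule lborel_Fubini[OF G, symmetric])
    also have "\<dots> = (LINT w|lborel. K w * cnj (V w))"
    proof (rule Bochner_Integration.integral_cong[OF refl])
      fix w
      have "(LINT y|lborel. G (y, w)) = (LINT y|lborel. K w * cnj (g y * cnj (tf_shift \<psi> w y)))"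
        by (simp add: G_def mult_ac)
      also have "\<dots> = K w * (LINT y|lborel. cnj (g y * cnj (tf_shift \<psi> w y)))" by (rule integral_mult_right_zero)
      also have "(LINT y|lborel. cnj (g y * cnj (tf_shift \<psi> w y))) = cnj (V w)"
        unfolding V_def stft_def by (rule Bochner_Integration.integral_cnj)
      finally show "(LINT y|lborel. G (y, w)) = K w * cnj (V w)" .
    qed
    finally show ?thesis .
  qed
  \<comment> \<open>The Wigner distribution is linear in its first argument, so the reconstruction
    of \<open>g\<close> passes through it; for fixed \<open>p\<close> this is an application of
    Fubini.\<close>
  have W: "Wigner g f p = of_real c0 * (LINT w|lborel. V w * Wigner (tf_shift \<psi> w) f p)" for p
  proof -
    obtain x \<eta> where p: "p = (x, \<eta>)" by (cases p)
    define G where "G = (\<lambda>q::(real^'n) \<times> ((real^'n) \<times> (real^'n)). V (snd q) * tf_shift \<psi> (snd q) (x + (1 / 2) *\<^sub>R fst q) * (cnj (f (x - (1 / 2) *\<^sub>R fst q)) * plane_wave (- \<eta>) (fst q)))"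
    have G: "integrable lborel G"
    proof (rule integrable_prod_dominated)
      show "G \<in> borel_measurable borel" unfolding G_def by measurable
      have "integrable lborel (\<lambda>y. f (x + (- (1 / 2)) *\<^sub>R y))"
        by (subst lborel_integrable_affine_iff) (use GS_integrable[OF st(1,2) fGS] GS_measurable[OF fGS] in auto)
      then show "integrable lborel (\<lambda>y. B * norm (f (x - (1 / 2) *\<^sub>R y)))" by simp
      show "integrable lborel (\<lambda>w. norm (V w))" using Vi by simp
      show "norm (G (y, w)) \<le> B * norm (f (x - (1 / 2) *\<^sub>R y)) * norm (V w)" for y w
        using mult_right_mono[OF gwB[of w "x + (1 / 2) *\<^sub>R y"], of "norm (f (x - (1 / 2) *\<^sub>R y)) * norm (V w)"]
        by (simp add: G_def norm_mult mult_ac)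
    qed
    have "Wigner g f p = (LINT y|lborel. of_real c0 * (LINT w|lborel. G (y, w)))"
      unfolding Wigner_eq_partial_fourier partial_fourier_def p fst_conv snd_conv
      by (rule Bochner_Integration.integral_cong[OF refl], subst rec) (simp add: G_def)
    also have "\<dots> = of_real c0 * (LINT y|lborel. LINT w|lborel. G (y, w))" by (rule integral_mult_right_zero)
    also have "(LINT y|lborel. LINT w|lborel. G (y, w)) = (LINT w|lborel. LINT y|lborel. G (y, w))" by (rule lborel_Fubini[OF G, symmetric])
    also have "\<dots> = (LINT w|lborel. V w * Wigner (tf_shift \<psi> w) f p)"
      by (simp add: G_def Wigner_eq_partial_fourier partial_fourier_def p mult.assoc)
    finally show ?thesis .
  qed
  have R: "L2_pairing (\<lambda>p. cnj (a p)) (Wigner g f) = of_real c0 * (LINT w|lborel. cnj (V w) * L2_pairing (\<lambda>p. cnj (a p)) (Wigner (tf_shift \<psi> w) f))"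
  proof -
    define G where "G = (\<lambda>q::((real^'n) \<times> (real^'n)) \<times> ((real^'n) \<times> (real^'n)). cnj (a (fst q)) * (cnj (V (snd q)) * cnj (Wigner (tf_shift \<psi> (snd q)) f (fst q))))"
    obtain \<mu> Ca where \<mu>: "\<mu> > 0" and Ca: "Ca > 0" "\<And>p. norm (a p) \<le> Ca * exp (\<mu> * phase_gauge t s p)"
    proof -
      obtain \<mu> where \<mu>: "\<mu> > 0" "\<And>h. h > 0 \<Longrightarrow> \<exists>C>0. \<forall>N z j.
        norm (iter_deriv (replicate N (axis j 1, 0)) a z) \<le> C * h ^ N * fact N powr s * exp (\<mu> * phase_gauge t s z) \<and>
        norm (iter_deriv (replicate N (0, axis j 1)) a z) \<le> C * h ^ N * fact N powr t * exp (\<mu> * phase_gauge t s z)"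
        using symbol_bounds[OF a] by blast
      from \<mu>(2)[of 1] obtain C where C: "C > 0" "\<forall>N z j. norm (iter_deriv (replicate N (axis j 1, 0)) a z) \<le> C * 1 ^ N * fact N powr s * exp (\<mu> * phase_gauge t s z)"
        by auto
      show ?thesis using that[OF \<mu>(1) C(1)] C(2)[rule_format, of 0] by simp
    qed
    \<comment> \<open>Enough to absorb the growth of the symbol and keep one unit of decay in
      \<open>p\<close>, after the gauge at \<open>p\<close> has been split at the midpoint of
      \<open>z\<close> and \<open>w\<close>.\<close>
    define \<rho> where "\<rho> = (\<mu> + 1) * gauge_const t s"
    have \<rho>: "\<rho> > 0" using \<mu> gauge_const_pos[of t s] by (simp add: \<rho>_def)
    obtain C\<Phi> where C\<Phi>: "C\<Phi> \<ge> 0" "\<And>p. norm (Wigner \<psi> \<psi> p) \<le> C\<Phi> * phase_decay t s \<rho> p"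
      using GS_pair_partial_fourier_bound[OF st(1,2) GS_pair_Wigner[OF st(1,2) \<psi> \<psi>] \<rho>] unfolding Wigner_eq_partial_fourier[symmetric] by blast
    \<comment> \<open>The growth left at the midpoint, distributed over \<open>z\<close> and
      \<open>w\<close>. The share of \<open>z\<close> is a constant, that of \<open>w\<close> is
      absorbed by the decay of \<open>V\<close> at rate \<open>\<rho>' + 1\<close>, with one unit to
      spare.\<close>
    define \<rho>' where "\<rho>' = \<rho> * gauge_const t s"
    have \<rho>': "\<rho>' > 0" using \<rho> gauge_const_pos[of t s] by (simp add: \<rho>'_def)
    obtain CV where CV: "CV \<ge> 0" "\<And>w. norm (V w) \<le> CV * phase_decay t s (\<rho>' + 1) w" using Vb[of "\<rho>' + 1"] \<rho>' by auto
    define E where "E = Ca * CV * C\<Phi> * exp (\<rho>' * phase_gauge t s z)"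
    have Gm: "G \<in> borel_measurable borel"
    proof -
      have "G \<in> borel_measurable (borel \<Otimes>\<^sub>M borel)"
      proof -
        have m: "(\<lambda>q::((real^'n) \<times> (real^'n)) \<times> ((real^'n) \<times> (real^'n)). (snd q, fst q)) \<in> borel \<Otimes>\<^sub>M borel \<rightarrow>\<^sub>M borel \<Otimes>\<^sub>M borel"
          by measurable
        from measurable_compose[OF m Wigner_tf_shift_measurable]
        have [measurable]: "(\<lambda>q. Wigner (tf_shift \<psi> (snd q)) (tf_shift \<psi> z) (fst q)) \<in> borel_measurable (borel \<Otimes>\<^sub>M borel)"
          by simp
        show ?thesis unfolding G_def f_def by measurable
      qed
      then show ?thesis by (simp add: borel_prod)
    qed
    have G: "integrable lborel G"
    proof (rule integrable_prod_dominated[OF Gm])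
      show "integrable lborel (\<lambda>p::(real^'n) \<times> (real^'n). E * phase_decay t s 1 p)" using st by (intro integrable_mult_right integrable_phase_decay) auto
      show "integrable lborel (phase_decay t s 1 :: (real^'n) \<times> (real^'n) \<Rightarrow> real)" using st by (intro integrable_phase_decay) auto
      fix p w
      let ?m = "(1 / 2) *\<^sub>R (z + w)"
      have "norm (G (p, w)) = norm (a p) * (norm (V w) * norm (Wigner \<psi> \<psi> (p - ?m)))"
        by (simp add: G_def f_def norm_mult Wigner_tf_shift[OF \<psi>_measurable])
      also have "\<dots> \<le> (Ca * exp (\<mu> * phase_gauge t s p)) * ((CV * phase_decay t s (\<rho>' + 1) w) * (C\<Phi> * phase_decay t s \<rho> (p - ?m)))"
        using Ca CV C\<Phi> by (intro mult_mono) auto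
      also have "\<dots> = Ca * CV * C\<Phi> * exp (\<mu> * phase_gauge t s p + (- ((\<rho>' + 1) * phase_gauge t s w) + - (\<rho> * phase_gauge t s (p - ?m))))"
        by (simp only: phase_decay_phase_gauge exp_add mult_ac)
      also have "\<dots> \<le> Ca * CV * C\<Phi> * exp (\<rho>' * phase_gauge t s z + (- (1 * phase_gauge t s p) + - (1 * phase_gauge t s w)))"
      proof (intro mult_left_mono)
        have "phase_gauge t s ?m \<le> phase_gauge t s (z + w)"
          unfolding phase_gauge_def using st by (intro add_mono powr_mono2) auto
        also have "\<dots> \<le> gauge_const t s * (phase_gauge t s z + phase_gauge t s w)" by (rule phase_gauge_add_le[OF st(1,2)])
        finally have 1: "phase_gauge t s ?m \<le> gauge_const t s * (phase_gauge t s z + phase_gauge t s w)" .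
        have 2: "phase_gauge t s p \<le> gauge_const t s * (phase_gauge t s (p - ?m) + phase_gauge t s ?m)"
          using phase_gauge_add_le[OF st(1,2), of "p - ?m" ?m] by simp
        have "(\<mu> + 1) * phase_gauge t s p \<le> \<rho> * phase_gauge t s (p - ?m) + \<rho> * phase_gauge t s ?m"
          using mult_left_mono[OF 2, of "\<mu> + 1"] \<mu> by (simp add: \<rho>_def algebra_simps)
        also have "\<rho> * phase_gauge t s ?m \<le> \<rho>' * phase_gauge t s z + \<rho>' * phase_gauge t s w"
          using mult_left_mono[OF 1, of \<rho>] \<rho> by (simp add: \<rho>'_def algebra_simps)
        finally show "exp (\<mu> * phase_gauge t s p + (- ((\<rho>' + 1) * phase_gauge t s w) + - (\<rho> * phase_gauge t s (p - ?m)))) \<le> exp (\<rho>' * phase_gauge t s z + (- (1 * phase_gauge t s p) + - (1 * phase_gauge t s w)))"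
          by (simp add: algebra_simps)
      qed (use Ca CV C\<Phi> in auto)
      also have "\<dots> = E * phase_decay t s 1 p * phase_decay t s 1 w"
        by (simp only: E_def phase_decay_phase_gauge exp_add mult_ac)
      finally show "norm (G (p, w)) \<le> E * phase_decay t s 1 p * phase_decay t s 1 w" .
    qed
    have "L2_pairing (\<lambda>p. cnj (a p)) (Wigner g f) = (LINT p|lborel. of_real c0 * (LINT w|lborel. G (p, w)))"
      unfolding L2_pairing_def
    proof (rule Bochner_Integration.integral_cong[OF refl])
      fix p
      have "cnj (LINT w|lborel. V w * Wigner (tf_shift \<psi> w) f p) = (LINT w|lborel. cnj (V w * Wigner (tf_shift \<psi> w) f p))"
        by (rule Bochner_Integration.integral_cnj[symmetric])
      then show "cnj (a p) * cnj (Wigner g f p) = of_real c0 * (LINT w|lborel. G (p, w))"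
        unfolding W by (simp add: G_def)
    qed
    also have "\<dots> = of_real c0 * (LINT p|lborel. LINT w|lborel. G (p, w))" by (rule integral_mult_right_zero)
    also have "(LINT p|lborel. LINT w|lborel. G (p, w)) = (LINT w|lborel. LINT p|lborel. G (p, w))" by (rule lborel_Fubini[OF G, symmetric])
    also have "\<dots> = (LINT w|lborel. cnj (V w) * L2_pairing (\<lambda>p. cnj (a p)) (Wigner (tf_shift \<psi> w) f))"
      by (rule Bochner_Integration.integral_cong[OF refl]) (simp add: G_def L2_pairing_def mult.left_commute)
    finally show ?thesis .
  qed
  have Kf: "K w = of_real (c0 / \<pi>n) * L2_pairing (\<lambda>p. cnj (a p)) (Wigner (tf_shift \<psi> w) f)" for w
    by (simp add: K_def phase_kernel_def f_def c0_def N2_def \<pi>n_def mult_ac)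
  have pw: "(2 * pi) powr (- real CARD('n)) = 1 / \<pi>n"
    by (simp add: \<pi>n_def powr_minus powr_realpow inverse_eq_divide)
  have "(LINT w|lborel. K w * cnj (V w)) = (LINT w|lborel. of_real (c0 / \<pi>n) * (cnj (V w) * L2_pairing (\<lambda>p. cnj (a p)) (Wigner (tf_shift \<psi> w) f)))"
    by (simp add: Kf mult_ac)
  also have "\<dots> = of_real (c0 / \<pi>n) * (LINT w|lborel. cnj (V w) * L2_pairing (\<lambda>p. cnj (a p)) (Wigner (tf_shift \<psi> w) f))"
    by (rule integral_mult_right_zero)
  also have "\<dots> = of_real (1 / \<pi>n) * L2_pairing (\<lambda>p. cnj (a p)) (Wigner g f)"
    unfolding R by simp
  finally show ?thesis
    unfolding L[unfolded K_def] pw f_def K_def .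
qed

text \<open>The superposition is a test function with the required pairings. For uniqueness, the
  difference of two candidates is again a test function and is paired with itself.\<close>

lemma weyl_tf_shift: "weyl t s (\<lambda>p. cnj (a p)) (tf_shift \<psi> z) = (\<lambda>y. LINT w|lborel. phase_kernel a \<psi> z w * tf_shift \<psi> w y)"
  unfolding weyl_def
proof (rule the_equality)
  let ?F = "\<lambda>y. LINT w|lborel. phase_kernel a \<psi> z w * tf_shift \<psi> w y"
  have F: "?F \<in> GS t s"
    by (rule GS_superposition[OF st(1,2) phase_kernel_measurable tf_shift_GS[OF st(1,2) \<psi>] kernel_times_tf_shift_bound tf_shift_continuous[OF st(1,2) \<psi>]])
  then show "?F \<in> GS t s \<and> (\<forall>g\<in>GS t s. L2_pairing ?F g =
      of_real ((2 * pi) powr (- real CARD('n))) * L2_pairing (\<lambda>p. cnj (a p)) (Wigner g (tf_shift \<psi> z)))"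
    using weyl_weak_identity by blast
  fix F' assume F': "F' \<in> GS t s \<and> (\<forall>g\<in>GS t s. L2_pairing F' g =
      of_real ((2 * pi) powr (- real CARD('n))) * L2_pairing (\<lambda>p. cnj (a p)) (Wigner g (tf_shift \<psi> z)))"
  define D where "D = (\<lambda>y. F' y - ?F y)"
  have D: "D \<in> GS t s" unfolding D_def using F F' by (intro GS_diff st(1,2)) auto
  have "L2_pairing F' D = L2_pairing ?F D" using F' weyl_weak_identity[OF D] D by simp
  then have "(LINT v|lborel. F' v * cnj (D v) - ?F v * cnj (D v)) = 0"
    using GS_mult_cnj_integrable[OF st(1,2) _ D, of F'] GS_mult_cnj_integrable[OF st(1,2) F D] F'
    by (subst Bochner_Integration.integral_diff) (auto simp: L2_pairing_def)
  then have "(LINT v|lborel. D v * cnj (D v)) = 0" by (simp add: D_def left_diff_distrib)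
  then have "D = (\<lambda>x. 0)" by (rule GS_eq_0_if_self_pairing[OF st(1,2) D])
  then show "F' = ?F" unfolding D_def fun_eq_iff by simp
qed

lemma dual_weyl_tf_shift_le:
  assumes u: "u \<in> GS_dual t s"
  shows "norm (u (weyl t s (\<lambda>p. cnj (a p)) (tf_shift \<psi> z))) \<le> (LINT w|lborel. norm (phase_kernel a \<psi> z w) * norm (u (tf_shift \<psi> w)))"
    and "integrable lborel (\<lambda>w. norm (phase_kernel a \<psi> z w) * norm (u (tf_shift \<psi> w)))"
proof -
  note le = dual_superposition_le[OF st(1,2) u integrable_phase_kernel tf_shift_GS[OF st(1,2) \<psi>] kernel_times_tf_shift_bound tf_shift_continuous[OF st(1,2) \<psi>]]
  show "norm (u (weyl t s (\<lambda>p. cnj (a p)) (tf_shift \<psi> z))) \<le> (LINT w|lborel. norm (phase_kernel a \<psi> z w) * norm (u (tf_shift \<psi> w)))"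
    unfolding weyl_tf_shift by (rule le(1))
  show "integrable lborel (\<lambda>w. norm (phase_kernel a \<psi> z w) * norm (u (tf_shift \<psi> w)))"
    by (rule le(2))
qed

end

section \<open>Wave front sets\<close>

lemma phase_gauge_dilation:
  assumes "0 < s" "0 < t" "0 < \<rho>"
  shows "phase_gauge t s (\<rho> powr t *\<^sub>R x, \<rho> powr s *\<^sub>R \<xi>) = \<rho> * phase_gauge t s (x, \<xi>)"
proof -
  have "(\<rho> powr t * norm x) powr (1 / t) = \<rho> * norm x powr (1 / t)"
    using assms by (simp add: powr_mult powr_powr)
  moreover have "(\<rho> powr s * norm \<xi>) powr (1 / s) = \<rho> * norm \<xi> powr (1 / s)"
    using assms by (simp add: powr_mult powr_powr)
  ultimately show ?thesis by (simp add: phase_gauge_def algebra_simps)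
qed

text \<open>\<open>GS_dual_bounded\<close> fixes one \<open>h\<close> and one \<open>r\<close> for
  \<open>u\<close>, and for these the seminorms of the shifted windows grow at a single
  rate.\<close>

lemma dual_tf_shift_bound:
  assumes st: "0 < s" "0 < t" and \<psi>: "\<psi> \<in> GS t s" and u: "u \<in> GS_dual t s"
  shows "\<exists>\<rho>>0. \<exists>C\<ge>0. \<forall>w. norm (u (tf_shift \<psi> w)) \<le> C * exp (\<rho> * phase_gauge t s w)"
proof -
  obtain h r C where h: "h > 0" and r: "r > 0" and C: "C > 0"
    and uC: "\<And>f A. f \<in> GS t s \<Longrightarrow> gevrey s h (\<lambda>x. A * decay (1 / t) r x) f \<Longrightarrow> norm (u f) \<le> C * A"
    using GS_dual_bounded[OF st u] by (elim exE conjE) blast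
  obtain \<rho> C' where "\<rho> > 0" "C' \<ge> 0" "\<And>w. gevrey s h (\<lambda>y. C' * exp (\<rho> * phase_gauge t s w) * decay (1 / t) r y) (tf_shift \<psi> w)"
    using gevrey_tf_shift[OF st \<psi> h r] by blast
  with uC[OF tf_shift_GS[OF st \<psi>]] C show ?thesis
    by (intro exI[of _ \<rho>] conjI exI[of _ "C * C'"]) (auto simp: mult.assoc)
qed

theorem theorem6p1:
  fixes s t :: real
    and a :: "(real ^ 'n::finite) \<times> (real ^ 'n) \<Rightarrow> complex"
    and \<psi> :: "real ^ 'n \<Rightarrow> complex"
    and u :: "(real ^ 'n \<Rightarrow> complex) \<Rightarrow> complex"
  assumes "s > 0" and "t > 0" and "s + t > 1"
    and "a \<in> symbol_class t s"
    and "\<psi> \<in> GS t s" and "\<psi> \<noteq> (\<lambda>x. 0)"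
    and "u \<in> GS_dual t s"
  shows "WF t s \<psi> (weyl_dual t s a u) \<subseteq> WF t s \<psi> u"
proof
  note st = assms(1,2)
  fix z0 assume z0: "z0 \<in> WF t s \<psi> (weyl_dual t s a u)"
  show "z0 \<in> WF t s \<psi> u"
  proof (rule ccontr)
    assume "z0 \<notin> WF t s \<psi> u"
    then obtain U where U: "open U" "U \<subseteq> - {0}" "z0 \<in> U" and
      bU: "\<And>r. r > 0 \<Longrightarrow> bdd_above {exp (r * \<rho>) * norm (STFT \<psi> u (\<rho> powr t *\<^sub>R x, \<rho> powr s *\<^sub>R \<xi>)) | \<rho> x \<xi>.
                   0 < \<rho> \<and> (x, \<xi>) \<in> U}"
      using z0 by (auto simp: WF_def)
    define c1 where "c1 = (2 * pi) powr (- (real CARD('n) / 2))"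
    have c1: "c1 > 0" by (simp add: c1_def)
    have STFT: "norm (STFT \<psi> v w) = c1 * norm (v (tf_shift \<psi> w))" for v w
      by (simp add: STFT_def tf_shift_def c1_def case_prod_beta norm_mult)
    define S where "S = (\<lambda>w. norm (u (tf_shift \<psi> w)))"
    \<comment> \<open>The decay near \<open>z0\<close>, freed of the normalising constant of
      \<open>STFT\<close>.\<close>
    have SU: "\<exists>C\<ge>0. \<forall>\<rho> x \<xi>. 0 < \<rho> \<longrightarrow> (x, \<xi>) \<in> U \<longrightarrow> S (\<rho> powr t *\<^sub>R x, \<rho> powr s *\<^sub>R \<xi>) \<le> C * exp (- (R * \<rho>))" if R: "R > 0" for R
    proof -
      obtain M where M: "\<And>\<rho> x \<xi>. 0 < \<rho> \<Longrightarrow> (x, \<xi>) \<in> U \<Longrightarrow>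
        exp (R * \<rho>) * (c1 * S (\<rho> powr t *\<^sub>R x, \<rho> powr s *\<^sub>R \<xi>)) \<le> M"
        using bU[OF R] unfolding bdd_above_def STFT S_def by blast
      have "S (\<rho> powr t *\<^sub>R x, \<rho> powr s *\<^sub>R \<xi>) \<le> \<bar>M\<bar> / c1 * exp (- (R * \<rho>))" if "0 < \<rho>" "(x, \<xi>) \<in> U" for \<rho> x \<xi>
        using M[OF that] c1 by (simp add: exp_minus field_simps)
      then show ?thesis using c1 by (intro exI[of _ "\<bar>M\<bar> / c1"]) auto
    qed
    obtain \<rho>1 C1 where \<rho>1: "\<rho>1 > 0" and C1: "C1 \<ge> 0" "\<And>w. S w \<le> C1 * exp (\<rho>1 * phase_gauge t s w)"
      using dual_tf_shift_bound[OF st assms(5,7)] unfolding S_def by blast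
    obtain \<nu> where \<nu>: "\<nu> \<ge> 0" and K: "\<And>r. r > 0 \<Longrightarrow> \<exists>C\<ge>0. \<forall>z w. norm (phase_kernel a \<psi> z w) \<le> C * exp (\<nu> * phase_gauge t s z) * exp (- (r * phase_gauge t s (w - z)))"
      using phase_kernel_bound[OF st assms(3-6)] by blast
    \<comment> \<open>With twice the radius inside \<open>U\<close>, every point outside
      \<open>U\<close> has distance at least \<open>e\<close> from all of
      \<open>ball z0 e\<close>.\<close>
    obtain e where e: "e > 0" "ball z0 (2 * e) \<subseteq> U"
    proof -
      obtain e where "e > 0" "ball z0 e \<subseteq> U" using U(1,3) open_contains_ball by blast
      then show ?thesis using that[of "e / 2"] by simp
    qed
    \<comment> \<open>A lower bound of the gauge on vectors of norm at least \<open>e\<close>: one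
      of their components has norm at least \<open>e / 2\<close>.\<close>
    define \<kappa> where "\<kappa> = min ((e / 2) powr (1 / t)) ((e / 2) powr (1 / s))"
    have \<kappa>: "\<kappa> > 0" using e by (simp add: \<kappa>_def)
    have Q\<kappa>: "\<kappa> \<le> phase_gauge t s v" if "e \<le> norm v" for v :: "(real^'n) \<times> (real^'n)"
    proof -
      have "norm v \<le> norm (fst v) + norm (snd v)" using norm_Pair_le[of "fst v" "snd v"] by simp
      with that have "e / 2 \<le> norm (fst v) \<or> e / 2 \<le> norm (snd v)" by linarith
      then show ?thesis
      proof
        assume "e / 2 \<le> norm (fst v)"
        then have "(e / 2) powr (1 / t) \<le> norm (fst v) powr (1 / t)" using e st by (intro powr_mono2) auto
        then show ?thesis by (simp add: \<kappa>_def phase_gauge_def min_le_iff_disj add_increasing2)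
      next
        assume "e / 2 \<le> norm (snd v)"
        then have "(e / 2) powr (1 / s) \<le> norm (snd v) powr (1 / s)" using e st by (intro powr_mono2) auto
        then show ?thesis by (simp add: \<kappa>_def phase_gauge_def min_le_iff_disj add_increasing)
      qed
    qed
    \<comment> \<open>An upper bound of the gauge on \<open>ball z0 e\<close>; by homogeneity the
      dilates by \<open>\<rho>\<close> have gauge at most \<open>\<rho> * M\<close>.\<close>
    define M where "M = gauge_const t s * (e powr (1 / t) + e powr (1 / s) + phase_gauge t s z0)"
    have M0: "0 \<le> M" using gauge_const_pos[of t s] by (simp add: M_def)
    have QM: "phase_gauge t s v \<le> M" if "v \<in> ball z0 e" for v
    proof -
      have d: "norm (fst (v - z0)) \<le> e" "norm (snd (v - z0)) \<le> e"
        using that norm_fst_le[of "fst (v - z0)" "snd (v - z0)"] norm_snd_le[of "snd (v - z0)" "fst (v - z0)"]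
        by (auto simp: dist_norm norm_minus_commute simp del: fst_diff snd_diff)
      have "phase_gauge t s v \<le> gauge_const t s * (phase_gauge t s (v - z0) + phase_gauge t s z0)" using phase_gauge_add_le[OF st, of "v - z0" z0] by simp
      also have "\<dots> \<le> M"
        unfolding M_def phase_gauge_def[of _ _ "v - z0"] using d st gauge_const_pos[of t s]
        by (intro mult_left_mono add_mono powr_mono2) auto
      finally show ?thesis .
    qed
    define I where "I = (LINT w|lborel. phase_decay t s 1 (w :: (real^'n) \<times> (real^'n)))"
    have int: "integrable lborel (phase_decay t s 1 :: (real^'n) \<times> (real^'n) \<Rightarrow> real)" using st by (intro integrable_phase_decay) auto
    have main: "\<exists>C. \<forall>\<rho> x \<xi>. 0 < \<rho> \<longrightarrow> (x, \<xi>) \<in> ball z0 e \<longrightarrow>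
      exp (r * \<rho>) * norm (u (weyl t s (\<lambda>p. cnj (a p)) (tf_shift \<psi> (\<rho> powr t *\<^sub>R x, \<rho> powr s *\<^sub>R \<xi>)))) \<le> C" if r: "r > 0" for r
    proof -
      \<comment> \<open>Inside \<open>U\<close> the decay of \<open>u\<close> has to outweigh the
        growth \<open>\<nu> * M * \<rho>\<close> of the kernel in \<open>z\<close> and still leave
        \<open>r * \<rho>\<close>.\<close>
      have "\<nu> * M + r > 0" using \<nu> M0 r by (simp add: add_nonneg_pos)
      from SU[OF this] obtain CU where CU: "CU \<ge> 0" "\<And>\<rho> x \<xi>. 0 < \<rho> \<Longrightarrow> (x, \<xi>) \<in> U \<Longrightarrow> S (\<rho> powr t *\<^sub>R x, \<rho> powr s *\<^sub>R \<xi>) \<le> CU * exp (- ((\<nu> * M + r) * \<rho>))"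
        by blast
      obtain Ka where Ka: "Ka \<ge> 0" "\<And>z w. norm (phase_kernel a \<psi> z w) \<le> Ka * exp (\<nu> * phase_gauge t s z) * exp (- (1 * phase_gauge t s (w - z)))"
        using K[of 1] by auto
      \<comment> \<open>Away from \<open>U\<close> the gauge of \<open>w - z\<close> is at least
        \<open>\<kappa> * \<rho>\<close>. This rate then covers the growth of the kernel in
        \<open>z\<close>, the share of the growth of \<open>u\<close> that falls on
        \<open>z\<close>, and the desired \<open>r * \<rho>\<close>.\<close>
      define r2 where "r2 = ((\<nu> + \<rho>1 * gauge_const t s) * M + r) / \<kappa>"
      have r2: "r2 > 0" "r2 * \<kappa> = (\<nu> + \<rho>1 * gauge_const t s) * M + r"
        using \<kappa> \<nu> \<rho>1 gauge_const_pos[of t s] M0 r by (auto simp: r2_def add_nonneg_pos)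
      \<comment> \<open>Three shares of the decay in \<open>w - z\<close>: one unit for
        integrability, the share of the growth of \<open>u\<close> that falls on
        \<open>w - z\<close>, and \<open>r2\<close>.\<close>
      have "1 + \<rho>1 * gauge_const t s + r2 > 0" using r2 \<rho>1 gauge_const_pos[of t s] by (simp add: add_pos_pos)
      from K[OF this] obtain Kb where Kb: "Kb \<ge> 0" "\<And>z w. norm (phase_kernel a \<psi> z w) \<le> Kb * exp (\<nu> * phase_gauge t s z) * exp (- ((1 + \<rho>1 * gauge_const t s + r2) * phase_gauge t s (w - z)))"
        by blast
      define C where "C = Ka * CU + Kb * C1"
      have "exp (r * \<rho>) * norm (u (weyl t s (\<lambda>p. cnj (a p)) (tf_shift \<psi> (\<rho> powr t *\<^sub>R x, \<rho> powr s *\<^sub>R \<xi>)))) \<le> C * I"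
        if \<rho>: "0 < \<rho>" and v: "(x, \<xi>) \<in> ball z0 e" for \<rho> x \<xi>
      proof -
        define z where "z = (\<rho> powr t *\<^sub>R x, \<rho> powr s *\<^sub>R \<xi>)"
        have Qz: "phase_gauge t s z \<le> \<rho> * M"
          unfolding z_def phase_gauge_dilation[OF st \<rho>] using QM[OF v] \<rho> by (intro mult_left_mono) auto
        have pt: "norm (phase_kernel a \<psi> z w) * S w \<le> C * exp (- (r * \<rho>)) * phase_decay t s 1 (w - z)" for w
        proof -
          \<comment> \<open>The dilation by \<open>\<rho>\<close> is undone, so that
            \<open>w'\<close> can be compared with \<open>U\<close>.\<close>
          define w' where "w' = (\<rho> powr (- t) *\<^sub>R fst w, \<rho> powr (- s) *\<^sub>R snd w)"
          have w: "w = (\<rho> powr t *\<^sub>R fst w', \<rho> powr s *\<^sub>R snd w')"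
            using \<rho> by (simp add: w'_def powr_minus)
          have wz: "w - z = (\<rho> powr t *\<^sub>R (fst w' - x), \<rho> powr s *\<^sub>R (snd w' - \<xi>))"
            by (subst w) (simp add: z_def scaleR_diff_right)
          have ez: "exp (\<nu> * phase_gauge t s z) \<le> exp (\<nu> * M * \<rho>)"
            using mult_left_mono[OF Qz \<nu>] by (simp add: mult_ac)
          show ?thesis
          proof (cases "w' \<in> U")
            case True
            have "S w \<le> CU * exp (- ((\<nu> * M + r) * \<rho>))"
              using CU(2)[OF \<rho>, of "fst w'" "snd w'"] True w by simp
            moreover have "norm (phase_kernel a \<psi> z w) \<le> Ka * exp (\<nu> * M * \<rho>) * exp (- (1 * phase_gauge t s (w - z)))"
              using Ka(1) ez by (intro order_trans[OF Ka(2)] mult_right_mono mult_left_mono) auto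
            ultimately have "norm (phase_kernel a \<psi> z w) * S w \<le> (Ka * exp (\<nu> * M * \<rho>) * exp (- (1 * phase_gauge t s (w - z)))) * (CU * exp (- ((\<nu> * M + r) * \<rho>)))"
              using Ka(1) by (intro mult_mono) (auto simp: S_def)
            also have "\<dots> = (Ka * CU) * (exp (\<nu> * M * \<rho> + - ((\<nu> * M + r) * \<rho>)) * phase_decay t s 1 (w - z))"
              unfolding exp_add by (simp add: phase_decay_phase_gauge mult_ac)
            also have "\<nu> * M * \<rho> + - ((\<nu> * M + r) * \<rho>) = - (r * \<rho>)" by (simp add: algebra_simps)
            also have "(Ka * CU) * (exp (- (r * \<rho>)) * phase_decay t s 1 (w - z)) \<le> C * (exp (- (r * \<rho>)) * phase_decay t s 1 (w - z))"
              using Kb(1) C1(1) by (intro mult_right_mono) (auto simp: C_def)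
            finally show ?thesis by (simp add: mult.assoc)
          next
            \<comment> \<open>Here only the global growth bound for \<open>u\<close> is available,
              and the kernel has to supply all of the decay.\<close>
            case False
            then have "w' \<notin> ball z0 (2 * e)" using e by blast
            then have "2 * e \<le> dist z0 w'" by simp
            moreover have "dist z0 w' \<le> dist z0 (x, \<xi>) + dist (x, \<xi>) w'" by (rule dist_triangle)
            ultimately have "e \<le> norm (w' - (x, \<xi>))" using v by (simp add: dist_norm norm_minus_commute)
            then have "\<kappa> \<le> phase_gauge t s (w' - (x, \<xi>))" by (rule Q\<kappa>)
            then have \<kappa>Q: "\<kappa> * \<rho> \<le> phase_gauge t s (w - z)"
              unfolding wz phase_gauge_dilation[OF st \<rho>] using \<rho> by (cases w') (simp add: mult.commute)
            have "phase_gauge t s w \<le> gauge_const t s * (phase_gauge t s (w - z) + phase_gauge t s z)" using phase_gauge_add_le[OF st, of "w - z" z] by simp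
            also have "\<dots> \<le> gauge_const t s * (phase_gauge t s (w - z) + \<rho> * M)" using Qz gauge_const_pos[of t s] by simp
            finally have "\<rho>1 * phase_gauge t s w \<le> \<rho>1 * (gauge_const t s * (phase_gauge t s (w - z) + \<rho> * M))" using \<rho>1 by simp
            then have "S w \<le> C1 * exp (\<rho>1 * (gauge_const t s * (phase_gauge t s (w - z) + \<rho> * M)))"
              using C1(1) by (intro order_trans[OF C1(2)] mult_left_mono) auto
            moreover have "norm (phase_kernel a \<psi> z w) \<le> Kb * exp (\<nu> * M * \<rho>) * exp (- ((1 + \<rho>1 * gauge_const t s + r2) * phase_gauge t s (w - z)))"
              using Kb(1) ez by (intro order_trans[OF Kb(2)] mult_right_mono mult_left_mono) auto
            ultimately have "norm (phase_kernel a \<psi> z w) * S w \<le> (Kb * exp (\<nu> * M * \<rho>) * exp (- ((1 + \<rho>1 * gauge_const t s + r2) * phase_gauge t s (w - z)))) *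
              (C1 * exp (\<rho>1 * (gauge_const t s * (phase_gauge t s (w - z) + \<rho> * M))))"
              using Kb(1) by (intro mult_mono) (auto simp: S_def)
            also have "\<dots> = (Kb * C1) * exp (\<nu> * M * \<rho> + - ((1 + \<rho>1 * gauge_const t s + r2) * phase_gauge t s (w - z)) + \<rho>1 * (gauge_const t s * (phase_gauge t s (w - z) + \<rho> * M)))"
              unfolding exp_add by (simp add: mult_ac)
            also have "\<dots> \<le> (Kb * C1) * exp (- (r * \<rho>) + - (1 * phase_gauge t s (w - z)))"
            proof (intro mult_left_mono)
              have "r2 * (\<kappa> * \<rho>) \<le> r2 * phase_gauge t s (w - z)" using \<kappa>Q r2 by (intro mult_left_mono) auto
              then have "((\<nu> + \<rho>1 * gauge_const t s) * M + r) * \<rho> \<le> r2 * phase_gauge t s (w - z)"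
                unfolding r2(2)[symmetric] by (simp add: mult.assoc)
              then show "exp (\<nu> * M * \<rho> + - ((1 + \<rho>1 * gauge_const t s + r2) * phase_gauge t s (w - z)) + \<rho>1 * (gauge_const t s * (phase_gauge t s (w - z) + \<rho> * M)))
                \<le> exp (- (r * \<rho>) + - (1 * phase_gauge t s (w - z)))"
                by (simp add: algebra_simps)
            qed (use Kb(1) C1(1) in auto)
            also have "\<dots> \<le> C * exp (- (r * \<rho>) + - (1 * phase_gauge t s (w - z)))"
              using Ka(1) CU(1) by (intro mult_right_mono) (auto simp: C_def)
            finally show ?thesis unfolding exp_add by (simp add: phase_decay_phase_gauge mult.assoc)
          qed
        qed
        have i2: "integrable lborel (\<lambda>w. C * exp (- (r * \<rho>)) * phase_decay t s 1 (w - z))"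
          by (intro integrable_mult_right integrable_translate(1) int)
        have "norm (u (weyl t s (\<lambda>p. cnj (a p)) (tf_shift \<psi> z))) \<le> (LINT w|lborel. norm (phase_kernel a \<psi> z w) * S w)"
          unfolding S_def by (rule dual_weyl_tf_shift_le(1)[OF st assms(3-6) assms(7)])
        also have "\<dots> \<le> (LINT w|lborel. C * exp (- (r * \<rho>)) * phase_decay t s 1 (w - z))"
          using dual_weyl_tf_shift_le(2)[OF st assms(3-6) assms(7)] i2 pt unfolding S_def by (intro integral_mono) auto
        also have "\<dots> = C * exp (- (r * \<rho>)) * I"
          using integrable_translate(2)[OF int, of z] by (simp add: I_def)
        finally show ?thesis
          unfolding z_def[symmetric] by (simp add: exp_minus field_simps)
      qed
      then show ?thesis by blast
    qed
    have "\<exists>V. open V \<and> V \<subseteq> - {0} \<and> z0 \<in> V \<and> (\<forall>r>0. bdd_above {exp (r * \<rho>) * norm (STFT \<psi> (weyl_dual t s a u) (\<rho> powr t *\<^sub>R x, \<rho> powr s *\<^sub>R \<xi>)) | \<rho> x \<xi>.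
                   0 < \<rho> \<and> (x, \<xi>) \<in> V})"
    proof (intro exI[of _ "ball z0 e"] conjI allI impI)
      show "open (ball z0 e)" "z0 \<in> ball z0 e" using e by auto
      have "ball z0 e \<subseteq> ball z0 (2 * e)" using e by (intro subset_ball) simp
      from order_trans[OF order_trans[OF this e(2)] U(2)] show "ball z0 e \<subseteq> - {0}" .
      fix r :: real assume "r > 0"
      from main[OF this] obtain C where C: "\<And>\<rho> x \<xi>. 0 < \<rho> \<Longrightarrow> (x, \<xi>) \<in> ball z0 e \<Longrightarrow>
        exp (r * \<rho>) * norm (u (weyl t s (\<lambda>p. cnj (a p)) (tf_shift \<psi> (\<rho> powr t *\<^sub>R x, \<rho> powr s *\<^sub>R \<xi>)))) \<le> C" by blast
      show "bdd_above {exp (r * \<rho>) * norm (STFT \<psi> (weyl_dual t s a u) (\<rho> powr t *\<^sub>R x, \<rho> powr s *\<^sub>R \<xi>)) | \<rho> x \<xi>.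
                   0 < \<rho> \<and> (x, \<xi>) \<in> ball z0 e}"
      proof (rule bdd_aboveI[of _ "c1 * C"])
        fix y assume "y \<in> {exp (r * \<rho>) * norm (STFT \<psi> (weyl_dual t s a u) (\<rho> powr t *\<^sub>R x, \<rho> powr s *\<^sub>R \<xi>)) | \<rho> x \<xi>. 0 < \<rho> \<and> (x, \<xi>) \<in> ball z0 e}"
        then obtain \<rho> x \<xi> where y: "y = exp (r * \<rho>) * norm (STFT \<psi> (weyl_dual t s a u) (\<rho> powr t *\<^sub>R x, \<rho> powr s *\<^sub>R \<xi>))"
          and *: "0 < \<rho>" "(x, \<xi>) \<in> ball z0 e" by blast
        show "y \<le> c1 * C"
          using mult_left_mono[OF C[OF *] less_imp_le[OF c1]] unfolding y STFT weyl_dual_def by (simp only: mult_ac)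
      qed
    qed
    with z0 show False unfolding WF_def by blast
  qed
qed

end
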